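(* There exists a constant $C>0$ (independent of $\nu,\mu,\eta$ and of the initial data) such that the following holds for every $b\in\mathbb{R}$. Let $0<\nu=\mu\le\eta\le1$ and let $(w,j,\theta)$ be the solution on $\Omega=\mathbb{T}\times\mathbb{R}$ of the linear system $$\begin{cases}\partial_t w+y\partial_x w-\partial_x j-\nu\Delta w-\partial_x\theta=0,\\ \partial_t j+y\partial_x j-\partial_x w-\mu\Delta j-2\partial_x b^1=0,\\ \partial_t\theta+y\partial_x\theta-\eta\Delta\theta=0,\end{cases}\qquad \mathbf{b}=(b^1,b^2)=-\nabla^{\perp}(-\Delta)^{-1}j,$$ with initial data $(w(0),j(0),\theta(0))$. Then $$\begin{aligned}&\|(\Lambda_t^bw,\Lambda_t^bj)\|_{L^\infty_t(L^2)}+\nu^{\frac12}\|(\nabla\Lambda_t^bw,\nabla\Lambda_t^bj)\|_{L^2_t(L^2)}+\nu^{\frac16}\|(|D_x|^{\frac13}\Lambda_t^bw,|D_x|^{\frac13}\Lambda_t^bj)\|_{L^2_t(L^2)}\\&\quad+\nu^{-4}(\nu\eta)^{-\frac16}\Big(\||D_x|^{\frac13}\Lambda_t^b\theta\|_{L^\infty_t(L^2)}+\eta^{\frac12}\|\nabla|D_x|^{\frac13}\Lambda_t^b\theta\|_{L^2_t(L^2)}+\eta^{\frac16}\||D_x|^{\frac23}\Lambda_t^b\theta\|_{L^2_t(L^2)}\Big)\\&\le C\Big(\nu^{-2}\|(w(0),j(0))\|_{H^b}+\nu^{-4}(\nu\eta)^{-\frac16}\||D_x|^{\frac13}\theta(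0)\|_{H^b}\Big).\end{aligned}$$
   Context: The spatial domain is $\Omega=\mathbb{T}\times\mathbb{R}$ with $\mathbb{T}=[0,2\pi]$ periodic in $x$, and $y\in\mathbb{R}$. Fourier variables are $(k,\xi)\in\mathbb{Z}\times\mathbb{R}$. For $t\ge0$ and $b\in\mathbb{R}$, $\Lambda_t^b=(1-\partial_x^2-(\partial_y+t\partial_x)^2)^{b/2}$ is the Fourier multiplier with symbol $\Lambda_t^b(k,\xi)=(1+k^2+(\xi+tk)^2)^{b/2}$. $|D_x|^s$ is the Fourier multiplier with symbol $|k|^s$. $\|f\|_{H^b}=\|\Lambda_0^bf\|_{L^2}$ is the Sobolev norm on $\Omega$. $L^p_t(L^2)$ denotes $L^p$ in time $t\in(0,\infty)$ with values in $L^2(\Omega)$, where $\Lambda_t^b$ is evaluated at the running time $t$. For a pair, $\|(f,g)\|_X=\sqrt{\|f\|_X^2+\|g\|_X^2}$. Here $\nabla^\perp=(-\partial_y,\partial_x)$, so $b^1=\partial_y(-\Delta)^{-1}j$ and $b^2=-\partial_x(-\Delta)^{-1}j$. Thus $\partial_xb^1=\partial_x\partial_y(-\Delta)^{-1}j$, which has zero $k=0$ mode. (The exponent $b\in\mathbb{R}$ is unrelated to the magnetic field $\mathbf{b}=(b^1,b^2)$.) The system is the vorticity/current-density form of the 2D Boussinesq-MHD equations linearized around the Couette flow $\mathbf{u}_{sh}=(y,0)$, $\mathbf{b}_{sh}=(1,0)$, $p_{sh}=0$, $\theta_{sh}=0$. *)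

theory Defs
  imports "HOL-Analysis.Analysis" "HOL-Probability.Essential_Supremum"
begin

text \<open>
  Functions on \<open>\<Omega> = \<T> \<times> \<real>\<close> are functions on \<open>\<real> \<times> \<real>\<close> that are \<open>2\<pi>\<close>-periodic in the
  first variable; integrals over \<open>\<Omega>\<close> are taken over one period. Since the Sobolev exponent is an
  arbitrary real number, the unknowns are tempered distributions on \<open>\<Omega>\<close>, that is, continuous
  linear functionals on the Schwartz space of \<open>\<Omega>\<close>.
\<close>

definition Om :: "(real \<times> real) set" where
  "Om = {0..<2*pi} \<times> UNIV"

subsection \<open>Schwartz functions on \<open>\<Omega>\<close>\<close>

definition dX :: "(real \<times> real \<Rightarrow> complex) \<Rightarrow> (real \<times> real \<Rightarrow> complex)" where
  "dX \<phi> = (\<lambda>(x, y). vector_derivative (\<lambda>s. \<phi> (s, y)) (at x))"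

definition dY :: "(real \<times> real \<Rightarrow> complex) \<Rightarrow> (real \<times> real \<Rightarrow> complex)" where
  "dY \<phi> = (\<lambda>(x, y). vector_derivative (\<lambda>s. \<phi> (x, s)) (at y))"

text \<open>Coinduction makes all iterated partial derivatives, in any order, satisfy the conditions.\<close>

coinductive schwartz :: "(real \<times> real \<Rightarrow> complex) \<Rightarrow> bool" where
  "\<lbrakk> \<And>p. \<phi> differentiable (at p);
     \<And>x y. \<phi> (x + 2*pi, y) = \<phi> (x, y);
     \<And>n::nat. \<exists>B. \<forall>x y. (1 + \<bar>y\<bar>) ^ n * norm (\<phi> (x, y)) \<le> B;
     schwartz (dX \<phi>); schwartz (dY \<phi>) \<rbrakk> \<Longrightarrow> schwartz \<phi>"

definition schwartz_norm :: "nat \<Rightarrow> (real \<times> real \<Rightarrow> complex) \<Rightarrow> real" where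
  "schwartz_norm N \<phi> =
     (\<Sum>m\<le>N. \<Sum>n\<le>N. SUP p. (1 + \<bar>snd p\<bar>) ^ N * norm (((dX ^^ m) ((dY ^^ n) \<phi>)) p))"

definition fourier :: "(real \<times> real \<Rightarrow> complex) \<Rightarrow> int \<Rightarrow> real \<Rightarrow> complex" where
  "fourier \<phi> k \<xi> =
     (\<integral>p\<in>Om. \<phi> p * cis (- (of_int k * fst p + \<xi> * snd p)) \<partial>lborel)"

text \<open>The multiplier \<open>m(D)\<close>, by Fourier inversion on \<open>\<Omega>\<close>.\<close>

definition mult_fun ::
  "(int \<Rightarrow> real \<Rightarrow> real) \<Rightarrow> (real \<times> real \<Rightarrow> complex) \<Rightarrow> (real \<times> real \<Rightarrow> complex)" where
  "mult_fun m \<phi> = (\<lambda>(x, y). 1 / (2*pi)\<^sup>2 *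
     (\<Sum>\<^sub>\<infinity>k. \<integral>\<xi>. of_real (m k \<xi>) * fourier \<phi> k \<xi> * cis (of_int k * x + \<xi> * y) \<partial>lborel))"

subsection \<open>Tempered distributions on \<open>\<Omega>\<close>\<close>

type_synonym dist = "(real \<times> real \<Rightarrow> complex) \<Rightarrow> complex"

text \<open>Only the values on Schwartz functions are meaningful.\<close>

definition linear_dist :: "dist \<Rightarrow> bool" where
  "linear_dist u \<longleftrightarrow> (\<forall>\<phi> \<psi> a c. schwartz \<phi> \<longrightarrow> schwartz \<psi> \<longrightarrow>
     u (\<lambda>p. a * \<phi> p + c * \<psi> p) = a * u \<phi> + c * u \<psi>)"

definition tempered :: "dist \<Rightarrow> bool" where
  "tempered u \<longleftrightarrow> linear_dist u \<and>
     (\<exists>N K. \<forall>\<phi>. schwartz \<phi> \<longrightarrow> norm (u \<phi>) \<le> K * schwartz_norm N \<phi>)"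

text \<open>The following operations are defined by transposition with respect to the bilinear pairing
  \<open>\<langle>f, \<phi>\<rangle> = \<integral>\<^sub>\<Omega> f \<phi>\<close>; hence the sign change of the frequencies in \<open>mult\<close>.\<close>

definition DX :: "dist \<Rightarrow> dist" where
  "DX u = (\<lambda>\<phi>. - u (dX \<phi>))"

definition DY :: "dist \<Rightarrow> dist" where
  "DY u = (\<lambda>\<phi>. - u (dY \<phi>))"

definition Lap :: "dist \<Rightarrow> dist" where
  "Lap u = (\<lambda>\<phi>. DX (DX u) \<phi> + DY (DY u) \<phi>)"

definition mult_y :: "dist \<Rightarrow> dist" where
  "mult_y u = (\<lambda>\<phi>. u (\<lambda>p. of_real (snd p) * \<phi> p))"

definition mult :: "(int \<Rightarrow> real \<Rightarrow> real) \<Rightarrow> dist \<Rightarrow> dist" where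
  "mult m u = (\<lambda>\<phi>. u (mult_fun (\<lambda>k \<xi>. m (- k) (- \<xi>)) \<phi>))"

definition Lambda :: "real \<Rightarrow> real \<Rightarrow> dist \<Rightarrow> dist" where
  "Lambda t b = mult (\<lambda>k \<xi>. (1 + (of_int k)\<^sup>2 + (\<xi> + t * of_int k)\<^sup>2) powr (b/2))"

definition absDx :: "real \<Rightarrow> dist \<Rightarrow> dist" where
  "absDx s = mult (\<lambda>k \<xi>. \<bar>of_int k\<bar> powr s)"

subsection \<open>Norms\<close>

text \<open>All norms take values in \<open>[0, \<infinity>]\<close>.\<close>

definition esqrt :: "ennreal \<Rightarrow> ennreal" where
  "esqrt a = (if a = top then top else ennreal (sqrt (enn2real a)))"

definition pair_norm :: "ennreal \<Rightarrow> ennreal \<Rightarrow> ennreal" where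
  "pair_norm a c = esqrt (a\<^sup>2 + c\<^sup>2)"

definition L2_fun :: "(real \<times> real \<Rightarrow> complex) \<Rightarrow> bool" where
  "L2_fun f \<longleftrightarrow> f \<in> borel_measurable lborel \<and>
     (\<integral>\<^sup>+p\<in>Om. ennreal ((norm (f p))\<^sup>2) \<partial>lborel) < top"

definition represents :: "(real \<times> real \<Rightarrow> complex) \<Rightarrow> dist \<Rightarrow> bool" where
  "represents f u \<longleftrightarrow> (\<forall>\<phi>. schwartz \<phi> \<longrightarrow> u \<phi> = (\<integral>p\<in>Om. f p * \<phi> p \<partial>lborel))"

text \<open>The representing function is unique almost everywhere on \<open>\<Omega>\<close>, so the infimum is over at
  most one value; it is \<open>\<infinity>\<close> if \<open>u\<close> is not in \<open>L\<^sup>2(\<Omega>)\<close>.\<close>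

definition L2_norm :: "dist \<Rightarrow> ennreal" where
  "L2_norm u = (INF f \<in> {f. L2_fun f \<and> represents f u}.
     esqrt (\<integral>\<^sup>+p\<in>Om. ennreal ((norm (f p))\<^sup>2) \<partial>lborel))"

definition L2_norm_grad :: "dist \<Rightarrow> ennreal" where
  "L2_norm_grad u = pair_norm (L2_norm (DX u)) (L2_norm (DY u))"

definition H_norm :: "real \<Rightarrow> dist \<Rightarrow> ennreal" where
  "H_norm b u = L2_norm (Lambda 0 b u)"

text \<open>Time norms over \<open>(0, \<infinity>)\<close> of the function \<open>t \<mapsto> \<parallel>u(t)\<parallel>\<close>.\<close>

definition Linf_t :: "(real \<Rightarrow> ennreal) \<Rightarrow> ennreal" where
  "Linf_t g = esssup (restrict_space lborel {0<..}) g"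

definition L2_t :: "(real \<Rightarrow> ennreal) \<Rightarrow> ennreal" where
  "L2_t g = esqrt (\<integral>\<^sup>+t\<in>{0<..}. (g t)\<^sup>2 \<partial>lborel)"

subsection \<open>The linearized system\<close>

text \<open>Continuity in time with values in tempered distributions. By the uniform boundedness
  principle, the uniform bound on compact time intervals follows from weak continuity of a family
  of tempered distributions; it is not an additional restriction.\<close>

definition time_continuous :: "(real \<Rightarrow> dist) \<Rightarrow> bool" where
  "time_continuous u \<longleftrightarrow>
     (\<forall>t\<ge>0. linear_dist (u t)) \<and>
     (\<forall>T\<ge>0. \<exists>N K. \<forall>t\<in>{0..T}. \<forall>\<phi>. schwartz \<phi> \<longrightarrow> norm (u t \<phi>) \<le> K * schwartz_norm N \<phi>) \<and>
     (\<forall>\<phi>. schwartz \<phi> \<longrightarrow> continuous_on {0..} (\<lambda>t. u t \<phi>))"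

definition time_differentiable :: "(real \<Rightarrow> dist) \<Rightarrow> bool" where
  "time_differentiable u \<longleftrightarrow>
     (\<forall>\<phi> t. schwartz \<phi> \<longrightarrow> 0 < t \<longrightarrow> (\<lambda>s. u s \<phi>) differentiable (at t))"

definition DT :: "(real \<Rightarrow> dist) \<Rightarrow> real \<Rightarrow> dist" where
  "DT u t = (\<lambda>\<phi>. vector_derivative (\<lambda>s. u s \<phi>) (at t))"

text \<open>\<open>\<b> = -\<nabla>\<^sup>\<bottom>(-\<Delta>)\<^sup>-\<^sup>1 j\<close> with \<open>\<nabla>\<^sup>\<bottom> = (-\<partial>\<^sub>y, \<partial>\<^sub>x)\<close>; here \<open>\<psi> = (-\<Delta>)\<^sup>-\<^sup>1 j\<close>.
  Tempered solutions \<open>\<psi>\<close> differ by functions \<open>\<alpha> + \<beta> y\<close>, which belong to the mode \<open>k = 0\<close> and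
  do not contribute to \<open>\<partial>\<^sub>x b\<^sup>1\<close>, the only quantity that enters the system. Its mode \<open>k = 0\<close>
  vanishes for every choice of \<open>\<psi>\<close>.\<close>

definition magnetic_field :: "dist \<Rightarrow> dist \<Rightarrow> dist \<Rightarrow> bool" where
  "magnetic_field j b1 b2 \<longleftrightarrow> (\<exists>\<psi>. tempered \<psi> \<and>
     (\<forall>\<phi>. schwartz \<phi> \<longrightarrow> - Lap \<psi> \<phi> = j \<phi> \<and> b1 \<phi> = DY \<psi> \<phi> \<and> b2 \<phi> = - DX \<psi> \<phi>))"

definition bmhd_solution ::
  "real \<Rightarrow> real \<Rightarrow> real \<Rightarrow> (real \<Rightarrow> dist) \<Rightarrow> (real \<Rightarrow> dist) \<Rightarrow> (real \<Rightarrow> dist) \<Rightarrow>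
   (real \<Rightarrow> dist) \<Rightarrow> (real \<Rightarrow> dist) \<Rightarrow> bool" where
  "bmhd_solution \<nu> \<mu> \<eta> w j \<theta> b1 b2 \<longleftrightarrow>
     time_continuous w \<and> time_continuous j \<and> time_continuous \<theta> \<and>
     time_differentiable w \<and> time_differentiable j \<and> time_differentiable \<theta> \<and>
     (\<forall>t>0. magnetic_field (j t) (b1 t) (b2 t)) \<and>
     (\<forall>t>0. \<forall>\<phi>. schwartz \<phi> \<longrightarrow>
        DT w t \<phi> + mult_y (DX (w t)) \<phi> - DX (j t) \<phi> - \<nu> * Lap (w t) \<phi> - DX (\<theta> t) \<phi> = 0 \<and>
        DT j t \<phi> + mult_y (DX (j t)) \<phi> - DX (w t) \<phi> - \<mu> * Lap (j t) \<phi> - 2 * DX (b1 t) \<phi> = 0 \<and>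
        DT \<theta> t \<phi> + mult_y (DX (\<theta> t)) \<phi> - \<eta> * Lap (\<theta> t) \<phi> = 0)"

end

theory Submission
  imports Defs "HOL-Probability.Characteristic_Functions" "HOL-Probability.Sinc_Integral"
begin

text \<open>
  On the Fourier side and along the characteristics \<open>\<xi> = \<zeta> - k t\<close> the system is a linear ODE in \<open>\<complex>\<^sup>3\<close>
  for each frequency. With \<open>p = k\<^sup>2 + (\<zeta> - k t)\<^sup>2\<close> the only growth comes from the
  term \<open>2 \<partial>\<^sub>x b\<^sup>1\<close>; the magnetic coupling of \<open>w\<close> and \<open>j\<close> is skew-Hermitian. A decreasing time
  weight, bounded below by a multiple of \<open>\<nu>\<^sup>2\<close>, absorbs this growth, up to a part that is
  absorbed by viscosity; this loss gives the powers of \<open>\<nu>\<close>. The temperature forcing is paid for by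
  the enhanced dissipation rate \<open>(\<eta> k\<^sup>2)\<^sup>1\<^sup>/\<^sup>3\<close> of \<open>\<theta>\<close>, obtained from an arctangent weight.
  The weight \<open>\<Lambda>\<^sub>t\<^sup>b\<close> is constant along characteristics, so the estimates for \<open>b\<close> follow from those
  for the moduli at each frequency.

  Since the unknowns are distributions, the representation of the solution by the
  ODE propagator is obtained by duality: a Schwartz test function evolved by the transposed
  propagator has a constant pairing with the solution. Data of finite \<open>H\<^sup>b\<close> norm are turned into
  square-integrable densities by the Riesz representation theorem.
\<close>

section \<open>Square-integrable functions\<close>

text \<open>In squared norms the target allows a loss of \<nu>^-4, whereas the time weight costs
  \<nu>^-2 in the sup norm and \<nu>^-3 in the integrated gradient. This slack lets viscosity alone
  yield the enhanced dissipation term of \<open>w\<close> and \<open>j\<close>: |k|^(2/3) \<le> p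
  for k \<noteq> 0, at the price \<nu>^(1/3 - 3). Only \<theta> needs the sharp rate. The mode k = 0
  of \<theta> is invisible to the data norm of |D_x|^(1/3) \<theta>(0) and may be arbitrary. It
  enters \<open>w\<close> and \<open>j\<close> only through \<partial>x \<theta>, where it vanishes,
  and the representation of the solution is arranged so that it never occurs. The dual problem
  requires all frequency derivatives of the propagator to grow at most polynomially. This is proved
  qualitatively, with constants depending on \<nu>, \<eta> and the time horizon; the constant of the
  theorem stems from the energy estimate alone. Norm bounds become bounds on pairings with test
  functions: the spatial norm is a supremum over Schwartz functions, which also gives its
  measurability in time, needed for the essential supremum.\<close>

definition l2 :: "'a measure \<Rightarrow> ('a \<Rightarrow> complex) \<Rightarrow> bool" where
  "l2 M f \<longleftrightarrow> f \<in> borel_measurable M \<and> integrable M (\<lambda>x. (norm (f x))\<^sup>2)"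

definition nrm2 :: "'a measure \<Rightarrow> ('a \<Rightarrow> complex) \<Rightarrow> real" where
  "nrm2 M f = sqrt (\<integral>x. (norm (f x))\<^sup>2 \<partial>M)"

lemma l2_measurable [measurable_dest]: "l2 M f \<Longrightarrow> f \<in> borel_measurable M"
  by (simp add: l2_def)

lemma nrm2_nonneg [simp]: "0 \<le> nrm2 M f"
  by (simp add: nrm2_def)

lemma nrm2_sq: "(nrm2 M f)\<^sup>2 = (\<integral>x. (norm (f x))\<^sup>2 \<partial>M)"
  by (simp add: nrm2_def)

lemma l2_nn_integral:
  assumes "l2 M f"
  shows "(\<integral>\<^sup>+x. ennreal ((norm (f x))\<^sup>2) \<partial>M) = ennreal ((nrm2 M f)\<^sup>2)"
  using assms unfolding nrm2_sq by (intro nn_integral_eq_integral) (auto simp: l2_def)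

lemma l2_iff_nn_integral:
  "l2 M f \<longleftrightarrow> f \<in> borel_measurable M \<and> (\<integral>\<^sup>+x. ennreal ((norm (f x))\<^sup>2) \<partial>M) < top"
  unfolding l2_def by (auto simp: integrable_iff_bounded less_top)

lemma norm_add_sq_le: "(norm (a + b :: complex))\<^sup>2 \<le> 2 * (norm a)\<^sup>2 + 2 * (norm b)\<^sup>2"
proof -
  have "(norm (a + b))\<^sup>2 \<le> (norm a + norm b)\<^sup>2"
    by (intro power_mono norm_triangle_ineq norm_ge_zero)
  also have "\<dots> \<le> 2 * (norm a)\<^sup>2 + 2 * (norm b)\<^sup>2"
    using sum_squares_bound[of "norm a" "norm b"] by (simp add: power2_sum)
  finally show ?thesis .
qed

lemma l2_lincomb:
  assumes "l2 M f" "l2 M g"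
  shows "l2 M (\<lambda>x. a * f x + c * g x)"
proof -
  have [measurable]: "f \<in> borel_measurable M" "g \<in> borel_measurable M"
    using assms by (auto simp: l2_def)
  have "integrable M (\<lambda>x. 2 * (norm a)\<^sup>2 * (norm (f x))\<^sup>2 + 2 * (norm c)\<^sup>2 * (norm (g x))\<^sup>2)"
    using assms by (auto simp: l2_def)
  then have "integrable M (\<lambda>x. (norm (a * f x + c * g x))\<^sup>2)"
  proof (rule Bochner_Integration.integrable_bound, goal_cases)
    case 2
    show ?case
      using norm_add_sq_le[of "a * f _" "c * g _"]
      by (auto simp: norm_mult power_mult_distrib mult.assoc)
  qed measurable
  then show ?thesis by (auto simp: l2_def)
qed

lemma l2_mult_integrable:
  assumes "l2 M f" "l2 M g"
  shows "integrable M (\<lambda>x. f x * g x)"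
proof -
  have [measurable]: "f \<in> borel_measurable M" "g \<in> borel_measurable M"
    using assms by (auto simp: l2_def)
  have "integrable M (\<lambda>x. (norm (f x))\<^sup>2 + (norm (g x))\<^sup>2)"
    using assms by (auto simp: l2_def)
  then show ?thesis
  proof (rule Bochner_Integration.integrable_bound, goal_cases)
    case 2
    have "norm (f x * g x) \<le> norm ((norm (f x))\<^sup>2 + (norm (g x))\<^sup>2)" for x
      using sum_squares_bound[of "norm (f x)" "norm (g x)"]
        mult_nonneg_nonneg[OF norm_ge_zero[of "f x"] norm_ge_zero[of "g x"]]
      unfolding norm_mult real_norm_def by linarith
    then show ?case by simp
  qed measurable
qed

lemma l2_cnj: "l2 M f \<Longrightarrow> l2 M (\<lambda>x. cnj (f x))"
  unfolding l2_def by (auto intro: borel_measurable_continuous_on[of cnj] continuous_intros)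

lemma norm_integral_le_nn_integral: "ennreal (norm (integral\<^sup>L M f)) \<le> (\<integral>\<^sup>+x. norm (f x) \<partial>M)"
  by (cases "integrable M f") (auto simp: integral_norm_bound_ennreal not_integrable_integral_eq)

lemma l2_cauchy_schwarz:
  assumes "l2 M f" "l2 M g"
  shows "norm (\<integral>x. f x * g x \<partial>M) \<le> nrm2 M f * nrm2 M g"
proof -
  have [measurable]: "f \<in> borel_measurable M" "g \<in> borel_measurable M"
    using assms by (auto simp: l2_def)
  have "(ennreal (norm (\<integral>x. f x * g x \<partial>M)))\<^sup>2 \<le> (\<integral>\<^sup>+x. ennreal (norm (f x)) * ennreal (norm (g x)) \<partial>M)\<^sup>2"
    using norm_integral_le_nn_integral[of M "\<lambda>x. f x * g x"]
    by (intro power_mono) (auto simp: norm_mult ennreal_mult)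
  also have "\<dots> \<le> (\<integral>\<^sup>+x. (ennreal (norm (f x)))\<^sup>2 \<partial>M) * (\<integral>\<^sup>+x. (ennreal (norm (g x)))\<^sup>2 \<partial>M)"
    by (intro Cauchy_Schwarz_nn_integral) auto
  also have "\<dots> = ennreal ((nrm2 M f * nrm2 M g)\<^sup>2)"
    using l2_nn_integral[OF assms(1)] l2_nn_integral[OF assms(2)]
    by (simp add: ennreal_power ennreal_mult power_mult_distrib)
  finally have "(norm (\<integral>x. f x * g x \<partial>M))\<^sup>2 \<le> (nrm2 M f * nrm2 M g)\<^sup>2"
    by (simp add: ennreal_power)
  then show ?thesis by (rule power2_le_imp_le) simp
qed

lemma power2_of_two_power: "((2::real)^n)\<^sup>2 = 4^n"
  by (simp add: power2_eq_square flip: power_mult_distrib)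

lemma four_power_mult_self: "(4::real)^n * 4^n = 16^n"
  by (simp flip: power_mult_distrib)

text \<open>Riesz-Fischer for increments that are already summable, which spares the choice of a
  subsequence. The factor (1/16)^n is spent in two halves: one (1/4)^n makes the weighted sum
  \<open>H\<close> of squared increments integrable, the other gives pointwise convergence at a
  geometric rate.\<close>

lemma l2_complete_fast:
  fixes \<phi> :: "nat \<Rightarrow> 'a \<Rightarrow> complex"
  assumes l2: "\<And>n. l2 M (\<phi> n)"
    and fast: "\<And>n. (nrm2 M (\<lambda>x. \<phi> (Suc n) x - \<phi> n x))\<^sup>2 \<le> c * (1/16)^n"
  shows "\<exists>F. l2 M F \<and> (\<lambda>n. nrm2 M (\<lambda>x. F x - \<phi> n x)) \<longlonglongrightarrow> 0"
proof -
  have [measurable]: "\<phi> n \<in> borel_measurable M" for n using l2 by (auto simp: l2_def)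
  define g where "g n x = norm (\<phi> (Suc n) x - \<phi> n x)" for n x
  have [measurable]: "g n \<in> borel_measurable M" for n unfolding g_def by measurable
  have dl2: "l2 M (\<lambda>x. \<phi> (Suc n) x - \<phi> n x)" for n
    using l2_lincomb[OF l2[of "Suc n"] l2[of n], of 1 "-1"] by simp
  define H where "H x = (\<Sum>n. ennreal (4^n * (g n x)\<^sup>2))" for x
  have [measurable]: "H \<in> borel_measurable M" unfolding H_def by measurable
  have c0: "c \<ge> 0" using fast[of 0] by (smt (verit) power_0 zero_le_power2 mult_cancel_left2)
  have "(\<integral>\<^sup>+x. H x \<partial>M) = (\<Sum>n. \<integral>\<^sup>+x. ennreal (4^n * (g n x)\<^sup>2) \<partial>M)"
    unfolding H_def by (intro nn_integral_suminf) measurable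
  also have "\<dots> \<le> (\<Sum>n. ennreal (c * (1/4)^n))"
  proof (intro suminf_le summableI)
    fix n
    have "(\<integral>\<^sup>+x. ennreal (4^n * (g n x)\<^sup>2) \<partial>M) = ennreal (4^n) * ennreal ((nrm2 M (\<lambda>x. \<phi> (Suc n) x - \<phi> n x))\<^sup>2)"
      using l2_nn_integral[OF dl2[of n]] by (simp add: ennreal_mult nn_integral_cmult g_def)
    also have "\<dots> \<le> ennreal (4^n * (c * (1/16)^n))"
      using fast[of n] by (subst ennreal_mult[symmetric]) (auto intro!: ennreal_leI)
    also have "4^n * (c * (1/16)^n) = c * (1/4)^n"
      by (simp add: power_divide field_simps four_power_mult_self)
    finally show "(\<integral>\<^sup>+x. ennreal (4^n * (g n x)\<^sup>2) \<partial>M) \<le> ennreal (c * (1/4)^n)" .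
  qed
  also have "\<dots> < top"
  proof -
    have "summable (\<lambda>n. c * (1/4)^n)" by (intro summable_mult summable_geometric) simp
    then have "(\<Sum>n. ennreal (c * (1/4)^n)) = ennreal (\<Sum>n. c * (1/4)^n)"
      using c0 by (intro suminf_ennreal2) auto
    then show ?thesis by simp
  qed
  finally have Hfin: "(\<integral>\<^sup>+x. H x \<partial>M) < top" .
  then have AEH: "AE x in M. H x < top"
    using nn_integral_PInf_AE[of H M] by (auto simp: less_top)
  define F where "F x = lim (\<lambda>n. \<phi> n x)" for x
  have [measurable]: "F \<in> borel_measurable M" unfolding F_def by measurable
  \<comment> \<open>Where \<open>H\<close> is finite, the i-th increment is at most sqrt(H) (1/2)^i,
    so the tail from n on is at most 2 sqrt(H) (1/2)^n; the bound is its square. The null set where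
    \<open>H\<close> is infinite is removed by \<open>AEH\<close>.\<close>
  have key: "ennreal ((norm (F x - \<phi> n x))\<^sup>2) \<le> ennreal (4 * (1/4)^n) * H x" if "H x < top" for x n
  proof -
    obtain h where h: "H x = ennreal h" "h \<ge> 0" using \<open>H x < top\<close> by (cases "H x") auto
    have gb: "g i x \<le> sqrt h * (1/2)^i" for i
    proof -
      have "(\<Sum>n\<in>{i}. ennreal (4^n * (g n x)\<^sup>2)) \<le> H x"
        unfolding H_def by (rule sum_le_suminf) auto
      then have "4^i * (g i x)\<^sup>2 \<le> h" using h by simp
      moreover have "(4::real)^i * (g i x)\<^sup>2 = (2^i * g i x)\<^sup>2"
        by (simp add: power_mult_distrib power2_of_two_power)
      ultimately have "2^i * g i x \<le> sqrt h" by (intro real_le_rsqrt) simp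
      then show ?thesis by (simp add: power_divide field_simps)
    qed
    have sg: "summable (\<lambda>i. sqrt h * (1/2::real)^i)" by (intro summable_mult summable_geometric) simp
    have sd: "summable (\<lambda>i. \<phi> (Suc i) x - \<phi> i x)"
      by (rule summable_comparison_test'[OF sg]) (use gb in \<open>auto simp: g_def\<close>)
    have "convergent (\<lambda>n. \<phi> n x)"
    proof -
      have "(\<lambda>n. \<Sum>i<n. \<phi> (Suc i) x - \<phi> i x) \<longlonglongrightarrow> (\<Sum>i. \<phi> (Suc i) x - \<phi> i x)"
        using sd by (rule summable_LIMSEQ)
      then have "(\<lambda>n. \<phi> n x - \<phi> 0 x) \<longlonglongrightarrow> (\<Sum>i. \<phi> (Suc i) x - \<phi> i x)"
        by (subst (asm) sum_lessThan_telescope)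
      then have "(\<lambda>n. \<phi> n x - \<phi> 0 x + \<phi> 0 x) \<longlonglongrightarrow> (\<Sum>i. \<phi> (Suc i) x - \<phi> i x) + \<phi> 0 x"
        by (intro tendsto_intros)
      then show ?thesis by (auto simp: convergent_def)
    qed
    then have lim: "(\<lambda>n. \<phi> n x) \<longlonglongrightarrow> F x" unfolding F_def by (simp add: convergent_LIMSEQ_iff)
    \<comment> \<open>The factor \<open>1 - (1/2)^m\<close> makes the induction on the number of
      increments close; afterwards it is bounded by 1.\<close>
    have fin: "norm (\<phi> (n + m) x - \<phi> n x) \<le> sqrt h * 2 * (1/2)^n * (1 - (1/2)^m)" for m
    proof (induction m)
      case (Suc m)
      have "norm (\<phi> (n + Suc m) x - \<phi> n x) \<le> norm (\<phi> (n + m) x - \<phi> n x) + g (n + m) x"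
        unfolding g_def using norm_triangle_ineq[of "\<phi> (n + m) x - \<phi> n x" "\<phi> (Suc (n+m)) x - \<phi> (n+m) x"] by simp
      also have "\<dots> \<le> sqrt h * 2 * (1/2)^n * (1 - (1/2)^m) + sqrt h * (1/2)^(n+m)"
        using Suc gb[of "n+m"] by simp
      also have "\<dots> = sqrt h * 2 * (1/2)^n * (1 - (1/2)^Suc m)"
        by (simp add: power_add algebra_simps)
      finally show ?case .
    qed simp
    have "norm (F x - \<phi> n x) \<le> sqrt h * 2 * (1/2)^n"
    proof (rule LIMSEQ_le_const2)
      show "(\<lambda>m. norm (\<phi> (m + n) x - \<phi> n x)) \<longlonglongrightarrow> norm (F x - \<phi> n x)"
        by (intro tendsto_intros LIMSEQ_ignore_initial_segment lim)
      show "\<exists>N. \<forall>m\<ge>N. norm (\<phi> (m + n) x - \<phi> n x) \<le> sqrt h * 2 * (1/2)^n"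
      proof (intro exI allI impI)
        fix m
        have "sqrt h * 2 * (1/2)^n * (1 - (1/2)^m) \<le> sqrt h * 2 * (1/2)^n * 1"
          using h by (intro mult_left_mono) auto
        then show "norm (\<phi> (m + n) x - \<phi> n x) \<le> sqrt h * 2 * (1/2)^n"
          using fin[of m] by (simp add: add.commute)
      qed
    qed
    then have "(norm (F x - \<phi> n x))\<^sup>2 \<le> (sqrt h * 2 * (1/2)^n)\<^sup>2"
      by (intro power_mono) auto
    also have "\<dots> = 4 * (1/4)^n * h"
      using h(2) by (simp add: power_mult_distrib power_divide power2_of_two_power)
    finally show ?thesis using h by (simp add: ennreal_mult[symmetric])
  qed
  have bd: "(\<integral>\<^sup>+x. ennreal ((norm (F x - \<phi> n x))\<^sup>2) \<partial>M) \<le> ennreal (4 * (1/4)^n) * (\<integral>\<^sup>+x. H x \<partial>M)" for n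
  proof -
    have "(\<integral>\<^sup>+x. ennreal ((norm (F x - \<phi> n x))\<^sup>2) \<partial>M) \<le> (\<integral>\<^sup>+x. ennreal (4 * (1/4)^n) * H x \<partial>M)"
      by (rule nn_integral_mono_AE) (use AEH key in auto)
    then show ?thesis by (simp add: nn_integral_cmult)
  qed
  have Fd: "l2 M (\<lambda>x. F x - \<phi> n x)" for n
    unfolding l2_iff_nn_integral
    using bd[of n] Hfin by (auto intro!: le_less_trans[OF bd[of n]] simp: ennreal_mult_less_top)
  have "l2 M (\<lambda>x. 1 * (F x - \<phi> 0 x) + 1 * \<phi> 0 x)" by (rule l2_lincomb[OF Fd l2])
  then have Fl2: "l2 M F" by simp
  obtain h where h: "(\<integral>\<^sup>+x. H x \<partial>M) = ennreal h" "h \<ge> 0" using Hfin by (cases "\<integral>\<^sup>+x. H x \<partial>M") auto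
  have le: "(nrm2 M (\<lambda>x. F x - \<phi> n x))\<^sup>2 \<le> 4 * (1/4)^n * h" for n
    using bd[of n] l2_nn_integral[OF Fd[of n]] h by (simp add: ennreal_mult[symmetric])
  have "(\<lambda>n. (1/4::real)^n) \<longlonglongrightarrow> 0" by (intro LIMSEQ_power_zero) simp
  then have lim: "(\<lambda>n. 4 * (1/4)^n * h) \<longlonglongrightarrow> 0"
    by (intro tendsto_mult_left_zero tendsto_mult_right_zero)
  have "(\<lambda>n. (nrm2 M (\<lambda>x. F x - \<phi> n x))\<^sup>2) \<longlonglongrightarrow> 0"
    by (rule tendsto_sandwich[OF _ _ tendsto_const lim]) (simp_all only: le zero_le_power2 eventually_True)
  from tendsto_real_sqrt[OF this] have "(\<lambda>n. nrm2 M (\<lambda>x. F x - \<phi> n x)) \<longlonglongrightarrow> 0"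
    by (simp only: real_sqrt_abs abs_of_nonneg nrm2_nonneg real_sqrt_zero)
  with Fl2 show ?thesis by auto
qed

text \<open>The real parameter \<open>t\<close> serves the variational argument of
  \<open>l2_riesz\<close>: t = 1 and t = -1 give the parallelogram law, general t the first
  variation.\<close>

lemma l2_expand:
  assumes "l2 M f" "l2 M g"
  shows "(nrm2 M (\<lambda>x. f x + of_real t * g x))\<^sup>2 =
    (nrm2 M f)\<^sup>2 + 2 * t * Re (\<integral>x. cnj (f x) * g x \<partial>M) + t\<^sup>2 * (nrm2 M g)\<^sup>2"
proof -
  have i: "integrable M (\<lambda>x. cnj (f x) * g x)" by (intro l2_mult_integrable l2_cnj assms)
  have i2: "integrable M (\<lambda>x. (norm (f x))\<^sup>2)" "integrable M (\<lambda>x. (norm (g x))\<^sup>2)"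
    using assms by (auto simp: l2_def)
  have "(norm (f x + of_real t * g x))\<^sup>2 = (norm (f x))\<^sup>2 + 2 * t * Re (cnj (f x) * g x) + t\<^sup>2 * (norm (g x))\<^sup>2" for x
    unfolding cmod_power2 by (simp add: power2_eq_square algebra_simps)
  moreover define r where "r x = Re (cnj (f x) * g x)" for x
  ultimately have e: "(norm (f x + of_real t * g x))\<^sup>2 = (norm (f x))\<^sup>2 + 2 * t * r x + t\<^sup>2 * (norm (g x))\<^sup>2" for x
    by simp
  have "integrable M r" unfolding r_def[abs_def] using i by (rule integrable_Re)
  moreover have "Re (\<integral>x. cnj (f x) * g x \<partial>M) = (\<integral>x. r x \<partial>M)" unfolding r_def using i by (simp only: integral_Re)
  ultimately show ?thesis
    unfolding nrm2_sq e using i2 by (simp del: times_complex.sel cnj.sel)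
qed

lemma l2_pairing_tendsto:
  assumes "l2 M F" "\<And>n. l2 M (\<phi> n)" "(\<lambda>n. nrm2 M (\<lambda>x. F x - \<phi> n x)) \<longlonglongrightarrow> 0" "l2 M g"
  shows "(\<lambda>n. \<integral>x. cnj (\<phi> n x) * g x \<partial>M) \<longlonglongrightarrow> (\<integral>x. cnj (F x) * g x \<partial>M)"
proof -
  have d: "l2 M (\<lambda>x. F x - \<phi> n x)" for n
    using l2_lincomb[OF assms(1,2), of 1 "-1" n] by simp
  have le: "norm ((\<integral>x. cnj (\<phi> n x) * g x \<partial>M) - (\<integral>x. cnj (F x) * g x \<partial>M)) \<le> nrm2 M (\<lambda>x. F x - \<phi> n x) * nrm2 M g" for n
  proof -
    have "(\<integral>x. cnj (F x) * g x \<partial>M) - (\<integral>x. cnj (\<phi> n x) * g x \<partial>M) = (\<integral>x. cnj (F x - \<phi> n x) * g x \<partial>M)"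
      by (subst Bochner_Integration.integral_diff[symmetric])
        (auto intro!: l2_mult_integrable l2_cnj assms simp: algebra_simps)
    then show ?thesis
      using l2_cauchy_schwarz[OF l2_cnj[OF d[of n]] assms(4)]
      by (simp only: norm_minus_commute nrm2_def complex_mod_cnj)
  qed
  have lim: "(\<lambda>n. nrm2 M (\<lambda>x. F x - \<phi> n x) * nrm2 M g) \<longlonglongrightarrow> 0"
    by (intro tendsto_mult_left_zero assms)
  have "(\<lambda>n. (\<integral>x. cnj (\<phi> n x) * g x \<partial>M) - (\<integral>x. cnj (F x) * g x \<partial>M)) \<longlonglongrightarrow> 0"
    using le by (intro Lim_null_comparison[OF always_eventually lim]) blast
  then show ?thesis by (simp add: LIM_zero_iff)
qed

text \<open>\<open>S\<close> is a mere linear space of functions, neither closed nor a quotient, so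
  the functional J(\<phi>) = |\<phi>|^2 - 2 Re l(\<phi>) is minimised over it. A minimising sequence
  is Cauchy by the parallelogram law, and its limit \<open>F\<close>, possibly outside
  \<open>S\<close>, satisfies the Euler equation against all of \<open>S\<close>. The pairing is
  bilinear, hence the conjugate of \<open>F\<close> at the end.\<close>

theorem l2_riesz:
  fixes M :: "'a measure"
  assumes ne: "S \<noteq> {}"
    and lc: "\<And>\<phi> \<psi> a c. \<phi> \<in> S \<Longrightarrow> \<psi> \<in> S \<Longrightarrow> (\<lambda>x. a * \<phi> x + c * \<psi> x) \<in> S"
    and l2S: "\<And>\<phi>. \<phi> \<in> S \<Longrightarrow> l2 M \<phi>"
    and lin: "\<And>\<phi> \<psi> a c. \<phi> \<in> S \<Longrightarrow> \<psi> \<in> S \<Longrightarrow> l (\<lambda>x. a * \<phi> x + c * \<psi> x) = a * l \<phi> + c * l \<psi>"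
    and bd: "\<And>\<phi>. \<phi> \<in> S \<Longrightarrow> norm (l \<phi> :: complex) \<le> K * nrm2 M \<phi>"
    and K: "K \<ge> 0"
  shows "\<exists>f. l2 M f \<and> nrm2 M f \<le> K \<and> (\<forall>\<phi>\<in>S. l \<phi> = (\<integral>x. f x * \<phi> x \<partial>M))"
proof -
  define J where "J \<phi> = (nrm2 M \<phi>)\<^sup>2 - 2 * Re (l \<phi>)" for \<phi>
  have Jlow: "J \<phi> \<ge> - K\<^sup>2" if "\<phi> \<in> S" for \<phi>
  proof -
    have "Re (l \<phi>) \<le> K * nrm2 M \<phi>" using complex_Re_le_cmod[of "l \<phi>"] bd[OF that] by linarith
    moreover have "0 \<le> (nrm2 M \<phi> - K)\<^sup>2" by simp
    ultimately show ?thesis unfolding J_def by (simp add: power2_eq_square algebra_simps)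
  qed
  define d where "d = (INF \<phi>\<in>S. J \<phi>)"
  have bdd: "bdd_below (J ` S)" using Jlow by (auto simp: bdd_below_def)
  have dle: "d \<le> J \<phi>" if "\<phi> \<in> S" for \<phi> unfolding d_def using bdd that by (rule cINF_lower)
  have "\<exists>\<phi>\<in>S. J \<phi> < d + (1/16)^n" for n
    using cINF_less_iff[OF ne bdd, of "d + (1/16)^n"] by (auto simp: d_def)
  then obtain \<phi> where \<phi>: "\<And>n. \<phi> n \<in> S" "\<And>n. J (\<phi> n) < d + (1/16)^n" by metis
  note \<phi>l2 = l2S[OF \<phi>(1)]
  \<comment> \<open>Parallelogram law for J: the midpoint \<open>?h\<close> lies in
    \<open>S\<close>, so \<open>J ?h\<close> is at least \<open>d\<close>, while both endpoints are
    within (1/16)^n of \<open>d\<close>.\<close>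
  have "(nrm2 M (\<lambda>x. \<phi> (Suc n) x - \<phi> n x))\<^sup>2 \<le> 4 * (1/16)^n" for n
  proof -
    let ?h = "\<lambda>x. (1/2) * \<phi> (Suc n) x + (1/2) * \<phi> n x"
    have hS: "?h \<in> S" by (intro lc \<phi>)
    have e1: "(nrm2 M (\<lambda>x. \<phi> (Suc n) x + of_real (-1) * \<phi> n x))\<^sup>2 =
      (nrm2 M (\<phi> (Suc n)))\<^sup>2 + 2 * (-1) * Re (\<integral>x. cnj (\<phi> (Suc n) x) * \<phi> n x \<partial>M) + (-1)\<^sup>2 * (nrm2 M (\<phi> n))\<^sup>2"
      by (intro l2_expand \<phi>l2)
    have e2: "(nrm2 M (\<lambda>x. \<phi> (Suc n) x + of_real 1 * \<phi> n x))\<^sup>2 =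
      (nrm2 M (\<phi> (Suc n)))\<^sup>2 + 2 * 1 * Re (\<integral>x. cnj (\<phi> (Suc n) x) * \<phi> n x \<partial>M) + 1\<^sup>2 * (nrm2 M (\<phi> n))\<^sup>2"
      by (intro l2_expand \<phi>l2)
    have e3: "(nrm2 M (\<lambda>x. \<phi> (Suc n) x + of_real 1 * \<phi> n x))\<^sup>2 = 4 * (nrm2 M ?h)\<^sup>2"
    proof -
      have "(norm (\<phi> (Suc n) x + of_real 1 * \<phi> n x))\<^sup>2 = 4 * (norm (?h x))\<^sup>2" for x
        unfolding cmod_power2 by (simp add: power2_eq_square algebra_simps)
      then show ?thesis unfolding nrm2_sq by simp
    qed
    have "(nrm2 M (\<lambda>x. \<phi> (Suc n) x - \<phi> n x))\<^sup>2 = 2 * J (\<phi> (Suc n)) + 2 * J (\<phi> n) - 4 * J ?h"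
      using e1 e2 e3 unfolding J_def lin[OF \<phi>(1)[of "Suc n"] \<phi>(1)[of n]] by simp
    also have "\<dots> \<le> 2 * (d + (1/16)^Suc n) + 2 * (d + (1/16)^n) - 4 * d"
      using \<phi>(2)[of "Suc n"] \<phi>(2)[of n] dle[OF hS] by argo
    also have "\<dots> \<le> 4 * (1/16)^n" by simp
    finally show ?thesis .
  qed
  then obtain F where F: "l2 M F" "(\<lambda>n. nrm2 M (\<lambda>x. F x - \<phi> n x)) \<longlonglongrightarrow> 0"
    using l2_complete_fast[of M \<phi> 4] \<phi>l2 by blast
  have reF: "Re (\<integral>x. cnj (F x) * \<psi> x \<partial>M) = Re (l \<psi>)" if \<psi>: "\<psi> \<in> S" for \<psi>
  proof -
    define q where "q = (nrm2 M \<psi>)\<^sup>2"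
    define r where "r = Re (\<integral>x. cnj (F x) * \<psi> x \<partial>M) - Re (l \<psi>)"
    \<comment> \<open>Minimality passed to the limit: moving \<open>\<phi> n\<close> by t \<psi>
      cannot lower J by more than (1/16)^n.\<close>
    have quad: "0 \<le> 2 * t * r + t\<^sup>2 * q" for t
    proof (rule LIMSEQ_le_const)
      let ?a = "\<lambda>n. (1/16)^n + 2 * t * (Re (\<integral>x. cnj (\<phi> n x) * \<psi> x \<partial>M) - Re (l \<psi>)) + t\<^sup>2 * q"
      have "?a \<longlonglongrightarrow> 0 + 2 * t * (Re (\<integral>x. cnj (F x) * \<psi> x \<partial>M) - Re (l \<psi>)) + t\<^sup>2 * q"
        by (intro tendsto_intros LIMSEQ_power_zero l2_pairing_tendsto F \<phi>l2 l2S \<psi>) simp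
      then show "?a \<longlonglongrightarrow> 2 * t * r + t\<^sup>2 * q" by (simp add: r_def)
      have "0 \<le> ?a n" for n
      proof -
        have S1: "(\<lambda>x. 1 * \<phi> n x + of_real t * \<psi> x) \<in> S" by (intro lc \<phi> \<psi>)
        have "d \<le> J (\<lambda>x. 1 * \<phi> n x + of_real t * \<psi> x)" by (rule dle[OF S1])
        also have "\<dots> = J (\<phi> n) + 2 * t * (Re (\<integral>x. cnj (\<phi> n x) * \<psi> x \<partial>M) - Re (l \<psi>)) + t\<^sup>2 * q"
          unfolding J_def lin[OF \<phi>(1) \<psi>] q_def using l2_expand[OF \<phi>l2[of n] l2S[OF \<psi>], of t]
          by (simp add: algebra_simps)
        finally show ?thesis using \<phi>(2)[of n] by linarith
      qed
      then show "\<exists>N. \<forall>n\<ge>N. 0 \<le> ?a n" by blast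
    qed
    have q0: "q \<ge> 0" by (simp add: q_def)
    have "r = 0"
    proof (rule ccontr)
      assume "r \<noteq> 0"
      \<comment> \<open>With -a for t the quadratic equals -a^2 (q + 2), negative unless r vanishes;
        the summand 1 in the denominator covers functions \<psi> of norm 0.\<close>
      define a where "a = r / (q + 1)"
      have ra: "r = a * (q + 1)" using q0 by (simp add: a_def)
      have "0 \<le> 2 * (- a) * r + (- a)\<^sup>2 * q" by (rule quad)
      also have "\<dots> = - (a\<^sup>2 * (q + 2))"
        by (subst ra) (simp add: power2_eq_square algebra_simps)
      also have "\<dots> < 0" using q0 \<open>r \<noteq> 0\<close> ra by auto
      finally show False by simp
    qed
    then show ?thesis by (simp add: r_def)
  qed
  have rep: "l \<psi> = (\<integral>x. cnj (F x) * \<psi> x \<partial>M)" if \<psi>: "\<psi> \<in> S" for \<psi>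
  proof (rule complex_eqI)
    show "Re (l \<psi>) = Re (\<integral>x. cnj (F x) * \<psi> x \<partial>M)" using reF[OF \<psi>] by simp
    \<comment> \<open>The real part at -\<i> \<psi> is the imaginary part at \<psi>; the summand
      with 0 only brings the function into the shape of \<open>lc\<close>.\<close>
    have S1: "(\<lambda>x. - \<i> * \<psi> x + 0 * \<psi> x) \<in> S" by (intro lc \<psi>)
    have "Re (\<integral>x. cnj (F x) * (- \<i> * \<psi> x + 0 * \<psi> x) \<partial>M) = Re (- \<i> * l \<psi> + 0 * l \<psi>)"
      using reF[OF S1] unfolding lin[OF \<psi> \<psi>] .
    moreover have "(\<integral>x. cnj (F x) * (- \<i> * \<psi> x + 0 * \<psi> x) \<partial>M) = - \<i> * (\<integral>x. cnj (F x) * \<psi> x \<partial>M)"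
      unfolding Bochner_Integration.integral_mult_right_zero[symmetric]
      by (intro Bochner_Integration.integral_cong) (simp_all add: algebra_simps)
    ultimately show "Im (l \<psi>) = Im (\<integral>x. cnj (F x) * \<psi> x \<partial>M)" by simp
  qed
  \<comment> \<open>\<open>F\<close> need not lie in \<open>S\<close>, so the bound on
    \<open>l\<close> is used at \<open>\<phi> n\<close>; the limit of the pairings gives |F|^2 \<le>
    K |F|.\<close>
  have "nrm2 M F \<le> K"
  proof -
    have lim1: "(\<lambda>n. Re (\<integral>x. cnj (\<phi> n x) * F x \<partial>M)) \<longlonglongrightarrow> Re (\<integral>x. cnj (F x) * F x \<partial>M)"
      by (intro tendsto_intros l2_pairing_tendsto F \<phi>l2)
    have "(\<integral>x. cnj (F x) * F x \<partial>M) = (\<integral>x. of_real ((norm (F x))\<^sup>2) \<partial>M)"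
      by (intro Bochner_Integration.integral_cong refl) (metis complex_norm_square mult.commute of_real_power)
    then have FF: "Re (\<integral>x. cnj (F x) * F x \<partial>M) = (nrm2 M F)\<^sup>2"
      unfolding nrm2_sq by (simp only: integral_complex_of_real Re_complex_of_real)
    have low: "(nrm2 M F)\<^sup>2 = 0 \<or> nrm2 M F > 0" by (simp add: order_less_le)
    have "Re (\<integral>x. cnj (\<phi> n x) * F x \<partial>M) \<le> K * (nrm2 M F + nrm2 M (\<lambda>x. F x - \<phi> n x))" for n
    proof -
      have "(\<integral>x. cnj (\<phi> n x) * F x \<partial>M) = cnj (\<integral>x. cnj (F x) * \<phi> n x \<partial>M)"
        by (subst Bochner_Integration.integral_cnj[symmetric]) (simp add: mult.commute)
      then have "Re (\<integral>x. cnj (\<phi> n x) * F x \<partial>M) = Re (l (\<phi> n))" using rep[OF \<phi>(1)[of n]] by simp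
      also have "\<dots> \<le> K * nrm2 M (\<phi> n)" using bd[OF \<phi>(1)[of n]] complex_Re_le_cmod order_trans by blast
      also have "nrm2 M (\<phi> n) \<le> nrm2 M F + nrm2 M (\<lambda>x. F x - \<phi> n x)"
      proof (rule power2_le_imp_le)
        have dl: "l2 M (\<lambda>x. F x - \<phi> n x)" using l2_lincomb[OF F(1) \<phi>l2, of 1 "-1" n] by simp
        have "(nrm2 M (\<phi> n))\<^sup>2 = (nrm2 M (\<lambda>x. F x + of_real (-1) * (F x - \<phi> n x)))\<^sup>2" by simp
        also have "\<dots> = (nrm2 M F)\<^sup>2 + 2 * (-1) * Re (\<integral>x. cnj (F x) * (F x - \<phi> n x) \<partial>M)
            + (-1)\<^sup>2 * (nrm2 M (\<lambda>x. F x - \<phi> n x))\<^sup>2" by (intro l2_expand F dl)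
        also have "\<dots> \<le> (nrm2 M F)\<^sup>2 + 2 * (nrm2 M F * nrm2 M (\<lambda>x. F x - \<phi> n x)) + (nrm2 M (\<lambda>x. F x - \<phi> n x))\<^sup>2"
          using l2_cauchy_schwarz[OF l2_cnj[OF F(1)] dl] abs_Re_le_cmod[of "\<integral>x. cnj (F x) * (F x - \<phi> n x) \<partial>M"]
          by (simp add: nrm2_def)
        finally show "(nrm2 M (\<phi> n))\<^sup>2 \<le> (nrm2 M F + nrm2 M (\<lambda>x. F x - \<phi> n x))\<^sup>2"
          by (simp add: power2_sum)
      qed simp
      finally show ?thesis using K by (simp add: mult_left_mono)
    qed
    moreover have "(\<lambda>n. K * (nrm2 M F + nrm2 M (\<lambda>x. F x - \<phi> n x))) \<longlonglongrightarrow> K * (nrm2 M F + 0)"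
      by (intro tendsto_intros F)
    ultimately have "(nrm2 M F)\<^sup>2 \<le> K * nrm2 M F"
      using LIMSEQ_le[OF lim1] FF by auto
    then show ?thesis using low K by (auto simp: power2_eq_square)
  qed
  moreover have "nrm2 M (\<lambda>x. cnj (F x)) = nrm2 M F" by (simp add: nrm2_def)
  ultimately show ?thesis using rep l2_cnj[OF F(1)] by (intro exI[of _ "\<lambda>x. cnj (F x)"]) auto
qed

text \<open>One Picard step in the norm with weight exp(-2K|t|): a derivative bounded by K times 2c
  exp(2K|t|) integrates to at most c exp(2K|t|), so every step halves the constant. Negative times
  are reduced to positive ones by reflection.\<close>

lemma geometric_weight_bound:
  fixes f :: "real \<Rightarrow> 'a::euclidean_space"
  assumes f0: "f 0 = 0" and K: "K > 0"
    and der: "\<And>t. (f has_vector_derivative f' t) (at t)"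
    and bd: "\<And>t. \<bar>t\<bar> \<le> r \<Longrightarrow> norm (f' t) \<le> 2 * K * c * exp (2 * K * \<bar>t\<bar>)"
    and c: "c \<ge> 0" and t: "\<bar>t\<bar> \<le> r"
  shows "norm (f t) \<le> c * exp (2 * K * \<bar>t\<bar>)"
proof -
  have pos: "norm (g s) \<le> c * exp (2 * K * s)"
    if g0: "g 0 = 0" and gd: "\<And>t. (g has_vector_derivative g' t) (at t)"
      and gb: "\<And>t. \<bar>t\<bar> \<le> r \<Longrightarrow> norm (g' t) \<le> 2 * K * c * exp (2 * K * \<bar>t\<bar>)" and s: "0 \<le> s" "s \<le> r"
    for g g' :: "real \<Rightarrow> 'a" and s
  proof (cases "s = 0")
    case True then show ?thesis using g0 c by simp
  next
    case False
    then have s0: "0 < s" using s by simp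
    have "norm (g s - g 0) \<le> c * exp (2 * K * s) - c * exp (2 * K * 0)"
    proof (rule differentiable_bound_general[OF s0, where f' = g' and \<phi> = "\<lambda>x. c * exp (2 * K * x)" and \<phi>' = "\<lambda>x. 2 * K * c * exp (2 * K * x)"])
      show "continuous_on {0..s} g"
        using gd has_vector_derivative_continuous continuous_at_imp_continuous_on by blast
      show "((\<lambda>x. c * exp (2 * K * x)) has_vector_derivative 2 * K * c * exp (2 * K * x)) (at x)" for x
        unfolding has_real_derivative_iff_has_vector_derivative[symmetric]
        by (auto intro!: derivative_eq_intros)
      show "norm (g' x) \<le> 2 * K * c * exp (2 * K * x)" if "0 < x" "x < s" for x
        using gb[of x] that s by simp
    qed (auto intro!: continuous_intros gd)
    then show ?thesis using g0 c by simp
  qed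
  show ?thesis
  proof (cases "t \<ge> 0")
    case True
    then show ?thesis using pos[OF f0 der bd, of t] t by simp
  next
    case False
    have "norm ((\<lambda>s. f (- s)) (- t)) \<le> c * exp (2 * K * (- t))"
    proof (rule pos)
      show "((\<lambda>s. f (- s)) has_vector_derivative (- f' (- s))) (at s)" for s
      proof -
        have "(uminus has_vector_derivative - 1) (at s)"
          unfolding has_real_derivative_iff_has_vector_derivative[symmetric]
          by (auto intro!: derivative_eq_intros)
        from vector_diff_chain_at[OF this der[of "- s"]] show ?thesis by (simp add: o_def)
      qed
      show "norm (- f' (- s)) \<le> 2 * K * c * exp (2 * K * \<bar>s\<bar>)" if "\<bar>s\<bar> \<le> r" for s
        using bd[of "- s"] that by simp
    qed (use f0 False t in auto)
    then show ?thesis using False by simp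
  qed
qed

section \<open>Linear ordinary differential equations\<close>

lemma antiderivative_interval_integral:
  fixes f :: "real \<Rightarrow> 'a::euclidean_space"
  assumes "continuous_on UNIV f"
  shows "((\<lambda>t. LBINT s=0..ereal t. f s) has_vector_derivative f t) (at t)"
proof -
  let ?a = "- \<bar>t\<bar> - 1" and ?b = "\<bar>t\<bar> + 1"
  have "((\<lambda>u. LBINT s=ereal 0..u. f s) has_vector_derivative f t) (at t within {?a..?b})"
    by (rule interval_integral_FTC2) (auto intro: continuous_on_subset[OF assms])
  then show ?thesis
    by (subst (asm) at_within_Icc_at) (auto simp: zero_ereal_def)
qed

lemma linear_ode_exists:
  fixes L :: "real \<Rightarrow> 'a::euclidean_space \<Rightarrow> 'a"
  assumes lin: "\<And>t. bounded_linear (L t)"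
    and cont: "\<And>y. continuous_on UNIV y \<Longrightarrow> continuous_on UNIV (\<lambda>t. L t (y t))"
    and bnd: "\<And>r. \<exists>K. \<forall>t x. \<bar>t\<bar> \<le> r \<longrightarrow> norm (L t x) \<le> K * norm x"
  shows "\<exists>y. y 0 = x0 \<and> (\<forall>t. (y has_vector_derivative L t (y t)) (at t))"
proof -
  define I :: "(real \<Rightarrow> 'a) \<Rightarrow> real \<Rightarrow> 'a" where "I f t = (LBINT s=0..t. f s)" for f t
  have I: "(I f has_vector_derivative f t) (at t)" if "continuous_on UNIV f" for f t
    using antiderivative_interval_integral[OF that, of t] unfolding I_def[abs_def] .
  have I0: "I f 0 = 0" for f unfolding I_def by (simp add: zero_ereal_def[symmetric])
  define Y where "Y = rec_nat (\<lambda>_. x0) (\<lambda>_ y t. x0 + I (\<lambda>s. L s (y s)) t)"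
  have Y0: "Y 0 = (\<lambda>_. x0)" and YS: "Y (Suc n) = (\<lambda>t. x0 + I (\<lambda>s. L s (Y n s)) t)" for n
    by (simp_all add: Y_def)
  have Yc: "continuous_on UNIV (Y n)" for n
  proof (induction n)
    case (Suc n)
    have "continuous_on UNIV (I (\<lambda>s. L s (Y n s)))"
      using I[OF cont[OF Suc]] has_vector_derivative_continuous continuous_at_imp_continuous_on by blast
    then show ?case unfolding YS by (intro continuous_intros)
  qed (simp add: Y0)
  have Yd: "(Y (Suc n) has_vector_derivative L t (Y n t)) (at t)" for n t
    unfolding YS using I[OF cont[OF Yc[of n]], of t]
    by (auto intro!: derivative_eq_intros)
  have Yat0: "Y n 0 = x0" for n by (cases n) (auto simp: Y0 YS I0)
  have "\<exists>y. \<forall>t\<in>{-r..r}. (\<lambda>n. Y n t) \<longlonglongrightarrow> y t \<and> (y has_vector_derivative L t (y t)) (at t within {-r..r})" if r: "r > 0" for r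
  proof -
    obtain K0 where K0: "\<And>t x. \<bar>t\<bar> \<le> r \<Longrightarrow> norm (L t x) \<le> K0 * norm x" using bnd by blast
    define K where "K = \<bar>K0\<bar> + 1"
    have Kp: "K > 0" by (simp add: K_def)
    have K: "norm (L t x) \<le> K * norm x" if "\<bar>t\<bar> \<le> r" for t x
    proof -
      have "K0 * norm x \<le> K * norm x" by (intro mult_right_mono) (auto simp: K_def)
      then show ?thesis using K0[OF that, of x] by linarith
    qed
    define C where "C = norm x0"
    have d: "norm (Y (Suc n) t - Y n t) \<le> (C * (1/2)^n) * exp (2 * K * \<bar>t\<bar>)" if "\<bar>t\<bar> \<le> r" for n t
      using that
    proof (induction n arbitrary: t)
      case 0
      show ?case
      proof (rule geometric_weight_bound[where f = "\<lambda>t. Y (Suc 0) t - Y 0 t" and f' = "\<lambda>t. L t (Y 0 t)" and K = K and r = r])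
        show "((\<lambda>t. Y (Suc 0) t - Y 0 t) has_vector_derivative L t (Y 0 t)) (at t)" for t
          using Yd[of 0 t] unfolding Y0 by (auto intro!: derivative_eq_intros)
        show "norm (L t (Y 0 t)) \<le> 2 * K * (C * (1/2)^0) * exp (2 * K * \<bar>t\<bar>)" if "\<bar>t\<bar> \<le> r" for t
        proof -
          have "K * C * 1 \<le> (K * C) * (2 * exp (2 * K * \<bar>t\<bar>))"
            using Kp by (intro mult_left_mono) (auto simp: C_def intro: order_trans[of 1 "exp (2 * K * \<bar>t\<bar>)"])
          then show ?thesis using K[OF that, of x0] by (simp add: Y0 C_def algebra_simps)
        qed
      qed (use 0 Kp in \<open>auto simp: Yat0 C_def\<close>)
    next
      case (Suc n)
      show ?case
      proof (rule geometric_weight_bound[where f = "\<lambda>t. Y (Suc (Suc n)) t - Y (Suc n) t" and f' = "\<lambda>t. L t (Y (Suc n) t) - L t (Y n t)" and K = K and r = r])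
        show "((\<lambda>t. Y (Suc (Suc n)) t - Y (Suc n) t) has_vector_derivative L t (Y (Suc n) t) - L t (Y n t)) (at t)" for t
          by (intro has_vector_derivative_diff Yd)
        show "norm (L t (Y (Suc n) t) - L t (Y n t)) \<le> 2 * K * (C * (1/2)^Suc n) * exp (2 * K * \<bar>t\<bar>)" if "\<bar>t\<bar> \<le> r" for t
        proof -
          have "norm (L t (Y (Suc n) t) - L t (Y n t)) = norm (L t (Y (Suc n) t - Y n t))"
            using lin[of t] by (simp add: linear_diff bounded_linear.linear)
          also have "\<dots> \<le> K * norm (Y (Suc n) t - Y n t)" by (rule K[OF that])
          also have "\<dots> \<le> K * ((C * (1/2)^n) * exp (2 * K * \<bar>t\<bar>))"
            using Suc.IH[OF that] Kp by (intro mult_left_mono) auto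
          finally show ?thesis by simp
        qed
      qed (use Suc.prems Kp in \<open>auto simp: Yat0 C_def\<close>)
    qed
    define E where "E = exp (2 * K * r)"
    have dE: "norm (Y (Suc n) t - Y n t) \<le> C * E * (1/2)^n" if "t \<in> {-r..r}" for n t
    proof -
      have "\<bar>t\<bar> \<le> r" using that by auto
      then have "C * (1/2)^n * exp (2 * K * \<bar>t\<bar>) \<le> C * (1/2)^n * E"
        unfolding E_def using Kp by (intro mult_left_mono) (auto simp: C_def)
      then show ?thesis using d[OF \<open>\<bar>t\<bar> \<le> r\<close>, of n] by (simp add: algebra_simps)
    qed
    have tel: "norm (Y (n + m) t - Y n t) \<le> 2 * C * E * (1/2)^n * (1 - (1/2)^m)" if "t \<in> {-r..r}" for n m t
    proof (induction m)
      case (Suc m)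
      have "norm (Y (n + Suc m) t - Y n t) \<le> norm (Y (n + m) t - Y n t) + norm (Y (Suc (n + m)) t - Y (n + m) t)"
        using norm_triangle_ineq[of "Y (n + m) t - Y n t" "Y (Suc (n+m)) t - Y (n+m) t"] by simp
      also have "\<dots> \<le> 2 * C * E * (1/2)^n * (1 - (1/2)^m) + C * E * (1/2)^(n+m)"
        using Suc dE[OF that, of "n+m"] by simp
      also have "\<dots> = 2 * C * E * (1/2)^n * (1 - (1/2)^Suc m)" by (simp add: power_add algebra_simps)
      finally show ?case .
    qed simp
    have CE: "C * E \<ge> 0" by (simp add: C_def E_def)
    have tel': "norm (Y m t - Y n t) \<le> 2 * C * E * (1/2)^n" if "t \<in> {-r..r}" "n \<le> m" for n m t
    proof -
      have "2 * C * E * (1/2)^n * (1 - (1/2)^(m-n)) \<le> 2 * C * E * (1/2)^n * 1"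
        using CE by (intro mult_left_mono) auto
      then show ?thesis using tel[OF that(1), of n "m - n"] that(2) by simp
    qed
    have lim0: "(\<lambda>n. 2 * C * E * (1/2)^n) \<longlonglongrightarrow> 0"
      by (intro tendsto_mult_right_zero LIMSEQ_power_zero) simp
    have conv: "convergent (\<lambda>n. Y n t)" if t: "t \<in> {-r..r}" for t
    proof -
      have sm: "summable (\<lambda>n. C * E * (1/2::real)^n)" by (intro summable_mult summable_geometric) simp
      have "summable (\<lambda>n. Y (Suc n) t - Y n t)"
        by (rule summable_comparison_test'[OF sm]) (rule dE[OF t])
      then have "(\<lambda>n. \<Sum>i<n. Y (Suc i) t - Y i t) \<longlonglongrightarrow> (\<Sum>i. Y (Suc i) t - Y i t)"
        by (rule summable_LIMSEQ)
      then have "(\<lambda>n. Y n t - Y 0 t) \<longlonglongrightarrow> (\<Sum>i. Y (Suc i) t - Y i t)"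
        by (subst (asm) sum_lessThan_telescope)
      then have "(\<lambda>n. Y n t - Y 0 t + Y 0 t) \<longlonglongrightarrow> (\<Sum>i. Y (Suc i) t - Y i t) + Y 0 t"
        by (intro tendsto_intros)
      then show ?thesis by (auto simp: convergent_def)
    qed
    define y where "y t = lim (\<lambda>n. Y n t)" for t
    have ylim: "(\<lambda>n. Y n t) \<longlonglongrightarrow> y t" if "t \<in> {-r..r}" for t
      using conv[OF that] unfolding y_def by (simp add: convergent_LIMSEQ_iff)
    have yd: "norm (y t - Y n t) \<le> 2 * C * E * (1/2)^n" if t: "t \<in> {-r..r}" for t n
    proof (rule LIMSEQ_le_const2)
      show "(\<lambda>m. norm (Y m t - Y n t)) \<longlonglongrightarrow> norm (y t - Y n t)" by (intro tendsto_intros ylim t)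
      show "\<exists>N. \<forall>m\<ge>N. norm (Y m t - Y n t) \<le> 2 * C * E * (1/2)^n" using tel'[OF t] by blast
    qed
    \<comment> \<open>The derivative of \<open>Y (Suc n)\<close> involves \<open>Y n\<close>, so it
      converges uniformly to \<open>L t (y t)\<close> and passes to the limit.\<close>
    have ex: "\<exists>g. \<forall>t\<in>{-r..r}. (\<lambda>n. Y (Suc n) t) \<longlonglongrightarrow> g t \<and>
        (g has_derivative (\<lambda>h. h *\<^sub>R L t (y t))) (at t within {-r..r})"
    proof (rule has_derivative_sequence[where f' = "\<lambda>n t h. h *\<^sub>R L t (Y n t)" and ?x0.0 = 0])
      show "(Y (Suc n) has_derivative (\<lambda>h. h *\<^sub>R L t (Y n t))) (at t within {-r..r})" for n t
        using Yd[of n t] unfolding has_vector_derivative_def by (rule has_derivative_at_withinI)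
      show "\<forall>\<^sub>F n in sequentially. \<forall>t\<in>{-r..r}. \<forall>h. norm (h *\<^sub>R L t (Y n t) - h *\<^sub>R L t (y t)) \<le> e * norm h" if "e > 0" for e
      proof -
        have "(\<lambda>n. K * (2 * C * E * (1/2)^n)) \<longlonglongrightarrow> 0" by (intro tendsto_mult_right_zero lim0)
        then have "\<forall>\<^sub>F n in sequentially. K * (2 * C * E * (1/2)^n) < e"
          using \<open>e > 0\<close> order_tendstoD(2) by blast
        then show ?thesis
        proof eventually_elim
          case (elim n)
          show ?case
          proof (intro ballI allI)
            fix t h assume t: "t \<in> {-r..r}"
            have "norm (h *\<^sub>R L t (Y n t) - h *\<^sub>R L t (y t)) = \<bar>h\<bar> * norm (L t (y t - Y n t))"
              unfolding linear_diff[OF bounded_linear.linear[OF lin]] scaleR_diff_right[symmetric] norm_scaleR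
              by (simp only: norm_minus_commute)
            also have "\<dots> \<le> \<bar>h\<bar> * (K * (2 * C * E * (1/2)^n))"
              using t Kp by (intro mult_left_mono order_trans[OF K] yd) auto
            also have "\<dots> \<le> \<bar>h\<bar> * e" using elim by (intro mult_left_mono) auto
            finally show "norm (h *\<^sub>R L t (Y n t) - h *\<^sub>R L t (y t)) \<le> e * norm h" by (simp add: mult.commute)
          qed
        qed
      qed
      show "(\<lambda>n. Y (Suc n) 0) \<longlonglongrightarrow> x0" by (simp add: Yat0)
    qed (use r in auto)
    then obtain g where g: "\<And>t. t \<in> {-r..r} \<Longrightarrow> (\<lambda>n. Y (Suc n) t) \<longlonglongrightarrow> g t"
      "\<And>t. t \<in> {-r..r} \<Longrightarrow> (g has_derivative (\<lambda>h. h *\<^sub>R L t (y t))) (at t within {-r..r})" by blast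
    have gy: "g t = y t" if "t \<in> {-r..r}" for t
      using g(1)[OF that] LIMSEQ_Suc[OF ylim[OF that]] LIMSEQ_unique by blast
    have "(y has_vector_derivative L t (y t)) (at t within {-r..r})" if "t \<in> {-r..r}" for t
      using has_derivative_transform[OF that gy[symmetric] g(2)[OF that]] unfolding has_vector_derivative_def by blast
    then show ?thesis using ylim by blast
  qed
  note main = this
  define y where "y t = lim (\<lambda>n. Y n t)" for t
  have "(y has_vector_derivative L t (y t)) (at t)" for t
  proof -
    define r where "r = \<bar>t\<bar> + 1"
    have "r > 0" by (simp add: r_def)
    from main[OF this] obtain z where z: "\<And>t. t\<in>{-r..r} \<Longrightarrow> (\<lambda>n. Y n t) \<longlonglongrightarrow> z t"
      "\<And>t. t\<in>{-r..r} \<Longrightarrow> (z has_vector_derivative L t (z t)) (at t within {-r..r})"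
      by blast
    have zy: "z t = y t" if "t \<in> {-r..r}" for t using z(1)[OF that] by (simp add: y_def limI)
    have t: "t \<in> {-r..r}" "-r < t" "t < r" by (auto simp: r_def)
    have "(y has_vector_derivative L t (z t)) (at t within {-r..r})"
      using has_vector_derivative_transform[OF t(1) zy[symmetric] z(2)[OF t(1)]] .
    then show ?thesis using t zy[OF t(1)] by (simp add: at_within_Icc_at)
  qed
  moreover have "y 0 = x0" by (simp add: y_def Yat0)
  ultimately show ?thesis by blast
qed

section \<open>Energy estimates at a single frequency\<close>

text \<open>\<open>Y\<close> plus the integral of \<open>g\<close> is nonincreasing and
  \<open>Y\<close> stays nonnegative, so the total dissipation never exceeds \<open>Y 0\<close>. The
  half line is exhausted by the intervals [0, n].\<close>

lemma lyapunov_decay: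
  fixes Y g :: "real \<Rightarrow> real"
  assumes Y: "\<And>t. (Y has_real_derivative Y' t) (at t)" and le: "\<And>t. Y' t \<le> - g t"
    and g0: "\<And>t. g t \<ge> 0" and gc: "continuous_on UNIV g" and Y0: "\<And>t. Y t \<ge> 0"
  shows "t \<ge> 0 \<Longrightarrow> Y t \<le> Y 0"
    and "(\<integral>\<^sup>+t\<in>{0<..}. ennreal (g t) \<partial>lborel) \<le> ennreal (Y 0)"
proof -
  define G where "G t = (LBINT s=0..ereal t. g s)" for t
  have G: "(G has_real_derivative g t) (at t)" for t
    unfolding G_def has_real_derivative_iff_has_vector_derivative
    using antiderivative_interval_integral[OF gc] .
  have dec: "Y t + G t \<le> Y 0 + G 0" if "t \<ge> 0" for t
  proof (rule DERIV_nonpos_imp_nonincreasing[OF that])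
    show "\<exists>y. ((\<lambda>t. Y t + G t) has_real_derivative y) (at x) \<and> y \<le> 0" for x
      using DERIV_add[OF Y[of x] G[of x]] le[of x] by (intro exI[of _ "Y' x + g x"]) auto
  qed
  have inc: "G 0 \<le> G t" if "t \<ge> 0" for t
    by (rule DERIV_nonneg_imp_nondecreasing[OF that]) (use G g0 in blast)
  show "Y t \<le> Y 0" if "t \<ge> 0" using dec[OF that] inc[OF that] by linarith
  have gm[measurable]: "g \<in> borel_measurable borel" using gc by (rule borel_measurable_continuous_onI)
  have part: "(\<integral>\<^sup>+t\<in>{0..real n}. ennreal (g t) \<partial>lborel) \<le> ennreal (Y 0)" for n
  proof -
    have "(\<integral>\<^sup>+t\<in>{0..real n}. ennreal (g t) \<partial>lborel) = ennreal (G (real n) - G 0)"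
      by (rule nn_integral_FTC_Icc) (use G g0 in auto)
    also have "\<dots> \<le> ennreal (Y 0)" using dec[of "real n"] Y0[of "real n"] by (intro ennreal_leI) simp
    finally show ?thesis .
  qed
  have "(\<integral>\<^sup>+t\<in>{0<..}. ennreal (g t) \<partial>lborel) \<le> (\<integral>\<^sup>+t. (SUP n. ennreal (g t) * indicator {0..real n} t) \<partial>lborel)"
  proof (rule nn_integral_mono)
    fix t
    show "ennreal (g t) * indicator {0<..} t \<le> (SUP n. ennreal (g t) * indicator {0..real n} t)"
    proof (cases "t > 0")
      case True
      obtain n where "t \<le> real n" using real_arch_simple by blast
      then have "ennreal (g t) * indicator {0<..} t \<le> ennreal (g t) * indicator {0..real n} t" using True by simp
      also have "\<dots> \<le> (SUP n. ennreal (g t) * indicator {0..real n} t)" by (intro SUP_upper) simp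
      finally show ?thesis .
    qed simp
  qed
  also have "\<dots> = (SUP n. \<integral>\<^sup>+t. ennreal (g t) * indicator {0..real n} t \<partial>lborel)"
    by (rule nn_integral_monotone_convergence_SUP)
      (auto simp: incseq_def le_fun_def intro!: mult_left_mono split: split_indicator)
  also have "\<dots> \<le> ennreal (Y 0)" using part by (intro SUP_least) auto
  finally show "(\<integral>\<^sup>+t\<in>{0<..}. ennreal (g t) \<partial>lborel) \<le> ennreal (Y 0)" .
qed

lemma has_real_derivative_norm_sq:
  assumes "(X has_vector_derivative (X' :: complex)) (at t)"
  shows "((\<lambda>t. (norm (X t))\<^sup>2) has_real_derivative 2 * Re (cnj (X t) * X')) (at t)"
proof -
  have a: "((\<lambda>t. Re (X t)) has_real_derivative Re X') (at t)"
    unfolding has_real_derivative_iff_has_vector_derivative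
    by (rule bounded_linear.has_vector_derivative[OF bounded_linear_Re assms])
  have b: "((\<lambda>t. Im (X t)) has_real_derivative Im X') (at t)"
    unfolding has_real_derivative_iff_has_vector_derivative
    by (rule bounded_linear.has_vector_derivative[OF bounded_linear_Im assms])
  show ?thesis
    unfolding cmod_power2
    by (rule DERIV_cong[OF DERIV_add[OF DERIV_power[OF a] DERIV_power[OF b]]]) (simp add: algebra_simps)
qed

lemma continuous_on_if_has_vector_derivative:
  assumes "\<And>t::real. (X has_vector_derivative X' t) (at t)"
  shows "continuous_on A X"
  by (intro continuous_at_imp_continuous_on ballI) (rule has_vector_derivative_continuous[OF assms])

lemma scalar_decay:
  fixes X :: "real \<Rightarrow> complex"
  assumes X: "\<And>t. (X has_vector_derivative - (complex_of_real (c t) * X t)) (at t)"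
    and c: "\<And>t. c t \<ge> 0" "continuous_on UNIV c"
  shows "t \<ge> 0 \<Longrightarrow> (norm (X t))\<^sup>2 \<le> (norm (X 0))\<^sup>2"
    and "(\<integral>\<^sup>+t\<in>{0<..}. ennreal (c t * (norm (X t))\<^sup>2) \<partial>lborel) \<le> ennreal ((norm (X 0))\<^sup>2)"
proof -
  have e: "2 * Re (cnj (X t) * - (complex_of_real (c t) * X t)) = - (2 * (c t * (norm (X t))\<^sup>2))" for t
    unfolding cmod_power2 by (simp add: power2_eq_square algebra_simps)
  have Xc: "continuous_on UNIV X" by (rule continuous_on_if_has_vector_derivative[OF X])
  have d: "((\<lambda>t. (norm (X t))\<^sup>2) has_real_derivative - (2 * (c t * (norm (X t))\<^sup>2))) (at t)" for t
    using has_real_derivative_norm_sq[OF X[of t]] unfolding e .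
  note L = lyapunov_decay[where Y = "\<lambda>t. (norm (X t))\<^sup>2" and g = "\<lambda>t. c t * (norm (X t))\<^sup>2", OF d]
  show "t \<ge> 0 \<Longrightarrow> (norm (X t))\<^sup>2 \<le> (norm (X 0))\<^sup>2"
    by (rule L(1)) (auto intro!: continuous_intros Xc c mult_nonneg_nonneg)
  show "(\<integral>\<^sup>+t\<in>{0<..}. ennreal (c t * (norm (X t))\<^sup>2) \<partial>lborel) \<le> ennreal ((norm (X 0))\<^sup>2)"
    by (rule L(2)) (auto intro!: continuous_intros Xc c mult_nonneg_nonneg)
qed

text \<open>Squaring removes the corner of the positive part at 0. This allows the weight
  \<open>m\<close> below to start decreasing at s = 0 and still be differentiable there.\<close>

lemma has_real_derivative_pos_part_sq:
  "((\<lambda>s::real. (max 0 s)\<^sup>2) has_real_derivative 2 * max 0 s) (at s)"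
proof (cases "s = 0")
  case True
  have "((\<lambda>h. (max 0 (0 + h))\<^sup>2 / h) \<longlongrightarrow> 0) (at (0::real))"
  proof (rule Lim_null_comparison)
    show "((\<lambda>h::real. \<bar>h\<bar>) \<longlongrightarrow> 0) (at 0)" by (auto intro!: tendsto_eq_intros)
    show "\<forall>\<^sub>F h in at (0::real). norm ((max 0 (0 + h))\<^sup>2 / h) \<le> \<bar>h\<bar>"
      by (intro always_eventually allI) (auto simp: max_def power2_eq_square)
  qed
  then show ?thesis using True by (simp add: DERIV_def)
next
  case False
  show ?thesis
  proof (cases "s > 0")
    case True
    have "((\<lambda>s::real. s\<^sup>2) has_real_derivative 2 * max 0 s) (at s)"
      using True by (auto intro!: derivative_eq_intros)
    then show ?thesis
      by (rule has_field_derivative_transform_within_open[where S = "{0<..}"]) (use True in \<open>auto\<close>)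
  next
    case False
    have "((\<lambda>s::real. 0) has_real_derivative 2 * max 0 s) (at s)"
      using False by (auto intro!: derivative_eq_intros)
    then show ?thesis
      by (rule has_field_derivative_transform_within_open[where S = "{..<0}"]) (use False \<open>s \<noteq> 0\<close> in \<open>auto\<close>)
  qed
qed

text \<open>One wave number k, never 0, followed along \<xi> = \<zeta> - k t. The quotient in the
  equation of \<open>J\<close> comes from 2 \<partial>x \<partial>y (-\<Delta>)^-1, whose symbol is
  -2 k \<xi> / (k^2 + \<xi>^2): it damps \<open>J\<close> while k \<xi> > 0 and amplifies it
  afterwards.\<close>

locale mode_ode =
  fixes \<nu> \<eta> k \<zeta> :: real and W J H :: "real \<Rightarrow> complex"
  assumes \<nu>: "0 < \<nu>" "\<nu> \<le> 1" and \<eta>: "0 < \<eta>" "\<eta> \<le> 1" and k: "\<bar>k\<bar> \<ge> 1"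
    and W: "\<And>t. (W has_vector_derivative (\<i> * k * J t - \<nu> * (k\<^sup>2 + (\<zeta> - k*t)\<^sup>2) * W t + \<i> * k * H t)) (at t)"
    and J: "\<And>t. (J has_vector_derivative (\<i> * k * W t - (2 * k * (\<zeta> - k*t) / (k\<^sup>2 + (\<zeta> - k*t)\<^sup>2)) * J t
        - \<nu> * (k\<^sup>2 + (\<zeta> - k*t)\<^sup>2) * J t)) (at t)"
    and H: "\<And>t. (H has_vector_derivative - (complex_of_real (\<eta> * (k\<^sup>2 + (\<zeta> - k*t)\<^sup>2)) * H t)) (at t)"
begin

definition "p t = k\<^sup>2 + (\<zeta> - k*t)\<^sup>2"
text \<open>Time counted from the critical instant at which the vertical frequency \<zeta> - k t
  vanishes: the magnetic term damps for s < 0 and amplifies for s > 0.\<close>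

definition "s t = t - \<zeta> / k"
definition "E t = (norm (W t))\<^sup>2 + (norm (J t))\<^sup>2"
definition "Z t = (norm (H t))\<^sup>2"
definition "r = (\<eta> * k\<^sup>2) powr (1/3)"
definition "\<delta> = \<nu>\<^sup>2 / 16"

lemma k0: "k \<noteq> 0" using k by auto
lemma k2: "k\<^sup>2 \<ge> 1" using one_le_power[OF k, of 2] by simp
lemma p_s: "p t = k\<^sup>2 * (1 + (s t)\<^sup>2)"
proof -
  have *: "\<zeta> - k * t = - (k * s t)" using k0 by (simp add: s_def field_simps)
  show ?thesis unfolding p_def * by (simp add: power_mult_distrib algebra_simps)
qed
lemma p_pos: "p t > 0" unfolding p_s using k0 by (simp add: add_pos_nonneg)
lemma p_ge: "p t \<ge> k\<^sup>2" unfolding p_def by simp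
lemma r_pos: "r > 0" using \<eta> k0 by (simp add: r_def)
lemma r3: "r^3 = \<eta> * k\<^sup>2" using \<eta> k0 by (simp add: r_def powr_power)
lemma W_cont: "continuous_on A W" by (rule continuous_on_if_has_vector_derivative[OF W])
lemma J_cont: "continuous_on A J" by (rule continuous_on_if_has_vector_derivative[OF J])
lemma H_cont: "continuous_on A H" by (rule continuous_on_if_has_vector_derivative[OF H])
lemma p_cont: "continuous_on A p" unfolding p_def by (intro continuous_intros)
lemma E_nonneg: "E t \<ge> 0" by (simp add: E_def)

lemma Z_deriv: "(Z has_real_derivative - (2 * (\<eta> * p t * Z t))) (at t)"
proof -
  have e: "2 * Re (cnj (H t) * - (complex_of_real (\<eta> * p t) * H t)) = - (2 * (\<eta> * p t * (norm (H t))\<^sup>2))"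
    unfolding cmod_power2 by (simp add: power2_eq_square algebra_simps)
  show ?thesis using has_real_derivative_norm_sq[OF H[of t]] e unfolding Z_def[abs_def] p_def by simp
qed

text \<open>The derivative of the weight \<open>n\<close> supplies the rate \<open>r\<close> where \<open>\<bar>s\<bar> \<le> 1 / r\<close>; elsewhere
  \<open>\<eta> p \<ge> r (r s)\<^sup>2\<close> already dominates \<open>r\<close>.\<close>

definition "n t = 1 + pi/2 - arctan (r * s t)"

lemma n_ge: "n t \<ge> 1" and n_le: "n t \<le> 5"
  using arctan_bounded[of "r * s t"] pi_less_4 by (auto simp: n_def)

lemma nZ_deriv: "\<exists>D. ((\<lambda>t. n t * Z t) has_real_derivative D) (at t) \<and> D \<le> - (r * Z t)"
proof (intro exI conjI)
  let ?D = "- (r / (1 + (r * s t)\<^sup>2)) * Z t + (- (2 * (\<eta> * p t * Z t))) * n t"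
  have "(n has_real_derivative - (r / (1 + (r * s t)\<^sup>2))) (at t)"
  proof -
    have "((\<lambda>t. r * s t) has_real_derivative r) (at t)"
      unfolding s_def[abs_def] by (auto intro!: derivative_eq_intros)
    from DERIV_diff[OF DERIV_const DERIV_chain2[OF DERIV_arctan this], of "1 + pi/2"]
    show ?thesis unfolding n_def[abs_def] divide_inverse by (simp only: diff_0 mult.commute[of _ r])
  qed
  from DERIV_mult[OF this Z_deriv] show "((\<lambda>t. n t * Z t) has_real_derivative ?D) (at t)" .
  define x where "x = (r * s t)\<^sup>2"
  have x: "x \<ge> 0" by (simp add: x_def)
  have Z0: "Z t \<ge> 0" by (simp add: Z_def)
  have "r * x = r^3 * (s t)\<^sup>2" by (simp add: x_def power2_eq_square power3_eq_cube)
  also have "\<dots> = \<eta> * k\<^sup>2 * (s t)\<^sup>2" by (simp only: r3)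
  also have "\<dots> \<le> \<eta> * p t" using \<eta> unfolding p_s by (simp add: algebra_simps)
  finally have "r * x \<le> \<eta> * p t" .
  moreover have "\<eta> * p t \<le> n t * (\<eta> * p t)"
    using mult_right_mono[OF n_ge[of t], of "\<eta> * p t"] \<eta> p_pos[of t] by simp
  ultimately have rx: "r * x \<le> n t * (\<eta> * p t)" by linarith
  \<comment> \<open>This inequality merges the region near the critical time with the outer one, so
    no case distinction on s is made.\<close>
  have "1 \<le> 1 / (1 + x) + x" using x by (simp add: field_simps)
  then have "r * 1 \<le> r * (1 / (1 + x) + x)" using r_pos by (intro mult_left_mono) auto
  then have "r \<le> r / (1 + x) + r * x" by (simp add: algebra_simps)
  moreover have "r * x \<ge> 0" using r_pos x by simp
  ultimately have "r \<le> r / (1 + x) + 2 * (n t * (\<eta> * p t))"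
    using rx by linarith
  then have "r * Z t \<le> (r / (1 + x) + 2 * (n t * (\<eta> * p t))) * Z t"
    using Z0 by (intro mult_right_mono)
  then show "?D \<le> - (r * Z t)" unfolding x_def by (simp add: algebra_simps)
qed

text \<open>For \<open>s > 0\<close> the energy \<open>\<bar>J\<bar>\<^sup>2\<close> may grow like \<open>(1 + s\<^sup>2)\<^sup>2\<close>, which the first summand of the weight \<open>m\<close>
  cancels; the growth of the \<open>\<delta>\<close>-part is absorbed by viscosity because \<open>\<delta>\<close> is of order \<open>\<nu>\<^sup>2\<close>.\<close>

definition "m t = 1 / (1 + (max 0 (s t))\<^sup>2)\<^sup>2 + \<delta>"

lemma \<delta>_pos: "\<delta> > 0" using \<nu> by (simp add: \<delta>_def)
lemma \<delta>_le: "\<delta> \<le> 1" using \<nu> power_le_one[of \<nu> 2] by (simp add: \<delta>_def)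
lemma m_ge: "m t \<ge> \<delta>" by (simp add: m_def)
lemma m_le: "m t \<le> 2"
proof -
  have "1 / (1 + (max 0 (s t))\<^sup>2)\<^sup>2 \<le> 1" by (simp add: divide_le_eq one_le_power)
  then show ?thesis using \<delta>_le by (simp add: m_def)
qed

lemma m_deriv: "(m has_real_derivative - (4 * max 0 (s t) / (1 + (max 0 (s t))\<^sup>2)^3)) (at t)"
proof -
  have s: "(s has_real_derivative 1) (at t)" unfolding s_def[abs_def] by (auto intro!: derivative_eq_intros)
  have u: "((\<lambda>t. (max 0 (s t))\<^sup>2) has_real_derivative 2 * max 0 (s t)) (at t)"
    using DERIV_chain2[OF has_real_derivative_pos_part_sq s] by simp
  have gen: "((\<lambda>t. 1 / (1 + v t)\<^sup>2 + \<delta>) has_real_derivative - (2 * v' / (1 + v t)^3)) (at t)"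
    if v: "(v has_real_derivative v') (at t)" and vt: "v t \<ge> 0" for v v'
  proof -
    have nz: "1 + v t \<noteq> 0" using vt by simp
    have a: "((\<lambda>t. (1 + v t)\<^sup>2) has_real_derivative 2 * (1 + v t) * v') (at t)"
      by (auto intro!: derivative_eq_intros v)
    have "(0 * q\<^sup>2 - 1 * (2 * q * v')) / (q\<^sup>2 * q\<^sup>2) + 0 = - (2 * v' / q^3)" if "q \<noteq> 0" for q :: real
      using that by (simp add: power2_eq_square power3_eq_cube field_simps)
    from DERIV_cong[OF DERIV_add[OF DERIV_divide[OF DERIV_const a] DERIV_const] this[OF nz]] nz show ?thesis
      by simp
  qed
  show ?thesis unfolding m_def[abs_def] using gen[OF u] by simp
qed

text \<open>For s \<le> 0 both terms on the left are nonpositive. For s > 0 put q = 1 + s^2 and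
  bound |J|^2 by E: the derivative -4 s / q^3 of 1/q^2 cancels the growth 4 s / q acting on that
  summand, and 4 s \<delta> / q is left to be compared with \<nu> p m.\<close>

lemma m_ineq: "- (4 * max 0 (s t) / (1 + (max 0 (s t))\<^sup>2)^3) * E t + m t * ((4 * s t / (1 + (s t)\<^sup>2)) * (norm (J t))\<^sup>2)
    \<le> \<nu> * p t * m t * E t"
proof (cases "s t > 0")
  case False
  then have "4 * s t / (1 + (s t)\<^sup>2) \<le> 0" by (intro divide_nonpos_pos) (auto intro: add_pos_nonneg)
  moreover have "m t \<ge> 0" using m_ge[of t] \<delta>_pos by linarith
  ultimately have "m t * ((4 * s t / (1 + (s t)\<^sup>2)) * (norm (J t))\<^sup>2) \<le> 0"
    by (intro mult_nonneg_nonpos mult_nonpos_nonneg) auto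
  moreover have "0 \<le> \<nu> * p t * m t * E t" using \<nu> p_pos[of t] \<open>m t \<ge> 0\<close> E_nonneg[of t] by simp
  ultimately show ?thesis using False by (simp add: max_def)
next
  case True
  define q where "q = 1 + (s t)\<^sup>2"
  have q: "q \<ge> 1" "q > 0" by (auto simp: q_def add_pos_nonneg)
  have mx: "max 0 (s t) = s t" using True by simp
  have mt: "m t = 1 / q\<^sup>2 + \<delta>" by (simp add: m_def mx q_def)
  have "m t \<ge> 0" using m_ge[of t] \<delta>_pos by linarith
  then have "m t * ((4 * s t / q) * (norm (J t))\<^sup>2) \<le> m t * ((4 * s t / q) * E t)"
    using True q by (intro mult_left_mono) (auto simp: E_def)
  then have "- (4 * s t / q^3) * E t + m t * ((4 * s t / q) * (norm (J t))\<^sup>2) \<le> (- (4 * s t / q^3) + m t * (4 * s t / q)) * E t"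
    by (simp add: algebra_simps)
  also have "- (4 * s t / q^3) + m t * (4 * s t / q) = 4 * s t * \<delta> / q"
    using q unfolding mt by (simp add: field_simps power2_eq_square power3_eq_cube)
  also have "4 * s t * \<delta> / q \<le> \<nu> * p t * m t"
  proof -
    have sq: "2 * s t \<le> q" unfolding q_def using sum_squares_bound[of "s t" 1] by simp
    \<comment> \<open>The origin of \<delta> = (\<nu> / 4)^2: the weight times q^2 is 1 + \<delta>
      q^2, at least \<nu> q / 2 by this inequality, which exceeds what the growth 4 s \<delta> \<le>
      \<nu>^2 q / 8 requires.\<close>
    have "2 * (\<nu> / 4 * q) \<le> 1 + (\<nu> / 4 * q)\<^sup>2" using sum_squares_bound[of "\<nu> / 4 * q" 1] by simp
    then have "\<nu> / 2 * q \<le> 1 + \<delta> * q\<^sup>2" by (simp add: \<delta>_def power_mult_distrib power_divide)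
    then have "\<nu> * (\<nu> / 2 * q) \<le> \<nu> * (1 + \<delta> * q\<^sup>2)" using \<nu> by (intro mult_left_mono) auto
    moreover have "\<nu>\<^sup>2 * (2 * s t) \<le> \<nu>\<^sup>2 * q" using sq by (intro mult_left_mono) auto
    moreover have "\<nu>\<^sup>2 * s t \<ge> 0" using True by simp
    ultimately have "4 * s t * \<delta> \<le> \<nu> * (1 + \<delta> * q\<^sup>2)" by (simp add: \<delta>_def power2_eq_square algebra_simps)
    then have "4 * s t * \<delta> / q \<le> \<nu> * (1 + \<delta> * q\<^sup>2) / q" using q by (intro divide_right_mono) auto
    also have "\<dots> = \<nu> * 1 * q * m t" using q by (simp add: mt field_simps power2_eq_square)
    also have "\<dots> \<le> \<nu> * k\<^sup>2 * q * m t" using k2 \<nu> q \<open>m t \<ge> 0\<close> by (intro mult_right_mono mult_left_mono) auto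
    finally show ?thesis unfolding p_s q_def by simp
  qed
  then have "4 * s t * \<delta> / q * E t \<le> \<nu> * p t * m t * E t" using E_nonneg by (intro mult_right_mono)
  finally show ?thesis unfolding mx q_def .
qed

lemma E_deriv:
  "(E has_real_derivative (4 * s t / (1 + (s t)\<^sup>2)) * (norm (J t))\<^sup>2 - 2 * \<nu> * p t * E t
     + 2 * Re (cnj (W t) * (\<i> * k * H t))) (at t)"
proof -
  have c: "2 * k * (\<zeta> - k*t) / p t = - (2 * s t / (1 + (s t)\<^sup>2))"
  proof -
    have "\<zeta> - k * t = - k * s t" using k0 by (simp add: s_def field_simps)
    then show ?thesis unfolding p_s using k0 by (simp add: power2_eq_square)
  qed
  define q where "q = 2 * k * (\<zeta> - k*t) / p t"
  have "2 * Re (cnj (W t) * (\<i> * k * J t - \<nu> * p t * W t + \<i> * k * H t))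
      + 2 * Re (cnj (J t) * (\<i> * k * W t - q * J t - \<nu> * p t * J t))
      = - (2 * q) * (norm (J t))\<^sup>2 - 2 * \<nu> * p t * E t + 2 * Re (cnj (W t) * (\<i> * k * H t))"
    unfolding E_def cmod_power2 by (simp add: power2_eq_square algebra_simps)
  then have e: "2 * Re (cnj (W t) * (\<i> * k * J t - \<nu> * p t * W t + \<i> * k * H t))
      + 2 * Re (cnj (J t) * (\<i> * k * W t - q * J t - \<nu> * p t * J t))
      = (4 * s t / (1 + (s t)\<^sup>2)) * (norm (J t))\<^sup>2 - 2 * \<nu> * p t * E t + 2 * Re (cnj (W t) * (\<i> * k * H t))"
    unfolding q_def c by simp
  show ?thesis
    using DERIV_add[OF has_real_derivative_norm_sq[OF W[of t]] has_real_derivative_norm_sq[OF J[of t]]] e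
    unfolding E_def[abs_def] p_def q_def by simp
qed

text \<open>The factor 4 / (\<nu> r): Young's inequality charges the forcing with 2 Z / \<nu>, the
  bound m \<le> 2 doubles this, and n Z decreases at least at the rate r Z.\<close>

definition "Y t = m t * E t + 4 / (\<nu> * r) * (n t * Z t)"

text \<open>Viscosity supplies 2 \<nu> p m E. One half of it pays for the growth through
  \<open>m_ineq\<close>, a quarter for the temperature forcing, and the last quarter, with m \<ge>
  \<delta>, is the dissipation that remains.\<close>

lemma Y_deriv: "\<exists>D. (Y has_real_derivative D) (at t) \<and> D \<le> - (\<nu> * \<delta> / 2 * (p t * E t))"
proof -
  obtain D where D: "((\<lambda>t. n t * Z t) has_real_derivative D) (at t)" "D \<le> - (r * Z t)" using nZ_deriv by blast
  let ?m' = "- (4 * max 0 (s t) / (1 + (max 0 (s t))\<^sup>2)^3)"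
  let ?R = "2 * Re (cnj (W t) * (\<i> * k * H t))"
  let ?E' = "(4 * s t / (1 + (s t)\<^sup>2)) * (norm (J t))\<^sup>2 - 2 * \<nu> * p t * E t + ?R"
  have m0: "m t \<ge> 0" using m_ge[of t] \<delta>_pos by linarith
  have "(Y has_real_derivative ?m' * E t + ?E' * m t + 4 / (\<nu> * r) * D) (at t)"
    unfolding Y_def[abs_def]
    by (rule DERIV_add[OF DERIV_mult[OF m_deriv E_deriv] DERIV_cmult[OF D(1)]])
  moreover have "?m' * E t + ?E' * m t + 4 / (\<nu> * r) * D \<le> - (\<nu> * \<delta> / 2 * (p t * E t))"
  proof -
    have R: "?R \<le> \<nu> * p t / 2 * E t + 2 / \<nu> * Z t"
    proof -
      have "?R \<le> 2 * norm (cnj (W t) * (\<i> * k * H t))" by (rule mult_left_mono[OF complex_Re_le_cmod]) simp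
      also have "\<dots> = 2 * (\<bar>k\<bar> * (norm (W t) * norm (H t)))" by (simp add: norm_mult)
      also have "\<dots> \<le> \<nu> * k\<^sup>2 / 2 * (norm (W t))\<^sup>2 + 2 / \<nu> * Z t"
      proof -
        \<comment> \<open>The forcing carries a factor k, so the part k^2 of p is enough to absorb
          it.\<close>
        have "0 \<le> (\<nu> * \<bar>k\<bar> * norm (W t) - 2 * norm (H t))\<^sup>2" by simp
        then have le: "4 * \<nu> * (\<bar>k\<bar> * (norm (W t) * norm (H t))) \<le> \<nu>\<^sup>2 * k\<^sup>2 * (norm (W t))\<^sup>2 + 4 * Z t"
          by (simp add: Z_def power2_diff power_mult_distrib algebra_simps)
        define a where "a = \<bar>k\<bar> * (norm (W t) * norm (H t))"
        define w where "w = k\<^sup>2 * (norm (W t))\<^sup>2"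
        from le have "2 * \<nu> * (2 * a) \<le> 2 * \<nu> * (\<nu> / 2 * w + 2 / \<nu> * Z t)"
          using \<nu> unfolding a_def[symmetric] by (simp add: w_def algebra_simps power2_eq_square)
        then have "2 * a \<le> \<nu> / 2 * w + 2 / \<nu> * Z t" using \<nu> by (subst (asm) mult_le_cancel_left_pos) auto
        then show ?thesis unfolding a_def w_def by (simp add: algebra_simps)
      qed
      also have "\<dots> \<le> \<nu> * p t / 2 * E t + 2 / \<nu> * Z t"
      proof -
        have "\<nu> * k\<^sup>2 / 2 * (norm (W t))\<^sup>2 \<le> \<nu> * p t / 2 * E t"
          using \<nu> p_ge[of t] p_pos[of t] by (intro mult_mono) (auto simp: E_def)
        then show ?thesis by simp
      qed
      finally show ?thesis .
    qed
    have "?R * m t \<le> (\<nu> * p t / 2 * E t + 2 / \<nu> * Z t) * m t" using R m0 by (intro mult_right_mono)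
    moreover have "2 / \<nu> * Z t * m t \<le> 2 / \<nu> * Z t * 2" using m_le[of t] \<nu> by (intro mult_left_mono) (auto simp: Z_def)
    moreover have "4 / (\<nu> * r) * D \<le> 4 / (\<nu> * r) * - (r * Z t)" using D(2) \<nu> r_pos by (intro mult_left_mono) auto
    moreover have "4 / (\<nu> * r) * - (r * Z t) = - (4 / \<nu> * Z t)" using r_pos by simp
    moreover have "\<nu> * p t / 2 * E t * \<delta> \<le> \<nu> * p t / 2 * E t * m t" using m_ge[of t] \<nu> p_pos[of t] E_nonneg[of t] by (intro mult_left_mono) auto
    moreover note m_ineq[of t]
    ultimately show ?thesis by (simp add: algebra_simps)
  qed
  ultimately show ?thesis by blast
qed

lemma Y0_le: "Y 0 \<le> 2 * E 0 + 20 / (\<nu> * r) * Z 0"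
proof -
  have "m 0 * E 0 \<le> 2 * E 0" using m_le E_nonneg by (intro mult_right_mono)
  moreover have "4 / (\<nu> * r) * (n 0 * Z 0) \<le> 4 / (\<nu> * r) * (5 * Z 0)"
    using n_le \<nu> r_pos by (intro mult_left_mono mult_right_mono) (auto simp: Z_def)
  ultimately show ?thesis by (simp add: Y_def)
qed

lemma Y_ge: "Y t \<ge> \<delta> * E t"
proof -
  have "\<delta> * E t \<le> m t * E t" using m_ge E_nonneg by (intro mult_right_mono)
  moreover have "0 \<le> 4 / (\<nu> * r) * (n t * Z t)"
    using n_ge[of t] \<nu> r_pos by (intro mult_nonneg_nonneg) (auto simp: Z_def)
  ultimately show ?thesis by (simp add: Y_def)
qed

text \<open>The constants are 16 / \<nu>^2 = 1 / \<delta>, from m \<ge> \<delta>, and 32 / \<nu>^3 =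
  2 / (\<nu> \<delta>), from the dissipation in \<open>Y_deriv\<close>; 20 is 4 times the upper
  bound 5 of the weight n.\<close>

lemma energy:
  shows "t \<ge> 0 \<Longrightarrow> E t \<le> 16 / \<nu>\<^sup>2 * (2 * E 0 + 20 / (\<nu> * r) * Z 0)"
    and "(\<integral>\<^sup>+t\<in>{0<..}. ennreal (p t * E t) \<partial>lborel) \<le> ennreal (32 / \<nu>^3 * (2 * E 0 + 20 / (\<nu> * r) * Z 0))"
proof -
  obtain D where D: "\<And>t. (Y has_real_derivative D t) (at t)" "\<And>t. D t \<le> - (\<nu> * \<delta> / 2 * (p t * E t))"
    using Y_deriv by metis
  have c: "continuous_on UNIV (\<lambda>t. \<nu> * \<delta> / 2 * (p t * E t))"
    unfolding E_def by (intro continuous_intros p_cont W_cont J_cont)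
  have Y0: "Y t \<ge> 0" for t using Y_ge[of t] \<delta>_pos E_nonneg[of t] by (smt (verit) mult_nonneg_nonneg)
  have g0: "\<nu> * \<delta> / 2 * (p t * E t) \<ge> 0" for t
    using \<nu> \<delta>_pos p_pos[of t] E_nonneg[of t] by simp
  note L = lyapunov_decay[OF D g0 c Y0]
  show "E t \<le> 16 / \<nu>\<^sup>2 * (2 * E 0 + 20 / (\<nu> * r) * Z 0)" if "t \<ge> 0"
  proof -
    have "\<delta> * E t \<le> 2 * E 0 + 20 / (\<nu> * r) * Z 0" using L(1)[OF that] Y_ge[of t] Y0_le by linarith
    then have "1 / \<delta> * (\<delta> * E t) \<le> 1 / \<delta> * (2 * E 0 + 20 / (\<nu> * r) * Z 0)" using \<delta>_pos by (intro mult_left_mono) auto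
    moreover have "1 / \<delta> * (\<delta> * E t) = E t" using \<delta>_pos by simp
    moreover have d: "1 / \<delta> = 16 / \<nu>\<^sup>2" by (simp add: \<delta>_def)
    ultimately show ?thesis unfolding d by (simp only:)
  qed
  have mE: "(\<lambda>t. p t * E t) \<in> borel_measurable borel"
    unfolding E_def by (intro borel_measurable_continuous_onI continuous_intros p_cont W_cont J_cont)
  have "(\<integral>\<^sup>+t\<in>{0<..}. ennreal (p t * E t) \<partial>lborel)
      = ennreal (2 / (\<nu> * \<delta>)) * (\<integral>\<^sup>+t\<in>{0<..}. ennreal (\<nu> * \<delta> / 2 * (p t * E t)) \<partial>lborel)"
  proof (subst nn_integral_cmult[symmetric])
    show "(\<integral>\<^sup>+t\<in>{0<..}. ennreal (p t * E t) \<partial>lborel) =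
      (\<integral>\<^sup>+t. ennreal (2 / (\<nu> * \<delta>)) * (ennreal (\<nu> * \<delta> / 2 * (p t * E t)) * indicator {0<..} t) \<partial>lborel)"
      using \<nu> \<delta>_pos p_pos E_nonneg
      by (intro nn_integral_cong) (auto simp: ennreal_mult[symmetric] less_imp_le split: split_indicator)
  qed (use mE in measurable)
  also have "\<dots> \<le> ennreal (2 / (\<nu> * \<delta>)) * ennreal (2 * E 0 + 20 / (\<nu> * r) * Z 0)"
    using L(2) Y0_le by (intro mult_left_mono order_trans[OF L(2)] ennreal_leI) auto
  also have "\<dots> = ennreal (32 / \<nu>^3 * (2 * E 0 + 20 / (\<nu> * r) * Z 0))"
    using \<nu> \<delta>_pos by (subst ennreal_mult'[symmetric]) (auto simp: \<delta>_def power2_eq_square power3_eq_cube field_simps)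
  finally show "(\<integral>\<^sup>+t\<in>{0<..}. ennreal (p t * E t) \<partial>lborel) \<le> ennreal (32 / \<nu>^3 * (2 * E 0 + 20 / (\<nu> * r) * Z 0))" .
qed

lemma heat:
  shows "t \<ge> 0 \<Longrightarrow> Z t \<le> Z 0"
    and "(\<integral>\<^sup>+t\<in>{0<..}. ennreal (\<eta> * p t * Z t) \<partial>lborel) \<le> ennreal (Z 0)"
    and "(\<integral>\<^sup>+t\<in>{0<..}. ennreal (r * Z t) \<partial>lborel) \<le> ennreal (5 * Z 0)"
proof -
  have c: "continuous_on UNIV (\<lambda>t. \<eta> * (k\<^sup>2 + (\<zeta> - k*t)\<^sup>2))" by (intro continuous_intros)
  have pos: "\<eta> * (k\<^sup>2 + (\<zeta> - k*t)\<^sup>2) \<ge> 0" for t using \<eta> by simp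
  note S = scalar_decay[OF H pos c]
  show "t \<ge> 0 \<Longrightarrow> Z t \<le> Z 0" using S(1) by (simp add: Z_def)
  show "(\<integral>\<^sup>+t\<in>{0<..}. ennreal (\<eta> * p t * Z t) \<partial>lborel) \<le> ennreal (Z 0)"
    using S(2) by (simp add: Z_def p_def)
  obtain D where D: "\<And>t. ((\<lambda>t. n t * Z t) has_real_derivative D t) (at t)" "\<And>t. D t \<le> - (r * Z t)"
    using nZ_deriv by metis
  have "(\<integral>\<^sup>+t\<in>{0<..}. ennreal (r * Z t) \<partial>lborel) \<le> ennreal (n 0 * Z 0)"
  proof (rule lyapunov_decay(2)[OF D])
    show "0 \<le> n t * Z t" for t using n_ge[of t] by (intro mult_nonneg_nonneg) (auto simp: Z_def)
    show "continuous_on UNIV (\<lambda>t. r * Z t)" unfolding Z_def by (intro continuous_intros H_cont)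
  qed (use r_pos in \<open>auto simp: Z_def\<close>)
  also have "\<dots> \<le> ennreal (5 * Z 0)" using n_le by (intro ennreal_leI mult_right_mono) (auto simp: Z_def)
  finally show "(\<integral>\<^sup>+t\<in>{0<..}. ennreal (r * Z t) \<partial>lborel) \<le> ennreal (5 * Z 0)" .
qed

end

section \<open>Symbols depending on time and frequency\<close>

type_synonym symb = "real \<Rightarrow> int \<Rightarrow> real \<Rightarrow> complex"

definition wt :: "int \<Rightarrow> real \<Rightarrow> real" where
  "wt k \<xi> = 1 + \<bar>real_of_int k\<bar> + \<bar>\<xi>\<bar>"

lemma wt_ge1: "wt k \<xi> \<ge> 1" by (simp add: wt_def)
lemma wt_pos: "wt k \<xi> > 0" using wt_ge1[of k \<xi>] by linarith

definition polyb :: "real \<Rightarrow> symb \<Rightarrow> bool" where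
  "polyb T f \<longleftrightarrow> (\<exists>n B. B \<ge> 0 \<and> (\<forall>t\<in>{0..T}. \<forall>k \<xi>. norm (f t k \<xi>) \<le> B * wt k \<xi> ^ n))"

definition rapid :: "real \<Rightarrow> symb \<Rightarrow> bool" where
  "rapid T f \<longleftrightarrow> (\<forall>n. \<exists>B. \<forall>t\<in>{0..T}. \<forall>k \<xi>. wt k \<xi> ^ n * norm (f t k \<xi>) \<le> B)"

definition dt :: "symb \<Rightarrow> symb \<Rightarrow> bool" where
  "dt f f' \<longleftrightarrow> (\<forall>t k \<xi>. ((\<lambda>s. f s k \<xi>) has_vector_derivative f' t k \<xi>) (at t))"

definition dxi :: "symb \<Rightarrow> symb \<Rightarrow> bool" where
  "dxi f f' \<longleftrightarrow> (\<forall>t k \<xi>. (f t k has_vector_derivative f' t k \<xi>) (at \<xi>))"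

text \<open>Coinduction replaces multi-indices: every mixed derivative in t and \<xi> again
  satisfies \<open>P\<close>. With \<open>polyb T\<close> or \<open>rapid T\<close> for
  \<open>P\<close> the bounds concern t in [0, T] only, while derivatives exist at all real times.
  \<open>om\<close> thus collects slowly increasing multipliers and \<open>sf\<close> families of
  Schwartz type.\<close>

coinductive smth :: "(symb \<Rightarrow> bool) \<Rightarrow> symb \<Rightarrow> bool" for P where
  "\<lbrakk> P f; dt f f1; dxi f f2; smth P f1; smth P f2 \<rbrakk> \<Longrightarrow> smth P f"

abbreviation om :: "real \<Rightarrow> symb \<Rightarrow> bool" where "om T \<equiv> smth (polyb T)"
abbreviation sf :: "real \<Rightarrow> symb \<Rightarrow> bool" where "sf T \<equiv> smth (rapid T)"

lemma smthD: "smth P f \<Longrightarrow> P f" by (erule smth.cases) simp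

lemma smthE:
  assumes "smth P f" obtains f1 f2 where "dt f f1" "dxi f f2" "smth P f1" "smth P f2"
  using assms by (auto elim: smth.cases)

text \<open>The Leibniz rule turns one product into a sum of two, so coinduction has to run up to
  finite sums of generators.\<close>

inductive_set adds :: "symb set \<Rightarrow> symb set" for G where
  base: "g \<in> G \<Longrightarrow> g \<in> adds G"
| add: "f \<in> adds G \<Longrightarrow> g \<in> adds G \<Longrightarrow> (\<lambda>t k \<xi>. f t k \<xi> + g t k \<xi>) \<in> adds G"

lemma dt_add: "dt f f' \<Longrightarrow> dt g g' \<Longrightarrow> dt (\<lambda>t k \<xi>. f t k \<xi> + g t k \<xi>) (\<lambda>t k \<xi>. f' t k \<xi> + g' t k \<xi>)"
  unfolding dt_def by (auto intro: has_vector_derivative_add)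
lemma dxi_add: "dxi f f' \<Longrightarrow> dxi g g' \<Longrightarrow> dxi (\<lambda>t k \<xi>. f t k \<xi> + g t k \<xi>) (\<lambda>t k \<xi>. f' t k \<xi> + g' t k \<xi>)"
  unfolding dxi_def by (auto intro: has_vector_derivative_add)
lemma dt_mult: "dt f f' \<Longrightarrow> dt g g' \<Longrightarrow> dt (\<lambda>t k \<xi>. f t k \<xi> * g t k \<xi>) (\<lambda>t k \<xi>. f t k \<xi> * g' t k \<xi> + f' t k \<xi> * g t k \<xi>)"
  unfolding dt_def by (auto intro: has_vector_derivative_mult)
lemma dxi_mult: "dxi f f' \<Longrightarrow> dxi g g' \<Longrightarrow> dxi (\<lambda>t k \<xi>. f t k \<xi> * g t k \<xi>) (\<lambda>t k \<xi>. f t k \<xi> * g' t k \<xi> + f' t k \<xi> * g t k \<xi>)"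
  unfolding dxi_def by (auto intro: has_vector_derivative_mult)

definition add_closed :: "(symb \<Rightarrow> bool) \<Rightarrow> bool" where
  "add_closed P \<longleftrightarrow> (\<forall>f g. P f \<longrightarrow> P g \<longrightarrow> P (\<lambda>t k \<xi>. f t k \<xi> + g t k \<xi>))"

definition mult_closed :: "(symb \<Rightarrow> bool) \<Rightarrow> (symb \<Rightarrow> bool) \<Rightarrow> bool" where
  "mult_closed Q P \<longleftrightarrow> (\<forall>f g. Q f \<longrightarrow> P g \<longrightarrow> P (\<lambda>t k \<xi>. f t k \<xi> * g t k \<xi>))"

text \<open>Differentiation is additive, so it is enough to control generators: a set closed under
  both derivatives up to finite sums is an invariant for the coinduction. Products, powers, shifts
  and the propagator are all treated by a suitable choice of \<open>G\<close>.\<close>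

lemma smth_adds:
  assumes Padd: "add_closed P"
    and G: "\<And>g. g \<in> G \<Longrightarrow> P g \<and> (\<exists>f1 f2. dt g f1 \<and> dxi g f2 \<and> f1 \<in> adds G \<and> f2 \<in> adds G)"
    and f: "f \<in> adds G"
  shows "smth P f"
  using f
proof (coinduction arbitrary: f)
  case smth
  have "P f \<and> (\<exists>f1 f2. dt f f1 \<and> dxi f f2 \<and> f1 \<in> adds G \<and> f2 \<in> adds G)"
    using smth
  proof induction
    case (base g) then show ?case by (rule G)
  next
    case (add f g)
    then obtain f1 f2 g1 g2 where "dt f f1" "dxi f f2" "f1 \<in> adds G" "f2 \<in> adds G"
      "dt g g1" "dxi g g2" "g1 \<in> adds G" "g2 \<in> adds G" by blast
    with add dt_add[of f f1 g g1] dxi_add[of f f2 g g2] adds.add[of f1 G g1] adds.add[of f2 G g2] Padd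
    show ?case unfolding add_closed_def by blast
  qed
  then show ?case by blast
qed

lemma polyb_add: "polyb T f \<Longrightarrow> polyb T g \<Longrightarrow> polyb T (\<lambda>t k \<xi>. f t k \<xi> + g t k \<xi>)"
proof -
  assume "polyb T f" "polyb T g"
  then obtain n B m C where *: "B \<ge> 0" "C \<ge> 0"
    "\<And>t k \<xi>. t \<in> {0..T} \<Longrightarrow> norm (f t k \<xi>) \<le> B * wt k \<xi> ^ n"
    "\<And>t k \<xi>. t \<in> {0..T} \<Longrightarrow> norm (g t k \<xi>) \<le> C * wt k \<xi> ^ m" unfolding polyb_def by metis
  have "norm (f t k \<xi> + g t k \<xi>) \<le> (B + C) * wt k \<xi> ^ (n + m)" if "t \<in> {0..T}" for t k \<xi>
  proof -
    have "B * wt k \<xi> ^ n \<le> B * wt k \<xi> ^ (n + m)" "C * wt k \<xi> ^ m \<le> C * wt k \<xi> ^ (n + m)"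
      using *(1,2) wt_ge1 by (auto intro!: mult_left_mono power_increasing)
    then show ?thesis
      using *(3)[OF that, of k \<xi>] *(4)[OF that, of k \<xi>] norm_triangle_ineq[of "f t k \<xi>" "g t k \<xi>"]
      by (simp add: distrib_right)
  qed
  then show ?thesis unfolding polyb_def using *(1,2) by (intro exI[of _ "n+m"] exI[of _ "B+C"]) auto
qed

lemma polyb_mult: "polyb T f \<Longrightarrow> polyb T g \<Longrightarrow> polyb T (\<lambda>t k \<xi>. f t k \<xi> * g t k \<xi>)"
proof -
  assume "polyb T f" "polyb T g"
  then obtain n B m C where *: "B \<ge> 0" "C \<ge> 0"
    "\<And>t k \<xi>. t \<in> {0..T} \<Longrightarrow> norm (f t k \<xi>) \<le> B * wt k \<xi> ^ n"
    "\<And>t k \<xi>. t \<in> {0..T} \<Longrightarrow> norm (g t k \<xi>) \<le> C * wt k \<xi> ^ m" unfolding polyb_def by metis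
  have "norm (f t k \<xi> * g t k \<xi>) \<le> (B * C) * wt k \<xi> ^ (n + m)" if "t \<in> {0..T}" for t k \<xi>
  proof -
    have "norm (f t k \<xi>) * norm (g t k \<xi>) \<le> (B * wt k \<xi> ^ n) * (C * wt k \<xi> ^ m)"
      using *(1,2) *(3)[OF that, of k \<xi>] *(4)[OF that, of k \<xi>] wt_pos[of k \<xi>]
      by (intro mult_mono) auto
    then show ?thesis by (simp add: norm_mult power_add mult_ac)
  qed
  then show ?thesis unfolding polyb_def using *(1,2) by (intro exI[of _ "n+m"] exI[of _ "B*C"]) auto
qed

lemma rapid_add: "rapid T f \<Longrightarrow> rapid T g \<Longrightarrow> rapid T (\<lambda>t k \<xi>. f t k \<xi> + g t k \<xi>)"
  unfolding rapid_def
proof (intro allI)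
  fix n
  assume f: "\<forall>n. \<exists>B. \<forall>t\<in>{0..T}. \<forall>k \<xi>. wt k \<xi> ^ n * norm (f t k \<xi>) \<le> B"
    and g: "\<forall>n. \<exists>B. \<forall>t\<in>{0..T}. \<forall>k \<xi>. wt k \<xi> ^ n * norm (g t k \<xi>) \<le> B"
  obtain B C where *: "\<And>t k \<xi>. t \<in> {0..T} \<Longrightarrow> wt k \<xi> ^ n * norm (f t k \<xi>) \<le> B"
    "\<And>t k \<xi>. t \<in> {0..T} \<Longrightarrow> wt k \<xi> ^ n * norm (g t k \<xi>) \<le> C" using f g by metis
  have "wt k \<xi> ^ n * norm (f t k \<xi> + g t k \<xi>) \<le> B + C" if "t \<in> {0..T}" for t k \<xi>
  proof -
    have "wt k \<xi> ^ n * norm (f t k \<xi> + g t k \<xi>) \<le> wt k \<xi> ^ n * (norm (f t k \<xi>) + norm (g t k \<xi>))"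
      using wt_pos[of k \<xi>] by (intro mult_left_mono norm_triangle_ineq) auto
    then show ?thesis using *[OF that, of k \<xi>] by (simp add: distrib_left)
  qed
  then show "\<exists>B. \<forall>t\<in>{0..T}. \<forall>k \<xi>. wt k \<xi> ^ n * norm (f t k \<xi> + g t k \<xi>) \<le> B" by blast
qed

lemma rapid_mult: "polyb T f \<Longrightarrow> rapid T g \<Longrightarrow> rapid T (\<lambda>t k \<xi>. f t k \<xi> * g t k \<xi>)"
  unfolding rapid_def
proof (intro allI)
  fix n
  assume f: "polyb T f" and g: "\<forall>n. \<exists>B. \<forall>t\<in>{0..T}. \<forall>k \<xi>. wt k \<xi> ^ n * norm (g t k \<xi>) \<le> B"
  obtain m C where C: "C \<ge> 0" "\<And>t k \<xi>. t \<in> {0..T} \<Longrightarrow> norm (f t k \<xi>) \<le> C * wt k \<xi> ^ m"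
    using f unfolding polyb_def by metis
  obtain B where B: "\<And>t k \<xi>. t \<in> {0..T} \<Longrightarrow> wt k \<xi> ^ (n + m) * norm (g t k \<xi>) \<le> B" using g by metis
  have "wt k \<xi> ^ n * norm (f t k \<xi> * g t k \<xi>) \<le> C * B" if "t \<in> {0..T}" for t k \<xi>
  proof -
    have "wt k \<xi> ^ n * norm (f t k \<xi> * g t k \<xi>) \<le> wt k \<xi> ^ n * ((C * wt k \<xi> ^ m) * norm (g t k \<xi>))"
      unfolding norm_mult using wt_pos[of k \<xi>] C(2)[OF that]
      by (intro mult_left_mono mult_right_mono) auto
    also have "\<dots> = C * (wt k \<xi> ^ (n + m) * norm (g t k \<xi>))" by (simp add: power_add mult_ac)
    also have "\<dots> \<le> C * B" using B[OF that] C by (intro mult_left_mono)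
    finally show ?thesis .
  qed
  then show "\<exists>B. \<forall>t\<in>{0..T}. \<forall>k \<xi>. wt k \<xi> ^ n * norm (f t k \<xi> * g t k \<xi>) \<le> B" by blast
qed

lemma add_closed_polyb: "add_closed (polyb T)"
  unfolding add_closed_def using polyb_add by blast

lemma add_closed_rapid: "add_closed (rapid T)"
  unfolding add_closed_def using rapid_add by blast

lemma mult_closed_polyb: "mult_closed (polyb T) (polyb T)"
  unfolding mult_closed_def using polyb_mult by blast

lemma mult_closed_rapid: "mult_closed (polyb T) (rapid T)"
  unfolding mult_closed_def using rapid_mult by blast

lemma smth_add_gen:
  assumes Padd: "add_closed P"
    and "smth P f" "smth P g"
  shows "smth P (\<lambda>t k \<xi>. f t k \<xi> + g t k \<xi>)"
proof (rule smth_adds[where G = "Collect (smth P)"])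
  show "P g \<and> (\<exists>f1 f2. dt g f1 \<and> dxi g f2 \<and> f1 \<in> adds (Collect (smth P)) \<and> f2 \<in> adds (Collect (smth P)))"
    if "g \<in> Collect (smth P)" for g
  proof -
    have g: "smth P g" using that by simp
    obtain f1 f2 where f: "dt g f1" "dxi g f2" "smth P f1" "smth P f2" using g by (rule smthE)
    have "f1 \<in> adds (Collect (smth P))" "f2 \<in> adds (Collect (smth P))"
      using f(3,4) by (auto intro!: adds.base)
    with f(1,2) smthD[OF g] show ?thesis by blast
  qed
qed (use assms in \<open>auto intro: adds.intros\<close>)

lemma smth_mult_gen:
  assumes Padd: "add_closed P" and Pm: "mult_closed Q P"
    and "smth Q f" "smth P g"
  shows "smth P (\<lambda>t k \<xi>. f t k \<xi> * g t k \<xi>)"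
proof -
  let ?G = "{\<lambda>t k \<xi>. f t k \<xi> * g t k \<xi> | f g. smth Q f \<and> smth P g}"
  show ?thesis
  proof (rule smth_adds[where G = ?G])
  show "P h \<and> (\<exists>f1 f2. dt h f1 \<and> dxi h f2 \<and> f1 \<in> adds ?G \<and> f2 \<in> adds ?G)" if "h \<in> ?G" for h
  proof -
    from that obtain f g where h: "h = (\<lambda>t k \<xi>. f t k \<xi> * g t k \<xi>)" and fg: "smth Q f" "smth P g" by blast
    obtain f1 f2 where f: "dt f f1" "dxi f f2" "smth Q f1" "smth Q f2" using fg(1) by (rule smthE)
    obtain g1 g2 where g: "dt g g1" "dxi g g2" "smth P g1" "smth P g2" using fg(2) by (rule smthE)
    have e: "(\<lambda>t k \<xi>. a t k \<xi> * b t k \<xi>) \<in> adds ?G" if "smth Q a" "smth P b" for a b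
      using that by (intro adds.base) blast
    have "P h" unfolding h using Pm smthD[OF fg(1)] smthD[OF fg(2)] unfolding mult_closed_def by blast
    moreover have "(\<lambda>t k \<xi>. f t k \<xi> * g1 t k \<xi> + f1 t k \<xi> * g t k \<xi>) \<in> adds ?G"
      by (rule adds.add[OF e[OF fg(1) g(3)] e[OF f(3) fg(2)]])
    moreover have "(\<lambda>t k \<xi>. f t k \<xi> * g2 t k \<xi> + f2 t k \<xi> * g t k \<xi>) \<in> adds ?G"
      by (rule adds.add[OF e[OF fg(1) g(4)] e[OF f(4) fg(2)]])
    ultimately show ?thesis using dt_mult[OF f(1) g(1)] dxi_mult[OF f(2) g(2)] unfolding h by blast
  qed
qed (use assms in \<open>auto intro: adds.intros\<close>)
qed

lemma om_add: "om T f \<Longrightarrow> om T g \<Longrightarrow> om T (\<lambda>t k \<xi>. f t k \<xi> + g t k \<xi>)"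
  by (rule smth_add_gen[OF add_closed_polyb])
lemma sf_add: "sf T f \<Longrightarrow> sf T g \<Longrightarrow> sf T (\<lambda>t k \<xi>. f t k \<xi> + g t k \<xi>)"
  by (rule smth_add_gen[OF add_closed_rapid])
lemma om_mult: "om T f \<Longrightarrow> om T g \<Longrightarrow> om T (\<lambda>t k \<xi>. f t k \<xi> * g t k \<xi>)"
  by (rule smth_mult_gen[OF add_closed_polyb mult_closed_polyb])
lemma sf_mult: "om T f \<Longrightarrow> sf T g \<Longrightarrow> sf T (\<lambda>t k \<xi>. f t k \<xi> * g t k \<xi>)"
  by (rule smth_mult_gen[OF add_closed_rapid mult_closed_rapid])

text \<open>Wave numbers are discrete and both derivatives of a function of k alone vanish, so
  growth is the only condition; cut-offs such as the indicator of k = 0 become admissible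
  multipliers.\<close>

lemma om_kfun:
  assumes "\<And>k. norm (h k) \<le> B * (1 + \<bar>real_of_int k\<bar>) ^ n"
  shows "om T (\<lambda>t k \<xi>. h k)"
proof -
  let ?G = "{\<lambda>(t::real) k (\<xi>::real). h k :: complex | h. \<exists>B n. B \<ge> 0 \<and> (\<forall>k. norm (h k) \<le> B * (1 + \<bar>real_of_int k\<bar>) ^ n)}"
  show ?thesis
  proof (rule smth_adds[OF add_closed_polyb, where G = ?G])
  fix g assume "g \<in> ?G"
  then obtain h B n where h: "g = (\<lambda>t k \<xi>. h k)" "B \<ge> 0" "\<And>k. norm (h k) \<le> B * (1 + \<bar>real_of_int k\<bar>) ^ n" by blast
  have "norm (h k) \<le> B * wt k \<xi> ^ n" for k \<xi>
  proof -
    have "B * (1 + \<bar>real_of_int k\<bar>) ^ n \<le> B * wt k \<xi> ^ n"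
      using h(2) by (intro mult_left_mono power_mono) (auto simp: wt_def)
    then show ?thesis using h(3)[of k] by linarith
  qed
  then have "polyb T g" unfolding polyb_def h using h(2) by blast
  moreover have "(\<lambda>t k \<xi>. 0) \<in> adds ?G" by (rule adds.base) (auto intro!: exI[of _ 0])
  moreover have "dt g (\<lambda>t k \<xi>. 0)" "dxi g (\<lambda>t k \<xi>. 0)" unfolding dt_def dxi_def h by auto
  ultimately show "polyb T g \<and> (\<exists>f1 f2. dt g f1 \<and> dxi g f2 \<and> f1 \<in> adds ?G \<and> f2 \<in> adds ?G)" by blast
next
  have "B \<ge> 0" using assms[of 0] order_trans[OF norm_ge_zero assms[of 0]] by simp
  then show "(\<lambda>t k \<xi>. h k) \<in> adds ?G" using assms by (intro adds.base) blast
qed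
qed

lemma om_const: "om T (\<lambda>t k \<xi>. c)"
  by (rule om_kfun[where B = "norm c" and n = 0]) simp

lemma om_k: "om T (\<lambda>t k \<xi>. of_int k)"
  by (rule om_kfun[where B = 1 and n = 1]) simp

lemma om_kbounded: "(\<And>k. norm (h k) \<le> B) \<Longrightarrow> om T (\<lambda>t k \<xi>. h k)"
  by (rule om_kfun[where n = 0]) simp

lemma om_xi: "om T (\<lambda>t k \<xi>. of_real \<xi>)"
proof (rule smth.intros)
  show "polyb T (\<lambda>t k \<xi>. of_real \<xi>)" unfolding polyb_def
    by (intro exI[of _ 1] exI[of _ 1]) (auto simp: wt_def)
  show "dt (\<lambda>t k \<xi>. complex_of_real \<xi>) (\<lambda>t k \<xi>. 0)" by (simp add: dt_def)
  show "dxi (\<lambda>t k \<xi>. complex_of_real \<xi>) (\<lambda>t k \<xi>. 1)"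
    unfolding dxi_def using has_vector_derivative_of_real[OF DERIV_ident] by auto
qed (rule om_const)+

lemma om_t: "om T (\<lambda>t k \<xi>. of_real t)"
proof (rule smth.intros)
  have "\<bar>t\<bar> \<le> \<bar>T\<bar> * 1" if "t \<in> {0..T}" for t using that by auto
  then show "polyb T (\<lambda>t k \<xi>. of_real t)" unfolding polyb_def
    by (intro exI[of _ 0] exI[of _ "\<bar>T\<bar>"]) auto
  show "dt (\<lambda>t k \<xi>. complex_of_real t) (\<lambda>t k \<xi>. 1)"
    unfolding dt_def using has_vector_derivative_of_real[OF DERIV_ident] by auto
  show "dxi (\<lambda>t k \<xi>. complex_of_real t) (\<lambda>t k \<xi>. 0)" by (simp add: dxi_def)
qed (rule om_const)+

lemma om_cmult: "om T f \<Longrightarrow> om T (\<lambda>t k \<xi>. c * f t k \<xi>)"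
  by (rule om_mult[OF om_const])
lemma sf_cmult: "sf T f \<Longrightarrow> sf T (\<lambda>t k \<xi>. c * f t k \<xi>)"
  by (rule sf_mult[OF om_const])
lemma om_diff: "om T f \<Longrightarrow> om T g \<Longrightarrow> om T (\<lambda>t k \<xi>. f t k \<xi> - g t k \<xi>)"
  using om_add[OF _ om_cmult[of T g "-1"], of f] by simp
lemma om_minus: "om T f \<Longrightarrow> om T (\<lambda>t k \<xi>. - f t k \<xi>)"
  using om_cmult[of T f "-1"] by simp
lemma om_power: "om T f \<Longrightarrow> om T (\<lambda>t k \<xi>. f t k \<xi> ^ n)"
  by (induction n) (auto intro: om_const om_mult)

lemmas om_intros = om_add om_diff om_minus om_mult om_const om_k om_xi om_t om_power

text \<open>Differentiation lowers the exponent by one and brings out a derivative of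
  \<open>y\<close>, so the generators contain all real exponents at once. As \<open>y\<close> is at
  least 1, every power, negative ones included, is dominated by a natural power of
  \<open>y\<close>.\<close>

lemma om_powr:
  fixes y :: "real \<Rightarrow> int \<Rightarrow> real \<Rightarrow> real"
  assumes y1: "\<And>t k \<xi>. y t k \<xi> \<ge> 1" and y: "om T (\<lambda>t k \<xi>. of_real (y t k \<xi>))"
  shows "om T (\<lambda>t k \<xi>. of_real (y t k \<xi> powr b))"
proof -
  let ?p = "\<lambda>b t k \<xi>. complex_of_real (y t k \<xi> powr b)"
  let ?G = "{\<lambda>t k \<xi>. c t k \<xi> * ?p b t k \<xi> | c b. om T c}"
  obtain z1 z2 where z: "dt (\<lambda>t k \<xi>. of_real (y t k \<xi>)) z1" "dxi (\<lambda>t k \<xi>. of_real (y t k \<xi>)) z2" "om T z1" "om T z2"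
    using y by (rule smthE)
  have gen: "((\<lambda>s. complex_of_real (u s powr b)) has_vector_derivative of_real b * u' * of_real (u t powr (b - 1))) (at t)"
    if u: "((\<lambda>s. complex_of_real (u s)) has_vector_derivative u') (at t)" and u1: "u t \<ge> 1" for u u' t b
  proof -
    have R: "(u has_real_derivative Re u') (at t)"
      using bounded_linear.has_vector_derivative[OF bounded_linear_Re u]
      by (simp add: has_real_derivative_iff_has_vector_derivative)
    have "((\<lambda>s. Im (complex_of_real (u s))) has_vector_derivative Im u') (at t)"
      by (rule bounded_linear.has_vector_derivative[OF bounded_linear_Im u])
    \<comment> \<open>The derivative comes from the complex calculus of \<open>om\<close>; it is
      real because the function is, and this gives access to the real chain rule for
      \<open>powr\<close>.\<close>
    then have "Im u' = 0" by (simp add: vector_derivative_unique_at[OF _ has_vector_derivative_const])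
    then have u'e: "u' = of_real (Re u')" by (simp add: complex_eq_iff)
    have "((\<lambda>s. u s powr b) has_real_derivative b * u t powr (b - 1) * Re u') (at t)"
      using DERIV_chain2[OF has_real_derivative_powr R] u1 by simp
    from has_vector_derivative_of_real[OF this] show ?thesis
      by (subst u'e) (simp add: mult_ac)
  qed
  have Dt: "dt (?p b) (\<lambda>t k \<xi>. of_real b * z1 t k \<xi> * ?p (b - 1) t k \<xi>)" for b
    using z(1) unfolding dt_def by (intro allI gen) (auto intro: y1)
  have Dx: "dxi (?p b) (\<lambda>t k \<xi>. of_real b * z2 t k \<xi> * ?p (b - 1) t k \<xi>)" for b
    using z(2) unfolding dxi_def by (intro allI gen) (auto intro: y1)
  have pb: "polyb T (?p b)" for b
  proof -
    obtain n B where B: "B \<ge> 0" "\<And>t k \<xi>. t \<in> {0..T} \<Longrightarrow> norm (complex_of_real (y t k \<xi>)) \<le> B * wt k \<xi> ^ n"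
      using smthD[OF y] unfolding polyb_def by metis
    define m where "m = nat \<lceil>\<bar>b\<bar>\<rceil>"
    have "norm (?p b t k \<xi>) \<le> B ^ m * wt k \<xi> ^ (n * m)" if "t \<in> {0..T}" for t k \<xi>
    proof -
      have "b \<le> real m" unfolding m_def using of_nat_ceiling[of "\<bar>b\<bar>"] by linarith
      then have "y t k \<xi> powr b \<le> y t k \<xi> powr (real m)"
        using y1[of t k \<xi>] by (intro powr_mono)
      also have "\<dots> = y t k \<xi> ^ m" using y1[of t k \<xi>] by (simp add: powr_realpow)
      also have "\<dots> \<le> (B * wt k \<xi> ^ n) ^ m" using y1[of t k \<xi>] B(2)[OF that, of k \<xi>] by (intro power_mono) auto
      finally show ?thesis by (simp add: power_mult_distrib power_mult)
    qed
    then show ?thesis unfolding polyb_def using B(1) by (intro exI[of _ "n * m"] exI[of _ "B ^ m"]) auto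
  qed
  have Gi: "(\<lambda>t k \<xi>. c t k \<xi> * ?p b t k \<xi>) \<in> adds ?G" if "om T c" for c b
    using that by (intro adds.base) blast
  have "f \<in> adds ?G \<Longrightarrow> om T f" for f
  proof (rule smth_adds[OF add_closed_polyb, where G = ?G])
    fix g assume "g \<in> ?G"
    then obtain c b where g: "g = (\<lambda>t k \<xi>. c t k \<xi> * ?p b t k \<xi>)" and c: "om T c" by blast
    obtain c1 c2 where c': "dt c c1" "dxi c c2" "om T c1" "om T c2" using c by (rule smthE)
    have e: "(\<lambda>t k \<xi>. c t k \<xi> * (of_real b * z t k \<xi> * ?p (b - 1) t k \<xi>) + c' t k \<xi> * ?p b t k \<xi>) \<in> adds ?G"
      if "om T z" "om T c'" for z c'
    proof (rule adds.add)
      have "om T (\<lambda>t k \<xi>. c t k \<xi> * (of_real b * z t k \<xi>))" using that c by (intro om_intros)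
      from Gi[OF this] show "(\<lambda>t k \<xi>. c t k \<xi> * (of_real b * z t k \<xi> * ?p (b - 1) t k \<xi>)) \<in> adds ?G"
        by (simp only: mult.assoc)
      show "(\<lambda>t k \<xi>. c' t k \<xi> * ?p b t k \<xi>) \<in> adds ?G" by (rule Gi) fact
    qed
    show "polyb T g \<and> (\<exists>f1 f2. dt g f1 \<and> dxi g f2 \<and> f1 \<in> adds ?G \<and> f2 \<in> adds ?G)"
      unfolding g using dt_mult[OF c'(1) Dt] dxi_mult[OF c'(2) Dx] e[OF z(3) c'(3)] e[OF z(4) c'(4)]
        polyb_mult[OF smthD[OF c] pb[of b]] by blast
  qed
  moreover have "(\<lambda>t k \<xi>. 1 * ?p b t k \<xi>) \<in> adds ?G" by (rule Gi[OF om_const])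
  ultimately show ?thesis by simp
qed

section \<open>Rapidly decaying symbols of the frequency alone\<close>

coinductive sg :: "(int \<Rightarrow> real \<Rightarrow> complex) \<Rightarrow> bool" where
  "\<lbrakk> \<And>n. \<exists>B. \<forall>k \<xi>. wt k \<xi> ^ n * norm (g k \<xi>) \<le> B;
     \<And>k \<xi>. (g k has_vector_derivative g' k \<xi>) (at \<xi>); sg g' \<rbrakk> \<Longrightarrow> sg g"

lemma sg_decay:
  assumes "sg g" shows "\<exists>B::real. \<forall>k \<xi>. wt k \<xi> ^ n * norm (g k \<xi>) \<le> B"
  using assms by (cases rule: sg.cases) blast

lemma sgE:
  assumes "sg g"
  obtains g' where "\<forall>k \<xi>. (g k has_vector_derivative g' k \<xi>) (at \<xi>)" "sg g'"
proof -
  have "\<exists>g'. (\<forall>k \<xi>. (g k has_vector_derivative g' k \<xi>) (at \<xi>)) \<and> sg g'"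
    using assms by (cases rule: sg.cases) blast
  then show thesis using that by blast
qed

lemma sg_zero: "sg (\<lambda>k \<xi>. 0)"
  by (coinduction) (auto intro!: exI[of _ "0::real"] exI[of _ "\<lambda>k \<xi>. 0"])

lemma sf_slice: "sf T f \<Longrightarrow> t \<in> {0..T} \<Longrightarrow> sg (f t)"
proof (coinduction arbitrary: f)
  case sg
  obtain f1 f2 where f: "dt f f1" "dxi f f2" "sf T f1" "sf T f2" using sg(1) by (rule smthE)
  have "\<exists>B. \<forall>k \<xi>. wt k \<xi> ^ n * norm (f t k \<xi>) \<le> B" for n
    using smthD[OF sg(1)] sg(2) unfolding rapid_def by blast
  then show ?case using f sg(2) unfolding dxi_def by (intro exI[of _ "f t"] exI[of _ "f2 t"]) blast
qed

text \<open>Transport of a symbol by the shear, anchored at time \<open>a\<close>. Each time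
  derivative produces a factor k, so the generators carry coefficients in \<open>om\<close>.\<close>

lemma sf_shift:
  assumes g: "sg g" and a: "0 \<le> a" "a \<le> T"
  shows "sf T (\<lambda>t k \<xi>. g k (\<xi> + of_int k * (t - a)))"
proof -
  let ?s = "\<lambda>g t k \<xi>. g k (\<xi> + real_of_int k * (t - a)) :: complex"
  let ?G = "{\<lambda>t k \<xi>. c t k \<xi> * ?s g t k \<xi> | c g. om T c \<and> sg g}"
  have Dt: "dt (?s g) (\<lambda>t k \<xi>. of_int k * ?s g' t k \<xi>)" and Dx: "dxi (?s g) (?s g')"
    if *: "\<forall>k \<xi>. (g k has_vector_derivative g' k \<xi>) (at \<xi>)" for g g'
  proof -
    have "((\<lambda>t. g k (\<xi> + of_int k * (t - a))) has_vector_derivative of_int k * g' k (\<xi> + of_int k * (t - a))) (at t)" for t k \<xi>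
    proof -
      have "((\<lambda>t. \<xi> + of_int k * (t - a)) has_vector_derivative of_int k) (at t)"
        unfolding has_real_derivative_iff_has_vector_derivative[symmetric] by (auto intro!: derivative_eq_intros)
      from vector_diff_chain_at[OF this *[rule_format]] show ?thesis by (simp add: o_def scaleR_conv_of_real)
    qed
    then show "dt (?s g) (\<lambda>t k \<xi>. of_int k * ?s g' t k \<xi>)" by (simp add: dt_def)
    have "((\<lambda>\<xi>. g k (\<xi> + of_int k * (t - a))) has_vector_derivative g' k (\<xi> + of_int k * (t - a))) (at \<xi>)" for t k \<xi>
    proof -
      have "((\<lambda>\<xi>. \<xi> + of_int k * (t - a)) has_vector_derivative 1) (at \<xi>)"
        unfolding has_real_derivative_iff_has_vector_derivative[symmetric] by (auto intro!: derivative_eq_intros)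
      from vector_diff_chain_at[OF this *[rule_format]] show ?thesis by (simp add: o_def)
    qed
    then show "dxi (?s g) (?s g')" by (simp add: dxi_def)
  qed
  have rap: "rapid T (?s g)" if sgg: "sg g" for g
    unfolding rapid_def
  proof
    fix n
    obtain B where B: "\<And>k \<xi>. wt k \<xi> ^ n * norm (g k \<xi>) \<le> B" using sg_decay[OF sgg, of n] by blast
    have "wt k \<xi> ^ n * norm (?s g t k \<xi>) \<le> (1 + T) ^ n * B" if t: "t \<in> {0..T}" for t k \<xi>
    proof -
      let ?x = "\<xi> + of_int k * (t - a)"
      \<comment> \<open>The shift is at most |k| T, so the weights before and after it differ at
        most by the factor 1 + T and the decay is uniform on [0, T].\<close>
      have "\<bar>\<xi>\<bar> \<le> \<bar>?x\<bar> + \<bar>of_int k * (t - a)\<bar>" by linarith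
      moreover have "\<bar>of_int k * (t - a)\<bar> \<le> \<bar>real_of_int k\<bar> * T"
        unfolding abs_mult using t a by (intro mult_left_mono) auto
      ultimately have "wt k \<xi> \<le> wt k ?x + \<bar>real_of_int k\<bar> * T" by (simp add: wt_def)
      also have "\<dots> \<le> (1 + T) * wt k ?x"
        using t a by (simp add: wt_def algebra_simps)
      finally have "wt k \<xi> ^ n \<le> ((1 + T) * wt k ?x) ^ n" using wt_pos[of k \<xi>] by (intro power_mono) auto
      then have "wt k \<xi> ^ n * norm (?s g t k \<xi>) \<le> ((1 + T) * wt k ?x) ^ n * norm (g k ?x)"
        by (intro mult_right_mono) auto
      also have "\<dots> = (1 + T) ^ n * (wt k ?x ^ n * norm (g k ?x))" by (simp add: power_mult_distrib mult_ac)
      also have "\<dots> \<le> (1 + T) ^ n * B" using a B by (intro mult_left_mono) auto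
      finally show ?thesis .
    qed
    then show "\<exists>B. \<forall>t\<in>{0..T}. \<forall>k \<xi>. wt k \<xi> ^ n * norm (?s g t k \<xi>) \<le> B" by blast
  qed
  have Gi: "(\<lambda>t k \<xi>. c t k \<xi> * ?s g t k \<xi>) \<in> adds ?G" if "om T c" "sg g" for c g
    using that by (intro adds.base) blast
  have "f \<in> adds ?G \<Longrightarrow> sf T f" for f
  proof (rule smth_adds[OF add_closed_rapid, where G = ?G])
    fix h assume "h \<in> ?G"
    then obtain c g where h: "h = (\<lambda>t k \<xi>. c t k \<xi> * ?s g t k \<xi>)" and c: "om T c" and g: "sg g" by blast
    obtain c1 c2 where c': "dt c c1" "dxi c c2" "om T c1" "om T c2" using c by (rule smthE)
    obtain g' where g': "\<forall>k \<xi>. (g k has_vector_derivative g' k \<xi>) (at \<xi>)" "sg g'" using g by (rule sgE)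
    have "(\<lambda>t k \<xi>. c t k \<xi> * (of_int k * ?s g' t k \<xi>) + c1 t k \<xi> * ?s g t k \<xi>) \<in> adds ?G"
    proof (rule adds.add)
      have "om T (\<lambda>t k \<xi>. c t k \<xi> * of_int k)" using c by (intro om_intros)
      from Gi[OF this g'(2)] show "(\<lambda>t k \<xi>. c t k \<xi> * (of_int k * ?s g' t k \<xi>)) \<in> adds ?G"
        by (simp only: mult.assoc)
      show "(\<lambda>t k \<xi>. c1 t k \<xi> * ?s g t k \<xi>) \<in> adds ?G" by (rule Gi[OF c'(3) g])
    qed
    moreover have "(\<lambda>t k \<xi>. c t k \<xi> * ?s g' t k \<xi> + c2 t k \<xi> * ?s g t k \<xi>) \<in> adds ?G"
      by (rule adds.add[OF Gi[OF c g'(2)] Gi[OF c'(4) g]])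
    ultimately show "rapid T h \<and> (\<exists>f1 f2. dt h f1 \<and> dxi h f2 \<and> f1 \<in> adds ?G \<and> f2 \<in> adds ?G)"
      unfolding h using dt_mult[OF c'(1) Dt[OF g'(1)]] dxi_mult[OF c'(2) Dx[OF g'(1)]]
        rapid_mult[OF smthD[OF c] rap[OF g]] by blast
  qed
  moreover have "(\<lambda>t k \<xi>. 1 * ?s g t k \<xi>) \<in> adds ?G" by (rule Gi[OF om_const g])
  ultimately show ?thesis by simp
qed

lemma sf_static:
  assumes g: "sg g" shows "sf T (\<lambda>t. g)"
proof -
  let ?G = "{\<lambda>t::real. g | g. sg g}"
  show ?thesis
  proof (rule smth_adds[OF add_closed_rapid, where G = ?G])
  fix h assume "h \<in> ?G"
  then obtain g where h: "h = (\<lambda>t. g)" and g: "sg g" by blast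
  obtain g' where g': "\<forall>k \<xi>. (g k has_vector_derivative g' k \<xi>) (at \<xi>)" "sg g'" using g by (rule sgE)
  have "rapid T h" unfolding h rapid_def using sg_decay[OF g] by (intro allI) (metis (no_types))
  moreover have "dt h (\<lambda>t k \<xi>. 0)" "dxi h (\<lambda>t. g')" unfolding dt_def dxi_def h using g' by auto
  moreover have "(\<lambda>t k \<xi>. 0) \<in> adds ?G" "(\<lambda>t. g') \<in> adds ?G" using sg_zero g' by (auto intro!: adds.base)
  ultimately show "rapid T h \<and> (\<exists>f1 f2. dt h f1 \<and> dxi h f2 \<and> f1 \<in> adds ?G \<and> f2 \<in> adds ?G)" by blast
next
  show "(\<lambda>t. g) \<in> adds ?G" using g by (intro adds.base) blast
qed
qed

text \<open>A multiplier of the frequency alone is encoded as a time-constant family on the horizon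
  0, so that the calculus of \<open>om\<close> also serves at fixed times.\<close>

lemma sg_mult:
  assumes "om 0 (\<lambda>t. m)" "sg g" shows "sg (\<lambda>k \<xi>. m k \<xi> * g k \<xi>)"
  using sf_slice[OF sf_mult[OF assms(1) sf_static[OF assms(2)]], of 0] by simp

lemma sg_add: "sg f \<Longrightarrow> sg g \<Longrightarrow> sg (\<lambda>k \<xi>. f k \<xi> + g k \<xi>)"
  using sf_slice[OF sf_add[OF sf_static sf_static], of f g 0 0] by simp

lemma sg_cmult: "sg g \<Longrightarrow> sg (\<lambda>k \<xi>. c * g k \<xi>)"
  by (rule sg_mult[OF om_const])

lemma om_slice:
  assumes f: "om T f" and t: "t \<in> {0..T}"
  shows "om 0 (\<lambda>_. f t)"
proof -
  let ?G = "{\<lambda>_::real. f t | f. om T f}"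
  have Gi: "(\<lambda>_. f t) \<in> adds ?G" if "om T f" for f
    using that by (intro adds.base) blast
  show ?thesis
  proof (rule smth_adds[OF add_closed_polyb, where G = ?G])
    fix h assume "h \<in> ?G"
    then obtain f where h: "h = (\<lambda>_. f t)" and f: "om T f" by blast
    obtain f1 f2 where f': "dt f f1" "dxi f f2" "om T f1" "om T f2" using f by (rule smthE)
    have p: "polyb 0 h" using smthD[OF f] t unfolding h polyb_def by blast
    have d: "dt h (\<lambda>t k \<xi>. 0)" "dxi h (\<lambda>_. f2 t)" using f' unfolding dt_def dxi_def h by auto
    have "(\<lambda>t k \<xi>. 0) \<in> adds ?G" by (rule Gi[OF om_const[of T 0]])
    with p d Gi[OF f'(4)] show "polyb 0 h \<and> (\<exists>f1 f2. dt h f1 \<and> dxi h f2 \<and> f1 \<in> adds ?G \<and> f2 \<in> adds ?G)"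
      by blast
  qed (rule Gi[OF f])
qed

section \<open>Inverse Fourier transforms of rapidly decaying symbols\<close>

lemma taylor2:
  fixes q :: "real \<Rightarrow> 'a::real_normed_vector"
  assumes q: "\<And>t. t \<in> {0..T} \<Longrightarrow> (q has_vector_derivative q1 t) (at t within {0..T})"
    and q1: "\<And>t. t \<in> {0..T} \<Longrightarrow> (q1 has_vector_derivative q2 t) (at t within {0..T})"
    and B: "\<And>t. t \<in> {0..T} \<Longrightarrow> norm (q2 t) \<le> B" and t: "t \<in> {0..T}" "t' \<in> {0..T}"
  shows "norm (q t' - q t - (t' - t) *\<^sub>R q1 t) \<le> B * (t' - t)\<^sup>2"
proof -
  let ?S = "closed_segment t t'"
  have sub: "?S \<subseteq> {0..T}" using t by (simp add: closed_segment_subset)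
  have B0: "B \<ge> 0" using B[OF t(1)] norm_ge_zero order_trans by blast
  have d: "norm (q1 x - q1 t) \<le> B * \<bar>t' - t\<bar>" if "x \<in> ?S" for x
  proof -
    have "norm (q1 x - q1 t) \<le> B * norm (x - t)"
    proof (rule differentiable_bound[of ?S q1 "\<lambda>x h. h *\<^sub>R q2 x"])
      show "(q1 has_derivative (\<lambda>h. h *\<^sub>R q2 x)) (at x within ?S)" if "x \<in> ?S" for x
        using q1[of x] that sub unfolding has_vector_derivative_def by (blast intro: has_derivative_subset)
      show "onorm (\<lambda>h. h *\<^sub>R q2 x) \<le> B" if "x \<in> ?S" for x
        using B[of x] that sub by (intro onorm_le) (auto simp: mult.commute[of B] intro!: mult_left_mono)
    qed (use that in auto)
    also have "\<dots> \<le> B * \<bar>t' - t\<bar>"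
      using that B0 segment_bound1[OF that] by (intro mult_left_mono) auto
    finally show ?thesis .
  qed
  have "norm (q t' - q t - (t' - t) *\<^sub>R q1 t) \<le> norm (t' - t) * (B * \<bar>t' - t\<bar>)"
  proof (rule vector_differentiable_bound_linearization[where S = ?S])
    show "(q has_vector_derivative q1 x) (at x within ?S)" if "x \<in> ?S" for x
      using q[of x] that sub unfolding has_vector_derivative_def by (blast intro: has_derivative_subset)
  qed (use d in auto)
  then show ?thesis by (simp add: power2_eq_square mult_ac flip: abs_mult)
qed

lemma has_vector_derivative_quadratic_remainder:
  fixes q :: "real \<Rightarrow> 'a::real_normed_vector"
  assumes "\<And>t'. t' \<in> S \<Longrightarrow> norm (q t' - q t - (t' - t) *\<^sub>R d) \<le> C * (t' - t)\<^sup>2"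
  shows "(q has_vector_derivative d) (at t within S)"
  unfolding has_vector_derivative_def has_derivative_within_alt2
proof (intro conjI allI impI)
  show "bounded_linear (\<lambda>h. h *\<^sub>R d)" by (rule bounded_linear_scaleR_left)
  fix e :: real assume e: "e > 0"
  have "\<forall>\<^sub>F y in at t within S. dist y t < e / (\<bar>C\<bar> + 1)"
    using e by (intro tendstoD[OF tendsto_ident_at]) auto
  moreover have "\<forall>\<^sub>F y in at t within S. y \<in> S" by (simp add: eventually_at_filter)
  ultimately show "\<forall>\<^sub>F y in at t within S. norm (q y - q t - (y - t) *\<^sub>R d) \<le> e * norm (y - t)"
  proof eventually_elim
    case (elim y)
    have "norm (q y - q t - (y - t) *\<^sub>R d) \<le> C * (y - t)\<^sup>2" by (rule assms) fact
    also have "\<dots> \<le> (\<bar>C\<bar> + 1) * (\<bar>y - t\<bar> * \<bar>y - t\<bar>)"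
      unfolding power2_eq_square abs_mult_self_eq by (intro mult_right_mono) auto
    also have "\<dots> = ((\<bar>C\<bar> + 1) * \<bar>y - t\<bar>) * \<bar>y - t\<bar>" by simp
    also have "\<dots> \<le> e * \<bar>y - t\<bar>"
      using elim(1) by (intro mult_right_mono) (auto simp: dist_real_def field_simps)
    finally show ?case by simp
  qed
qed

section \<open>The measure on frequency space and an integrable weight\<close>

definition FM :: "(int \<times> real) measure" where
  "FM = count_space UNIV \<Otimes>\<^sub>M lborel"

lemma space_FM [simp]: "space FM = UNIV"
  by (simp add: FM_def space_pair_measure)

interpretation FM: pair_sigma_finite "count_space (UNIV :: int set)" "lborel :: real measure"
  by (intro pair_sigma_finite.intro sigma_finite_measure_count_space_countable lborel.sigma_finite_measure_axioms) auto

lemma measurable_FM: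
  assumes "\<And>k. (\<lambda>\<xi>. f (k, \<xi>)) \<in> borel_measurable borel"
  shows "f \<in> borel_measurable FM"
  unfolding FM_def using assms by (intro measurable_pair_measure_countable1) auto

lemma nn_integral_FM:
  "f \<in> borel_measurable FM \<Longrightarrow> (\<integral>\<^sup>+z. f z \<partial>FM) = (\<integral>\<^sup>+k. \<integral>\<^sup>+\<xi>. f (k, \<xi>) \<partial>lborel \<partial>count_space UNIV)"
  unfolding FM_def by (subst lborel.nn_integral_fst) auto

lemma integral_FM:
  fixes f :: "_ \<Rightarrow> complex"
  shows "integrable FM f \<Longrightarrow> (\<integral>z. f z \<partial>FM) = (\<integral>k. \<integral>\<xi>. f (k, \<xi>) \<partial>lborel \<partial>count_space UNIV)"
  unfolding FM_def by (subst FM.integral_fst') auto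

lemma integrable_inverse_one_plus_sq: "integrable lborel (\<lambda>x::real. inverse (1 + x\<^sup>2))"
  using integrable_inverse_1_plus_square by (simp add: set_integrable_def)

lemma integrable_inverse_sq_int: "integrable (count_space (UNIV::int set)) (\<lambda>k. 1 / (1 + \<bar>real_of_int k\<bar>)\<^sup>2)"
proof -
  let ?f = "\<lambda>k::int. 1 / (1 + \<bar>real_of_int k\<bar>)\<^sup>2"
  have s: "summable (\<lambda>n. norm (1 / (1 + real n)\<^sup>2))"
    using sums_summable[OF inverse_squares_sums] by (simp add: add.commute)
  have "Infinite_Set_Sum.abs_summable_on ?f (range int)" "Infinite_Set_Sum.abs_summable_on ?f (range (\<lambda>n. - int n))"
    using s by (intro abs_summable_on_reindex; simp add: abs_summable_on_nat_iff')+
  then have "Infinite_Set_Sum.abs_summable_on ?f (range int \<union> range (\<lambda>n. - int n))" by (rule abs_summable_on_union)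
  moreover have "range int \<union> range (\<lambda>n. - int n) = UNIV"
  proof -
    have "k \<in> range int \<union> range (\<lambda>n. - int n)" for k by (cases k rule: int_cases2) auto
    then show ?thesis by blast
  qed
  ultimately show ?thesis by (simp add: Infinite_Set_Sum.abs_summable_on_def)
qed

text \<open>Two powers of \<open>wt\<close> make the sum over k converge and two the integral over
  \<xi>; hence the exponent 4 in the absolute bounds that follow.\<close>

lemma integrable_wt4: "integrable FM (\<lambda>z. 1 / wt (fst z) (snd z) ^ 4)"
proof -
  let ?h = "\<lambda>z::int \<times> real. 1 / (1 + \<bar>real_of_int (fst z)\<bar>)\<^sup>2 * inverse (1 + (snd z)\<^sup>2)"
  have m: "?h \<in> borel_measurable FM" by (rule measurable_FM) simp
  have "integrable FM ?h"
    unfolding FM_def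
  proof (rule FM.Fubini_integrable)
    show "?h \<in> borel_measurable (count_space UNIV \<Otimes>\<^sub>M lborel)" using m by (simp add: FM_def)
    have "(\<integral>\<xi>. norm (?h (k, \<xi>)) \<partial>lborel) = 1 / (1 + \<bar>real_of_int k\<bar>)\<^sup>2 * (\<integral>\<xi>. inverse (1 + \<xi>\<^sup>2) \<partial>lborel)" for k
      by (subst Bochner_Integration.integral_mult_right_zero[symmetric]) (auto intro!: Bochner_Integration.integral_cong simp: abs_mult)
    then show "integrable (count_space UNIV) (\<lambda>k. \<integral>\<xi>. norm (?h (k, \<xi>)) \<partial>lborel)"
      by (simp only:) (intro integrable_mult_left integrable_inverse_sq_int)
  qed (use integrable_inverse_one_plus_sq in auto)
  then show ?thesis
  proof (rule Bochner_Integration.integrable_bound)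
    show "(\<lambda>z. 1 / wt (fst z) (snd z) ^ 4) \<in> borel_measurable FM"
      by (rule measurable_FM) (simp add: wt_def)
    have "norm (1 / wt k \<xi> ^ 4) \<le> norm (?h (k, \<xi>))" for k \<xi>
    proof -
      have a: "(1 + \<bar>real_of_int k\<bar>)\<^sup>2 \<le> (wt k \<xi>)\<^sup>2" by (intro power_mono) (auto simp: wt_def)
      have "1 + \<xi>\<^sup>2 \<le> (1 + \<bar>\<xi>\<bar>)\<^sup>2" by (simp add: power2_sum)
      also have "\<dots> \<le> (wt k \<xi>)\<^sup>2" by (intro power_mono) (auto simp: wt_def)
      finally have b: "1 + \<xi>\<^sup>2 \<le> (wt k \<xi>)\<^sup>2" .
      have "(1 + \<bar>real_of_int k\<bar>)\<^sup>2 * (1 + \<xi>\<^sup>2) \<le> (wt k \<xi>)\<^sup>2 * (wt k \<xi>)\<^sup>2"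
        by (intro mult_mono a b) (auto intro: add_nonneg_nonneg)
      also have "\<dots> = wt k \<xi> ^ 4" by (simp add: power4_eq_xxxx power2_eq_square)
      finally have "(1 + \<bar>real_of_int k\<bar>)\<^sup>2 * (1 + \<xi>\<^sup>2) \<le> wt k \<xi> ^ 4" .
      moreover have "0 < (1 + \<bar>real_of_int k\<bar>)\<^sup>2 * (1 + \<xi>\<^sup>2)"
        by (intro mult_pos_pos zero_less_power) (auto intro: add_pos_nonneg)
      ultimately have "1 / wt k \<xi> ^ 4 \<le> 1 / ((1 + \<bar>real_of_int k\<bar>)\<^sup>2 * (1 + \<xi>\<^sup>2))"
        by (intro divide_left_mono mult_pos_pos[OF zero_less_power[OF wt_pos]]) auto
      also have "\<dots> = ?h (k, \<xi>)" by (simp add: inverse_eq_divide)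
      finally show ?thesis using wt_pos[of k \<xi>] by (simp add: abs_of_pos)
    qed
    then show "AE z in FM. norm (1 / wt (fst z) (snd z) ^ 4) \<le> norm (?h z)" by (auto simp: split_beta)
  qed
qed

lemma sg_continuous: "sg g \<Longrightarrow> continuous_on UNIV (g k)"
  by (erule sgE) (rule continuous_on_if_has_vector_derivative, blast)

lemma sg_measurable: "sg g \<Longrightarrow> (\<lambda>z. g (fst z) (snd z)) \<in> borel_measurable FM"
  by (rule measurable_FM) (auto intro: borel_measurable_continuous_onI sg_continuous)

lemma sg_bound4:
  assumes "sg g" shows "\<exists>B\<ge>0. \<forall>k \<xi>. norm (g k \<xi>) \<le> B / wt k \<xi> ^ 4"
proof -
  obtain B where B: "\<forall>k \<xi>. wt k \<xi> ^ 4 * norm (g k \<xi>) \<le> B" using sg_decay[OF assms] by blast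
  have "B \<ge> 0" using B[rule_format, of 0 0] wt_pos[of 0 0] by (smt (verit) mult_nonneg_nonneg norm_ge_zero zero_le_power)
  moreover have "norm (g k \<xi>) \<le> B / wt k \<xi> ^ 4" for k \<xi>
    using B wt_pos[of k \<xi>] by (simp add: pos_le_divide_eq mult.commute)
  ultimately show ?thesis by blast
qed

definition ez :: "int \<times> real \<Rightarrow> real \<times> real \<Rightarrow> complex" where
  "ez z p = cis (of_int (fst z) * fst p + snd z * snd p)"

lemma norm_ez [simp]: "norm (ez z p) = 1" by (simp add: ez_def)

lemma ez_measurable: "(\<lambda>z. ez z p) \<in> borel_measurable FM"
  by (rule measurable_FM) (auto simp: ez_def cis_conv_exp)

lemma integrable_wt4_bound:
  assumes m: "f \<in> borel_measurable FM" and B: "\<And>z. norm (f z :: complex) \<le> B / wt (fst z) (snd z) ^ 4"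
  shows "integrable FM f"
proof (rule Bochner_Integration.integrable_bound)
  show "integrable FM (\<lambda>z. B * (1 / wt (fst z) (snd z) ^ 4))" by (intro integrable_mult_right integrable_wt4)
  show "AE z in FM. norm (f z) \<le> norm (B * (1 / wt (fst z) (snd z) ^ 4))"
  proof (intro AE_I2)
    fix z
    have "B / wt (fst z) (snd z) ^ 4 \<le> \<bar>B\<bar> / wt (fst z) (snd z) ^ 4"
      using wt_pos[of "fst z" "snd z"] by (intro divide_right_mono) auto
    then show "norm (f z) \<le> norm (B * (1 / wt (fst z) (snd z) ^ 4))"
      using B[of z] wt_pos[of "fst z" "snd z"] by (simp add: abs_mult)
  qed
qed fact

lemma sg_integrable:
  assumes "sg g" shows "integrable FM (\<lambda>z. g (fst z) (snd z) * ez z p)" "integrable FM (\<lambda>z. g (fst z) (snd z))"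
proof -
  obtain B where B: "B \<ge> 0" "\<forall>k \<xi>. norm (g k \<xi>) \<le> B / wt k \<xi> ^ 4" using sg_bound4[OF assms] by blast
  show "integrable FM (\<lambda>z. g (fst z) (snd z) * ez z p)"
    by (rule integrable_wt4_bound[where B = B])
      (use B in \<open>auto simp: norm_mult intro!: borel_measurable_times sg_measurable assms ez_measurable\<close>)
  show "integrable FM (\<lambda>z. g (fst z) (snd z))"
    by (rule integrable_wt4_bound[where B = B]) (use B in \<open>auto intro!: sg_measurable assms\<close>)
qed

definition IF :: "(int \<Rightarrow> real \<Rightarrow> complex) \<Rightarrow> real \<times> real \<Rightarrow> complex" where
  "IF g p = 1 / (2*pi)\<^sup>2 * (\<integral>z. g (fst z) (snd z) * ez z p \<partial>FM)"

definition WI :: real where "WI = (\<integral>z. 1 / wt (fst z) (snd z) ^ 4 \<partial>FM)"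

lemma WI_nonneg: "WI \<ge> 0" unfolding WI_def by (intro Bochner_Integration.integral_nonneg) (auto simp: less_imp_le wt_pos)

lemma integral_FM_bound:
  assumes B: "\<And>z. norm (f z :: complex) \<le> B / wt (fst z) (snd z) ^ 4" and B0: "B \<ge> 0"
  shows "norm (\<integral>z. f z \<partial>FM) \<le> B * WI"
proof (cases "integrable FM f")
  case True
  have "norm (\<integral>z. f z \<partial>FM) \<le> (\<integral>z. norm (f z) \<partial>FM)" by (rule integral_norm_bound)
  also have "\<dots> \<le> (\<integral>z. B * (1 / wt (fst z) (snd z) ^ 4) \<partial>FM)"
    using B by (intro integral_mono integrable_norm True integrable_mult_right integrable_wt4) auto
  also have "\<dots> = B * WI" unfolding WI_def by (rule Bochner_Integration.integral_mult_right_zero)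
  finally show ?thesis .
next
  case False
  then show ?thesis using B0 WI_nonneg by (simp add: not_integrable_integral_eq)
qed

lemma inverse_two_pi_sq_le: "1 / (2*pi)\<^sup>2 \<le> 1"
proof -
  have "1 \<le> (2*pi)\<^sup>2" using pi_ge_two by (intro one_le_power) linarith
  then show ?thesis by (subst divide_le_eq_1_pos) auto
qed

lemma IF_bound:
  assumes B: "\<And>k \<xi>. norm (g k \<xi>) \<le> B / wt k \<xi> ^ 4" and B0: "B \<ge> 0"
  shows "norm (IF g p) \<le> B * WI"
proof -
  have "norm (\<integral>z. g (fst z) (snd z) * ez z p \<partial>FM) \<le> B * WI"
    using B0 B by (intro integral_FM_bound) (auto simp: norm_mult)
  moreover note inverse_two_pi_sq_le
  ultimately have "1 / (2*pi)\<^sup>2 * norm (\<integral>z. g (fst z) (snd z) * ez z p \<partial>FM) \<le> 1 * (B * WI)"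
    using B0 WI_nonneg by (intro mult_mono) auto
  then show ?thesis by (simp add: IF_def norm_mult norm_divide norm_power)
qed

lemma IF_lincomb:
  assumes "sg f" "sg g"
  shows "IF (\<lambda>k \<xi>. a * f k \<xi> + c * g k \<xi>) p = a * IF f p + c * IF g p"
proof -
  have "(\<integral>z. (a * f (fst z) (snd z) + c * g (fst z) (snd z)) * ez z p \<partial>FM)
     = (\<integral>z. a * (f (fst z) (snd z) * ez z p) + c * (g (fst z) (snd z) * ez z p) \<partial>FM)"
    by (intro Bochner_Integration.integral_cong) (auto simp: algebra_simps)
  also have "\<dots> = a * (\<integral>z. f (fst z) (snd z) * ez z p \<partial>FM) + c * (\<integral>z. g (fst z) (snd z) * ez z p \<partial>FM)"
    using sg_integrable(1)[OF assms(1)] sg_integrable(1)[OF assms(2)] by simp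
  finally show ?thesis by (simp add: IF_def algebra_simps)
qed

lemma cis_taylor: "norm (cis (a + h) - cis a - \<i> * of_real h * cis a) \<le> h\<^sup>2"
proof -
  have "cis (a + h) - cis a - \<i> * of_real h * cis a = cis a * (cis h - 1 - \<i> * of_real h)"
    unfolding cis_mult[symmetric] by (simp add: algebra_simps)
  then have "norm (cis (a + h) - cis a - \<i> * of_real h * cis a) = norm (cis h - 1 - \<i> * of_real h)"
    by (simp add: norm_mult)
  also have "\<dots> = norm (exp (\<i> * of_real h) - (\<Sum>k\<le>1. (\<i> * of_real h)^k / fact k))"
    by (simp add: cis_conv_exp algebra_simps)
  also have "\<dots> \<le> \<bar>h\<bar>^(Suc 1) / fact (Suc 1)" by (rule iexp_approx1)
  also have "\<dots> \<le> h\<^sup>2" by (simp add: power2_eq_square)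
  finally show ?thesis .
qed

lemma has_derivative_quadratic_remainder:
  fixes f :: "'a::real_normed_vector \<Rightarrow> 'b::real_normed_vector"
  assumes bl: "bounded_linear D" and r: "\<And>d. norm (f (p + d) - f p - D d) \<le> C * (norm d)\<^sup>2"
  shows "(f has_derivative D) (at p)"
  unfolding has_derivative_at
proof (intro conjI bl)
  show "((\<lambda>h. norm (f (p + h) - f p - D h) / norm h) \<longlongrightarrow> 0) (at 0)"
  proof (rule Lim_null_comparison)
    show "\<forall>\<^sub>F h in at 0. norm (norm (f (p + h) - f p - D h) / norm h) \<le> C * norm h"
      unfolding eventually_at_filter
    proof (intro always_eventually allI impI)
      fix h :: 'a assume h: "h \<noteq> 0"
      have "norm (f (p + h) - f p - D h) \<le> (C * norm h) * norm h" using r[of h] by (simp add: power2_eq_square)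
      then show "norm (norm (f (p + h) - f p - D h) / norm h) \<le> C * norm h" using h by (simp add: divide_le_eq)
    qed
    show "((\<lambda>h::'a. C * norm h) \<longlongrightarrow> 0) (at 0)"
      by (intro tendsto_mult_right_zero tendsto_norm_zero tendsto_ident_at)
  qed
qed

lemma sg_k: "sg g \<Longrightarrow> sg (\<lambda>k \<xi>. \<i> * of_int k * g k \<xi>)"
  by (rule sg_mult) (intro om_intros)
lemma sg_xi: "sg g \<Longrightarrow> sg (\<lambda>k \<xi>. \<i> * of_real \<xi> * g k \<xi>)"
  by (rule sg_mult) (intro om_intros)

text \<open>Differentiation under the integral with an explicit remainder: the exponential is
  expanded to first order, and the error is at most the square of the phase increment.\<close>

lemma IF_has_derivative:
  assumes g: "sg g"
  shows "(IF g has_derivative (\<lambda>d. of_real (fst d) * IF (\<lambda>k \<xi>. \<i> * of_int k * g k \<xi>) p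
      + of_real (snd d) * IF (\<lambda>k \<xi>. \<i> * of_real \<xi> * g k \<xi>) p)) (at p)"
    (is "(_ has_derivative ?D) _")
proof -
  \<comment> \<open>Four powers of the weight are spent on integrability and two on the square of
    the phase increment, which is at most 2 \<open>wt\<close> times the norm of \<open>d\<close>;
    this also explains the factor 4.\<close>
  obtain B where B: "\<forall>k \<xi>. wt k \<xi> ^ 6 * norm (g k \<xi>) \<le> B" using sg_decay[OF g] by blast
  have B0: "B \<ge> 0" using B[rule_format, of 0 0] wt_pos[of 0 0] by (smt (verit) mult_nonneg_nonneg norm_ge_zero zero_le_power)
  show ?thesis
  proof (rule has_derivative_quadratic_remainder[where C = "4 * B * WI"])
    show "bounded_linear ?D"
      by (intro bounded_linear_add bounded_linear_compose[OF bounded_linear_mult_left]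
          bounded_linear_compose[OF bounded_linear_of_real] bounded_linear_fst bounded_linear_snd)
    fix d :: "real \<times> real"
    let ?g = "\<lambda>z. g (fst z) (snd z)"
    let ?h = "\<lambda>z::int\<times>real. of_int (fst z) * fst d + snd z * snd d"
    have D: "?D d = 1 / (2*pi)\<^sup>2 * (\<integral>z. ?g z * (\<i> * of_real (?h z) * ez z p) \<partial>FM)"
    proof -
      have "(\<integral>z. ?g z * (\<i> * of_real (?h z) * ez z p) \<partial>FM)
        = (\<integral>z. of_real (fst d) * (\<i> * of_int (fst z) * ?g z * ez z p) + of_real (snd d) * (\<i> * of_real (snd z) * ?g z * ez z p) \<partial>FM)"
        by (intro Bochner_Integration.integral_cong) (auto simp: algebra_simps)
      also have "\<dots> = of_real (fst d) * (\<integral>z. \<i> * of_int (fst z) * ?g z * ez z p \<partial>FM)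
          + of_real (snd d) * (\<integral>z. \<i> * of_real (snd z) * ?g z * ez z p \<partial>FM)"
        using sg_integrable(1)[OF sg_k[OF g]] sg_integrable(1)[OF sg_xi[OF g]] by simp
      finally show ?thesis by (simp add: IF_def algebra_simps)
    qed
    have i3: "integrable FM (\<lambda>z. ?g z * (\<i> * of_real (?h z) * ez z p))"
    proof -
      have "integrable FM (\<lambda>z. of_real (fst d) * (\<i> * of_int (fst z) * ?g z * ez z p) + of_real (snd d) * (\<i> * of_real (snd z) * ?g z * ez z p))"
        using sg_integrable(1)[OF sg_k[OF g]] sg_integrable(1)[OF sg_xi[OF g]] by simp
      then show ?thesis by (rule Bochner_Integration.integrable_cong[THEN iffD1, rotated 2]) (auto simp: algebra_simps)
    qed
    have "IF g (p + d) - IF g p - ?D d = 1 / (2*pi)\<^sup>2 * (\<integral>z. ?g z * (ez z (p + d) - ez z p - \<i> * of_real (?h z) * ez z p) \<partial>FM)"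
    proof -
      have "(\<integral>z. ?g z * (ez z (p + d) - ez z p - \<i> * of_real (?h z) * ez z p) \<partial>FM)
        = (\<integral>z. ?g z * ez z (p + d) - ?g z * ez z p - ?g z * (\<i> * of_real (?h z) * ez z p) \<partial>FM)"
        by (intro Bochner_Integration.integral_cong) (auto simp: algebra_simps)
      also have "\<dots> = (\<integral>z. ?g z * ez z (p + d) \<partial>FM) - (\<integral>z. ?g z * ez z p \<partial>FM) - (\<integral>z. ?g z * (\<i> * of_real (?h z) * ez z p) \<partial>FM)"
        using sg_integrable(1)[OF g] i3 by simp
      finally show ?thesis unfolding D by (simp only: IF_def right_diff_distrib)
    qed
    also have "norm \<dots> \<le> 1 * (4 * B * (norm d)\<^sup>2 * WI)"
    proof -
      have "norm (?g z * (ez z (p + d) - ez z p - \<i> * of_real (?h z) * ez z p)) \<le> 4 * B * (norm d)\<^sup>2 / wt (fst z) (snd z) ^ 4" for z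
      proof -
        let ?w = "wt (fst z) (snd z)"
        have "norm (ez z (p + d) - ez z p - \<i> * of_real (?h z) * ez z p) \<le> (?h z)\<^sup>2"
          using cis_taylor[of "of_int (fst z) * fst p + snd z * snd p" "?h z"] by (simp add: ez_def algebra_simps)
        also have "(?h z)\<^sup>2 \<le> (2 * ?w * norm d)\<^sup>2"
        proof -
          have "\<bar>fst d\<bar> \<le> norm d" "\<bar>snd d\<bar> \<le> norm d"
            using norm_fst_le[of "fst d" "snd d"] norm_snd_le[of "snd d" "fst d"] by auto
          then have "\<bar>of_int (fst z) * fst d\<bar> \<le> ?w * norm d" "\<bar>snd z * snd d\<bar> \<le> ?w * norm d"
            unfolding abs_mult by (auto intro!: mult_mono simp: wt_def)
          then have "\<bar>?h z\<bar> \<le> 2 * ?w * norm d" by linarith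
          then show ?thesis by (rule power2_le_iff_abs_le[THEN iffD2, rotated]) (auto simp: wt_pos less_imp_le)
        qed
        finally have "norm (?g z * (ez z (p + d) - ez z p - \<i> * of_real (?h z) * ez z p)) \<le> norm (?g z) * (2 * ?w * norm d)\<^sup>2"
          unfolding norm_mult[of "?g z"] by (intro mult_left_mono) auto
        also have "\<dots> = 4 * (norm d)\<^sup>2 * (?w ^ 6 * norm (?g z)) / ?w ^ 4"
          using wt_pos[of "fst z" "snd z"] by (simp add: power_mult_distrib field_simps flip: power_add)
        also have "\<dots> \<le> 4 * (norm d)\<^sup>2 * B / ?w ^ 4"
          using B wt_pos[of "fst z" "snd z"] by (intro divide_right_mono mult_left_mono) auto
        finally show ?thesis by (simp add: mult_ac)
      qed
      then have "norm (\<integral>z. ?g z * (ez z (p + d) - ez z p - \<i> * of_real (?h z) * ez z p) \<partial>FM) \<le> 4 * B * (norm d)\<^sup>2 * WI"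
        using B0 by (intro integral_FM_bound) auto
      moreover note inverse_two_pi_sq_le
      ultimately have "1 / (2*pi)\<^sup>2 * norm (\<integral>z. ?g z * (ez z (p + d) - ez z p - \<i> * of_real (?h z) * ez z p) \<partial>FM) \<le> 1 * (4 * B * (norm d)\<^sup>2 * WI)"
        using B0 WI_nonneg by (intro mult_mono) auto
      then show ?thesis by (simp add: norm_mult norm_divide norm_power)
    qed
    finally show "norm (IF g (p + d) - IF g p - ?D d) \<le> 4 * B * WI * (norm d)\<^sup>2" by (simp add: mult_ac)
  qed
qed

lemma dX_eqI:
  assumes "(\<phi> has_derivative (\<lambda>d. of_real (fst d) * a + of_real (snd d) * b)) (at p)"
  shows "dX \<phi> p = a" "dY \<phi> p = b"
    "((\<lambda>s. \<phi> (s, snd p)) has_vector_derivative a) (at (fst p))"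
    "((\<lambda>s. \<phi> (fst p, s)) has_vector_derivative b) (at (snd p))"
proof -
  obtain x y where p: "p = (x, y)" by (cases p)
  have "((\<lambda>s. \<phi> (s, y)) has_derivative (\<lambda>h. of_real (fst (h, 0::real)) * a + of_real (snd (h, 0::real)) * b)) (at x)"
    by (rule has_derivative_compose[where f = "\<lambda>s. (s, y)" and g = \<phi>])
      (use assms in \<open>auto simp: p intro!: derivative_eq_intros\<close>)
  then show X: "((\<lambda>s. \<phi> (s, snd p)) has_vector_derivative a) (at (fst p))"
    by (simp add: has_vector_derivative_def scaleR_conv_of_real p)
  have "((\<lambda>s. \<phi> (x, s)) has_derivative (\<lambda>h. of_real (fst (0::real, h)) * a + of_real (snd (0::real, h)) * b)) (at y)"
    by (rule has_derivative_compose[where f = "\<lambda>s. (x, s)" and g = \<phi>])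
      (use assms in \<open>auto simp: p intro!: derivative_eq_intros\<close>)
  then show Y: "((\<lambda>s. \<phi> (fst p, s)) has_vector_derivative b) (at (snd p))"
    by (simp add: has_vector_derivative_def scaleR_conv_of_real p)
  show "dX \<phi> p = a" "dY \<phi> p = b"
    using vector_derivative_at[OF X] vector_derivative_at[OF Y] by (simp_all add: dX_def dY_def p)
qed

lemma dX_IF: "sg g \<Longrightarrow> dX (IF g) = IF (\<lambda>k \<xi>. \<i> * of_int k * g k \<xi>)"
  and dY_IF: "sg g \<Longrightarrow> dY (IF g) = IF (\<lambda>k \<xi>. \<i> * of_real \<xi> * g k \<xi>)"
  using dX_eqI(1,2)[OF IF_has_derivative] by (auto intro!: ext)

lemma integral_deriv_eq_0:
  fixes F :: "real \<Rightarrow> complex"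
  assumes F: "\<And>x. (F has_vector_derivative f x) (at x)" and f: "continuous_on UNIV f" "integrable lborel f"
    and lim: "(F \<longlongrightarrow> 0) at_top" "(F \<longlongrightarrow> 0) at_bot"
  shows "(\<integral>x. f x \<partial>lborel) = 0"
proof -
  have "(LBINT x=-\<infinity>..\<infinity>. f x) = 0 - 0"
  proof (rule interval_integral_FTC_integrable)
    show "isCont f x" for x using f(1) by (simp add: continuous_on_eq_continuous_at)
    show "set_integrable lborel (einterval (- \<infinity>) \<infinity>) f" using f(2) by (simp add: set_integrable_def)
    show "((F \<circ> real_of_ereal) \<longlongrightarrow> 0) (at_right (- \<infinity>))" "((F \<circ> real_of_ereal) \<longlongrightarrow> 0) (at_left \<infinity>)"
      using lim by (simp_all add: ereal_tendsto_simps)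
  qed (auto intro: F)
  then show ?thesis
    by (simp add: interval_lebesgue_integral_def set_lebesgue_integral_def)
qed

lemma tendsto_0_of_decay:
  assumes "\<And>x. norm (F x :: complex) \<le> B / (1 + \<bar>x\<bar>)"
  shows "(F \<longlongrightarrow> 0) at_top" "(F \<longlongrightarrow> 0) at_bot"
proof -
  have "((\<lambda>x::real. B / (1 + \<bar>x\<bar>)) \<longlongrightarrow> 0) at_top" by real_asymp
  then show "(F \<longlongrightarrow> 0) at_top" by (rule Lim_null_comparison[rotated]) (use assms in auto)
  have "((\<lambda>x::real. B / (1 + \<bar>x\<bar>)) \<longlongrightarrow> 0) at_bot" by real_asymp
  then show "(F \<longlongrightarrow> 0) at_bot" by (rule Lim_null_comparison[rotated]) (use assms in auto)
qed

lemma FM_slice_integrable: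
  assumes "sg g" shows "integrable lborel (\<lambda>\<xi>. g k \<xi> * cis (a + \<xi> * y))"
proof -
  obtain B where B: "B \<ge> 0" "\<forall>k \<xi>. norm (g k \<xi>) \<le> B / wt k \<xi> ^ 4" using sg_bound4[OF assms] by blast
  have "integrable lborel (\<lambda>\<xi>::real. B * inverse (1 + \<xi>\<^sup>2))" using integrable_inverse_one_plus_sq by simp
  then show ?thesis
  proof (rule Bochner_Integration.integrable_bound)
    have "g k \<in> borel_measurable borel" using sg_continuous[OF assms] by (rule borel_measurable_continuous_onI)
    then show "(\<lambda>\<xi>. g k \<xi> * cis (a + \<xi> * y)) \<in> borel_measurable lborel" by (simp add: cis_conv_exp)
    have "norm (g k \<xi> * cis (a + \<xi> * y)) \<le> norm (B * inverse (1 + \<xi>\<^sup>2))" for \<xi>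
    proof -
      have "1 + \<xi>\<^sup>2 \<le> (1 + \<bar>\<xi>\<bar>)\<^sup>2" by (simp add: power2_sum)
      also have "\<dots> \<le> (wt k \<xi>)\<^sup>2" by (intro power_mono) (auto simp: wt_def)
      also have "\<dots> \<le> wt k \<xi> ^ 4" using wt_ge1 by (intro power_increasing) auto
      finally have "B / wt k \<xi> ^ 4 \<le> B / (1 + \<xi>\<^sup>2)"
        using B wt_pos[of k \<xi>] by (intro divide_left_mono mult_pos_pos) (auto intro: add_pos_nonneg)
      then show ?thesis using B(1) B(2)[rule_format, of k \<xi>] by (simp add: norm_mult divide_inverse)
    qed
    then show "AE \<xi> in lborel. norm (g k \<xi> * cis (a + \<xi> * y)) \<le> norm (B * inverse (1 + \<xi>\<^sup>2))" by simp
  qed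
qed

text \<open>Integration by parts in \<xi> at each k: the derivative of g times the exponential has
  integral 0 because the product decays.\<close>

lemma IF_xi_deriv:
  assumes g: "sg g" and g': "\<forall>k \<xi>. (g k has_vector_derivative g' k \<xi>) (at \<xi>)" "sg g'"
  shows "IF (\<lambda>k \<xi>. \<i> * g' k \<xi>) p = of_real (snd p) * IF g p"
proof -
  let ?F = "\<lambda>k \<xi>. g k \<xi> * cis (of_int k * fst p + \<xi> * snd p)"
  let ?f = "\<lambda>k \<xi>. g k \<xi> * (\<i> * of_real (snd p) * cis (of_int k * fst p + \<xi> * snd p)) + g' k \<xi> * cis (of_int k * fst p + \<xi> * snd p)"
  have cisd: "((\<lambda>\<xi>. cis (a + \<xi> * y)) has_vector_derivative \<i> * of_real y * cis (a + \<xi> * y)) (at \<xi>)" for a y \<xi>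
  proof -
    have "((\<lambda>\<xi>. complex_of_real (a + \<xi> * y)) has_vector_derivative of_real y) (at \<xi>)"
      by (rule has_vector_derivative_of_real) (auto intro!: derivative_eq_intros)
    then have "((\<lambda>\<xi>. \<i> * complex_of_real (a + \<xi> * y)) has_vector_derivative \<i> * of_real y) (at \<xi>)"
      by (rule has_vector_derivative_mult_right)
    from field_vector_diff_chain_at[OF this DERIV_exp] show ?thesis by (simp add: o_def cis_conv_exp)
  qed
  have z: "(\<integral>\<xi>. ?f k \<xi> \<partial>lborel) = 0" for k
  proof (rule integral_deriv_eq_0)
    show "(?F k has_vector_derivative ?f k \<xi>) (at \<xi>)" for \<xi>
      by (rule has_vector_derivative_mult[OF g'(1)[rule_format] cisd])
    show "continuous_on UNIV (?f k)"
      by (intro continuous_intros sg_continuous g g' continuous_on_cis)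
    have "integrable lborel (\<lambda>\<xi>. (\<i> * of_real (snd p)) * (g k \<xi> * cis (of_int k * fst p + \<xi> * snd p)) + g' k \<xi> * cis (of_int k * fst p + \<xi> * snd p))"
      using FM_slice_integrable[OF g] FM_slice_integrable[OF g'(2)] by simp
    then show "integrable lborel (?f k)" by (simp add: mult_ac)
    obtain B where B: "B \<ge> 0" "\<forall>k \<xi>. norm (g k \<xi>) \<le> B / wt k \<xi> ^ 4" using sg_bound4[OF g] by blast
    have "norm (?F k \<xi>) \<le> B / (1 + \<bar>\<xi>\<bar>)" for \<xi>
    proof -
      have "1 + \<bar>\<xi>\<bar> \<le> wt k \<xi> ^ 1" by (simp add: wt_def)
      also have "\<dots> \<le> wt k \<xi> ^ 4" using wt_ge1 by (intro power_increasing) auto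
      finally have "B / wt k \<xi> ^ 4 \<le> B / (1 + \<bar>\<xi>\<bar>)"
        using B wt_pos[of k \<xi>] by (intro divide_left_mono mult_pos_pos) (auto intro: add_pos_nonneg)
      then show ?thesis using B(2)[rule_format, of k \<xi>] by (simp add: norm_mult)
    qed
    then show "(?F k \<longlongrightarrow> 0) at_top" "(?F k \<longlongrightarrow> 0) at_bot" by (rule tendsto_0_of_decay)+
  qed
  have i: "integrable FM (\<lambda>z. (\<i> * of_real (snd p)) * (g (fst z) (snd z) * ez z p) + g' (fst z) (snd z) * ez z p)"
    using sg_integrable(1)[OF g] sg_integrable(1)[OF g'(2)] by simp
  have "(\<integral>z. (\<i> * of_real (snd p)) * (g (fst z) (snd z) * ez z p) + g' (fst z) (snd z) * ez z p \<partial>FM) = 0"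
    unfolding integral_FM[OF i] using z by (simp add: ez_def mult_ac)
  then have "(\<i> * of_real (snd p)) * (\<integral>z. g (fst z) (snd z) * ez z p \<partial>FM) + (\<integral>z. g' (fst z) (snd z) * ez z p \<partial>FM) = 0"
    using sg_integrable(1)[OF g] sg_integrable(1)[OF g'(2)] by simp
  then have "(\<integral>z. g' (fst z) (snd z) * ez z p \<partial>FM) = - (\<i> * of_real (snd p) * (\<integral>z. g (fst z) (snd z) * ez z p \<partial>FM))"
    by (simp add: eq_neg_iff_add_eq_0 add.commute)
  moreover have "(\<integral>z. \<i> * g' (fst z) (snd z) * ez z p \<partial>FM) = \<i> * (\<integral>z. g' (fst z) (snd z) * ez z p \<partial>FM)"
    unfolding mult.assoc by simp
  ultimately have "(\<integral>z. \<i> * g' (fst z) (snd z) * ez z p \<partial>FM) = of_real (snd p) * (\<integral>z. g (fst z) (snd z) * ez z p \<partial>FM)"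
    by (simp flip: mult.assoc)
  then show ?thesis by (simp add: IF_def)
qed

lemma rapid_bound4:
  assumes "rapid T f" shows "\<exists>B\<ge>0. \<forall>t\<in>{0..T}. \<forall>k \<xi>. norm (f t k \<xi>) \<le> B / wt k \<xi> ^ 4"
proof -
  obtain B where B: "\<forall>t\<in>{0..T}. \<forall>k \<xi>. wt k \<xi> ^ 4 * norm (f t k \<xi>) \<le> B" using assms unfolding rapid_def by blast
  have "norm (f t k \<xi>) \<le> \<bar>B\<bar> / wt k \<xi> ^ 4" if "t \<in> {0..T}" for t k \<xi>
    using B that wt_pos[of k \<xi>] order_trans[OF _ abs_ge_self[of B]] by (simp add: pos_le_divide_eq mult.commute)
  then show ?thesis by (intro exI[of _ "\<bar>B\<bar>"]) auto
qed

text \<open>Each factor |y| is traded for a \<xi>-derivative of the symbol, so the induction ranges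
  over all symbols in \<open>sf\<close>. Uniformity in t is what Taylor expansions in time
  require.\<close>

lemma IF_weight_bound:
  assumes "sf T f" shows "\<exists>B. \<forall>t\<in>{0..T}. \<forall>p. (1 + \<bar>snd p\<bar>) ^ N * norm (IF (f t) p) \<le> B"
  using assms
proof (induction N arbitrary: f)
  case 0
  obtain B where B: "B \<ge> 0" "\<forall>t\<in>{0..T}. \<forall>k \<xi>. norm (f t k \<xi>) \<le> B / wt k \<xi> ^ 4"
    using rapid_bound4[OF smthD[OF 0]] by blast
  then have "norm (IF (f t) p) \<le> B * WI" if "t \<in> {0..T}" for t p
    using that by (intro IF_bound) auto
  then have "\<forall>t\<in>{0..T}. \<forall>p. (1 + \<bar>snd p\<bar>) ^ 0 * norm (IF (f t) p) \<le> B * WI" by simp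
  then show ?case by blast
next
  case (Suc N)
  obtain f1 f2 where f: "dt f f1" "dxi f f2" "sf T f1" "sf T f2" using Suc.prems by (rule smthE)
  obtain B where B: "\<forall>t\<in>{0..T}. \<forall>p. (1 + \<bar>snd p\<bar>) ^ N * norm (IF (f t) p) \<le> B" using Suc.IH[OF Suc.prems] by blast
  obtain C where C: "\<forall>t\<in>{0..T}. \<forall>p. (1 + \<bar>snd p\<bar>) ^ N * norm (IF (\<lambda>k \<xi>. \<i> * f2 t k \<xi>) p) \<le> C"
    using Suc.IH[OF sf_cmult[OF f(4), of \<i>]] by blast
  have "(1 + \<bar>snd p\<bar>) ^ Suc N * norm (IF (f t) p) \<le> B + C" if t: "t \<in> {0..T}" for t p
  proof -
    have "\<bar>snd p\<bar> * norm (IF (f t) p) = norm (IF (\<lambda>k \<xi>. \<i> * f2 t k \<xi>) p)"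
      using IF_xi_deriv[OF sf_slice[OF Suc.prems t] _ sf_slice[OF f(4) t], of p] f(2) unfolding dxi_def
      by (simp add: norm_mult)
    then have "(1 + \<bar>snd p\<bar>) ^ Suc N * norm (IF (f t) p) = (1 + \<bar>snd p\<bar>) ^ N * norm (IF (f t) p) + (1 + \<bar>snd p\<bar>) ^ N * norm (IF (\<lambda>k \<xi>. \<i> * f2 t k \<xi>) p)"
      by (simp add: algebra_simps)
    then show ?thesis using B[rule_format, OF t, of p] C[rule_format, OF t, of p] by linarith
  qed
  then show ?case by blast
qed

text \<open>The image of \<open>IF\<close> is closed under both derivatives and serves as
  coinduction invariant; periodicity in x comes from the integrality of the wave numbers.\<close>

lemma schwartz_IF:
  assumes "sg g" shows "schwartz (IF g)"
proof -
  have "\<exists>g. sg g \<and> \<phi> = IF g \<Longrightarrow> schwartz \<phi>" for \<phi>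
  proof (coinduction arbitrary: \<phi>)
    case schwartz
    then obtain g where g: "sg g" "\<phi> = IF g" by blast
    have "\<phi> differentiable (at p)" for p using IF_has_derivative[OF g(1)] unfolding g(2) differentiable_def by blast
    moreover have "\<phi> (x + 2*pi, y) = \<phi> (x, y)" for x y
    proof -
      have "ez z (x + 2*pi, y) = ez z (x, y)" for z
      proof -
        have "ez z (x + 2*pi, y) = ez z (x, y) * cis (2 * pi * of_int (fst z))"
          by (simp add: ez_def cis_mult algebra_simps)
        also have "cis (2 * pi * of_int (fst z)) = 1" by (rule cis_multiple_2pi) auto
        finally show ?thesis by simp
      qed
      then show ?thesis unfolding g(2) IF_def by simp
    qed
    moreover have "\<exists>B. \<forall>x y. (1 + \<bar>y\<bar>) ^ n * norm (\<phi> (x, y)) \<le> B" for n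
    proof -
      obtain B where "\<forall>t\<in>{0..0::real}. \<forall>p. (1 + \<bar>snd p\<bar>) ^ n * norm (IF g p) \<le> B"
        using IF_weight_bound[OF sf_static[OF g(1), of 0], of n] by blast
      then have "\<forall>p. (1 + \<bar>snd p\<bar>) ^ n * norm (IF g p) \<le> B" by simp
      then have "\<forall>x y. (1 + \<bar>y\<bar>) ^ n * norm (IF g (x, y)) \<le> B" by (metis snd_conv)
      then show ?thesis unfolding g(2) by blast
    qed
    moreover have "\<exists>h. sg h \<and> dX \<phi> = IF h" "\<exists>h. sg h \<and> dY \<phi> = IF h"
      unfolding g(2) using dX_IF[OF g(1)] dY_IF[OF g(1)] sg_k[OF g(1)] sg_xi[OF g(1)] by blast+
    ultimately show ?case by (intro exI[of _ \<phi>]) blast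
  qed
  then show ?thesis using assms by blast
qed

section \<open>Distributions tested with time-dependent functions\<close>

definition kx :: "nat \<Rightarrow> nat \<Rightarrow> int \<Rightarrow> real \<Rightarrow> complex" where
  "kx m n k \<xi> = (\<i> * of_int k) ^ m * (\<i> * of_real \<xi>) ^ n"

lemma om_kx: "om T (\<lambda>t. kx m n)"
  unfolding kx_def by (intro om_intros)

lemma sg_kx: "sg g \<Longrightarrow> sg (\<lambda>k \<xi>. kx m n k \<xi> * g k \<xi>)"
  by (rule sg_mult[OF om_kx])

lemma iterated_dX_dY_IF:
  assumes "sg g"
  shows "(dX ^^ m) ((dY ^^ n) (IF g)) = IF (\<lambda>k \<xi>. kx m n k \<xi> * g k \<xi>)"
proof -
  have Y: "(dY ^^ n) (IF g) = IF (\<lambda>k \<xi>. kx 0 n k \<xi> * g k \<xi>)"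
  proof (induction n)
    case (Suc n)
    show ?case using dY_IF[OF sg_kx[OF assms, of 0 n]] by (simp add: Suc kx_def mult_ac)
  qed (simp add: kx_def)
  show ?thesis
  proof (induction m)
    case (Suc m)
    show ?case using dX_IF[OF sg_kx[OF assms, of m n]] by (simp add: Suc kx_def mult_ac)
  qed (simp add: Y)
qed

lemma schwartz_norm_IF_le:
  assumes g: "sg g" and B: "\<And>m n p. m \<le> N \<Longrightarrow> n \<le> N \<Longrightarrow> (1 + \<bar>snd p\<bar>) ^ N * norm (IF (\<lambda>k \<xi>. kx m n k \<xi> * g k \<xi>) p) \<le> b m n"
  shows "schwartz_norm N (IF g) \<le> (\<Sum>m\<le>N. \<Sum>n\<le>N. b m n)"
  unfolding schwartz_norm_def iterated_dX_dY_IF[OF g]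
  by (intro sum_mono cSUP_least) (use B in auto)

lemma IF_lincomb3:
  assumes "sg f" "sg g" "sg h"
  shows "IF (\<lambda>k \<xi>. f k \<xi> - g k \<xi> - a * h k \<xi>) p = IF f p - IF g p - a * IF h p"
  using IF_lincomb[OF assms(1,2), of 1 "-1" p]
    IF_lincomb[OF sg_add[OF assms(1) sg_cmult[OF assms(2), of "-1"]] assms(3), of 1 "-a" p]
  by simp

lemma sg_lincomb3:
  assumes "sg f" "sg g" "sg h" shows "sg (\<lambda>k \<xi>. f k \<xi> - g k \<xi> - a * h k \<xi>)"
  using sg_add[OF sg_add[OF assms(1) sg_cmult[OF assms(2), of "-1"]] sg_cmult[OF assms(3), of "-a"]] by simp

lemma IF_time_derivative:
  assumes h: "sf T h" "dt h h1" "sf T h1" and t: "t \<in> {0..T}"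
  shows "((\<lambda>t. IF (h t) p) has_vector_derivative IF (h1 t) p) (at t within {0..T})"
proof -
  obtain h2 where h2: "dt h1 h2" "sf T h2" using h(3) by (rule smthE)
  obtain B where B: "B \<ge> 0" "\<forall>t\<in>{0..T}. \<forall>k \<xi>. norm (h2 t k \<xi>) \<le> B / wt k \<xi> ^ 4"
    using rapid_bound4[OF smthD[OF h2(2)]] by blast
  have pw: "norm (h t' k \<xi> - h t k \<xi> - of_real (t' - t) * h1 t k \<xi>) \<le> (B * (t' - t)\<^sup>2) / wt k \<xi> ^ 4"
    if t': "t' \<in> {0..T}" for t' k \<xi>
  proof -
    have "norm (h t' k \<xi> - h t k \<xi> - (t' - t) *\<^sub>R h1 t k \<xi>) \<le> B / wt k \<xi> ^ 4 * (t' - t)\<^sup>2"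
      by (rule taylor2[where T = T and q = "\<lambda>t. h t k \<xi>" and ?q1.0 = "\<lambda>t. h1 t k \<xi>" and ?q2.0 = "\<lambda>t. h2 t k \<xi>"])
        (use h(2) h2(1) B t t' in \<open>auto simp: dt_def intro: has_vector_derivative_at_within\<close>)
    then show ?thesis by (simp add: scaleR_conv_of_real)
  qed
  show ?thesis
  proof (rule has_vector_derivative_quadratic_remainder[where C = "B * WI"])
    fix t' assume t': "t' \<in> {0..T}"
    have "IF (h t') p - IF (h t) p - (t' - t) *\<^sub>R IF (h1 t) p
        = IF (\<lambda>k \<xi>. h t' k \<xi> - h t k \<xi> - of_real (t' - t) * h1 t k \<xi>) p"
      using IF_lincomb3[OF sf_slice[OF h(1) t'] sf_slice[OF h(1) t] sf_slice[OF h(3) t]]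
      by (simp add: scaleR_conv_of_real)
    also have "norm \<dots> \<le> (B * (t' - t)\<^sup>2) * WI"
      by (rule IF_bound[OF pw[OF t']]) (use B in auto)
    finally show "norm (IF (h t') p - IF (h t) p - (t' - t) *\<^sub>R IF (h1 t) p) \<le> B * WI * (t' - t)\<^sup>2"
      by (simp add: mult_ac)
  qed
qed

text \<open>\<open>kx\<close> moves the space derivatives of a fixed seminorm into the symbol; then
  \<open>taylor2\<close> applies at every point to the weighted value, with the second time
  derivative bounded through \<open>IF_weight_bound\<close>.\<close>

lemma schwartz_norm_taylor:
  assumes f: "sf T f" "dt f f1" "sf T f1"
  shows "\<exists>B\<ge>0. \<forall>t\<in>{0..T}. \<forall>t'\<in>{0..T}.
    schwartz_norm N (IF (\<lambda>k \<xi>. f t' k \<xi> - f t k \<xi> - of_real (t' - t) * f1 t k \<xi>)) \<le> B * (t' - t)\<^sup>2"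
proof -
  obtain f2 where f2: "dt f1 f2" "sf T f2" using f(3) by (rule smthE)
  let ?m = "\<lambda>m n f t k \<xi>. kx m n k \<xi> * f t k \<xi> :: complex"
  have "\<exists>B. \<forall>t\<in>{0..T}. \<forall>p. (1 + \<bar>snd p\<bar>) ^ N * norm (IF (?m m n f2 t) p) \<le> B" for m n
    using IF_weight_bound[OF sf_mult[OF om_kx f2(2)], of N] by simp
  then obtain b where b: "\<forall>t\<in>{0..T}. \<forall>p. (1 + \<bar>snd p\<bar>) ^ N * norm (IF (?m m n f2 t) p) \<le> b m n" for m n
    by metis
  have dtm: "dt (?m m n g) (?m m n g')" if "dt g g'" for m n g g'
    using that unfolding dt_def by (auto intro!: has_vector_derivative_mult_right)
  have sgm: "sf T (?m m n g)" if "sf T g" for m n g using sf_mult[OF om_kx that] .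
  have "schwartz_norm N (IF (\<lambda>k \<xi>. f t' k \<xi> - f t k \<xi> - of_real (t' - t) * f1 t k \<xi>)) \<le> (\<Sum>m\<le>N. \<Sum>n\<le>N. \<bar>b m n\<bar>) * (t' - t)\<^sup>2"
    if t: "t \<in> {0..T}" "t' \<in> {0..T}" for t t'
  proof -
    have "schwartz_norm N (IF (\<lambda>k \<xi>. f t' k \<xi> - f t k \<xi> - of_real (t' - t) * f1 t k \<xi>)) \<le> (\<Sum>m\<le>N. \<Sum>n\<le>N. \<bar>b m n\<bar> * (t' - t)\<^sup>2)"
    proof (rule schwartz_norm_IF_le)
      show "sg (\<lambda>k \<xi>. f t' k \<xi> - f t k \<xi> - of_real (t' - t) * f1 t k \<xi>)"
        by (intro sg_lincomb3 sf_slice[OF f(1)] sf_slice[OF f(3)] t)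
      fix m n and p :: "real \<times> real"
      define w :: real where "w = (1 + \<bar>snd p\<bar>) ^ N"
      have w0: "w \<ge> 0" by (simp add: w_def)
      have "norm (w *\<^sub>R IF (?m m n f t') p - w *\<^sub>R IF (?m m n f t) p - (t' - t) *\<^sub>R (w *\<^sub>R IF (?m m n f1 t) p)) \<le> \<bar>b m n\<bar> * (t' - t)\<^sup>2"
      proof (rule taylor2[where T = T and q = "\<lambda>t. w *\<^sub>R IF (?m m n f t) p" and ?q1.0 = "\<lambda>t. w *\<^sub>R IF (?m m n f1 t) p" and ?q2.0 = "\<lambda>t. w *\<^sub>R IF (?m m n f2 t) p"])
        show "((\<lambda>t. w *\<^sub>R IF (?m m n f t) p) has_vector_derivative w *\<^sub>R IF (?m m n f1 t) p) (at t within {0..T})"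
          if "t \<in> {0..T}" for t
          by (intro bounded_linear.has_vector_derivative[OF bounded_linear_scaleR_right] IF_time_derivative sgm f dtm that)
        show "((\<lambda>t. w *\<^sub>R IF (?m m n f1 t) p) has_vector_derivative w *\<^sub>R IF (?m m n f2 t) p) (at t within {0..T})"
          if "t \<in> {0..T}" for t
          by (intro bounded_linear.has_vector_derivative[OF bounded_linear_scaleR_right] IF_time_derivative sgm f f2 dtm that)
        show "norm (w *\<^sub>R IF (?m m n f2 t) p) \<le> \<bar>b m n\<bar>" if "t \<in> {0..T}" for t
          using b[rule_format, OF that, of p m n] w0 by (simp add: w_def)
      qed (use t in auto)
      moreover have "w *\<^sub>R IF (?m m n f t') p - w *\<^sub>R IF (?m m n f t) p - (t' - t) *\<^sub>R (w *\<^sub>R IF (?m m n f1 t) p)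
         = w *\<^sub>R IF (\<lambda>k \<xi>. kx m n k \<xi> * (f t' k \<xi> - f t k \<xi> - of_real (t' - t) * f1 t k \<xi>)) p"
      proof -
        have e: "(\<lambda>k \<xi>. kx m n k \<xi> * (f t' k \<xi> - f t k \<xi> - of_real (t' - t) * f1 t k \<xi>))
          = (\<lambda>k \<xi>. ?m m n f t' k \<xi> - ?m m n f t k \<xi> - of_real (t' - t) * ?m m n f1 t k \<xi>)"
          by (auto simp: algebra_simps)
        show ?thesis
          unfolding e IF_lincomb3[OF sf_slice[OF sgm[OF f(1)] t(2)] sf_slice[OF sgm[OF f(1)] t(1)] sf_slice[OF sgm[OF f(3)] t(1)]]
          by (simp add: scaleR_conv_of_real algebra_simps)
      qed
      ultimately show "(1 + \<bar>snd p\<bar>) ^ N * norm (IF (\<lambda>k \<xi>. kx m n k \<xi> * (f t' k \<xi> - f t k \<xi> - of_real (t' - t) * f1 t k \<xi>)) p) \<le> \<bar>b m n\<bar> * (t' - t)\<^sup>2"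
        using w0 by (simp add: w_def)
    qed
    also have "\<dots> = (\<Sum>m\<le>N. \<Sum>n\<le>N. \<bar>b m n\<bar>) * (t' - t)\<^sup>2" by (simp add: sum_distrib_right)
    finally show ?thesis .
  qed
  then show ?thesis by (intro exI[of _ "\<Sum>m\<le>N. \<Sum>n\<le>N. \<bar>b m n\<bar>"]) (auto intro: sum_nonneg)
qed

lemma linear_dist_lincomb:
  assumes u: "linear_dist u" and "sg f" "sg g"
  shows "u (IF (\<lambda>k \<xi>. a * f k \<xi> + c * g k \<xi>)) = a * u (IF f) + c * u (IF g)"
proof -
  have "IF (\<lambda>k \<xi>. a * f k \<xi> + c * g k \<xi>) = (\<lambda>p. a * IF f p + c * IF g p)"
    using IF_lincomb[OF assms(2,3)] by auto
  then show ?thesis using u schwartz_IF[OF assms(2)] schwartz_IF[OF assms(3)] unfolding linear_dist_def by simp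
qed

lemma linear_dist_add:
  assumes "linear_dist u" "sg f" "sg g" shows "u (IF (\<lambda>k \<xi>. f k \<xi> + g k \<xi>)) = u (IF f) + u (IF g)"
  using linear_dist_lincomb[OF assms, of 1 1] by simp

lemma linear_dist_cmult:
  assumes "linear_dist u" "sg f" shows "u (IF (\<lambda>k \<xi>. a * f k \<xi>)) = a * u (IF f)"
  using linear_dist_lincomb[OF assms assms(2), of a 0] by simp

lemma time_continuous_linear: "time_continuous u \<Longrightarrow> t \<ge> 0 \<Longrightarrow> linear_dist (u t)"
  by (simp add: time_continuous_def)

lemma time_continuous_continuous_on: "time_continuous u \<Longrightarrow> schwartz \<phi> \<Longrightarrow> continuous_on {0..} (\<lambda>t. u t \<phi>)"
  by (simp add: time_continuous_def)

text \<open>Distribution and test function move at the same time. Expanding the test function at t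
  leaves pairings of \<open>u s\<close> with two fixed functions; the remainder is of second order
  in a Schwartz seminorm that bounds all \<open>u s\<close> on [0, T] simultaneously.\<close>

lemma pairing_decomp:
  assumes u: "time_continuous u" and f: "sf T f" "dt f f1" "sf T f1" and t: "t \<in> {0..T}"
  obtains E C where "\<And>s. s \<in> {0..T} \<Longrightarrow> u s (IF (f s)) = u s (IF (f t)) + (s - t) *\<^sub>R u s (IF (f1 t)) + E s"
    "\<And>s. s \<in> {0..T} \<Longrightarrow> norm (E s) \<le> C * (s - t)\<^sup>2"
proof -
  let ?r = "\<lambda>s k \<xi>. f s k \<xi> - f t k \<xi> - of_real (s - t) * f1 t k \<xi>"
  have T: "T \<ge> 0" using t by auto
  obtain N K where K: "\<And>s \<phi>. s \<in> {0..T} \<Longrightarrow> schwartz \<phi> \<Longrightarrow> norm (u s \<phi>) \<le> K * schwartz_norm N \<phi>"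
    using u T unfolding time_continuous_def by metis
  obtain B where B: "B \<ge> 0" "\<forall>t\<in>{0..T}. \<forall>t'\<in>{0..T}.
    schwartz_norm N (IF (\<lambda>k \<xi>. f t' k \<xi> - f t k \<xi> - of_real (t' - t) * f1 t k \<xi>)) \<le> B * (t' - t)\<^sup>2"
    using schwartz_norm_taylor[OF f] by blast
  have sr: "sg (?r s)" if "s \<in> {0..T}" for s
    by (intro sg_lincomb3 sf_slice[OF f(1)] sf_slice[OF f(3)] t that)
  show thesis
  proof (rule that[where E = "\<lambda>s. u s (IF (?r s))" and C = "\<bar>K\<bar> * B"])
    fix s assume s: "s \<in> {0..T}"
    have L: "linear_dist (u s)" using time_continuous_linear[OF u] s by auto
    note S = sf_slice[OF f(1) t] sf_slice[OF f(3) t] sr[OF s]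
    have "(\<lambda>k \<xi>. f s k \<xi>) = (\<lambda>k \<xi>. (f t k \<xi> + of_real (s - t) * f1 t k \<xi>) + ?r s k \<xi>)" by auto
    then have "u s (IF (f s)) = u s (IF (\<lambda>k \<xi>. (f t k \<xi> + of_real (s - t) * f1 t k \<xi>) + ?r s k \<xi>))" by metis
    also have "\<dots> = u s (IF (\<lambda>k \<xi>. f t k \<xi> + of_real (s - t) * f1 t k \<xi>)) + u s (IF (?r s))"
      by (intro linear_dist_add L sg_add sg_cmult S)
    also have "u s (IF (\<lambda>k \<xi>. f t k \<xi> + of_real (s - t) * f1 t k \<xi>)) = u s (IF (f t)) + u s (IF (\<lambda>k \<xi>. of_real (s - t) * f1 t k \<xi>))"
      by (intro linear_dist_add L sg_cmult S)
    also have "u s (IF (\<lambda>k \<xi>. of_real (s - t) * f1 t k \<xi>)) = of_real (s - t) * u s (IF (f1 t))"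
      by (intro linear_dist_cmult L S)
    finally show "u s (IF (f s)) = u s (IF (f t)) + (s - t) *\<^sub>R u s (IF (f1 t)) + u s (IF (?r s))"
      by (simp add: scaleR_conv_of_real)
    have r: "schwartz_norm N (IF (?r s)) \<le> B * (s - t)\<^sup>2" using B(2) t s by blast
    have n0: "norm (u s (IF (?r s))) \<le> K * schwartz_norm N (IF (?r s))" by (rule K[OF s schwartz_IF[OF sr[OF s]]])
    \<comment> \<open>\<open>K\<close> may be negative, so the passage to its absolute value uses
      that the seminorm is nonnegative; for a real supremum this rests on the family being bounded
      above.\<close>
    have sn: "schwartz_norm N (IF (?r s)) \<ge> 0"
      unfolding schwartz_norm_def iterated_dX_dY_IF[OF sr[OF s]]
    proof (intro sum_nonneg)
      fix m n
      obtain c where c: "\<forall>t\<in>{0..0::real}. \<forall>p. (1 + \<bar>snd p\<bar>) ^ N * norm (IF (\<lambda>k \<xi>. kx m n k \<xi> * ?r s k \<xi>) p) \<le> c"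
        using IF_weight_bound[OF sf_static[OF sg_kx[OF sr[OF s]], of 0], of N m n] by blast
      have "0 \<le> (1 + \<bar>snd (0::real\<times>real)\<bar>) ^ N * norm (IF (\<lambda>k \<xi>. kx m n k \<xi> * ?r s k \<xi>) 0)" by simp
      also have "\<dots> \<le> (SUP p. (1 + \<bar>snd p\<bar>) ^ N * norm (IF (\<lambda>k \<xi>. kx m n k \<xi> * ?r s k \<xi>) p))"
        using c by (intro cSUP_upper) (auto simp: bdd_above_def)
      finally show "0 \<le> (SUP p. (1 + \<bar>snd p\<bar>) ^ N * norm (IF (\<lambda>k \<xi>. kx m n k \<xi> * ?r s k \<xi>) p))" .
    qed
    have "K * schwartz_norm N (IF (?r s)) \<le> \<bar>K\<bar> * schwartz_norm N (IF (?r s))" using sn by (intro mult_right_mono) auto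
    also have "\<dots> \<le> \<bar>K\<bar> * (B * (s - t)\<^sup>2)" using r by (intro mult_left_mono) auto
    finally show "norm (u s (IF (?r s))) \<le> \<bar>K\<bar> * B * (s - t)\<^sup>2" using n0 by simp
  qed
qed

lemma pairing_derivative:
  assumes u: "time_continuous u" "time_differentiable u" and f: "sf T f" "dt f f1" "sf T f1" and t: "0 < t" "t < T"
  shows "((\<lambda>s. u s (IF (f s))) has_vector_derivative DT u t (IF (f t)) + u t (IF (f1 t))) (at t)"
proof -
  have t': "t \<in> {0..T}" using t by auto
  obtain E C where E: "\<And>s. s \<in> {0..T} \<Longrightarrow> u s (IF (f s)) = u s (IF (f t)) + (s - t) *\<^sub>R u s (IF (f1 t)) + E s"
    "\<And>s. s \<in> {0..T} \<Longrightarrow> norm (E s) \<le> C * (s - t)\<^sup>2"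
    using pairing_decomp[OF u(1) f t'] by blast
  have D: "((\<lambda>s. u s \<phi>) has_vector_derivative DT u t \<phi>) (at t)" if "schwartz \<phi>" for \<phi>
    using u(2) that t(1) unfolding time_differentiable_def DT_def by (simp add: vector_derivative_works[symmetric])
  have "((\<lambda>s. (s - t) *\<^sub>R u s (IF (f1 t))) has_vector_derivative (t - t) *\<^sub>R DT u t (IF (f1 t)) + 1 *\<^sub>R u t (IF (f1 t))) (at t)"
    by (rule has_vector_derivative_scaleR[OF _ D[OF schwartz_IF[OF sf_slice[OF f(3) t']]]]) (auto intro!: derivative_eq_intros)
  then have 1: "((\<lambda>s. (s - t) *\<^sub>R u s (IF (f1 t))) has_vector_derivative u t (IF (f1 t))) (at t)" by simp
  have "E t = 0" using E(2)[OF t'] by simp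
  then have "(E has_vector_derivative 0) (at t within {0..T})"
    by (intro has_vector_derivative_quadratic_remainder[where C = C]) (use E(2) in auto)
  then have 2: "(E has_vector_derivative 0) (at t)" using t by (simp add: at_within_Icc_at)
  have "((\<lambda>s. u s (IF (f t)) + (s - t) *\<^sub>R u s (IF (f1 t)) + E s) has_vector_derivative DT u t (IF (f t)) + u t (IF (f1 t)) + 0) (at t)"
    by (intro has_vector_derivative_add D 1 2 schwartz_IF sf_slice[OF f(1) t'])
  then have "((\<lambda>s. u s (IF (f s))) has_vector_derivative DT u t (IF (f t)) + u t (IF (f1 t)) + 0) (at t)"
    by (rule has_vector_derivative_transform_within_open[where S = "{0<..<T}"]) (use E(1) t in auto)
  then show ?thesis by simp
qed

lemma pairing_continuous:
  assumes u: "time_continuous u" and f: "sf T f"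
  shows "continuous_on {0..T} (\<lambda>s. u s (IF (f s)))"
proof -
  obtain f1 where f1: "dt f f1" "sf T f1" using f by (rule smthE)
  show ?thesis
    unfolding continuous_on_def
  proof
    fix t assume t: "t \<in> {0..T}"
    obtain E C where E: "\<And>s. s \<in> {0..T} \<Longrightarrow> u s (IF (f s)) = u s (IF (f t)) + (s - t) *\<^sub>R u s (IF (f1 t)) + E s"
      "\<And>s. s \<in> {0..T} \<Longrightarrow> norm (E s) \<le> C * (s - t)\<^sup>2"
      using pairing_decomp[OF u f f1 t] by blast
    have D: "((\<lambda>s. u s \<phi>) \<longlongrightarrow> u t \<phi>) (at t within {0..T})" if "schwartz \<phi>" for \<phi>
      using continuous_on_subset[OF time_continuous_continuous_on[OF u that], of "{0..T}"] t
      unfolding continuous_on_def by auto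
    have e0: "(E \<longlongrightarrow> 0) (at t within {0..T})"
    proof (rule Lim_null_comparison)
      show "\<forall>\<^sub>F s in at t within {0..T}. norm (E s) \<le> C * (s - t)\<^sup>2" using E(2) by (simp add: eventually_at_filter)
      have "((\<lambda>s. C * (s - t)\<^sup>2) \<longlongrightarrow> C * (t - t)\<^sup>2) (at t within {0..T})" by (intro tendsto_intros)
      then show "((\<lambda>s. C * (s - t)\<^sup>2) \<longlongrightarrow> 0) (at t within {0..T})" by simp
    qed
    have "((\<lambda>s. u s (IF (f t)) + (s - t) *\<^sub>R u s (IF (f1 t)) + E s) \<longlongrightarrow> u t (IF (f t)) + (t - t) *\<^sub>R u t (IF (f1 t)) + 0) (at t within {0..T})"
      by (intro tendsto_intros D e0 schwartz_IF sf_slice[OF f t] sf_slice[OF f1(2) t])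
    then have "((\<lambda>s. u s (IF (f t)) + (s - t) *\<^sub>R u s (IF (f1 t)) + E s) \<longlongrightarrow> u t (IF (f t))) (at t within {0..T})" by simp
    then show "((\<lambda>s. u s (IF (f s))) \<longlongrightarrow> u t (IF (f t))) (at t within {0..T})"
      by (rule Lim_transform_eventually) (use E(1) in \<open>simp add: eventually_at_filter\<close>)
  qed
qed

section \<open>Fourier transform of Schwartz functions\<close>

lemma Om_borel [measurable]: "Om \<in> sets borel"
proof -
  have "closed {p::real\<times>real. 0 \<le> fst p}" "open {p::real\<times>real. fst p < 2*pi}"
    by (intro closed_Collect_le open_Collect_less continuous_intros)+
  then have "{p::real\<times>real. 0 \<le> fst p} \<inter> {p. fst p < 2*pi} \<in> sets borel"
    by (intro sets.Int borel_closed borel_open)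
  moreover have "Om = {p. 0 \<le> fst p} \<inter> {p. fst p < 2*pi}" by (auto simp: Om_def)
  ultimately show ?thesis by simp
qed

definition OmM :: "(real \<times> real) measure" where "OmM = restrict_space lborel Om"

lemma integral_Om: "(\<integral>p\<in>Om. (f p :: complex) \<partial>lborel) = (\<integral>p. f p \<partial>OmM)"
  unfolding OmM_def set_lebesgue_integral_def by (subst integral_restrict_space) auto

lemma nn_integral_Om: "(\<integral>\<^sup>+p\<in>Om. f p \<partial>lborel) = (\<integral>\<^sup>+p. f p \<partial>OmM)"
  unfolding OmM_def by (subst nn_integral_restrict_space) auto

lemma measurable_OmM: "f \<in> borel_measurable borel \<Longrightarrow> f \<in> borel_measurable OmM"
  unfolding OmM_def by (rule measurable_restrict_space1) simp

lemma integrable_OmM: "integrable OmM (f :: _ \<Rightarrow> 'a::{banach,second_countable_topology}) \<longleftrightarrow> integrable lborel (\<lambda>p. indicator Om p *\<^sub>R f p)"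
  unfolding OmM_def by (subst integrable_restrict_space) (auto simp: set_integrable_def)

lemma integral_OmM: "(\<integral>p. (f p :: complex) \<partial>OmM) = (\<integral>p. indicator Om p *\<^sub>R f p \<partial>lborel)"
  unfolding OmM_def by (subst integral_restrict_space) auto

lemma sigma_finite_OmM: "sigma_finite_measure OmM"
  unfolding OmM_def by (rule sigma_finite_measure_restrict_space[OF lborel.sigma_finite_measure_axioms]) simp

lemma indicator_Om: "indicator Om (x, y) = (indicator {0..<2*pi} x :: real)"
  by (simp add: Om_def indicator_def)

lemma integrable_OmM_weight: "integrable OmM (\<lambda>p. inverse (1 + (snd p)\<^sup>2))"
proof -
  let ?f = "\<lambda>p::real\<times>real. indicator {0..<2*pi} (fst p) * inverse (1 + (snd p)\<^sup>2) :: real"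
  have "integrable (lborel \<Otimes>\<^sub>M lborel) ?f"
  proof (rule lborel_pair.Fubini_integrable)
    show "?f \<in> borel_measurable (lborel \<Otimes>\<^sub>M lborel)" by measurable
    have e: "(\<integral>y. norm (?f (x, y)) \<partial>lborel) = indicator {0..<2*pi} x * (\<integral>y. inverse (1 + y\<^sup>2) \<partial>lborel)" for x
      by (subst Bochner_Integration.integral_mult_right_zero[symmetric]) (auto intro!: Bochner_Integration.integral_cong simp: abs_mult)
    have "integrable lborel (indicator {0..<2*pi} :: real \<Rightarrow> real)" by (rule integrable_real_indicator) auto
    then show "integrable lborel (\<lambda>x. \<integral>y. norm (?f (x, y)) \<partial>lborel)"
      unfolding e by (rule integrable_mult_left)
    show "AE x in lborel. integrable lborel (\<lambda>y. ?f (x, y))"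
      using integrable_inverse_one_plus_sq by (intro AE_I2) simp
  qed
  then show ?thesis
    unfolding integrable_OmM lborel_prod
    by (rule Bochner_Integration.integrable_cong[THEN iffD1, rotated 2]) (auto simp: indicator_Om)
qed

section \<open>Closure properties of Schwartz functions\<close>

lemma schwartz_differentiable: "schwartz \<phi> \<Longrightarrow> \<phi> differentiable (at p)"
  by (erule schwartz.cases) blast
lemma schwartz_periodic: "schwartz \<phi> \<Longrightarrow> \<phi> (x + 2*pi, y) = \<phi> (x, y)"
  by (erule schwartz.cases) blast
lemma schwartz_decay:
  assumes "schwartz \<phi>" shows "\<exists>B. \<forall>x y. (1 + \<bar>y\<bar>) ^ n * norm (\<phi> (x, y)) \<le> B"
  using assms by (cases rule: schwartz.cases) blast
lemma schwartz_dX: "schwartz \<phi> \<Longrightarrow> schwartz (dX \<phi>)"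
  by (erule schwartz.cases) blast
lemma schwartz_dY: "schwartz \<phi> \<Longrightarrow> schwartz (dY \<phi>)"
  by (erule schwartz.cases) blast

lemma schwartz_continuous: "schwartz \<phi> \<Longrightarrow> continuous_on UNIV \<phi>"
  by (intro continuous_at_imp_continuous_on ballI differentiable_imp_continuous_within schwartz_differentiable)

lemma schwartz_measurable: "schwartz \<phi> \<Longrightarrow> \<phi> \<in> borel_measurable borel"
  by (intro borel_measurable_continuous_onI schwartz_continuous)

lemma has_vector_derivative_dX:
  assumes "\<phi> differentiable (at (x, y))"
  shows "((\<lambda>s. \<phi> (s, y)) has_vector_derivative dX \<phi> (x, y)) (at x)"
proof -
  have "(\<lambda>s. (s, y)) differentiable (at x)"
    by (rule differentiableI) (auto intro!: derivative_eq_intros)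
  then have "(\<phi> \<circ> (\<lambda>s. (s, y))) differentiable (at x)"
    by (rule differentiable_chain_at) (use assms in simp)
  then show ?thesis unfolding dX_def by (simp add: vector_derivative_works o_def)
qed

lemma has_vector_derivative_dY:
  assumes "\<phi> differentiable (at (x, y))"
  shows "((\<lambda>s. \<phi> (x, s)) has_vector_derivative dY \<phi> (x, y)) (at y)"
proof -
  have "(\<lambda>s. (x, s)) differentiable (at y)"
    by (rule differentiableI) (auto intro!: derivative_eq_intros)
  then have "(\<phi> \<circ> (\<lambda>s. (x, s))) differentiable (at y)"
    by (rule differentiable_chain_at) (use assms in simp)
  then show ?thesis unfolding dY_def by (simp add: vector_derivative_works o_def)
qed

text \<open>The y-derivative of y \<phi> is \<phi> + y \<partial>y \<phi>, a sum and not again a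
  multiple by y; the coinduction invariant therefore has to be a linear span, which yields both
  closure properties at once.\<close>

inductive_set schwartz_span :: "(real \<times> real \<Rightarrow> complex) set" where
  "schwartz \<phi> \<Longrightarrow> \<phi> \<in> schwartz_span"
| "schwartz \<phi> \<Longrightarrow> (\<lambda>p. of_real (snd p) * \<phi> p) \<in> schwartz_span"
| "\<phi> \<in> schwartz_span \<Longrightarrow> \<psi> \<in> schwartz_span \<Longrightarrow> (\<lambda>p. a * \<phi> p + c * \<psi> p) \<in> schwartz_span"

lemma schwartz_span_props:
  assumes "\<phi> \<in> schwartz_span"
  shows "(\<forall>p. \<phi> differentiable (at p)) \<and> (\<forall>x y. \<phi> (x + 2*pi, y) = \<phi> (x, y)) \<and>
    (\<forall>n. \<exists>B. \<forall>x y. (1 + \<bar>y\<bar>) ^ n * norm (\<phi> (x, y)) \<le> B) \<and> dX \<phi> \<in> schwartz_span \<and> dY \<phi> \<in> schwartz_span"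
  using assms
proof induction
  case (1 \<phi>)
  then show ?case
    using schwartz_differentiable schwartz_periodic schwartz_decay schwartz_dX schwartz_dY
    by (auto intro: schwartz_span.intros)
next
  case (2 \<phi>)
  let ?f = "\<lambda>p. of_real (snd p) * \<phi> p"
  have ds: "(\<lambda>p::real\<times>real. complex_of_real (snd p)) differentiable (at p)" for p
    by (rule differentiableI) (auto intro!: derivative_eq_intros)
  have d: "?f differentiable (at p)" for p
    using ds schwartz_differentiable[OF 2] by (rule differentiable_mult)
  have per: "?f (x + 2*pi, y) = ?f (x, y)" for x y using schwartz_periodic[OF 2] by simp
  have dec: "\<exists>B. \<forall>x y. (1 + \<bar>y\<bar>) ^ n * norm (?f (x, y)) \<le> B" for n
  proof -
    obtain B where B: "\<forall>x y. (1 + \<bar>y\<bar>) ^ Suc n * norm (\<phi> (x, y)) \<le> B" using schwartz_decay[OF 2] by blast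
    have "(1 + \<bar>y\<bar>) ^ n * norm (?f (x, y)) \<le> B" for x y
    proof -
      have "(1 + \<bar>y\<bar>) ^ n * norm (?f (x, y)) \<le> (1 + \<bar>y\<bar>) ^ n * ((1 + \<bar>y\<bar>) * norm (\<phi> (x, y)))"
        by (intro mult_left_mono) (auto simp: norm_mult intro: mult_right_mono)
      also have "\<dots> = (1 + \<bar>y\<bar>) ^ Suc n * norm (\<phi> (x, y))" by (simp only: power_Suc mult_ac)
      also have "\<dots> \<le> B" using B by blast
      finally show ?thesis .
    qed
    then show ?thesis by blast
  qed
  have X: "dX ?f = (\<lambda>p. of_real (snd p) * dX \<phi> p)"
  proof
    fix p :: "real \<times> real"
    obtain x y where p: "p = (x, y)" by (cases p)
    have "((\<lambda>s. of_real y * \<phi> (s, y)) has_vector_derivative of_real y * dX \<phi> (x, y)) (at x)"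
      by (intro has_vector_derivative_mult_right has_vector_derivative_dX schwartz_differentiable 2)
    then show "dX ?f p = of_real (snd p) * dX \<phi> p" unfolding p by (simp add: dX_def vector_derivative_at)
  qed
  have Y: "dY ?f = (\<lambda>p. 1 * \<phi> p + 1 * (of_real (snd p) * dY \<phi> p))"
  proof
    fix p :: "real \<times> real"
    obtain x y where p: "p = (x, y)" by (cases p)
    have "((\<lambda>s. of_real s * \<phi> (x, s)) has_vector_derivative of_real y * dY \<phi> (x, y) + of_real 1 * \<phi> (x, y)) (at y)"
      by (intro has_vector_derivative_mult has_vector_derivative_of_real has_vector_derivative_dY schwartz_differentiable 2)
        (auto intro!: derivative_eq_intros)
    then show "dY ?f p = 1 * \<phi> p + 1 * (of_real (snd p) * dY \<phi> p)" unfolding p by (simp add: dY_def vector_derivative_at add.commute)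
  qed
  have "dX ?f \<in> schwartz_span" unfolding X by (intro schwartz_span.intros schwartz_dX 2)
  moreover have "dY ?f \<in> schwartz_span" unfolding Y
    by (rule schwartz_span.intros(3)[OF schwartz_span.intros(1)[OF 2] schwartz_span.intros(2)[OF schwartz_dY[OF 2]]])
  ultimately show ?case using d per dec by blast
next
  case (3 \<phi> \<psi> a c)
  let ?f = "\<lambda>p. a * \<phi> p + c * \<psi> p"
  have d: "?f differentiable (at p)" for p
  proof -
    have "\<phi> differentiable (at p)" "\<psi> differentiable (at p)" using 3 by blast+
    then show ?thesis by (intro differentiable_add differentiable_mult differentiable_const)
  qed
  have per: "?f (x + 2*pi, y) = ?f (x, y)" for x y using 3 by simp
  have dec: "\<exists>B. \<forall>x y. (1 + \<bar>y\<bar>) ^ n * norm (?f (x, y)) \<le> B" for n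
  proof -
    obtain B where B: "\<forall>x y. (1 + \<bar>y\<bar>) ^ n * norm (\<phi> (x, y)) \<le> B" using 3 by blast
    obtain C where C: "\<forall>x y. (1 + \<bar>y\<bar>) ^ n * norm (\<psi> (x, y)) \<le> C" using 3 by blast
    have "(1 + \<bar>y\<bar>) ^ n * norm (?f (x, y)) \<le> norm a * B + norm c * C" for x y
    proof -
      have "(1 + \<bar>y\<bar>) ^ n * norm (?f (x, y)) \<le> (1 + \<bar>y\<bar>) ^ n * (norm a * norm (\<phi> (x, y)) + norm c * norm (\<psi> (x, y)))"
        by (intro mult_left_mono norm_triangle_le) (auto simp: norm_mult)
      also have "\<dots> = norm a * ((1 + \<bar>y\<bar>) ^ n * norm (\<phi> (x, y))) + norm c * ((1 + \<bar>y\<bar>) ^ n * norm (\<psi> (x, y)))"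
        by (simp add: algebra_simps)
      also have "\<dots> \<le> norm a * B + norm c * C" using B C by (intro add_mono mult_left_mono) auto
      finally show ?thesis .
    qed
    then show ?thesis by blast
  qed
  have X: "dX ?f = (\<lambda>p. a * dX \<phi> p + c * dX \<psi> p)"
  proof
    fix p :: "real \<times> real"
    obtain x y where p: "p = (x, y)" by (cases p)
    have "((\<lambda>s. a * \<phi> (s, y) + c * \<psi> (s, y)) has_vector_derivative a * dX \<phi> (x, y) + c * dX \<psi> (x, y)) (at x)"
      using 3 by (intro has_vector_derivative_add has_vector_derivative_mult_right has_vector_derivative_dX) blast+
    then show "dX ?f p = a * dX \<phi> p + c * dX \<psi> p" unfolding p by (simp add: dX_def vector_derivative_at)
  qed
  have Y: "dY ?f = (\<lambda>p. a * dY \<phi> p + c * dY \<psi> p)"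
  proof
    fix p :: "real \<times> real"
    obtain x y where p: "p = (x, y)" by (cases p)
    have "((\<lambda>s. a * \<phi> (x, s) + c * \<psi> (x, s)) has_vector_derivative a * dY \<phi> (x, y) + c * dY \<psi> (x, y)) (at y)"
      using 3 by (intro has_vector_derivative_add has_vector_derivative_mult_right has_vector_derivative_dY) blast+
    then show "dY ?f p = a * dY \<phi> p + c * dY \<psi> p" unfolding p by (simp add: dY_def vector_derivative_at)
  qed
  have "dX ?f \<in> schwartz_span" "dY ?f \<in> schwartz_span" unfolding X Y using 3 by (auto intro!: schwartz_span.intros(3))
  then show ?case using d per dec by blast
qed

lemma schwartz_spanD: "\<phi> \<in> schwartz_span \<Longrightarrow> schwartz \<phi>"
proof (coinduction arbitrary: \<phi>)
  case schwartz
  then show ?case using schwartz_span_props[OF schwartz] by (intro exI[of _ \<phi>]) auto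
qed

lemma schwartz_lincomb: "schwartz \<phi> \<Longrightarrow> schwartz \<psi> \<Longrightarrow> schwartz (\<lambda>p. a * \<phi> p + c * \<psi> p)"
  by (rule schwartz_spanD[OF schwartz_span.intros(3)[OF schwartz_span.intros(1) schwartz_span.intros(1)]])

lemma schwartz_mult_snd: "schwartz \<phi> \<Longrightarrow> schwartz (\<lambda>p. of_real (snd p) * \<phi> p)"
  by (rule schwartz_spanD[OF schwartz_span.intros(2)])

lemma schwartz_bound2:
  assumes "schwartz \<phi>" shows "\<exists>B\<ge>0. \<forall>p. norm (\<phi> p) \<le> B * inverse (1 + (snd p)\<^sup>2)"
proof -
  obtain B where B: "\<forall>x y. (1 + \<bar>y\<bar>) ^ 2 * norm (\<phi> (x, y)) \<le> B" using schwartz_decay[OF assms] by blast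
  have "norm (\<phi> p) \<le> \<bar>B\<bar> * inverse (1 + (snd p)\<^sup>2)" for p
  proof -
    obtain x y where p: "p = (x, y)" by (cases p)
    have "(1 + y\<^sup>2) * norm (\<phi> p) \<le> (1 + \<bar>y\<bar>)\<^sup>2 * norm (\<phi> p)"
      by (intro mult_right_mono) (auto simp: power2_sum)
    also have "\<dots> \<le> \<bar>B\<bar>" using B[rule_format, of y x] p by auto
    finally have "norm (\<phi> p) * (1 + y\<^sup>2) \<le> \<bar>B\<bar>" by (simp add: mult.commute)
    moreover have "1 + y\<^sup>2 > 0" by (simp add: add_pos_nonneg)
    ultimately have "norm (\<phi> p) \<le> \<bar>B\<bar> / (1 + y\<^sup>2)" by (simp only: pos_le_divide_eq)
    then show ?thesis by (simp add: p divide_inverse)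
  qed
  then show ?thesis by (intro exI[of _ "\<bar>B\<bar>"]) auto
qed

lemma schwartz_integrable:
  assumes \<phi>: "schwartz \<phi>" and h: "h \<in> borel_measurable borel" "\<And>p. norm (h p) \<le> c"
  shows "integrable OmM (\<lambda>p. \<phi> p * h p)"
proof -
  obtain B where B: "B \<ge> 0" "\<forall>p. norm (\<phi> p) \<le> B * inverse (1 + (snd p)\<^sup>2)" using schwartz_bound2[OF \<phi>] by blast
  have "integrable OmM (\<lambda>p. (c * B) * inverse (1 + (snd p)\<^sup>2))" by (intro integrable_mult_right integrable_OmM_weight)
  then show ?thesis
  proof (rule Bochner_Integration.integrable_bound)
    show "(\<lambda>p. \<phi> p * h p) \<in> borel_measurable OmM"
      by (rule measurable_OmM[OF borel_measurable_times[OF schwartz_measurable[OF \<phi>] h(1)]])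
    have c: "c \<ge> 0" using h(2)[of 0] norm_ge_zero order_trans by blast
    have "norm (\<phi> p * h p) \<le> norm ((c * B) * inverse (1 + (snd p)\<^sup>2))" for p
    proof -
      have "norm (\<phi> p) * norm (h p) \<le> (B * inverse (1 + (snd p)\<^sup>2)) * c"
        using B(1) B(2)[rule_format, of p] h(2)[of p] by (intro mult_mono mult_nonneg_nonneg) auto
      then show ?thesis using B(1) c by (simp add: norm_mult mult_ac abs_mult)
    qed
    then show "AE p in OmM. norm (\<phi> p * h p) \<le> norm ((c * B) * inverse (1 + (snd p)\<^sup>2))" by simp
  qed
qed

lemma ez_p_measurable: "ez z \<in> borel_measurable borel"
  unfolding ez_def by (intro borel_measurable_continuous_onI continuous_on_cis continuous_intros)

lemma schwartz_integrable_ez: "schwartz \<phi> \<Longrightarrow> integrable OmM (\<lambda>p. \<phi> p * ez z p)"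
  by (rule schwartz_integrable[OF _ ez_p_measurable, of _ _ 1]) auto

lemma fourier_ez: "fourier \<phi> k \<xi> = (\<integral>p. \<phi> p * ez (-k, -\<xi>) p \<partial>OmM)"
  unfolding fourier_def integral_Om ez_def by simp

lemma ez_deriv_x: "((\<lambda>s. ez z (s, y)) has_vector_derivative \<i> * of_int (fst z) * ez z (x, y)) (at x)"
  and ez_deriv_y: "((\<lambda>s. ez z (x, s)) has_vector_derivative \<i> * of_real (snd z) * ez z (x, y)) (at y)"
proof -
  have g: "((\<lambda>s. cis (f s)) has_vector_derivative \<i> * of_real f' * cis (f x)) (at x)"
    if "(f has_real_derivative f') (at x)" for f f' x
  proof -
    have "((\<lambda>s. \<i> * complex_of_real (f s)) has_vector_derivative \<i> * of_real f') (at x)"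
      by (intro has_vector_derivative_mult_right has_vector_derivative_of_real that)
    from field_vector_diff_chain_at[OF this DERIV_exp] show ?thesis by (simp add: o_def cis_conv_exp)
  qed
  have "((\<lambda>s. real_of_int (fst z) * s + snd z * y) has_real_derivative of_int (fst z)) (at x)"
    by (auto intro!: derivative_eq_intros)
  from g[OF this] show "((\<lambda>s. ez z (s, y)) has_vector_derivative \<i> * of_int (fst z) * ez z (x, y)) (at x)"
    by (simp add: ez_def)
  have "((\<lambda>s. real_of_int (fst z) * x + snd z * s) has_real_derivative snd z) (at y)"
    by (auto intro!: derivative_eq_intros)
  from g[OF this] show "((\<lambda>s. ez z (x, s)) has_vector_derivative \<i> * of_real (snd z) * ez z (x, y)) (at y)"
    by (simp add: ez_def)
qed

lemma schwartz_slice_continuous: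
  assumes "schwartz \<phi>" shows "continuous_on UNIV (\<lambda>s. \<phi> (s, y))" "continuous_on UNIV (\<lambda>s. \<phi> (x, s))"
  by (rule continuous_on_compose2[OF schwartz_continuous[OF assms] continuous_on_Pair[OF continuous_on_id continuous_on_const]], simp)
    (rule continuous_on_compose2[OF schwartz_continuous[OF assms] continuous_on_Pair[OF continuous_on_const continuous_on_id]], simp)

lemma ez_slice_continuous: "continuous_on UNIV (\<lambda>s. ez z (s, y))" "continuous_on UNIV (\<lambda>s. ez z (x, s))"
  unfolding ez_def by (auto intro!: continuous_on_cis continuous_intros)

lemma fourier_dX:
  assumes \<phi>: "schwartz \<phi>" shows "fourier (dX \<phi>) k \<xi> = \<i> * of_int k * fourier \<phi> k \<xi>"
proof -
  let ?e = "ez (-k, -\<xi>)"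
  let ?F = "\<lambda>p. \<phi> p * (\<i> * of_int (- k) * ?e p) + dX \<phi> p * ?e p"
  have i: "integrable OmM ?F"
  proof -
    have "integrable OmM (\<lambda>p. (\<i> * of_int (- k)) * (\<phi> p * ?e p) + dX \<phi> p * ?e p)"
      by (intro Bochner_Integration.integrable_add integrable_mult_right schwartz_integrable_ez schwartz_dX \<phi>)
    then show ?thesis by (rule Bochner_Integration.integrable_cong[THEN iffD1, rotated 2]) (auto simp: algebra_simps)
  qed
  have z: "(\<integral>x. indicator Om (x, y) *\<^sub>R ?F (x, y) \<partial>lborel) = 0" for y
  proof -
    \<comment> \<open>The period in \<open>Om\<close> is half-open, whereas the fundamental theorem
      is applied on a closed interval; the endpoint 2\<pi> is a null set.\<close>
    have "(\<integral>x. indicator Om (x, y) *\<^sub>R ?F (x, y) \<partial>lborel) = (\<integral>x. indicator {0..2*pi} x *\<^sub>R ?F (x, y) \<partial>lborel)"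
    proof (rule integral_cong_AE)
      have m: "(\<lambda>x. ?F (x, y)) \<in> borel_measurable borel"
        by (intro borel_measurable_continuous_onI continuous_intros schwartz_slice_continuous ez_slice_continuous \<phi> schwartz_dX)
      show "(\<lambda>x. indicator Om (x, y) *\<^sub>R ?F (x, y)) \<in> borel_measurable lborel"
        unfolding indicator_Om using m by measurable
      show "(\<lambda>x. indicator {0..2*pi} x *\<^sub>R ?F (x, y)) \<in> borel_measurable lborel" using m by measurable
      show "AE x in lborel. indicator Om (x, y) *\<^sub>R ?F (x, y) = indicator {0..2*pi} x *\<^sub>R ?F (x, y)"
        using AE_lborel_singleton[of "2*pi"]
        by eventually_elim (auto simp: Om_def indicator_def)
    qed
    also have "\<dots> = \<phi> (2*pi, y) * ?e (2*pi, y) - \<phi> (0, y) * ?e (0, y)"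
    proof (rule integral_FTC_Icc)
      show "((\<lambda>s. \<phi> (s, y) * ?e (s, y)) has_vector_derivative ?F (x, y)) (at x within {0..2*pi})" for x
        by (rule has_vector_derivative_at_within, rule has_vector_derivative_mult[OF has_vector_derivative_dX[OF schwartz_differentiable[OF \<phi>]] ez_deriv_x[of "(-k, -\<xi>)", unfolded fst_conv]])
      show "continuous_on {0..2*pi} (\<lambda>x. ?F (x, y))"
        by (rule continuous_on_subset[OF _ subset_UNIV])
          (intro continuous_intros schwartz_slice_continuous ez_slice_continuous \<phi> schwartz_dX)
    qed simp
    also have "\<dots> = 0"
    proof -
      have "\<phi> (2*pi, y) = \<phi> (0, y)" using schwartz_periodic[OF \<phi>, of 0 y] by simp
      moreover have "?e (2*pi, y) = ?e (0, y)"
      proof -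
        have "?e (2*pi, y) = ?e (0, y) * cis (2 * pi * of_int (-k))" by (simp add: ez_def cis_mult algebra_simps)
        also have "cis (2 * pi * of_int (-k)) = 1" by (rule cis_multiple_2pi) auto
        finally show ?thesis by simp
      qed
      ultimately show ?thesis by simp
    qed
    finally show ?thesis .
  qed
  have "(\<integral>p. ?F p \<partial>OmM) = (\<integral>y. \<integral>x. indicator Om (x, y) *\<^sub>R ?F (x, y) \<partial>lborel \<partial>lborel)"
  proof -
    have "integrable (lborel \<Otimes>\<^sub>M lborel) (\<lambda>p. indicator Om p *\<^sub>R ?F p)"
      using i unfolding integrable_OmM lborel_prod .
    then show ?thesis unfolding integral_OmM
      by (subst lborel_pair.integral_snd) (simp_all add: lborel_prod split_beta')
  qed
  then have "(\<integral>p. ?F p \<partial>OmM) = 0" unfolding z by simp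
  moreover have "(\<integral>p. ?F p \<partial>OmM) = (\<integral>p. (\<i> * of_int (- k)) * (\<phi> p * ?e p) + dX \<phi> p * ?e p \<partial>OmM)"
    by (intro Bochner_Integration.integral_cong) (auto simp: algebra_simps)
  moreover have "\<dots> = (\<i> * of_int (- k)) * (\<integral>p. \<phi> p * ?e p \<partial>OmM) + (\<integral>p. dX \<phi> p * ?e p \<partial>OmM)"
    using schwartz_integrable_ez[OF \<phi>] schwartz_integrable_ez[OF schwartz_dX[OF \<phi>]] by simp
  ultimately show ?thesis unfolding fourier_ez by (simp add: eq_neg_iff_add_eq_0 algebra_simps)
qed

lemma schwartz_slice_bound:
  assumes "schwartz \<phi>" shows "integrable lborel (\<lambda>s. \<phi> (x, s) * ez z (x, s))"
proof -
  obtain B where B: "B \<ge> 0" "\<forall>p. norm (\<phi> p) \<le> B * inverse (1 + (snd p)\<^sup>2)" using schwartz_bound2[OF assms] by blast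
  have "integrable lborel (\<lambda>y. B * inverse (1 + y\<^sup>2))" by (intro integrable_mult_right integrable_inverse_one_plus_sq)
  then show ?thesis
  proof (rule Bochner_Integration.integrable_bound)
    have "(\<lambda>s. \<phi> (x, s) * ez z (x, s)) \<in> borel_measurable borel"
      by (intro borel_measurable_continuous_onI continuous_intros schwartz_slice_continuous ez_slice_continuous assms)
    then show "(\<lambda>s. \<phi> (x, s) * ez z (x, s)) \<in> borel_measurable lborel" by simp
    show "AE s in lborel. norm (\<phi> (x, s) * ez z (x, s)) \<le> norm (B * inverse (1 + s\<^sup>2))"
    proof (intro AE_I2)
      fix s
      show "norm (\<phi> (x, s) * ez z (x, s)) \<le> norm (B * inverse (1 + s\<^sup>2))"
        using B(2)[rule_format, of "(x, s)"] by (simp add: norm_mult)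
    qed
  qed
qed

lemma fourier_dY:
  assumes \<phi>: "schwartz \<phi>" shows "fourier (dY \<phi>) k \<xi> = \<i> * of_real \<xi> * fourier \<phi> k \<xi>"
proof -
  let ?e = "ez (-k, -\<xi>)"
  let ?F = "\<lambda>p. \<phi> p * (\<i> * of_real (- \<xi>) * ?e p) + dY \<phi> p * ?e p"
  have i: "integrable OmM ?F"
  proof -
    have "integrable OmM (\<lambda>p. (\<i> * of_real (- \<xi>)) * (\<phi> p * ?e p) + dY \<phi> p * ?e p)"
      by (intro Bochner_Integration.integrable_add integrable_mult_right schwartz_integrable_ez schwartz_dY \<phi>)
    then show ?thesis by (rule Bochner_Integration.integrable_cong[THEN iffD1, rotated 2]) (auto simp: algebra_simps)
  qed
  have z: "(\<integral>y. ?F (x, y) \<partial>lborel) = 0" for x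
  proof (rule integral_deriv_eq_0)
    show "((\<lambda>s. \<phi> (x, s) * ?e (x, s)) has_vector_derivative ?F (x, y)) (at y)" for y
      by (rule has_vector_derivative_mult[OF has_vector_derivative_dY[OF schwartz_differentiable[OF \<phi>]] ez_deriv_y[of "(-k, -\<xi>)", unfolded snd_conv]])
    show "continuous_on UNIV (\<lambda>y. ?F (x, y))"
      by (intro continuous_intros schwartz_slice_continuous ez_slice_continuous \<phi> schwartz_dY)
    have "integrable lborel (\<lambda>y. (\<i> * of_real (- \<xi>)) * (\<phi> (x, y) * ?e (x, y)) + dY \<phi> (x, y) * ?e (x, y))"
      by (intro Bochner_Integration.integrable_add integrable_mult_right schwartz_slice_bound schwartz_dY \<phi>)
    then show "integrable lborel (\<lambda>y. ?F (x, y))"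
      by (rule Bochner_Integration.integrable_cong[THEN iffD1, rotated 2]) (auto simp: algebra_simps)
    obtain B where B: "\<forall>x y. (1 + \<bar>y\<bar>) ^ 1 * norm (\<phi> (x, y)) \<le> B" using schwartz_decay[OF \<phi>] by blast
    have "norm (\<phi> (x, y) * ?e (x, y)) \<le> B / (1 + \<bar>y\<bar>)" for y
      using B[rule_format, of y x] by (simp add: norm_mult pos_le_divide_eq mult.commute add_pos_nonneg)
    then show "((\<lambda>y. \<phi> (x, y) * ?e (x, y)) \<longlongrightarrow> 0) at_top" "((\<lambda>y. \<phi> (x, y) * ?e (x, y)) \<longlongrightarrow> 0) at_bot"
      by (rule tendsto_0_of_decay)+
  qed
  have "(\<integral>p. ?F p \<partial>OmM) = (\<integral>x. \<integral>y. indicator Om (x, y) *\<^sub>R ?F (x, y) \<partial>lborel \<partial>lborel)"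
  proof -
    have "integrable (lborel \<Otimes>\<^sub>M lborel) (\<lambda>p. indicator Om p *\<^sub>R ?F p)"
      using i unfolding integrable_OmM lborel_prod .
    then show ?thesis unfolding integral_OmM
      by (subst lborel_pair.integral_fst) (simp_all add: lborel_prod split_beta')
  qed
  then have "(\<integral>p. ?F p \<partial>OmM) = 0" unfolding indicator_Om using z by simp
  moreover have "(\<integral>p. ?F p \<partial>OmM) = (\<integral>p. (\<i> * of_real (- \<xi>)) * (\<phi> p * ?e p) + dY \<phi> p * ?e p \<partial>OmM)"
    by (intro Bochner_Integration.integral_cong) (auto simp: algebra_simps)
  moreover have "\<dots> = (\<i> * of_real (- \<xi>)) * (\<integral>p. \<phi> p * ?e p \<partial>OmM) + (\<integral>p. dY \<phi> p * ?e p \<partial>OmM)"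
    using schwartz_integrable_ez[OF \<phi>] schwartz_integrable_ez[OF schwartz_dY[OF \<phi>]] by simp
  ultimately show ?thesis unfolding fourier_ez by (simp add: eq_neg_iff_add_eq_0 algebra_simps)
qed

text \<open>As \<open>wt\<close> is 1 + |k| + |\<xi>|, one more power of it times the transform of
  \<phi> is the sum of three terms with the previous power, for \<phi>, \<open>dX \<phi>\<close> and
  \<open>dY \<phi>\<close>; the induction therefore ranges over all Schwartz functions.\<close>

lemma fourier_decay:
  assumes "schwartz \<phi>" shows "\<exists>B. \<forall>k \<xi>. wt k \<xi> ^ n * norm (fourier \<phi> k \<xi>) \<le> B"
  using assms
proof (induction n arbitrary: \<phi>)
  case 0
  have "norm (fourier \<phi> k \<xi>) \<le> (\<integral>p. norm (\<phi> p) \<partial>OmM)" for k \<xi>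
    unfolding fourier_ez using integral_norm_bound[of OmM "\<lambda>p. \<phi> p * ez (-k, -\<xi>) p"] by (simp add: norm_mult)
  then show ?case by (intro exI[of _ "\<integral>p. norm (\<phi> p) \<partial>OmM"]) simp
next
  case (Suc n)
  obtain B where B: "\<forall>k \<xi>. wt k \<xi> ^ n * norm (fourier \<phi> k \<xi>) \<le> B" using Suc.IH[OF Suc.prems] by blast
  obtain C where C: "\<forall>k \<xi>. wt k \<xi> ^ n * norm (fourier (dX \<phi>) k \<xi>) \<le> C" using Suc.IH[OF schwartz_dX[OF Suc.prems]] by blast
  obtain D where D: "\<forall>k \<xi>. wt k \<xi> ^ n * norm (fourier (dY \<phi>) k \<xi>) \<le> D" using Suc.IH[OF schwartz_dY[OF Suc.prems]] by blast
  have "wt k \<xi> ^ Suc n * norm (fourier \<phi> k \<xi>) \<le> B + C + D" for k \<xi>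
  proof -
    have "wt k \<xi> ^ Suc n * norm (fourier \<phi> k \<xi>) = wt k \<xi> ^ n * norm (fourier \<phi> k \<xi>)
      + wt k \<xi> ^ n * norm (fourier (dX \<phi>) k \<xi>) + wt k \<xi> ^ n * norm (fourier (dY \<phi>) k \<xi>)"
      unfolding fourier_dX[OF Suc.prems] fourier_dY[OF Suc.prems]
      by (simp add: norm_mult wt_def algebra_simps)
    then show ?thesis using B[rule_format, of k \<xi>] C[rule_format, of k \<xi>] D[rule_format, of k \<xi>] by linarith
  qed
  then show ?case by blast
qed

lemma fourier_deriv:
  assumes \<phi>: "schwartz \<phi>"
  shows "(fourier \<phi> k has_vector_derivative - \<i> * fourier (\<lambda>p. of_real (snd p) * \<phi> p) k \<xi>) (at \<xi>)"
proof (rule has_vector_derivative_quadratic_remainder[where S = UNIV and C = "\<integral>p. norm (of_real (snd p) * (of_real (snd p) * \<phi> p)) \<partial>OmM"])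
  fix \<xi>'
  let ?y\<phi> = "\<lambda>p. of_real (snd p) * \<phi> p"
  let ?yy\<phi> = "\<lambda>p. of_real (snd p) * ?y\<phi> p"
  note y = schwartz_mult_snd[OF \<phi>]
  note yy = schwartz_mult_snd[OF y]
  let ?h = "\<xi>' - \<xi>"
  let ?R = "\<lambda>p. \<phi> p * (ez (-k, -\<xi>') p - ez (-k, -\<xi>) p - \<i> * of_real (- ?h * snd p) * ez (-k, -\<xi>) p)"
  have Re: "?R = (\<lambda>p. \<phi> p * ez (-k, -\<xi>') p - \<phi> p * ez (-k, -\<xi>) p - (- \<i> * of_real ?h) * (?y\<phi> p * ez (-k, -\<xi>) p))"
  proof
    fix p
    have "a * (e1 - e2 - \<i> * of_real (- h * y) * e2) = a * e1 - a * e2 - (- \<i> * of_real h) * ((of_real y * a) * e2)"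
      for a e1 e2 :: complex and h y :: real by (simp add: algebra_simps)
    then show "?R p = \<phi> p * ez (-k, -\<xi>') p - \<phi> p * ez (-k, -\<xi>) p - (- \<i> * of_real ?h) * (?y\<phi> p * ez (-k, -\<xi>) p)" .
  qed
  have iR: "integrable OmM ?R" unfolding Re
    by (intro Bochner_Integration.integrable_diff integrable_mult_right schwartz_integrable_ez \<phi> y)
  have "fourier \<phi> k \<xi>' - fourier \<phi> k \<xi> - ?h *\<^sub>R (- \<i> * fourier ?y\<phi> k \<xi>) = (\<integral>p. ?R p \<partial>OmM)"
    unfolding Re fourier_ez
    using schwartz_integrable_ez[OF \<phi>] schwartz_integrable_ez[OF y]
    by (simp add: scaleR_conv_of_real)
  also have "norm \<dots> \<le> (\<integral>p. ?h\<^sup>2 * norm (?yy\<phi> p) \<partial>OmM)"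
  proof (rule integral_norm_bound[THEN order_trans], rule integral_mono)
    show "integrable OmM (\<lambda>p. norm (?R p))" using iR by (rule integrable_norm)
    show "integrable OmM (\<lambda>p. ?h\<^sup>2 * norm (?yy\<phi> p))"
      using schwartz_integrable[OF yy, of "\<lambda>_. 1" 1] by (intro integrable_mult_right integrable_norm) simp
    fix p
    have "norm (ez (-k, -\<xi>') p - ez (-k, -\<xi>) p - \<i> * of_real (- ?h * snd p) * ez (-k, -\<xi>) p) \<le> (- ?h * snd p)\<^sup>2"
    proof -
      have "of_int (-k) * fst p + (-\<xi>') * snd p = (of_int (-k) * fst p + (-\<xi>) * snd p) + - ?h * snd p"
        by (simp add: algebra_simps)
      then show ?thesis unfolding ez_def fst_conv snd_conv using cis_taylor by metis
    qed
    then have "norm (?R p) \<le> norm (\<phi> p) * (- ?h * snd p)\<^sup>2" unfolding norm_mult[of "\<phi> p"] by (intro mult_left_mono) auto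
    also have "norm (\<phi> p) * (- ?h * snd p)\<^sup>2 = ?h\<^sup>2 * (\<bar>snd p\<bar>\<^sup>2 * norm (\<phi> p))"
      by (simp only: power_mult_distrib power2_minus power2_abs mult_ac)
    also have "\<bar>snd p\<bar>\<^sup>2 * norm (\<phi> p) = norm (?yy\<phi> p)"
      by (simp only: norm_mult norm_of_real power2_eq_square mult.assoc)
    finally show "norm (?R p) \<le> ?h\<^sup>2 * norm (?yy\<phi> p)" .
  qed
  also have "\<dots> = (\<integral>p. norm (?yy\<phi> p) \<partial>OmM) * ?h\<^sup>2"
    by (subst Bochner_Integration.integral_mult_right_zero) (rule mult.commute)
  finally show "norm (fourier \<phi> k \<xi>' - fourier \<phi> k \<xi> - ?h *\<^sub>R (- \<i> * fourier ?y\<phi> k \<xi>)) \<le> (\<integral>p. norm (?yy\<phi> p) \<partial>OmM) * ?h\<^sup>2" .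
qed

text \<open>The \<xi>-derivative is -\<i> times the transform of y \<phi>, so the coinduction
  invariant admits a scalar factor.\<close>

lemma sg_fourier:
  assumes "schwartz \<phi>" shows "sg (fourier \<phi>)"
proof -
  have "\<exists>c \<phi>. schwartz \<phi> \<and> g = (\<lambda>k \<xi>. c * fourier \<phi> k \<xi>) \<Longrightarrow> sg g" for g
  proof (coinduction arbitrary: g)
    case sg
    then obtain c \<phi> where \<phi>: "schwartz \<phi>" and g: "g = (\<lambda>k \<xi>. c * fourier \<phi> k \<xi>)" by blast
    have "\<exists>B. \<forall>k \<xi>. wt k \<xi> ^ n * norm (g k \<xi>) \<le> B" for n
    proof -
      obtain B where "\<forall>k \<xi>. wt k \<xi> ^ n * norm (fourier \<phi> k \<xi>) \<le> B" using fourier_decay[OF \<phi>] by blast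
      then have "norm c * (wt k \<xi> ^ n * norm (fourier \<phi> k \<xi>)) \<le> norm c * B" for k \<xi> by (intro mult_left_mono) auto
      then show ?thesis unfolding g by (intro exI[of _ "norm c * B"]) (simp add: norm_mult mult_ac)
    qed
    moreover have "(g k has_vector_derivative (c * - \<i>) * fourier (\<lambda>p. of_real (snd p) * \<phi> p) k \<xi>) (at \<xi>)" for k \<xi>
      unfolding g using has_vector_derivative_mult_right[OF fourier_deriv[OF \<phi>, of k \<xi>], of c] by (simp add: mult.assoc)
    ultimately show ?case
      using schwartz_mult_snd[OF \<phi>]
      by (intro exI[of _ g] exI[of _ "\<lambda>k \<xi>. (c * - \<i>) * fourier (\<lambda>p. of_real (snd p) * \<phi> p) k \<xi>"]) blast
  qed
  from this[of "\<lambda>k \<xi>. 1 * fourier \<phi> k \<xi>"] assms have "sg (\<lambda>k \<xi>. 1 * fourier \<phi> k \<xi>)" by blast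
  then show ?thesis by simp
qed

section \<open>Fourier inversion and multipliers\<close>

interpretation OF: pair_sigma_finite OmM FM
proof -
  interpret O: sigma_finite_measure OmM by (rule sigma_finite_OmM)
  show "pair_sigma_finite OmM FM"
    unfolding FM_def by (intro pair_sigma_finite.intro O.sigma_finite_measure_axioms FM.sigma_finite_measure_axioms)
qed

lemma ez_joint_measurable: "(\<lambda>w. ez (snd w) (fst w)) \<in> borel_measurable (OmM \<Otimes>\<^sub>M FM)"
proof -
  have k: "(\<lambda>z. real_of_int (fst z)) \<in> borel_measurable FM" by (rule measurable_FM) simp
  have x: "(\<lambda>z::int\<times>real. snd z) \<in> borel_measurable FM" by (rule measurable_FM) simp
  have f: "fst \<in> borel_measurable OmM" "snd \<in> borel_measurable OmM"
    by (intro measurable_OmM borel_measurable_continuous_onI continuous_intros)+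
  have "(\<lambda>w. real_of_int (fst (snd w)) * fst (fst w) + snd (snd w) * snd (fst w)) \<in> borel_measurable (OmM \<Otimes>\<^sub>M FM)"
    using measurable_compose[OF measurable_snd k] measurable_compose[OF measurable_snd x]
      measurable_compose[OF measurable_fst f(1)] measurable_compose[OF measurable_fst f(2)]
    by (intro borel_measurable_add borel_measurable_times) auto
  then show ?thesis unfolding ez_def
    by (rule borel_measurable_continuous_on[of cis, rotated]) (intro continuous_on_cis continuous_on_id)
qed

lemma fubini_OmM_FM:
  fixes a :: "real \<times> real \<Rightarrow> complex" and h :: "int \<times> real \<Rightarrow> complex"
  assumes a: "integrable OmM a" and h: "integrable FM h"
    and e: "(\<lambda>w. e (fst w) (snd w)) \<in> borel_measurable (OmM \<Otimes>\<^sub>M FM)" "\<And>p z. norm (e p z) \<le> (1::real)"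
  shows "(\<integral>p. a p * (\<integral>z. h z * e p z \<partial>FM) \<partial>OmM) = (\<integral>z. h z * (\<integral>p. a p * e p z \<partial>OmM) \<partial>FM)"
proof -
  have am: "a \<in> borel_measurable OmM" and hm: "h \<in> borel_measurable FM" using a h by auto
  have "(\<lambda>w. a (fst w) * h (snd w)) \<in> borel_measurable (OmM \<Otimes>\<^sub>M FM)"
    by (intro borel_measurable_times measurable_compose[OF measurable_fst am] measurable_compose[OF measurable_snd hm])
  then have i0: "integrable (OmM \<Otimes>\<^sub>M FM) (\<lambda>w. a (fst w) * h (snd w))"
  proof (rule OF.Fubini_integrable)
    have "(\<integral>z. norm (a p * h z) \<partial>FM) = norm (a p) * (\<integral>z. norm (h z) \<partial>FM)" for p
      unfolding norm_mult by simp
    then show "integrable OmM (\<lambda>p. \<integral>z. norm (a (fst (p, z)) * h (snd (p, z))) \<partial>FM)"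
      using a by (simp only: fst_conv snd_conv) (intro integrable_mult_left integrable_norm)
    show "AE p in OmM. integrable FM (\<lambda>z. a (fst (p, z)) * h (snd (p, z)))" using h by simp
  qed
  have i: "integrable (OmM \<Otimes>\<^sub>M FM) (\<lambda>w. a (fst w) * h (snd w) * e (fst w) (snd w))"
    using i0
  proof (rule Bochner_Integration.integrable_bound)
    show "(\<lambda>w. a (fst w) * h (snd w) * e (fst w) (snd w)) \<in> borel_measurable (OmM \<Otimes>\<^sub>M FM)"
      by (rule borel_measurable_times[OF borel_measurable_integrable[OF i0] e(1)])
    have "norm (x * e p z) \<le> norm x" for x p z
      using mult_left_mono[OF e(2)[of p z], of "norm x"] by (simp add: norm_mult)
    then show "AE w in OmM \<Otimes>\<^sub>M FM. norm (a (fst w) * h (snd w) * e (fst w) (snd w)) \<le> norm (a (fst w) * h (snd w))" by simp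
  qed
  have "(\<integral>p. a p * (\<integral>z. h z * e p z \<partial>FM) \<partial>OmM) = (\<integral>p. \<integral>z. a p * h z * e p z \<partial>FM \<partial>OmM)"
    by (simp add: mult.assoc)
  also have "\<dots> = (\<integral>z. \<integral>p. a p * h z * e p z \<partial>OmM \<partial>FM)"
    by (rule OF.Fubini_integral[symmetric]) (use i in \<open>simp add: split_beta'\<close>)
  also have "\<dots> = (\<integral>z. h z * (\<integral>p. a p * e p z \<partial>OmM) \<partial>FM)"
  proof (rule Bochner_Integration.integral_cong[OF refl])
    fix z
    have "(\<integral>p. a p * h z * e p z \<partial>OmM) = (\<integral>p. h z * (a p * e p z) \<partial>OmM)"
      by (intro Bochner_Integration.integral_cong refl) (simp only: mult_ac)
    then show "(\<integral>p. a p * h z * e p z \<partial>OmM) = h z * (\<integral>p. a p * e p z \<partial>OmM)" by simp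
  qed
  finally show ?thesis .
qed

lemma cnj_ez: "cnj (ez z p) = ez (- fst z, - snd z) p"
  by (simp add: ez_def cis_cnj)

text \<open>One Fubini exchange serves twice: with \<phi> = \<open>IF g\<close> and inversion it
  becomes Plancherel's identity, with g = \<open>fourier \<phi>\<close> it leads to Bessel's
  inequality.\<close>

lemma pairing_cnj_IF:
  assumes \<phi>: "schwartz \<phi>" and g: "sg g"
  shows "(\<integral>p. \<phi> p * cnj (IF g p) \<partial>OmM) = 1 / (2*pi)\<^sup>2 * (\<integral>z. cnj (g (fst z) (snd z)) * fourier \<phi> (fst z) (snd z) \<partial>FM)"
proof -
  have "cnj (IF g p) = 1 / (2*pi)\<^sup>2 * (\<integral>z. cnj (g (fst z) (snd z)) * cnj (ez z p) \<partial>FM)" for p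
    unfolding IF_def by (simp add: Bochner_Integration.integral_cnj[symmetric])
  then have "(\<integral>p. \<phi> p * cnj (IF g p) \<partial>OmM) = (\<integral>p. 1 / (2*pi)\<^sup>2 * (\<phi> p * (\<integral>z. cnj (g (fst z) (snd z)) * cnj (ez z p) \<partial>FM)) \<partial>OmM)"
    by (simp add: mult_ac)
  also have "\<dots> = 1 / (2*pi)\<^sup>2 * (\<integral>p. \<phi> p * (\<integral>z. cnj (g (fst z) (snd z)) * cnj (ez z p) \<partial>FM) \<partial>OmM)"
    by (rule Bochner_Integration.integral_mult_right_zero)
  also have "(\<integral>p. \<phi> p * (\<integral>z. cnj (g (fst z) (snd z)) * cnj (ez z p) \<partial>FM) \<partial>OmM)
      = (\<integral>z. cnj (g (fst z) (snd z)) * (\<integral>p. \<phi> p * cnj (ez z p) \<partial>OmM) \<partial>FM)"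
  proof (rule fubini_OmM_FM)
    show "integrable OmM \<phi>" using schwartz_integrable[OF \<phi>, of "\<lambda>_. 1" 1] by simp
    show "integrable FM (\<lambda>z. cnj (g (fst z) (snd z)))" using sg_integrable(2)[OF g] by simp
    show "(\<lambda>w. cnj (ez (snd w) (fst w))) \<in> borel_measurable (OmM \<Otimes>\<^sub>M FM)"
      by (rule borel_measurable_continuous_on[OF _ ez_joint_measurable]) (intro continuous_intros)
  qed simp
  finally show ?thesis by (simp add: fourier_ez cnj_ez)
qed

section \<open>Gaussian regularisation and Fourier inversion\<close>

lemma integral_gauss_cis:
  assumes "\<epsilon> > 0"
  shows "(\<integral>y. cis (\<tau> * y) * of_real (exp (- (\<epsilon> * y)\<^sup>2 / 2)) \<partial>lborel) = of_real (sqrt (2*pi) / \<epsilon> * exp (- (\<tau> / \<epsilon>)\<^sup>2 / 2))"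
proof -
  have c: "(\<integral>x. cis (t * x) * of_real (exp (- x\<^sup>2 / 2)) \<partial>lborel) = of_real (sqrt (2*pi) * exp (- t\<^sup>2 / 2))" for t
  proof -
    have "of_real (exp (- t\<^sup>2 / 2)) = (\<integral>x. iexp (t * x) \<partial>std_normal_distribution)"
      using fun_cong[OF char_std_normal_distribution, of t] by (simp add: char_def)
    also have "\<dots> = (\<integral>x. std_normal_density x *\<^sub>R iexp (t * x) \<partial>lborel)"
      by (subst integral_density) (auto simp: normal_density_nonneg)
    also have "\<dots> = (\<integral>x. (1 / sqrt (2*pi)) * (cis (t * x) * of_real (exp (- x\<^sup>2 / 2))) \<partial>lborel)"
      by (intro Bochner_Integration.integral_cong refl)
        (simp add: std_normal_density_def scaleR_conv_of_real cis_conv_exp mult_ac)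
    also have "\<dots> = (1 / sqrt (2*pi)) * (\<integral>x. cis (t * x) * of_real (exp (- x\<^sup>2 / 2)) \<partial>lborel)" by simp
    finally show ?thesis by (simp add: field_simps)
  qed
  have "(\<integral>y. cis (\<tau> * y) * of_real (exp (- (\<epsilon> * y)\<^sup>2 / 2)) \<partial>lborel)
      = \<bar>1 / \<epsilon>\<bar> *\<^sub>R (\<integral>s. cis (\<tau> * (0 + 1 / \<epsilon> * s)) * of_real (exp (- (\<epsilon> * (0 + 1 / \<epsilon> * s))\<^sup>2 / 2)) \<partial>lborel)"
    by (rule lborel_integral_real_affine) (use assms in simp)
  also have "\<dots> = (1 / \<epsilon>) *\<^sub>R (\<integral>s. cis (\<tau> / \<epsilon> * s) * of_real (exp (- s\<^sup>2 / 2)) \<partial>lborel)"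
    using assms by simp
  also have "\<dots> = of_real (sqrt (2*pi) / \<epsilon> * exp (- (\<tau> / \<epsilon>)\<^sup>2 / 2))"
    unfolding c by (simp add: scaleR_conv_of_real)
  finally show ?thesis .
qed

lemma integral_cis_period:
  "(\<integral>x. indicator {0..<2*pi} x *\<^sub>R cis (of_int n * x) \<partial>lborel) = (if n = 0 then of_real (2*pi) else 0)"
proof -
  have "(\<integral>x. indicator {0..<2*pi} x *\<^sub>R cis (of_int n * x) \<partial>lborel) = (\<integral>x. indicator {0..2*pi} x *\<^sub>R cis (of_int n * x) \<partial>lborel)"
  proof (rule integral_cong_AE)
    show "AE x in lborel. indicator {0..<2*pi} x *\<^sub>R cis (of_int n * x) = indicator {0..2*pi} x *\<^sub>R cis (of_int n * x)"
      using AE_lborel_singleton[of "2*pi"] by eventually_elim (auto simp: indicator_def)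
  qed (auto simp: cis_conv_exp)
  also have "\<dots> = (if n = 0 then of_real (2*pi) else 0)"
  proof (cases "n = 0")
    case True
    then show ?thesis by (simp add: scaleR_conv_of_real)
  next
    case False
    have "(\<integral>x. indicator {0..2*pi} x *\<^sub>R cis (of_int n * x) \<partial>lborel)
      = 1 / (\<i> * of_int n) * cis (of_int n * (2*pi)) - 1 / (\<i> * of_int n) * cis (of_int n * 0)"
    proof (rule integral_FTC_Icc)
      have "((\<lambda>x. 1 / (\<i> * of_int n) * ez (n, 0) (x, 0)) has_vector_derivative 1 / (\<i> * of_int n) * (\<i> * of_int n * ez (n, 0) (x, 0))) (at x)" for x
        using ez_deriv_x[of "(n, 0)" 0 x] by (intro has_vector_derivative_mult_right) simp
      then show "((\<lambda>x. 1 / (\<i> * of_int n) * cis (of_int n * x)) has_vector_derivative cis (of_int n * x)) (at x within {0..2*pi})" for x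
        using False by (auto simp: ez_def intro: has_vector_derivative_at_within)
    qed (auto intro!: continuous_on_cis continuous_intros)
    also have "cis (of_int n * (2*pi)) = 1" using cis_multiple_2pi[of "of_int n"] by (simp add: mult.commute)
    finally show ?thesis using False by simp
  qed
  finally show ?thesis .
qed

lemma gauss_decay: "\<epsilon> > 0 \<Longrightarrow> exp (- (\<epsilon> * y)\<^sup>2 / 2) \<le> 2 / \<epsilon>\<^sup>2 * inverse (1 + y\<^sup>2) + inverse (1 + y\<^sup>2)" for y \<epsilon> :: real
proof -
  assume e: "\<epsilon> > 0"
  have "1 + (\<epsilon> * y)\<^sup>2 / 2 \<le> exp ((\<epsilon> * y)\<^sup>2 / 2)" by (rule exp_ge_add_one_self)
  then have "1 / exp ((\<epsilon> * y)\<^sup>2 / 2) \<le> 1 / (1 + (\<epsilon> * y)\<^sup>2 / 2)"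
    by (intro divide_left_mono mult_pos_pos) (auto intro: add_pos_nonneg)
  also have "\<dots> \<le> (2 / \<epsilon>\<^sup>2 + 1) / (1 + y\<^sup>2)"
  proof -
    have "1 + y\<^sup>2 \<le> (2 / \<epsilon>\<^sup>2 + 1) * (1 + (\<epsilon> * y)\<^sup>2 / 2)"
    proof -
      have "(2 / \<epsilon>\<^sup>2 + 1) * (1 + (\<epsilon> * y)\<^sup>2 / 2) = 2 / \<epsilon>\<^sup>2 + y\<^sup>2 + 1 + (\<epsilon> * y)\<^sup>2 / 2"
        using e by (simp add: power_mult_distrib field_simps)
      also have "\<dots> \<ge> 1 + y\<^sup>2" using e by simp
      finally show ?thesis .
    qed
    moreover have "0 < 1 + y\<^sup>2" "0 < 1 + (\<epsilon> * y)\<^sup>2 / 2" by (auto intro: add_pos_nonneg)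
    ultimately show ?thesis by (simp add: divide_le_eq pos_le_divide_eq mult.commute)
  qed
  finally show ?thesis by (simp add: exp_minus inverse_eq_divide add_divide_distrib)
qed

lemma gauss_integrable_OmM: "\<epsilon> > 0 \<Longrightarrow> integrable OmM (\<lambda>p. cnj (ez z p) * of_real (exp (- (\<epsilon> * snd p)\<^sup>2 / 2)))"
proof -
  assume e: "\<epsilon> > 0"
  have "integrable OmM (\<lambda>p. 2 / \<epsilon>\<^sup>2 * inverse (1 + (snd p)\<^sup>2) + inverse (1 + (snd p)\<^sup>2))"
    by (intro Bochner_Integration.integrable_add integrable_mult_right integrable_OmM_weight)
  then show ?thesis
  proof (rule Bochner_Integration.integrable_bound)
    show "(\<lambda>p. cnj (ez z p) * of_real (exp (- (\<epsilon> * snd p)\<^sup>2 / 2))) \<in> borel_measurable OmM"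
      unfolding ez_def by (intro measurable_OmM borel_measurable_continuous_onI continuous_intros continuous_on_cis) auto
    show "AE p in OmM. norm (cnj (ez z p) * of_real (exp (- (\<epsilon> * snd p)\<^sup>2 / 2))) \<le> norm (2 / \<epsilon>\<^sup>2 * inverse (1 + (snd p)\<^sup>2) + inverse (1 + (snd p)\<^sup>2))"
    proof (rule AE_I2)
      fix p :: "real \<times> real"
      show "norm (cnj (ez z p) * of_real (exp (- (\<epsilon> * snd p)\<^sup>2 / 2))) \<le> norm (2 / \<epsilon>\<^sup>2 * inverse (1 + (snd p)\<^sup>2) + inverse (1 + (snd p)\<^sup>2))"
        using gauss_decay[OF e, of "snd p"] by (simp add: norm_mult)
    qed
  qed
qed

text \<open>In x the exponentials are orthogonal over a period. In y they are not integrable; the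
  Gaussian factor replaces the delta function in \<xi> by an approximate identity of width
  \<epsilon>.\<close>

lemma gauss_kernel:
  assumes e: "\<epsilon> > 0"
  shows "(\<integral>p. cnj (ez z' p) * of_real (exp (- (\<epsilon> * snd p)\<^sup>2 / 2)) * ez z p \<partial>OmM) =
    (if fst z = fst z' then of_real (2*pi) else 0) * of_real (sqrt (2*pi) / \<epsilon> * exp (- ((snd z - snd z') / \<epsilon>)\<^sup>2 / 2))"
proof -
  let ?f = "\<lambda>p. cnj (ez z' p) * of_real (exp (- (\<epsilon> * snd p)\<^sup>2 / 2)) * ez z p"
  have i: "integrable OmM ?f"
  proof (rule Bochner_Integration.integrable_bound[OF gauss_integrable_OmM[OF e, of z']])
    show "?f \<in> borel_measurable OmM"
      unfolding ez_def by (intro measurable_OmM borel_measurable_continuous_onI continuous_intros continuous_on_cis) auto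
  qed (simp add: norm_mult)
  have fe: "indicator Om (x, y) *\<^sub>R ?f (x, y) = (indicator {0..<2*pi} x *\<^sub>R cis (of_int (fst z - fst z') * x)) *
      (cis ((snd z - snd z') * y) * of_real (exp (- (\<epsilon> * y)\<^sup>2 / 2)))" for x y
    unfolding indicator_Om cnj_ez unfolding ez_def by (simp add: cis_mult algebra_simps)
  have "(\<integral>p. ?f p \<partial>OmM) = (\<integral>x. \<integral>y. indicator Om (x, y) *\<^sub>R ?f (x, y) \<partial>lborel \<partial>lborel)"
  proof -
    have "integrable (lborel \<Otimes>\<^sub>M lborel) (\<lambda>p. indicator Om p *\<^sub>R ?f p)"
      using i unfolding integrable_OmM lborel_prod .
    then show ?thesis unfolding integral_OmM
      by (subst lborel_pair.integral_fst) (simp_all add: lborel_prod split_beta')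
  qed
  also have "\<dots> = (\<integral>x. indicator {0..<2*pi} x *\<^sub>R cis (of_int (fst z - fst z') * x) \<partial>lborel) *
      (\<integral>y. cis ((snd z - snd z') * y) * of_real (exp (- (\<epsilon> * y)\<^sup>2 / 2)) \<partial>lborel)"
    unfolding fe Bochner_Integration.integral_mult_right_zero Bochner_Integration.integral_mult_left_zero ..
  finally show ?thesis unfolding integral_cis_period integral_gauss_cis[OF e] by simp
qed

lemma integral_FM_single:
  fixes f :: "int \<times> real \<Rightarrow> complex"
  assumes "integrable FM f" "\<And>k \<xi>. k \<noteq> k' \<Longrightarrow> f (k, \<xi>) = 0"
  shows "(\<integral>z. f z \<partial>FM) = (\<integral>\<xi>. f (k', \<xi>) \<partial>lborel)"
proof -
  let ?F = "\<lambda>k. \<integral>\<xi>. f (k, \<xi>) \<partial>lborel"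
  have z: "?F k = 0" if "k \<noteq> k'" for k using assms(2)[OF that] by simp
  have "(\<integral>k. ?F k \<partial>count_space UNIV) = (\<integral>k. (if k = k' then ?F k' else 0) \<partial>count_space UNIV)"
    using z by (intro Bochner_Integration.integral_cong) auto
  also have "\<dots> = (\<Sum>a | a \<in> UNIV \<and> (if a = k' then ?F k' else 0) \<noteq> 0. (if a = k' then ?F k' else 0))"
    by (rule lebesgue_integral_count_space_finite_support) (rule finite_subset[of _ "{k'}"], auto)
  also have "\<dots> = (\<Sum>a\<in>{k'}. (if a = k' then ?F k' else 0))"
    by (rule sum.mono_neutral_left) auto
  finally show ?thesis by (simp add: integral_FM[OF assms(1)])
qed

text \<open>By Fubini the pairing integrates g against \<open>gauss_kernel\<close>. Only the wave
  number of \<open>z'\<close> survives, and \<xi> = snd z' + \<epsilon> s turns the kernel into the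
  standard normal density, the factors 2\<pi> cancelling the normalisation of
  \<open>IF\<close>.\<close>

lemma IF_gauss_pairing:
  assumes g: "sg g" and e: "\<epsilon> > 0"
  shows "(\<integral>p. (cnj (ez z' p) * of_real (exp (- (\<epsilon> * snd p)\<^sup>2 / 2))) * IF g p \<partial>OmM)
    = (\<integral>s. std_normal_density s *\<^sub>R g (fst z') (snd z' + \<epsilon> * s) \<partial>lborel)"
proof -
  let ?a = "\<lambda>p. cnj (ez z' p) * of_real (exp (- (\<epsilon> * snd p)\<^sup>2 / 2))"
  let ?g = "\<lambda>z. g (fst z) (snd z)"
  let ?c = "complex_of_real (2*pi)"
  let ?G = "\<lambda>\<xi>. of_real (sqrt (2*pi) / \<epsilon> * exp (- ((\<xi> - snd z') / \<epsilon>)\<^sup>2 / 2)) :: complex"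
  let ?J = "\<lambda>z. (if fst z = fst z' then ?c else 0) * ?G (snd z)"
  have "(\<integral>p. ?a p * IF g p \<partial>OmM) = (\<integral>p. 1 / (2*pi)\<^sup>2 * (?a p * (\<integral>z. ?g z * ez z p \<partial>FM)) \<partial>OmM)"
    by (intro Bochner_Integration.integral_cong refl) (simp add: IF_def)
  also have "\<dots> = 1 / (2*pi)\<^sup>2 * (\<integral>p. ?a p * (\<integral>z. ?g z * ez z p \<partial>FM) \<partial>OmM)"
    by (rule Bochner_Integration.integral_mult_right_zero)
  also have "(\<integral>p. ?a p * (\<integral>z. ?g z * ez z p \<partial>FM) \<partial>OmM) = (\<integral>z. ?g z * (\<integral>p. ?a p * ez z p \<partial>OmM) \<partial>FM)"
    by (rule fubini_OmM_FM[OF gauss_integrable_OmM[OF e] sg_integrable(2)[OF g] ez_joint_measurable]) simp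
  also have "\<dots> = (\<integral>z. ?g z * ?J z \<partial>FM)" unfolding gauss_kernel[OF e] ..
  also have "\<dots> = (\<integral>\<xi>. ?g (fst z', \<xi>) * ?J (fst z', \<xi>) \<partial>lborel)"
  proof (rule integral_FM_single)
    obtain B where B: "B \<ge> 0" "\<forall>k \<xi>. norm (g k \<xi>) \<le> B / wt k \<xi> ^ 4" using sg_bound4[OF g] by blast
    define D where "D = 2 * pi * (sqrt (2*pi) / \<epsilon>)"
    have D: "norm (?J z) \<le> D" for z
    proof -
      have "norm (?G \<xi>) \<le> sqrt (2*pi) / \<epsilon> * 1" for \<xi>
        unfolding norm_of_real abs_mult using e by (intro mult_mono) auto
      then have "norm (if fst z = fst z' then ?c else 0) * norm (?G (snd z)) \<le> (2*pi) * (sqrt (2*pi) / \<epsilon>)"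
        using e by (intro mult_mono) auto
      then show ?thesis by (simp only: norm_mult D_def)
    qed
    show "integrable FM (\<lambda>z. ?g z * ?J z)"
    proof (rule integrable_wt4_bound[where B = "B * D"])
      have "?J \<in> borel_measurable FM" by (rule measurable_FM) simp
      then show "(\<lambda>z. ?g z * ?J z) \<in> borel_measurable FM" by (rule borel_measurable_times[OF sg_measurable[OF g]])
      show "norm (?g z * ?J z) \<le> B * D / wt (fst z) (snd z) ^ 4" for z
      proof -
        have "norm (?g z) * norm (?J z) \<le> (B / wt (fst z) (snd z) ^ 4) * D"
          using B D[of z] wt_pos[of "fst z" "snd z"] by (intro mult_mono) auto
        then show ?thesis by (simp only: norm_mult times_divide_eq_left)
      qed
    qed
  qed auto
  also have "\<dots> = (\<integral>\<xi>. ?c * (g (fst z') \<xi> * ?G \<xi>) \<partial>lborel)"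
    by (intro Bochner_Integration.integral_cong refl) simp
  also have "\<dots> = ?c * (\<integral>\<xi>. g (fst z') \<xi> * ?G \<xi> \<partial>lborel)" by (rule Bochner_Integration.integral_mult_right_zero)
  also have "(\<integral>\<xi>. g (fst z') \<xi> * ?G \<xi> \<partial>lborel) = \<bar>\<epsilon>\<bar> *\<^sub>R (\<integral>s. g (fst z') (snd z' + \<epsilon> * s) * ?G (snd z' + \<epsilon> * s) \<partial>lborel)"
    by (rule lborel_integral_real_affine) (use e in simp)
  also have "\<dots> = (\<integral>s. (2*pi) *\<^sub>R (std_normal_density s *\<^sub>R g (fst z') (snd z' + \<epsilon> * s)) \<partial>lborel)"
  proof (subst Bochner_Integration.integral_scaleR_right[symmetric], rule Bochner_Integration.integral_cong[OF refl])
    fix s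
    have "\<bar>\<epsilon>\<bar> * (sqrt (2*pi) / \<epsilon> * exp (- ((snd z' + \<epsilon> * s - snd z') / \<epsilon>)\<^sup>2 / 2)) = (2*pi) * std_normal_density s"
      using e by (simp add: std_normal_density_def field_simps)
    then have "complex_of_real \<bar>\<epsilon>\<bar> * ?G (snd z' + \<epsilon> * s) = of_real ((2*pi) * std_normal_density s)"
      by (simp only: of_real_mult[symmetric])
    then have "complex_of_real \<bar>\<epsilon>\<bar> * (g (fst z') (snd z' + \<epsilon> * s) * ?G (snd z' + \<epsilon> * s))
        = g (fst z') (snd z' + \<epsilon> * s) * of_real ((2*pi) * std_normal_density s)"
      by (subst mult.left_commute) (simp only:)
    also have "\<dots> = of_real (2*pi) * (of_real (std_normal_density s) * g (fst z') (snd z' + \<epsilon> * s))"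
      by (simp only: of_real_mult mult_ac)
    finally show "\<bar>\<epsilon>\<bar> *\<^sub>R (g (fst z') (snd z' + \<epsilon> * s) * ?G (snd z' + \<epsilon> * s)) = (2*pi) *\<^sub>R (std_normal_density s *\<^sub>R g (fst z') (snd z' + \<epsilon> * s))"
      by (simp only: scaleR_conv_of_real)
  qed
  also have "\<dots> = ?c * (\<integral>s. std_normal_density s *\<^sub>R g (fst z') (snd z' + \<epsilon> * s) \<partial>lborel)"
    by (simp add: scaleR_conv_of_real)
  finally show ?thesis by (simp add: power2_eq_square)
qed

text \<open>The regularised pairing with \<epsilon> = 1/(n + 1) has two limits by dominated
  convergence: the transform of \<open>IF g\<close> on the physical side and g itself on the
  frequency side.\<close>

theorem fourier_IF:
  assumes g: "sg g" shows "fourier (IF g) = g"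
proof (intro ext)
  fix k :: int and \<xi> :: real
  let ?z = "(k, \<xi>)"
  let ?e = "\<lambda>n::nat. inverse (real (Suc n))"
  let ?I = "\<lambda>n. \<integral>p. (cnj (ez ?z p) * of_real (exp (- (?e n * snd p)\<^sup>2 / 2))) * IF g p \<partial>OmM"
  have sIF: "schwartz (IF g)" by (rule schwartz_IF[OF g])
  have e0: "?e \<longlonglongrightarrow> 0" by (rule LIMSEQ_inverse_real_of_nat)
  have A: "?I \<longlonglongrightarrow> (\<integral>p. cnj (ez ?z p) * IF g p \<partial>OmM)"
  proof (rule integral_dominated_convergence[where w = "\<lambda>p. norm (IF g p)"])
    show "(\<lambda>p. cnj (ez ?z p) * IF g p) \<in> borel_measurable OmM"
      unfolding ez_def by (intro measurable_OmM borel_measurable_continuous_onI continuous_intros continuous_on_cis schwartz_continuous sIF)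
    show "(\<lambda>p. (cnj (ez ?z p) * of_real (exp (- (?e n * snd p)\<^sup>2 / 2))) * IF g p) \<in> borel_measurable OmM" for n
      unfolding ez_def by (intro measurable_OmM borel_measurable_continuous_onI continuous_intros continuous_on_cis schwartz_continuous sIF) auto
    show "integrable OmM (\<lambda>p. norm (IF g p))" using schwartz_integrable[OF sIF, of "\<lambda>_. 1" 1] by (intro integrable_norm) simp
    show "AE p in OmM. (\<lambda>n. (cnj (ez ?z p) * of_real (exp (- (?e n * snd p)\<^sup>2 / 2))) * IF g p) \<longlonglongrightarrow> cnj (ez ?z p) * IF g p"
    proof (intro AE_I2)
      fix p :: "real \<times> real"
      have "(\<lambda>n. (cnj (ez ?z p) * of_real (exp (- (?e n * snd p)\<^sup>2 / 2))) * IF g p) \<longlonglongrightarrow> (cnj (ez ?z p) * of_real (exp (- (0 * snd p)\<^sup>2 / 2))) * IF g p"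
        by (intro tendsto_intros e0) auto
      then show "(\<lambda>n. (cnj (ez ?z p) * of_real (exp (- (?e n * snd p)\<^sup>2 / 2))) * IF g p) \<longlonglongrightarrow> cnj (ez ?z p) * IF g p" by simp
    qed
    show "AE p in OmM. norm ((cnj (ez ?z p) * of_real (exp (- (?e n * snd p)\<^sup>2 / 2))) * IF g p) \<le> norm (IF g p)" for n
      by (intro AE_I2) (simp add: norm_mult mult_left_le_one_le)
  qed
  have A': "(\<integral>p. cnj (ez ?z p) * IF g p \<partial>OmM) = fourier (IF g) k \<xi>"
    by (simp add: fourier_ez cnj_ez mult.commute)
  have B: "?I \<longlonglongrightarrow> (\<integral>s. std_normal_density s *\<^sub>R g k \<xi> \<partial>lborel)"
  proof -
    have Ie: "?I = (\<lambda>n. \<integral>s. std_normal_density s *\<^sub>R g k (\<xi> + ?e n * s) \<partial>lborel)"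
      using IF_gauss_pairing[OF g, of "?e _" ?z] by simp
    obtain B where B: "B \<ge> 0" "\<forall>k \<xi>. norm (g k \<xi>) \<le> B / wt k \<xi> ^ 4" using sg_bound4[OF g] by blast
    have gB: "norm (g k x) \<le> B" for k x
    proof -
      have "B / wt k x ^ 4 \<le> B / 1" using B(1) wt_ge1[of k x] by (intro divide_left_mono) (auto intro: one_le_power)
      then show ?thesis using B(2)[rule_format, of k x] by simp
    qed
    have gm: "g k \<in> borel_measurable borel" by (intro borel_measurable_continuous_onI sg_continuous g)
    show ?thesis unfolding Ie
    proof (rule integral_dominated_convergence[where w = "\<lambda>s. B * std_normal_density s"])
      show "(\<lambda>s. std_normal_density s *\<^sub>R g k \<xi>) \<in> borel_measurable lborel" by simp
      show "(\<lambda>s. std_normal_density s *\<^sub>R g k (\<xi> + ?e n * s)) \<in> borel_measurable lborel" for n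
        using gm by measurable
      show "integrable lborel (\<lambda>s. B * std_normal_density s)" by simp
      show "AE s in lborel. (\<lambda>n. std_normal_density s *\<^sub>R g k (\<xi> + ?e n * s)) \<longlonglongrightarrow> std_normal_density s *\<^sub>R g k \<xi>"
      proof (intro AE_I2)
        fix s :: real
        have "(\<lambda>n. \<xi> + ?e n * s) \<longlonglongrightarrow> \<xi> + 0 * s" by (intro tendsto_intros e0)
        then have "(\<lambda>n. g k (\<xi> + ?e n * s)) \<longlonglongrightarrow> g k (\<xi> + 0 * s)"
          by (rule continuous_on_tendsto_compose[OF sg_continuous[OF g]]) auto
        then show "(\<lambda>n. std_normal_density s *\<^sub>R g k (\<xi> + ?e n * s)) \<longlonglongrightarrow> std_normal_density s *\<^sub>R g k \<xi>"
          by (intro tendsto_intros) simp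
      qed
      show "AE s in lborel. norm (std_normal_density s *\<^sub>R g k (\<xi> + ?e n * s)) \<le> B * std_normal_density s" for n
      proof (intro AE_I2)
        fix s :: real
        have "std_normal_density s * norm (g k (\<xi> + ?e n * s)) \<le> std_normal_density s * B"
          using gB by (intro mult_left_mono) (auto simp: normal_density_nonneg)
        then show "norm (std_normal_density s *\<^sub>R g k (\<xi> + ?e n * s)) \<le> B * std_normal_density s"
          by (simp only: norm_scaleR abs_of_nonneg[OF normal_density_nonneg] mult.commute[of B])
      qed
    qed
  qed
  have B': "(\<integral>s. std_normal_density s *\<^sub>R g k \<xi> \<partial>lborel) = g k \<xi>"
    by simp
  show "fourier (IF g) k \<xi> = g k \<xi>"
    using LIMSEQ_unique[OF A B] unfolding A' B' .
qed

lemma l2_schwartz: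
  assumes "schwartz \<phi>" shows "l2 OmM \<phi>"
proof -
  obtain B where B: "B \<ge> 0" "\<forall>p. norm (\<phi> p) \<le> B * inverse (1 + (snd p)\<^sup>2)" using schwartz_bound2[OF assms] by blast
  have b: "norm (cnj (\<phi> p)) \<le> B" for p
  proof -
    have "inverse (1 + (snd p)\<^sup>2) \<le> 1" by (simp add: inverse_le_1_iff)
    then have "B * inverse (1 + (snd p)\<^sup>2) \<le> B * 1" using B(1) by (intro mult_left_mono)
    then show ?thesis using B(2)[rule_format, of p] by simp
  qed
  have "integrable OmM (\<lambda>p. \<phi> p * cnj (\<phi> p))"
    by (rule schwartz_integrable[OF assms _ b]) (intro borel_measurable_continuous_onI continuous_intros schwartz_continuous assms)
  then have "integrable OmM (\<lambda>p. norm (\<phi> p * cnj (\<phi> p)))" by (rule integrable_norm)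
  then show ?thesis using measurable_OmM[OF schwartz_measurable[OF assms]]
    by (simp add: l2_def norm_mult power2_eq_square)
qed

lemma l2_sg:
  assumes "sg g" shows "l2 FM (\<lambda>z. g (fst z) (snd z))"
proof -
  obtain B where B: "B \<ge> 0" "\<forall>k \<xi>. norm (g k \<xi>) \<le> B / wt k \<xi> ^ 4" using sg_bound4[OF assms] by blast
  have "norm (g k \<xi> * cnj (g k \<xi>)) \<le> (B * B) / wt k \<xi> ^ 4" for k \<xi>
  proof -
    have "B / wt k \<xi> ^ 4 \<le> B / 1" using B(1) wt_ge1[of k \<xi>] by (intro divide_left_mono) (auto intro: one_le_power)
    then have "norm (g k \<xi>) \<le> B" using B(2)[rule_format, of k \<xi>] by simp
    then have "norm (g k \<xi>) * norm (g k \<xi>) \<le> B * (B / wt k \<xi> ^ 4)"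
      using B(1) B(2)[rule_format, of k \<xi>] by (intro mult_mono) auto
    then show ?thesis by (simp add: norm_mult)
  qed
  then have "integrable FM (\<lambda>z. g (fst z) (snd z) * cnj (g (fst z) (snd z)))"
    using sg_measurable[OF assms] borel_measurable_continuous_on[OF continuous_on_cnj[OF continuous_on_id] sg_measurable[OF assms]]
    by (intro integrable_wt4_bound[where B = "B * B"] borel_measurable_times) auto
  then have "integrable FM (\<lambda>z. norm (g (fst z) (snd z) * cnj (g (fst z) (snd z))))" by (rule integrable_norm)
  then show ?thesis using sg_measurable[OF assms] by (simp add: l2_def norm_mult power2_eq_square)
qed

lemma nrm2_sq_complex: "of_real ((nrm2 M f)\<^sup>2) = (\<integral>x. f x * cnj (f x) \<partial>M)"
proof -
  have "(\<integral>x. f x * cnj (f x) \<partial>M) = (\<integral>x. complex_of_real ((norm (f x))\<^sup>2) \<partial>M)"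
    by (intro Bochner_Integration.integral_cong refl) (simp only: complex_norm_square)
  then show ?thesis unfolding nrm2_sq by (simp only: integral_complex_of_real)
qed

lemma plancherel_IF:
  assumes g: "sg g" shows "nrm2 OmM (IF g) = nrm2 FM (\<lambda>z. g (fst z) (snd z)) / (2*pi)"
proof -
  have "complex_of_real ((nrm2 OmM (IF g))\<^sup>2) = of_real ((nrm2 FM (\<lambda>z. g (fst z) (snd z)))\<^sup>2 / (2*pi)\<^sup>2)"
    unfolding nrm2_sq_complex pairing_cnj_IF[OF schwartz_IF[OF g] g] fourier_IF[OF g] of_real_divide
    by (simp add: mult.commute)
  then have "(nrm2 OmM (IF g))\<^sup>2 = (nrm2 FM (\<lambda>z. g (fst z) (snd z)) / (2*pi))\<^sup>2"
    by (simp only: of_real_eq_iff power_divide)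
  then show ?thesis by (rule power2_eq_imp_eq) auto
qed

text \<open>Pairing \<phi> with the conjugate of \<open>IF (fourier \<phi>)\<close> reproduces the
  squared norm n^2 of the transform over (2\<pi>)^2, while Cauchy-Schwarz and
  \<open>plancherel_IF\<close> bound it by |\<phi>| n / (2\<pi>); one factor n is then
  cancelled.\<close>

lemma bessel_fourier:
  assumes \<phi>: "schwartz \<phi>" shows "nrm2 FM (\<lambda>z. fourier \<phi> (fst z) (snd z)) \<le> 2*pi * nrm2 OmM \<phi>"
proof -
  let ?n = "nrm2 FM (\<lambda>z. fourier \<phi> (fst z) (snd z))"
  note sf = sg_fourier[OF \<phi>]
  have "(\<integral>p. \<phi> p * cnj (IF (fourier \<phi>) p) \<partial>OmM) = of_real (?n\<^sup>2 / (2*pi)\<^sup>2)"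
    unfolding pairing_cnj_IF[OF \<phi> sf] of_real_divide nrm2_sq_complex by (simp add: mult.commute)
  then have "norm (\<integral>p. \<phi> p * cnj (IF (fourier \<phi>) p) \<partial>OmM) = \<bar>?n\<^sup>2 / (2*pi)\<^sup>2\<bar>"
    by (simp only: norm_of_real)
  then have "?n\<^sup>2 / (2*pi)\<^sup>2 = norm (\<integral>p. \<phi> p * cnj (IF (fourier \<phi>) p) \<partial>OmM)" by (simp only: abs_of_nonneg zero_le_divide_iff zero_le_power2 simp_thms)
  also have "\<dots> \<le> nrm2 OmM \<phi> * nrm2 OmM (\<lambda>p. cnj (IF (fourier \<phi>) p))"
    by (intro l2_cauchy_schwarz l2_cnj l2_schwartz \<phi> schwartz_IF sf)
  also have "nrm2 OmM (\<lambda>p. cnj (IF (fourier \<phi>) p)) = ?n / (2*pi)"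
    using plancherel_IF[OF sf] by (simp add: nrm2_def)
  finally have "?n * ?n \<le> (2*pi * nrm2 OmM \<phi>) * ?n"
    by (simp add: power2_eq_square field_simps)
  then show ?thesis
    by (cases "?n = 0") (auto simp: mult_le_cancel_right order_less_le)
qed

text \<open>\<open>mult_fun\<close> uses an unconditional sum over k. Integrability on the product
  space makes the inner integrals absolutely summable, and the sum agrees with the integral against
  counting measure.\<close>

lemma mult_fun_IF:
  assumes "sg (\<lambda>k \<xi>. of_real (m k \<xi>) * fourier \<phi> k \<xi>)"
  shows "mult_fun m \<phi> = IF (\<lambda>k \<xi>. of_real (m k \<xi>) * fourier \<phi> k \<xi>)"
proof
  fix p :: "real \<times> real"
  obtain x y where p: "p = (x, y)" by (cases p)
  let ?f = "\<lambda>z. of_real (m (fst z) (snd z)) * fourier \<phi> (fst z) (snd z) * ez z p"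
  have i: "integrable FM ?f" by (rule sg_integrable(1)[OF assms])
  have "integrable (count_space UNIV) (\<lambda>k. \<integral>\<xi>. ?f (k, \<xi>) \<partial>lborel)"
    using i unfolding FM_def by (rule FM.integrable_fst')
  then have abs: "Infinite_Set_Sum.abs_summable_on (\<lambda>k. \<integral>\<xi>. ?f (k, \<xi>) \<partial>lborel) UNIV"
    by (simp add: Infinite_Set_Sum.abs_summable_on_def)
  have "(\<Sum>\<^sub>\<infinity>k. \<integral>\<xi>. ?f (k, \<xi>) \<partial>lborel) = (\<integral>k. \<integral>\<xi>. ?f (k, \<xi>) \<partial>lborel \<partial>count_space UNIV)"
    unfolding infsetsum_infsum[OF abs, symmetric] infsetsum_def ..
  then show "mult_fun m \<phi> p = IF (\<lambda>k \<xi>. of_real (m k \<xi>) * fourier \<phi> k \<xi>) p"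
    unfolding IF_def integral_FM[OF i] by (simp add: mult_fun_def p ez_def)
qed

section \<open>The L2 norm of a distribution as a dual norm\<close>

lemma esqrt_nn_integral:
  assumes "l2 M f" shows "esqrt (\<integral>\<^sup>+x. ennreal ((norm (f x))\<^sup>2) \<partial>M) = ennreal (nrm2 M f)"
  unfolding l2_nn_integral[OF assms] esqrt_def by simp

text \<open>A finite infimum means that a representing function exists. Cauchy-Schwarz holds for
  each of them, so |u \<phi>| / |\<phi>| is below every competitor and hence below the infimum; test
  functions of norm 0 are treated apart.\<close>

lemma L2_norm_bound:
  assumes \<phi>: "schwartz \<phi>" and K: "L2_norm u \<le> ennreal K" "K \<ge> 0"
  shows "norm (u \<phi>) \<le> K * nrm2 OmM \<phi>"
proof -
  have key: "norm (u \<phi>) \<le> nrm2 OmM f * nrm2 OmM \<phi>" "esqrt (\<integral>\<^sup>+p\<in>Om. ennreal ((norm (f p))\<^sup>2) \<partial>lborel) = ennreal (nrm2 OmM f)"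
    if f: "L2_fun f" "represents f u" for f
  proof -
    have l: "l2 OmM f" using f(1) unfolding L2_fun_def nn_integral_Om l2_iff_nn_integral
      by (auto intro: measurable_OmM)
    have "u \<phi> = (\<integral>p. f p * \<phi> p \<partial>OmM)" using f(2) \<phi> unfolding represents_def integral_Om by blast
    then show "norm (u \<phi>) \<le> nrm2 OmM f * nrm2 OmM \<phi>" using l2_cauchy_schwarz[OF l l2_schwartz[OF \<phi>]] by simp
    show "esqrt (\<integral>\<^sup>+p\<in>Om. ennreal ((norm (f p))\<^sup>2) \<partial>lborel) = ennreal (nrm2 OmM f)"
      unfolding nn_integral_Om by (rule esqrt_nn_integral[OF l])
  qed
  have ne: "{f. L2_fun f \<and> represents f u} \<noteq> {}"
  proof
    assume e: "{f. L2_fun f \<and> represents f u} = {}"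
    have "L2_norm u = top" unfolding L2_norm_def e by simp
    then show False using K by (simp add: top_unique)
  qed
  show ?thesis
  proof (cases "nrm2 OmM \<phi> = 0")
    case True
    then show ?thesis using key ne by fastforce
  next
    case False
    then have n0: "nrm2 OmM \<phi> > 0" by (simp add: order_less_le)
    have "ennreal (norm (u \<phi>) / nrm2 OmM \<phi>) \<le> L2_norm u"
      unfolding L2_norm_def
    proof (rule INF_greatest)
      fix f assume "f \<in> {f. L2_fun f \<and> represents f u}"
      then have f: "L2_fun f" "represents f u" by auto
      show "ennreal (norm (u \<phi>) / nrm2 OmM \<phi>) \<le> esqrt (\<integral>\<^sup>+p\<in>Om. ennreal ((norm (f p))\<^sup>2) \<partial>lborel)"
        unfolding key(2)[OF f] using key(1)[OF f] n0 by (intro ennreal_leI) (simp add: divide_le_eq)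
    qed
    also note K(1)
    finally have "norm (u \<phi>) / nrm2 OmM \<phi> \<le> K" using K(2) by simp
    then show ?thesis using n0 by (simp add: divide_le_eq)
  qed
qed

text \<open>The converse of \<open>L2_norm_bound\<close>, by Riesz representation over the Schwartz
  functions. With both, an estimate of the norm is the same as an estimate of all pairings.\<close>

lemma L2_norm_le:
  assumes lin: "linear_dist u" and K: "K \<ge> 0" and bd: "\<And>\<phi>. schwartz \<phi> \<Longrightarrow> norm (u \<phi>) \<le> K * nrm2 OmM \<phi>"
  shows "L2_norm u \<le> ennreal K"
proof -
  have "\<exists>f. l2 OmM f \<and> nrm2 OmM f \<le> K \<and> (\<forall>\<phi>\<in>Collect schwartz. u \<phi> = (\<integral>p. f p * \<phi> p \<partial>OmM))"
  proof (rule l2_riesz)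
    show "Collect schwartz \<noteq> {}" using schwartz_IF[OF sg_zero] by blast
  qed (use lin K bd in \<open>auto intro: schwartz_lincomb l2_schwartz simp: linear_dist_def\<close>)
  then obtain f where f: "l2 OmM f" "nrm2 OmM f \<le> K" "\<And>\<phi>. schwartz \<phi> \<Longrightarrow> u \<phi> = (\<integral>p. f p * \<phi> p \<partial>OmM)" by auto
  \<comment> \<open>The density is measurable only for the restricted measure; extension by zero
    makes it Borel on the plane, as \<open>L2_fun\<close> demands.\<close>
  let ?f = "\<lambda>p. indicator Om p *\<^sub>R f p"
  have fm: "?f \<in> borel_measurable lborel"
    using f(1) unfolding l2_def OmM_def by (subst (asm) borel_measurable_restrict_space_iff) auto
  have eq: "(\<integral>\<^sup>+p\<in>Om. ennreal ((norm (?f p))\<^sup>2) \<partial>lborel) = (\<integral>\<^sup>+p. ennreal ((norm (f p))\<^sup>2) \<partial>OmM)"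
    unfolding nn_integral_Om[symmetric] by (intro nn_integral_cong) (simp split: split_indicator)
  have "L2_fun ?f" unfolding L2_fun_def eq using fm f(1) by (simp add: l2_iff_nn_integral)
  moreover have "represents ?f u"
    unfolding represents_def
  proof (intro allI impI)
    fix \<phi> assume "schwartz \<phi>"
    then have "u \<phi> = (\<integral>p\<in>Om. f p * \<phi> p \<partial>lborel)" unfolding integral_Om by (rule f(3))
    also have "\<dots> = (\<integral>p\<in>Om. ?f p * \<phi> p \<partial>lborel)"
      unfolding set_lebesgue_integral_def by (intro Bochner_Integration.integral_cong refl) (simp split: split_indicator)
    finally show "u \<phi> = (\<integral>p\<in>Om. ?f p * \<phi> p \<partial>lborel)" .
  qed
  ultimately have "L2_norm u \<le> esqrt (\<integral>\<^sup>+p\<in>Om. ennreal ((norm (?f p))\<^sup>2) \<partial>lborel)"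
    unfolding L2_norm_def by (intro INF_lower) simp
  also have "\<dots> = ennreal (nrm2 OmM f)" unfolding eq by (rule esqrt_nn_integral[OF f(1)])
  also have "\<dots> \<le> ennreal K" using f(2) by (rule ennreal_leI)
  finally show ?thesis .
qed

section \<open>The propagator\<close>

lemma continuous_on_if_const:
  "(c \<Longrightarrow> continuous_on S f) \<Longrightarrow> (\<not> c \<Longrightarrow> continuous_on S g) \<Longrightarrow> continuous_on S (\<lambda>x. if c then f x else g x)"
  by (cases c) simp_all

lemma linear_system_exists:
  fixes B :: "real \<Rightarrow> 3 \<Rightarrow> 3 \<Rightarrow> complex"
  assumes B: "\<And>i j. continuous_on UNIV (\<lambda>t. B t i j)"
  shows "\<exists>y. (\<forall>i. y 0 i = x0 i) \<and> (\<forall>t i. ((\<lambda>t. y t i) has_vector_derivative (\<Sum>j\<in>UNIV. B t i j * y t j)) (at t))"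
proof -
  let ?L = "\<lambda>t (x::complex^3). (\<chi> i. \<Sum>j\<in>UNIV. B t i j * x $ j) :: complex^3"
  have "\<exists>y. y 0 = (\<chi> i. x0 i) \<and> (\<forall>t. (y has_vector_derivative ?L t (y t)) (at t))"
  proof (rule linear_ode_exists)
    show "bounded_linear (?L t)" for t
      unfolding linear_conv_bounded_linear[symmetric]
      by (rule linearI) (simp_all add: vec_eq_iff algebra_simps sum.distrib scaleR_sum_right)
    show "continuous_on UNIV (\<lambda>t. ?L t (y t))" if "continuous_on UNIV y" for y
      using that B by (intro continuous_on_vec_lambda continuous_intros) auto
    show "\<exists>K. \<forall>t x. \<bar>t\<bar> \<le> r \<longrightarrow> norm (?L t x) \<le> K * norm x" for r
    proof -
      have "\<exists>b. \<forall>t. \<bar>t\<bar> \<le> r \<longrightarrow> norm (B t i j) \<le> b" for i j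
      proof -
        have "compact ((\<lambda>t. B t i j) ` {-r..r})"
          by (intro compact_continuous_image continuous_on_subset[OF B]) auto
        then obtain b where "\<forall>x\<in>(\<lambda>t. B t i j) ` {-r..r}. norm x \<le> b"
          using compact_imp_bounded bounded_iff by metis
        then show ?thesis by (intro exI[of _ b]) (auto simp: abs_le_iff)
      qed
      then obtain b where b: "\<And>i j t. \<bar>t\<bar> \<le> r \<Longrightarrow> norm (B t i j) \<le> b i j" by metis
      have "norm (?L t x) \<le> (\<Sum>i\<in>UNIV. \<Sum>j\<in>UNIV. b i j) * norm x" if t: "\<bar>t\<bar> \<le> r" for t x
      proof -
        have "norm (?L t x) \<le> (\<Sum>i\<in>UNIV. norm (?L t x $ i))"
          unfolding norm_vec_def by (rule L2_set_le_sum) simp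
        also have "\<dots> \<le> (\<Sum>i\<in>UNIV. \<Sum>j\<in>UNIV. b i j * norm x)"
        proof (rule sum_mono)
          fix i :: 3
          have "norm (\<Sum>j\<in>UNIV. B t i j * x $ j) \<le> (\<Sum>j\<in>UNIV. norm (B t i j * x $ j))" by (rule norm_sum)
          also have "\<dots> \<le> (\<Sum>j\<in>UNIV. b i j * norm x)"
          proof (rule sum_mono)
            fix j :: 3
            have "0 \<le> b i j" using b[OF t, of i j] norm_ge_zero order_trans by blast
            then show "norm (B t i j * x $ j) \<le> b i j * norm x"
              unfolding norm_mult using b[OF t, of i j] Finite_Cartesian_Product.norm_nth_le[of x j] by (intro mult_mono) auto
          qed
          finally show "norm (?L t x $ i) \<le> (\<Sum>j\<in>UNIV. b i j * norm x)" by simp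
        qed
        finally show ?thesis by (simp add: sum_distrib_right)
      qed
      then show ?thesis by blast
    qed
  qed
  then obtain y where y: "y 0 = (\<chi> i. x0 i)" "\<And>t. (y has_vector_derivative ?L t (y t)) (at t)" by blast
  have "((\<lambda>t. y t $ i) has_vector_derivative (\<Sum>j\<in>UNIV. B t i j * y t $ j)) (at t)" for t i
    using bounded_linear.has_vector_derivative[OF bounded_linear_vec_nth[of i] y(2)[of t]] by simp
  then show ?thesis using y(1) by (intro exI[of _ "\<lambda>t i. y t $ i"]) auto
qed

definition kron :: "3 \<Rightarrow> 3 \<Rightarrow> complex" where "kron i j = (if i = j then 1 else 0)"

lemma sum_kron [simp]: "(\<Sum>l\<in>UNIV. kron i l * f l) = f i" "(\<Sum>l\<in>UNIV. f l * kron l j) = f j"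
  by (simp_all add: kron_def if_distrib[of "\<lambda>x. x * _"] if_distrib[of "\<lambda>x. _ * x"] cong: if_cong)

definition QSP :: "(real \<Rightarrow> 3 \<Rightarrow> 3 \<Rightarrow> complex) \<Rightarrow> (real \<Rightarrow> 3 \<Rightarrow> 3 \<Rightarrow> complex) \<Rightarrow> (real \<Rightarrow> 3 \<Rightarrow> 3 \<Rightarrow> complex) \<Rightarrow> bool" where
  "QSP B Q S \<longleftrightarrow> (\<forall>t i j. ((\<lambda>t. Q t i j) has_vector_derivative (\<Sum>l\<in>UNIV. B t i l * Q t l j)) (at t)) \<and>
    (\<forall>t i j. ((\<lambda>t. S t i j) has_vector_derivative - (\<Sum>l\<in>UNIV. S t i l * B t l j)) (at t)) \<and>
    (\<forall>t i j. (\<Sum>l\<in>UNIV. Q t i l * S t l j) = kron i j)"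

text \<open>\<open>Q\<close> solves the equation columnwise and \<open>S\<close> the adjoint
  equation rowwise, so S Q has derivative zero and stays the identity; in finite dimension a left
  inverse is a right inverse. Constructing \<open>S\<close> from its own equation avoids
  differentiating an inverse matrix.\<close>

lemma fundamental_system:
  fixes B :: "real \<Rightarrow> 3 \<Rightarrow> 3 \<Rightarrow> complex"
  assumes B: "\<And>i j. continuous_on UNIV (\<lambda>t. B t i j)"
  shows "\<exists>Q S. QSP B Q S"
proof -
  have "\<exists>y. (\<forall>i. y 0 i = kron i j) \<and> (\<forall>t i. ((\<lambda>t. y t i) has_vector_derivative (\<Sum>l\<in>UNIV. B t i l * y t l)) (at t))" for j
    by (rule linear_system_exists[OF B])
  then obtain q where q: "\<And>j i. q j 0 i = kron i j"
    "\<And>j t i. ((\<lambda>t. q j t i) has_vector_derivative (\<Sum>l\<in>UNIV. B t i l * q j t l)) (at t)" by metis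
  have "\<exists>y. (\<forall>j. y 0 j = kron i j) \<and> (\<forall>t j. ((\<lambda>t. y t j) has_vector_derivative (\<Sum>l\<in>UNIV. - B t l j * y t l)) (at t))" for i
    by (rule linear_system_exists) (intro continuous_intros B)
  then obtain s where s: "\<And>i j. s i 0 j = kron i j"
    "\<And>i t j. ((\<lambda>t. s i t j) has_vector_derivative (\<Sum>l\<in>UNIV. - B t l j * s i t l)) (at t)" by metis
  define Q where "Q t i j = q j t i" for t i j
  define S where "S t i j = s i t j" for t i j
  have Q: "((\<lambda>t. Q t i j) has_vector_derivative (\<Sum>l\<in>UNIV. B t i l * Q t l j)) (at t)" for t i j
    using q(2) unfolding Q_def by blast
  have S: "((\<lambda>t. S t i j) has_vector_derivative - (\<Sum>l\<in>UNIV. S t i l * B t l j)) (at t)" for t i j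
    using s(2)[of i j t] unfolding S_def by (simp add: sum_negf mult.commute)
  have SQ: "(\<Sum>l\<in>UNIV. S t i l * Q t l j) = kron i j" for t i j
  proof -
    have "((\<lambda>t. \<Sum>l\<in>UNIV. S t i l * Q t l j) has_vector_derivative
       (\<Sum>l\<in>UNIV. S t i l * (\<Sum>m\<in>UNIV. B t l m * Q t m j) + - (\<Sum>m\<in>UNIV. S t i m * B t m l) * Q t l j)) (at t)" for t
      by (intro has_vector_derivative_sum has_vector_derivative_mult Q S)
    moreover have "(\<Sum>l\<in>UNIV. S t i l * (\<Sum>m\<in>UNIV. B t l m * Q t m j) + - (\<Sum>m\<in>UNIV. S t i m * B t m l) * Q t l j) = 0" for t
      unfolding sum_3 by (simp add: algebra_simps)
    ultimately have "((\<lambda>t. \<Sum>l\<in>UNIV. S t i l * Q t l j) has_vector_derivative 0) (at t)" for t by simp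
    then obtain c where c: "\<And>t. (\<Sum>l\<in>UNIV. S t i l * Q t l j) = c"
      using has_vector_derivative_zero_constant[of UNIV "\<lambda>t. \<Sum>l\<in>UNIV. S t i l * Q t l j"] by auto
    have "c = (\<Sum>l\<in>UNIV. S 0 i l * Q 0 l j)" using c[of 0] by simp
    also have "\<dots> = kron i j" by (simp add: S_def Q_def s q)
    finally show ?thesis using c by simp
  qed
  have QS: "(\<Sum>l\<in>UNIV. Q t i l * S t l j) = kron i j" for t i j
  proof -
    let ?S = "\<chi> i j. S t i j" and ?Q = "\<chi> i j. Q t i j"
    have "?S ** ?Q = mat 1" using SQ by (simp add: matrix_matrix_mult_def mat_def vec_eq_iff kron_def)
    then have "?Q ** ?S = mat 1" by (simp only: matrix_left_right_inverse)
    then show ?thesis by (simp add: matrix_matrix_mult_def mat_def vec_eq_iff kron_def)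
  qed
  show ?thesis
    unfolding QSP_def using Q S QS by blast
qed

lemma summands_le_one_plus: "0 \<le> a \<Longrightarrow> 0 \<le> b \<Longrightarrow> a + b \<le> C \<Longrightarrow> c \<le> 1 \<Longrightarrow> 0 \<le> C \<Longrightarrow> a \<le> 1 + C \<and> b \<le> 1 + C \<and> c \<le> 1 + C"
  for a b c C :: real by linarith

locale bmhd =
  fixes \<nu> \<eta> :: real
  assumes \<nu>: "0 < \<nu>" "\<nu> \<le> 1" and \<eta>: "0 < \<eta>" "\<eta> \<le> 1"
begin

text \<open>The symbol of the system at the frequency \<open>(-k, -\<xi>)\<close>; the denominator is never \<open>0\<close>,
  and the entry vanishes for \<open>k = 0\<close>.\<close>

definition pk :: "int \<Rightarrow> real \<Rightarrow> real" where
  "pk k \<xi> = (if k = 0 then 1 else (of_int k)\<^sup>2 + \<xi>\<^sup>2)"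

definition Ad :: "int \<Rightarrow> real \<Rightarrow> 3 \<Rightarrow> 3 \<Rightarrow> complex" where
  "Ad k \<xi> i j =
    (if i = 1 then (if j = 1 then - of_real \<nu> * (of_int k ^ 2 + of_real \<xi> ^ 2) else - \<i> * of_int k)
     else if i = 2 then (if j = 1 then - \<i> * of_int k
       else if j = 2 then - 2 * of_int k * of_real \<xi> * of_real (pk k \<xi> powr (-1)) - of_real \<nu> * (of_int k ^ 2 + of_real \<xi> ^ 2) else 0)
     else (if j = 3 then - of_real \<eta> * (of_int k ^ 2 + of_real \<xi> ^ 2) else 0))"

lemma pk_ge1: "pk k \<xi> \<ge> 1"
proof (cases "k = 0")
  case False
  then have "1 \<le> \<bar>real_of_int k\<bar>" by linarith
  then have "1 \<le> \<bar>real_of_int k\<bar>\<^sup>2" by (rule one_le_power)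
  then show ?thesis using False by (simp add: pk_def add_increasing2)
qed (simp add: pk_def)

lemma Ad_continuous: "continuous_on UNIV (\<lambda>\<xi>. Ad k \<xi> i j)"
proof -
  have p: "continuous_on UNIV (\<lambda>\<xi>. pk k \<xi> powr (-1))"
  proof (rule continuous_on_powr)
    show "continuous_on UNIV (pk k)" unfolding pk_def by (cases "k = 0") (auto intro!: continuous_intros)
    show "\<forall>\<xi>\<in>UNIV. pk k \<xi> \<noteq> 0" using pk_ge1 by (metis not_one_le_zero)
  qed simp
  have c: "continuous_on UNIV (\<lambda>\<xi>. - of_real c * (of_int k ^ 2 + complex_of_real \<xi> ^ 2))" for c
    by (intro continuous_intros)
  have "continuous_on UNIV (\<lambda>\<xi>. - 2 * of_int k * complex_of_real \<xi> * of_real (pk k \<xi> powr (-1)))"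
    by (intro continuous_on_mult continuous_on_of_real p continuous_on_const continuous_on_id)
  then have d: "continuous_on UNIV (\<lambda>\<xi>. - 2 * of_int k * complex_of_real \<xi> * of_real (pk k \<xi> powr (-1)) - of_real \<nu> * (of_int k ^ 2 + of_real \<xi> ^ 2))"
    by (rule continuous_on_diff) (intro continuous_intros)
  show ?thesis unfolding Ad_def by (intro continuous_on_if_const c d continuous_on_const)
qed

text \<open>Along \<xi> = \<zeta> - k t one has d/dt = -k d/d\<xi>, so this generates the same
  evolution with the frequency as independent variable. Division by zero makes it vanish for k =
  0.\<close>

definition Bd :: "int \<Rightarrow> real \<Rightarrow> 3 \<Rightarrow> 3 \<Rightarrow> complex" where "Bd k \<xi> i j = - (1 / of_int k) * Ad k \<xi> i j"

definition QS :: "int \<Rightarrow> (real \<Rightarrow> 3 \<Rightarrow> 3 \<Rightarrow> complex) \<times> (real \<Rightarrow> 3 \<Rightarrow> 3 \<Rightarrow> complex)" where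
  "QS k = (SOME p. QSP (Bd k) (fst p) (snd p))"

definition "Qf k = fst (QS k)"
definition "Sf k = snd (QS k)"

lemma QS_props:
  "((\<lambda>t. Qf k t i j) has_vector_derivative (\<Sum>l\<in>UNIV. Bd k t i l * Qf k t l j)) (at t)"
  "((\<lambda>t. Sf k t i j) has_vector_derivative - (\<Sum>l\<in>UNIV. Sf k t i l * Bd k t l j)) (at t)"
  "(\<Sum>l\<in>UNIV. Qf k t i l * Sf k t l j) = kron i j"
proof -
  have "continuous_on UNIV (\<lambda>\<xi>. Bd k \<xi> i j)" for i j
    unfolding Bd_def by (intro continuous_intros Ad_continuous)
  then have "\<exists>Q S. QSP (Bd k) Q S" by (rule fundamental_system)
  then have "\<exists>p. QSP (Bd k) (fst p) (snd p)" by auto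
  then have "QSP (Bd k) (fst (QS k)) (snd (QS k))" unfolding QS_def by (rule someI_ex)
  then show "((\<lambda>t. Qf k t i j) has_vector_derivative (\<Sum>l\<in>UNIV. Bd k t i l * Qf k t l j)) (at t)"
    "((\<lambda>t. Sf k t i j) has_vector_derivative - (\<Sum>l\<in>UNIV. Sf k t i l * Bd k t l j)) (at t)"
    "(\<Sum>l\<in>UNIV. Qf k t i l * Sf k t l j) = kron i j"
    unfolding Qf_def Sf_def QSP_def by blast+
qed

definition diff_coeff :: "3 \<Rightarrow> real" where "diff_coeff i = (if i = 3 then \<eta> else \<nu>)"

text \<open>\<open>U t k \<zeta>\<close> maps the data at the frequency \<open>\<zeta>\<close> to the solution at time \<open>t\<close> and frequency
  \<open>\<zeta> - k t\<close>. For \<open>k \<noteq> 0\<close> the time variable is eliminated: along characteristics \<open>t\<close> is an affine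
  function of the frequency, so derivatives of \<open>U\<close> in \<open>\<zeta>\<close> are again algebraic in \<open>U\<close>.\<close>

definition U :: "real \<Rightarrow> int \<Rightarrow> real \<Rightarrow> 3 \<Rightarrow> 3 \<Rightarrow> complex" where
  "U t k \<zeta> i j = (if k = 0 then of_real (exp (- diff_coeff i * \<zeta>\<^sup>2 * t)) * kron i j
     else (\<Sum>l\<in>UNIV. Qf k (\<zeta> - of_int k * t) i l * Sf k \<zeta> l j))"

lemma U_0: "U 0 k \<zeta> i j = kron i j"
  using QS_props(3) by (simp add: U_def)

lemma Ad_zero: "Ad 0 \<xi> i j = - of_real (diff_coeff i * \<xi>\<^sup>2) * kron i j"
  unfolding Ad_def kron_def diff_coeff_def using exhaust_3[of i] exhaust_3[of j] by auto

lemma Ad_zero_sum: "(\<Sum>l\<in>UNIV. Ad 0 \<xi> i l * f l) = - of_real (diff_coeff i * \<xi>\<^sup>2) * f i"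
  unfolding Ad_zero by (simp only: mult.assoc sum_distrib_left[symmetric] sum_kron)

lemma U_time_deriv:
  "((\<lambda>t. U t k \<zeta> i j) has_vector_derivative (\<Sum>l\<in>UNIV. Ad k (\<zeta> - of_int k * t) i l * U t k \<zeta> l j)) (at t)"
proof (cases "k = 0")
  case True
  have "((\<lambda>t. exp (- diff_coeff i * \<zeta>\<^sup>2 * t)) has_real_derivative - diff_coeff i * \<zeta>\<^sup>2 * exp (- diff_coeff i * \<zeta>\<^sup>2 * t)) (at t)"
    by (auto intro!: derivative_eq_intros)
  from has_vector_derivative_mult_left[OF has_vector_derivative_of_real[OF this], of "kron i j"] show ?thesis
    unfolding True Ad_zero_sum unfolding U_def by (simp add: mult.assoc)
next
  case False
  have g: "((\<lambda>t. \<zeta> - of_int k * t) has_vector_derivative - of_int k) (at t)"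
    unfolding has_real_derivative_iff_has_vector_derivative[symmetric] by (auto intro!: derivative_eq_intros)
  have "((\<lambda>t. Qf k (\<zeta> - of_int k * t) i l) has_vector_derivative
      (\<Sum>m\<in>UNIV. Ad k (\<zeta> - of_int k * t) i m * Qf k (\<zeta> - of_int k * t) m l)) (at t)" for l
    using vector_diff_chain_at[OF g QS_props(1)[where k = k and i = i and j = l and t = "\<zeta> - of_int k * t"]] False
    by (simp add: o_def Bd_def scaleR_conv_of_real sum_distrib_left)
  then have "((\<lambda>t. \<Sum>l\<in>UNIV. Qf k (\<zeta> - of_int k * t) i l * Sf k \<zeta> l j) has_vector_derivative
      (\<Sum>l\<in>UNIV. (\<Sum>m\<in>UNIV. Ad k (\<zeta> - of_int k * t) i m * Qf k (\<zeta> - of_int k * t) m l) * Sf k \<zeta> l j)) (at t)"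
    by (intro has_vector_derivative_sum has_vector_derivative_mult_left)
  then show ?thesis using False unfolding U_def sum_3 by (simp add: algebra_simps)
qed

text \<open>One formula for all k: at k = 0 the sums vanish with \<open>Bd\<close> and the last term
  differentiates the explicit heat factor; for k \<noteq> 0 the last term vanishes and the sums come
  from the two factors of \<open>U\<close>.\<close>

lemma U_freq_deriv:
  "((\<lambda>\<zeta>. U t k \<zeta> i j) has_vector_derivative
     (\<Sum>l\<in>UNIV. Bd k (\<zeta> - of_int k * t) i l * U t k \<zeta> l j) - (\<Sum>l\<in>UNIV. U t k \<zeta> i l * Bd k \<zeta> l j)
     + (if k = 0 then - 2 * of_real (diff_coeff i) else 0) * of_real \<zeta> * of_real t * U t k \<zeta> i j) (at \<zeta>)"
proof (cases "k = 0")
  case True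
  have "((\<lambda>\<zeta>. exp (- diff_coeff i * \<zeta>\<^sup>2 * t)) has_real_derivative - 2 * diff_coeff i * \<zeta> * t * exp (- diff_coeff i * \<zeta>\<^sup>2 * t)) (at \<zeta>)"
    by (auto intro!: derivative_eq_intros)
  from has_vector_derivative_mult_left[OF has_vector_derivative_of_real[OF this], of "kron i j"] show ?thesis
    unfolding True U_def Bd_def by (simp add: mult.assoc)
next
  case False
  have g: "((\<lambda>\<zeta>. \<zeta> - of_int k * t) has_vector_derivative 1) (at \<zeta>)"
    unfolding has_real_derivative_iff_has_vector_derivative[symmetric] by (auto intro!: derivative_eq_intros)
  have "((\<lambda>\<zeta>. Qf k (\<zeta> - of_int k * t) i l) has_vector_derivative
      (\<Sum>m\<in>UNIV. Bd k (\<zeta> - of_int k * t) i m * Qf k (\<zeta> - of_int k * t) m l)) (at \<zeta>)" for l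
    using vector_diff_chain_at[OF g QS_props(1)[where k = k and i = i and j = l and t = "\<zeta> - of_int k * t"]] by (simp add: o_def)
  then have "((\<lambda>\<zeta>. \<Sum>l\<in>UNIV. Qf k (\<zeta> - of_int k * t) i l * Sf k \<zeta> l j) has_vector_derivative
      (\<Sum>l\<in>UNIV. Qf k (\<zeta> - of_int k * t) i l * - (\<Sum>m\<in>UNIV. Sf k \<zeta> l m * Bd k \<zeta> m j)
        + (\<Sum>m\<in>UNIV. Bd k (\<zeta> - of_int k * t) i m * Qf k (\<zeta> - of_int k * t) m l) * Sf k \<zeta> l j)) (at \<zeta>)"
    by (intro has_vector_derivative_sum has_vector_derivative_mult QS_props)
  then show ?thesis using False unfolding U_def sum_3 by (simp add: algebra_simps)
qed

lemma U_joint_continuous: "continuous_on UNIV (\<lambda>w. U (fst w) k (snd w) i j)"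
proof (cases "k = 0")
  case True
  then show ?thesis unfolding U_def by (auto intro!: continuous_intros)
next
  case False
  have Q: "continuous_on UNIV (\<lambda>t. Qf k t i l)" and S: "continuous_on UNIV (\<lambda>t. Sf k t l j)" for l
    by (rule continuous_on_if_has_vector_derivative[OF QS_props(1)], rule continuous_on_if_has_vector_derivative[OF QS_props(2)])
  have "continuous_on UNIV (\<lambda>w. Qf k (snd w - of_int k * fst w) i l)" "continuous_on UNIV (\<lambda>w. Sf k (snd w) l j)" for l
    by (rule continuous_on_compose2[OF Q]; auto intro!: continuous_intros)
      (rule continuous_on_compose2[OF S]; auto intro!: continuous_intros)
  then show ?thesis using False unfolding U_def by (auto intro!: continuous_intros)
qed

definition sol :: "(3 \<Rightarrow> complex) \<Rightarrow> int \<Rightarrow> real \<Rightarrow> real \<Rightarrow> 3 \<Rightarrow> complex" where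
  "sol d k \<zeta> t i = (\<Sum>j\<in>UNIV. U t k \<zeta> i j * d j)"

lemma sol_0: "sol d k \<zeta> 0 i = d i"
  unfolding sol_def U_0 by (rule sum_kron)

lemma sol_deriv: "((\<lambda>t. sol d k \<zeta> t i) has_vector_derivative (\<Sum>l\<in>UNIV. Ad k (\<zeta> - of_int k * t) i l * sol d k \<zeta> t l)) (at t)"
proof -
  have "((\<lambda>t. sol d k \<zeta> t i) has_vector_derivative (\<Sum>j\<in>UNIV. (\<Sum>l\<in>UNIV. Ad k (\<zeta> - of_int k * t) i l * U t k \<zeta> l j) * d j)) (at t)"
    unfolding sol_def by (intro has_vector_derivative_sum has_vector_derivative_mult_left U_time_deriv)
  then show ?thesis unfolding sol_def sum_3 by (simp add: algebra_simps)
qed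

text \<open>\<open>Ad\<close> is a symbol at the reflected frequency, as the bilinear pairing with
  test functions requires, so the mode system applies with -k and -\<zeta>. The reflection leaves
  k^2 + \<xi>^2 and k \<xi> unchanged.\<close>

lemma sol_mode_ode:
  assumes k0: "k \<noteq> 0"
  shows "mode_ode \<nu> \<eta> (- of_int k) (- \<zeta>) (\<lambda>t. sol d k \<zeta> t 1) (\<lambda>t. sol d k \<zeta> t 2) (\<lambda>t. sol d k \<zeta> t 3)"
proof (rule mode_ode.intro)
  have "1 \<le> \<bar>k\<bar>" using k0 by linarith
  then have "real_of_int 1 \<le> real_of_int \<bar>k\<bar>" by (simp only: of_int_le_iff)
  then show "1 \<le> \<bar>- real_of_int k\<bar>" by simp
  have m: "- \<zeta> - - real_of_int k * t = - (\<zeta> - of_int k * t)" for t by simp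
  have pk: "pk k \<xi> powr (-1) = 1 / ((of_int k)\<^sup>2 + \<xi>\<^sup>2)" for \<xi>
    using k0 pk_ge1[of k \<xi>] by (simp add: pk_def powr_minus_divide)
  have n: "(1::3) \<noteq> 2" "(1::3) \<noteq> 3" "(2::3) \<noteq> 3" "(2::3) \<noteq> 1" "(3::3) \<noteq> 1" "(3::3) \<noteq> 2" by simp_all
  note A = Ad_def sum_3 n if_False if_True simp_thms refl
  have e1: "(\<Sum>l\<in>UNIV. Ad k x 1 l * f l) = \<i> * complex_of_real (- real_of_int k) * f 2
      - complex_of_real (\<nu> * ((- real_of_int k)\<^sup>2 + (- x)\<^sup>2)) * f 1 + \<i> * complex_of_real (- real_of_int k) * f 3" for x f
    unfolding A by simp
  have e2: "(\<Sum>l\<in>UNIV. Ad k x 2 l * f l) = \<i> * complex_of_real (- real_of_int k) * f 1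
      - complex_of_real (2 * - real_of_int k * - x / ((- real_of_int k)\<^sup>2 + (- x)\<^sup>2)) * f 2
      - complex_of_real (\<nu> * ((- real_of_int k)\<^sup>2 + (- x)\<^sup>2)) * f 2" for x f
    unfolding A pk by (simp add: left_diff_distrib)
  have e3: "(\<Sum>l\<in>UNIV. Ad k x 3 l * f l) = - (complex_of_real (\<eta> * ((- real_of_int k)\<^sup>2 + (- x)\<^sup>2)) * f 3)" for x f
    unfolding A by simp
  show "((\<lambda>t. sol d k \<zeta> t 1) has_vector_derivative \<i> * complex_of_real (- real_of_int k) * sol d k \<zeta> t 2
      - complex_of_real (\<nu> * ((- real_of_int k)\<^sup>2 + (- \<zeta> - - real_of_int k * t)\<^sup>2)) * sol d k \<zeta> t 1
      + \<i> * complex_of_real (- real_of_int k) * sol d k \<zeta> t 3) (at t)" for t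
    using sol_deriv[of d k \<zeta> 1 t] unfolding m e1 .
  show "((\<lambda>t. sol d k \<zeta> t 2) has_vector_derivative \<i> * complex_of_real (- real_of_int k) * sol d k \<zeta> t 1
      - complex_of_real (2 * - real_of_int k * (- \<zeta> - - real_of_int k * t) / ((- real_of_int k)\<^sup>2 + (- \<zeta> - - real_of_int k * t)\<^sup>2)) * sol d k \<zeta> t 2
      - complex_of_real (\<nu> * ((- real_of_int k)\<^sup>2 + (- \<zeta> - - real_of_int k * t)\<^sup>2)) * sol d k \<zeta> t 2) (at t)" for t
    using sol_deriv[of d k \<zeta> 2 t] unfolding m e2 .
  show "((\<lambda>t. sol d k \<zeta> t 3) has_vector_derivative - (complex_of_real (\<eta> * ((- real_of_int k)\<^sup>2 + (- \<zeta> - - real_of_int k * t)\<^sup>2)) * sol d k \<zeta> t 3)) (at t)" for t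
    using sol_deriv[of d k \<zeta> 3 t] unfolding m e3 .
qed (use \<nu> \<eta> in blast)+

abbreviation "WJ d k \<zeta> t \<equiv> (norm (sol d k \<zeta> t 1))\<^sup>2 + (norm (sol d k \<zeta> t 2))\<^sup>2"
abbreviation "pt k \<zeta> t \<equiv> (real_of_int k)\<^sup>2 + (\<zeta> - of_int k * t)\<^sup>2"
abbreviation "rk k \<equiv> (\<eta> * (real_of_int k)\<^sup>2) powr (1/3)"
abbreviation "data_energy d k \<equiv> 2 * ((norm (d 1))\<^sup>2 + (norm (d 2))\<^sup>2) + 20 / (\<nu> * rk k) * (norm (d (3::3) :: complex))\<^sup>2"

lemma sol_bounds:
  assumes k0: "k \<noteq> 0"
  shows "t \<ge> 0 \<Longrightarrow> WJ d k \<zeta> t \<le> 16 / \<nu>\<^sup>2 * data_energy d k"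
    and "(\<integral>\<^sup>+t\<in>{0<..}. ennreal (pt k \<zeta> t * WJ d k \<zeta> t) \<partial>lborel) \<le> ennreal (32 / \<nu>^3 * data_energy d k)"
    and "t \<ge> 0 \<Longrightarrow> (norm (sol d k \<zeta> t 3))\<^sup>2 \<le> (norm (d 3))\<^sup>2"
    and "(\<integral>\<^sup>+t\<in>{0<..}. ennreal (\<eta> * pt k \<zeta> t * (norm (sol d k \<zeta> t 3))\<^sup>2) \<partial>lborel) \<le> ennreal ((norm (d 3))\<^sup>2)"
    and "(\<integral>\<^sup>+t\<in>{0<..}. ennreal (rk k * (norm (sol d k \<zeta> t 3))\<^sup>2) \<partial>lborel) \<le> ennreal (5 * (norm (d 3))\<^sup>2)"
proof -
  interpret M: mode_ode \<nu> \<eta> "- of_int k" "- \<zeta>" "\<lambda>t. sol d k \<zeta> t 1" "\<lambda>t. sol d k \<zeta> t 2" "\<lambda>t. sol d k \<zeta> t 3"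
    by (rule sol_mode_ode[OF k0])
  have p: "M.p = pt k \<zeta>"
    unfolding M.p_def by (rule ext) (simp add: power2_eq_square algebra_simps)
  have r: "M.r = rk k" unfolding M.r_def by (simp only: power2_minus)
  have E: "M.E = WJ d k \<zeta>" and Z: "M.Z = (\<lambda>t. (norm (sol d k \<zeta> t 3))\<^sup>2)"
    unfolding M.E_def M.Z_def by (rule ext, rule refl)+
  note en = M.energy[unfolded p r E Z sol_0] and he = M.heat[unfolded p r E Z sol_0]
  show "t \<ge> 0 \<Longrightarrow> WJ d k \<zeta> t \<le> 16 / \<nu>\<^sup>2 * data_energy d k" by (rule en(1))
  show "(\<integral>\<^sup>+t\<in>{0<..}. ennreal (pt k \<zeta> t * WJ d k \<zeta> t) \<partial>lborel) \<le> ennreal (32 / \<nu>^3 * data_energy d k)"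
    by (rule en(2))
  show "t \<ge> 0 \<Longrightarrow> (norm (sol d k \<zeta> t 3))\<^sup>2 \<le> (norm (d 3))\<^sup>2" by (rule he(1))
  show "(\<integral>\<^sup>+t\<in>{0<..}. ennreal (\<eta> * pt k \<zeta> t * (norm (sol d k \<zeta> t 3))\<^sup>2) \<partial>lborel) \<le> ennreal ((norm (d 3))\<^sup>2)"
    by (rule he(2))
  show "(\<integral>\<^sup>+t\<in>{0<..}. ennreal (rk k * (norm (sol d k \<zeta> t 3))\<^sup>2) \<partial>lborel) \<le> ennreal (5 * (norm (d 3))\<^sup>2)"
    by (rule he(3))
qed

lemma sol_bounds_zero:
  shows "t \<ge> 0 \<Longrightarrow> (norm (sol d 0 \<zeta> t i))\<^sup>2 \<le> (norm (d i))\<^sup>2"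
    and "(\<integral>\<^sup>+t\<in>{0<..}. ennreal (diff_coeff i * pt 0 \<zeta> t * (norm (sol d 0 \<zeta> t i))\<^sup>2) \<partial>lborel) \<le> ennreal ((norm (d i))\<^sup>2)"
proof -
  have D: "((\<lambda>t. sol d 0 \<zeta> t i) has_vector_derivative - (complex_of_real (diff_coeff i * \<zeta>\<^sup>2) * sol d 0 \<zeta> t i)) (at t)" for t
    using sol_deriv[of d 0 \<zeta> i t] unfolding Ad_zero_sum by simp
  have c: "continuous_on UNIV (\<lambda>t::real. diff_coeff i * \<zeta>\<^sup>2)" "\<And>t::real. 0 \<le> diff_coeff i * \<zeta>\<^sup>2"
    using \<nu> \<eta> by (auto simp: diff_coeff_def)
  note * = scalar_decay[of "\<lambda>t. sol d 0 \<zeta> t i" "\<lambda>t. diff_coeff i * \<zeta>\<^sup>2"]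
  show "t \<ge> 0 \<Longrightarrow> (norm (sol d 0 \<zeta> t i))\<^sup>2 \<le> (norm (d i))\<^sup>2"
    using *(1)[OF D c(2) c(1)] unfolding sol_0 by blast
  show "(\<integral>\<^sup>+t\<in>{0<..}. ennreal (diff_coeff i * pt 0 \<zeta> t * (norm (sol d 0 \<zeta> t i))\<^sup>2) \<partial>lborel) \<le> ennreal ((norm (d i))\<^sup>2)"
    using *(2)[OF D c(2) c(1)] unfolding sol_0 by simp
qed

lemma rk_ge: "k \<noteq> 0 \<Longrightarrow> \<eta> powr (1/3) \<le> rk k"
proof -
  assume k: "k \<noteq> 0"
  have "1 \<le> \<bar>real_of_int k\<bar>" using k by linarith
  then have "1 \<le> \<bar>real_of_int k\<bar>\<^sup>2" by (rule one_le_power)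
  then have "\<eta> * 1 \<le> \<eta> * (real_of_int k)\<^sup>2" using \<eta> by (intro mult_left_mono) auto
  then show ?thesis using \<eta> by (intro powr_mono2) auto
qed

text \<open>The columns of \<open>U\<close> are solutions with unit data, to which the energy bounds
  apply. The constant depends on \<nu> and \<eta> but on neither t nor the frequency; it serves to
  make \<open>U\<close> an admissible multiplier.\<close>

lemma U_bounded: "\<exists>C\<ge>0. \<forall>t\<ge>0. \<forall>k \<zeta> i j. norm (U t k \<zeta> i j) \<le> C"
proof -
  define C where "C = 16 / \<nu>\<^sup>2 * (4 + 20 / (\<nu> * \<eta> powr (1/3)))"
  have C0: "C \<ge> 0" using \<nu> by (simp add: C_def)
  \<comment> \<open>From the square to the modulus by 2 x \<le> 1 + x^2, without a root in the
    constant.\<close>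
  have sq: "x \<le> 1 + C" if "x\<^sup>2 \<le> 1 + C" for x :: real
  proof -
    have "2 * x \<le> 1 + x\<^sup>2" using sum_squares_bound[of x 1] by (simp add: power2_eq_square)
    then show ?thesis using that C0 by linarith
  qed
  have "norm (U t k \<zeta> i j) \<le> 1 + C" if t: "t \<ge> 0" for t k \<zeta> i j
  proof (rule sq)
    define d :: "3 \<Rightarrow> complex" where "d l = kron l j" for l
    have d: "(norm (d l))\<^sup>2 \<le> 1" for l by (simp add: d_def kron_def)
    have U: "U t k \<zeta> i j = sol d k \<zeta> t i" unfolding sol_def d_def by (rule sum_kron(2)[symmetric])
    show "(norm (U t k \<zeta> i j))\<^sup>2 \<le> 1 + C"
    proof (cases "k = 0")
      case True
      show ?thesis unfolding U unfolding True using sol_bounds_zero(1)[OF t, of d \<zeta> i] d[of i] C0 by linarith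
    next
      case k: False
      have "data_energy d k \<le> 4 + 20 / (\<nu> * \<eta> powr (1/3)) * 1"
      proof (rule add_mono)
        have "2 * (x + y) \<le> 4" if "x \<le> 1" "y \<le> 1" for x y :: real
          using mult_left_mono[OF add_mono[OF that], of 2] by simp
        from this[OF d d] show "2 * ((norm (d 1))\<^sup>2 + (norm (d 2))\<^sup>2) \<le> 4" .
        have "20 / (\<nu> * rk k) \<le> 20 / (\<nu> * \<eta> powr (1/3))"
          using rk_ge[OF k] \<nu> \<eta> by (intro divide_left_mono mult_left_mono mult_pos_pos) (auto simp: k)
        then show "20 / (\<nu> * rk k) * (norm (d 3))\<^sup>2 \<le> 20 / (\<nu> * \<eta> powr (1/3)) * 1"
          using d[of 3] \<nu> by (intro mult_mono) auto
      qed
      then have "16 / \<nu>\<^sup>2 * data_energy d k \<le> C" unfolding C_def by (intro mult_left_mono) auto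
      then have "WJ d k \<zeta> t \<le> C" using sol_bounds(1)[OF k t, of d \<zeta>] by linarith
      moreover have "(norm (sol d k \<zeta> t 3))\<^sup>2 \<le> 1" using sol_bounds(3)[OF k t, of d \<zeta>] d[of 3] by (rule order_trans)
      ultimately have "\<forall>l. (norm (sol d k \<zeta> t l))\<^sup>2 \<le> 1 + C"
        unfolding forall_3 using summands_le_one_plus[of _ _ C, OF zero_le_power2 zero_le_power2 _ _ C0] by blast
      then show ?thesis unfolding U by blast
    qed
  qed
  then show ?thesis using C0 by (intro exI[of _ "1 + C"]) auto
qed

lemma om_Ad:
  assumes x: "om T (\<lambda>t k \<xi>. of_real (x t k \<xi>))"
  shows "om T (\<lambda>t k \<xi>. Ad k (x t k \<xi>) i j)"
proof -
  \<comment> \<open>The case distinction in \<open>pk\<close> is rewritten as a sum with bounded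
    cut-offs in k; since \<open>pk\<close> is at least 1, its power -1 is then covered by
    \<open>om_powr\<close>.\<close>
  have 0: "om T (\<lambda>t k \<xi>. if k = 0 then 1 else 0)" by (rule om_kbounded[where B = 1]) simp
  have 1: "om T (\<lambda>t k \<xi>. if k = 0 then 0 else 1)" by (rule om_kbounded[where B = 1]) simp
  have q: "om T (\<lambda>t k \<xi>. of_int k ^ 2 + of_real (x t k \<xi>) ^ 2)"
    by (rule om_add[OF om_power[OF om_k] om_power[OF x]])
  have "om T (\<lambda>t k \<xi>. (if k = 0 then 1 else 0) + (if k = 0 then 0 else 1) * (of_int k ^ 2 + of_real (x t k \<xi>) ^ 2))"
    by (rule om_add[OF 0 om_mult[OF 1 q]])
  moreover have "(\<lambda>t k \<xi>. (if k = 0 then 1 else 0) + (if k = 0 then 0 else 1) * (of_int k ^ 2 + of_real (x t k \<xi>) ^ 2))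
      = (\<lambda>t k \<xi>. complex_of_real (pk k (x t k \<xi>)))" by (intro ext) (simp add: pk_def)
  ultimately have "om T (\<lambda>t k \<xi>. complex_of_real (pk k (x t k \<xi>)))" by simp
  from om_powr[OF pk_ge1 this, of "-1"]
  have p: "om T (\<lambda>t k \<xi>. complex_of_real (pk k (x t k \<xi>) powr (-1)))" .
  have a: "om T (\<lambda>t k \<xi>. - 2 * of_int k * complex_of_real (x t k \<xi>) * complex_of_real (pk k (x t k \<xi>) powr (-1)))"
    by (rule om_mult[OF om_mult[OF om_cmult[OF om_k] x] p])
  have b: "om T (\<lambda>t k \<xi>. - of_real c * (of_int k ^ 2 + of_real (x t k \<xi>) ^ 2))" for c by (rule om_cmult[OF q])
  have b': "om T (\<lambda>t k \<xi>. of_real \<nu> * (of_int k ^ 2 + of_real (x t k \<xi>) ^ 2))" by (rule om_cmult[OF q])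
  have e: "om T (\<lambda>t k \<xi>. if c then f t k \<xi> else g t k \<xi>)" if "om T f" "om T g" for c f g using that by (cases c) simp_all
  show ?thesis unfolding Ad_def
    by (rule e, rule e, rule b, rule om_cmult[OF om_k], rule e, rule e, rule om_cmult[OF om_k], rule e,
        rule om_diff[OF a b'], rule om_const, rule e, rule b, rule om_const)
qed

lemma om_Bd:
  assumes x: "om T (\<lambda>t k \<xi>. of_real (x t k \<xi>))"
  shows "om T (\<lambda>t k \<xi>. Bd k (x t k \<xi>) i j)"
  unfolding Bd_def
proof (rule om_mult[OF om_kbounded om_Ad[OF x]])
  show "norm (- (1 / of_int k) :: complex) \<le> 1" for k
  proof (cases "k = 0")
    case False
    then have "1 \<le> \<bar>real_of_int k\<bar>" by linarith
    then show ?thesis by (simp add: norm_divide divide_le_eq)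
  qed simp
qed

text \<open>Both first derivatives of an entry of \<open>U\<close> are combinations of entries of
  \<open>U\<close> with coefficients in \<open>om\<close>, so the products of such coefficients with
  entries are closed generators. The bound on the entries themselves is \<open>U_bounded\<close>;
  the reversed time T - t is nonnegative on [0, T] and fits the backward dual problem.\<close>

lemma om_U: "om T (\<lambda>t k \<xi>. U (T - t) k \<xi> i j)"
proof -
  define V where "V i j = (\<lambda>t k \<xi>. U (T - t) k \<xi> i j)" for i j
  let ?G = "{\<lambda>t k \<xi>. c t k \<xi> * V i j t k \<xi> | c i j. om T c}"
  have mem: "(\<lambda>t k \<xi>. c t k \<xi> * V i j t k \<xi>) \<in> adds ?G" if "om T c" for c i j
    using that by (intro adds.base) blast
  obtain C where C: "C \<ge> 0" "\<And>t k \<zeta> i j. t \<ge> 0 \<Longrightarrow> norm (U t k \<zeta> i j) \<le> C" using U_bounded by blast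
  have PV: "polyb T (V i j)" for i j
    unfolding polyb_def V_def using C by (intro exI[of _ 0] exI[of _ C]) auto
  have tT: "om T (\<lambda>t k \<xi>. of_real (T - t))" using om_diff[OF om_const om_t, of T "of_real T"] by simp
  have sh: "om T (\<lambda>t k \<xi>. of_real (\<xi> - of_int k * (T - t)))"
    using om_diff[OF om_xi om_mult[OF om_k tT]] by simp
  have A: "om T (\<lambda>t k \<xi>. Ad k (\<xi> - of_int k * (T - t)) i j)" for i j by (rule om_Ad[OF sh])
  have B: "om T (\<lambda>t k \<xi>. Bd k (\<xi> - of_int k * (T - t)) i j)" for i j by (rule om_Bd[OF sh])
  have B0: "om T (\<lambda>t k \<xi>. Bd k \<xi> i j)" for i j by (rule om_Bd[OF om_xi])
  define R where "R i = (\<lambda>t (k::int) \<xi>. (if k = 0 then - 2 * of_real (diff_coeff i) else 0) * of_real \<xi> * complex_of_real (T - t))" for i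
  have R: "om T (R i)" for i
  proof -
    have "om T (\<lambda>t k \<xi>. if k = 0 then - 2 * complex_of_real (diff_coeff i) else 0)"
      by (rule om_kbounded[where B = "norm (- 2 * complex_of_real (diff_coeff i))"]) simp
    from om_mult[OF om_mult[OF this om_xi] tT] show ?thesis unfolding R_def .
  qed
  have "om T (\<lambda>t k \<xi>. 1 * V i j t k \<xi>)"
  proof (rule smth_adds[OF add_closed_polyb _ mem[OF om_const]])
    fix g assume "g \<in> ?G"
    then obtain c i j where g: "g = (\<lambda>t k \<xi>. c t k \<xi> * V i j t k \<xi>)" and c: "om T c" by blast
    obtain c1 c2 where c12: "dt c c1" "dxi c c2" "om T c1" "om T c2" using c by (rule smthE)
    have P: "polyb T g" unfolding g using mult_closed_polyb smthD[OF c] PV unfolding mult_closed_def by blast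
    let ?A = "\<lambda>l t k \<xi>. (- c t k \<xi>) * Ad k (\<xi> - of_int k * (T - t)) i l"
    let ?B = "\<lambda>l t k \<xi>. c t k \<xi> * Bd k (\<xi> - of_int k * (T - t)) i l"
    let ?D = "\<lambda>l t k \<xi>. (- c t k \<xi>) * Bd k \<xi> l j"
    let ?R = "\<lambda>t k \<xi>. c t k \<xi> * R i t k \<xi>"
    let ?f1 = "\<lambda>t k \<xi>. (?A 1 t k \<xi> * V 1 j t k \<xi> + ?A 2 t k \<xi> * V 2 j t k \<xi>) + (?A 3 t k \<xi> * V 3 j t k \<xi> + c1 t k \<xi> * V i j t k \<xi>)"
    let ?f2 = "\<lambda>t k \<xi>. ((?B 1 t k \<xi> * V 1 j t k \<xi> + ?B 2 t k \<xi> * V 2 j t k \<xi>) + (?B 3 t k \<xi> * V 3 j t k \<xi> + c2 t k \<xi> * V i j t k \<xi>))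
      + ((?D 1 t k \<xi> * V i 1 t k \<xi> + ?D 2 t k \<xi> * V i 2 t k \<xi>) + (?D 3 t k \<xi> * V i 3 t k \<xi> + ?R t k \<xi> * V i j t k \<xi>))"
    have mA: "om T (?A l)" for l by (rule om_mult[OF om_minus[OF c] A])
    have mB: "om T (?B l)" for l by (rule om_mult[OF c B])
    have mB0: "om T (?D l)" for l by (rule om_mult[OF om_minus[OF c] B0])
    have mR: "om T ?R" by (rule om_mult[OF c R])
    have f1: "?f1 \<in> adds ?G"
      by (rule adds.add[OF adds.add[OF mem[OF mA] mem[OF mA]] adds.add[OF mem[OF mA] mem[OF c12(3)]]])
    have f2: "?f2 \<in> adds ?G"
      by (rule adds.add[OF adds.add[OF adds.add[OF mem[OF mB] mem[OF mB]] adds.add[OF mem[OF mB] mem[OF c12(4)]]]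
            adds.add[OF adds.add[OF mem[OF mB0] mem[OF mB0]] adds.add[OF mem[OF mB0] mem[OF mR]]]])
    have "dt (V i j) (\<lambda>t k \<xi>. - (\<Sum>l\<in>UNIV. Ad k (\<xi> - of_int k * (T - t)) i l * V l j t k \<xi>))"
      unfolding dt_def
    proof (intro allI)
      fix t k \<xi>
      have s: "((\<lambda>t. T - t) has_vector_derivative - 1) (at t)"
        unfolding has_real_derivative_iff_has_vector_derivative[symmetric] by (auto intro!: derivative_eq_intros)
      show "((\<lambda>s. V i j s k \<xi>) has_vector_derivative - (\<Sum>l\<in>UNIV. Ad k (\<xi> - of_int k * (T - t)) i l * V l j t k \<xi>)) (at t)"
        using vector_diff_chain_at[OF s U_time_deriv[of k \<xi> i j "T - t"]] unfolding V_def o_def by simp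
    qed
    from dt_mult[OF c12(1) this]
    have d1: "dt g ?f1" unfolding g sum_3 by (simp add: algebra_simps)
    have "dxi (V i j) (\<lambda>t k \<xi>. (\<Sum>l\<in>UNIV. Bd k (\<xi> - of_int k * (T - t)) i l * V l j t k \<xi>)
        - (\<Sum>l\<in>UNIV. V i l t k \<xi> * Bd k \<xi> l j) + R i t k \<xi> * V i j t k \<xi>)"
      unfolding dxi_def V_def R_def using U_freq_deriv by blast
    from dxi_mult[OF c12(2) this]
    have d2: "dxi g ?f2" unfolding g sum_3 by (simp add: algebra_simps)
    show "polyb T g \<and> (\<exists>f1 f2. dt g f1 \<and> dxi g f2 \<and> f1 \<in> adds ?G \<and> f2 \<in> adds ?G)"
      using P d1 d2 f1 f2 by blast
  qed
  then show ?thesis by (simp add: V_def)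
qed

end

section \<open>The dual problem\<close>

lemma IF_Lap:
  assumes u: "linear_dist u" and g: "sg g"
  shows "Lap u (IF g) = u (IF (\<lambda>k \<xi>. - (of_int k ^ 2 + of_real \<xi> ^ 2) * g k \<xi>))"
proof -
  have s: "sg (\<lambda>k \<xi>. \<i> * of_int k * (\<i> * of_int k * g k \<xi>))" "sg (\<lambda>k \<xi>. \<i> * of_real \<xi> * (\<i> * of_real \<xi> * g k \<xi>))"
    using g by (intro sg_k sg_xi; assumption)+
  have "Lap u (IF g) = u (IF (\<lambda>k \<xi>. \<i> * of_int k * (\<i> * of_int k * g k \<xi>))) + u (IF (\<lambda>k \<xi>. \<i> * of_real \<xi> * (\<i> * of_real \<xi> * g k \<xi>)))"
    unfolding Lap_def DX_def DY_def dX_IF[OF g] dY_IF[OF g] dX_IF[OF sg_k[OF g]] dY_IF[OF sg_xi[OF g]] by simp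
  also have "\<dots> = u (IF (\<lambda>k \<xi>. \<i> * of_int k * (\<i> * of_int k * g k \<xi>) + \<i> * of_real \<xi> * (\<i> * of_real \<xi> * g k \<xi>)))"
    by (rule linear_dist_add[OF u s, symmetric])
  also have "(\<lambda>k \<xi>. \<i> * of_int k * (\<i> * of_int k * g k \<xi>) + \<i> * of_real \<xi> * (\<i> * of_real \<xi> * g k \<xi>))
      = (\<lambda>k \<xi>. - (of_int k ^ 2 + of_real \<xi> ^ 2) * g k \<xi>)"
    by (intro ext) (simp add: power2_eq_square algebra_simps)
  finally show ?thesis .
qed

text \<open>On symbols y acts as \<i> \<partial>\<xi> and the transpose of \<partial>x as
  multiplication by -\<i> k, so the shear term becomes transport in \<xi> with speed proportional to
  k.\<close>

lemma IF_mult_y_DX: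
  assumes u: "linear_dist u" and g: "sg g" and g': "\<forall>k \<xi>. (g k has_vector_derivative g' k \<xi>) (at \<xi>)" "sg g'"
  shows "mult_y (DX u) (IF g) = u (IF (\<lambda>k \<xi>. of_int k * g' k \<xi>))"
proof -
  have e: "(\<lambda>p. of_real (snd p) * IF g p) = IF (\<lambda>k \<xi>. \<i> * g' k \<xi>)"
    using IF_xi_deriv[OF g g'] by (intro ext) simp
  have "mult_y (DX u) (IF g) = - u (IF (\<lambda>k \<xi>. \<i> * of_int k * (\<i> * g' k \<xi>)))"
    unfolding mult_y_def DX_def e by (simp only: dX_IF[OF sg_cmult[OF g'(2)]])
  also have "\<dots> = (-1) * u (IF (\<lambda>k \<xi>. \<i> * of_int k * (\<i> * g' k \<xi>)))" by simp
  also have "\<dots> = u (IF (\<lambda>k \<xi>. (-1) * (\<i> * of_int k * (\<i> * g' k \<xi>))))"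
    by (rule linear_dist_cmult[OF u sg_k[OF sg_cmult[OF g'(2)]], symmetric])
  also have "(\<lambda>k \<xi>. (-1) * (\<i> * of_int k * (\<i> * g' k \<xi>))) = (\<lambda>k \<xi>. of_int k * g' k \<xi>)"
    by (intro ext) (simp add: algebra_simps)
  finally show ?thesis .
qed

lemma eq_neg_add_subst: "x = - y + (c::complex) \<Longrightarrow> s = c \<Longrightarrow> x = - y + s"
  by simp

locale bmhd_sol = bmhd +
  fixes w j \<theta> b1 b2 :: "real \<Rightarrow> dist"
  assumes solution: "bmhd_solution \<nu> \<nu> \<eta> w j \<theta> b1 b2"
begin

definition us :: "3 \<Rightarrow> real \<Rightarrow> dist" where
  "us i = (if i = 1 then w else if i = 2 then j else \<theta>)"

lemma us_continuous: "time_continuous (us i)" and us_differentiable: "time_differentiable (us i)"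
  using solution unfolding bmhd_solution_def us_def by auto

lemma us_linear: "t \<ge> 0 \<Longrightarrow> linear_dist (us i t)"
  by (rule time_continuous_linear[OF us_continuous])

lemma sg_Ad: "sg g \<Longrightarrow> sg (\<lambda>k \<xi>. Ad k \<xi> i l * g k \<xi>)"
  by (rule sg_mult[OF om_Ad[OF om_xi]])

text \<open>Testing with \<open>IF g\<close> moves every operator onto the symbol: the shear gives
  the transport term and the remaining terms the row i of \<open>Ad\<close>. The magnetic term takes
  the work, being given through a stream function.\<close>

lemma pde:
  assumes t: "t > 0" and g: "sg g" and g': "\<forall>k \<xi>. (g k has_vector_derivative g' k \<xi>) (at \<xi>)" "sg g'"
  shows "DT (us i) t (IF g) = - us i t (IF (\<lambda>k \<xi>. of_int k * g' k \<xi>)) + (\<Sum>l\<in>UNIV. us l t (IF (\<lambda>k \<xi>. Ad k \<xi> i l * g k \<xi>)))"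
proof -
  have lin: "linear_dist (w t)" "linear_dist (j t)" "linear_dist (\<theta> t)"
    using us_linear[of t 1] us_linear[of t 2] us_linear[of t 3] t by (simp_all add: us_def)
  note s = schwartz_IF[OF g]
  have n: "(2::3) \<noteq> 1" "(3::3) \<noteq> 1" "(3::3) \<noteq> 2" "(1::3) \<noteq> 2" "(1::3) \<noteq> 3" "(2::3) \<noteq> 3" by simp_all
  have eqs: "DT w t (IF g) + mult_y (DX (w t)) (IF g) - DX (j t) (IF g) - \<nu> * Lap (w t) (IF g) - DX (\<theta> t) (IF g) = 0"
    "DT j t (IF g) + mult_y (DX (j t)) (IF g) - DX (w t) (IF g) - \<nu> * Lap (j t) (IF g) - 2 * DX (b1 t) (IF g) = 0"
    "DT \<theta> t (IF g) + mult_y (DX (\<theta> t)) (IF g) - \<eta> * Lap (\<theta> t) (IF g) = 0"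
    using solution t s unfolding bmhd_solution_def by blast+
  have y: "mult_y (DX u) (IF g) = u (IF (\<lambda>k \<xi>. of_int k * g' k \<xi>))" if "linear_dist u" for u
    by (rule IF_mult_y_DX[OF that g g'])
  have dx: "DX u (IF g) = u (IF (\<lambda>k \<xi>. - \<i> * of_int k * g k \<xi>))" if "linear_dist u" for u
  proof -
    have "DX u (IF g) = (-1) * u (IF (\<lambda>k \<xi>. \<i> * of_int k * g k \<xi>))" unfolding DX_def dX_IF[OF g] by simp
    also have "\<dots> = u (IF (\<lambda>k \<xi>. (-1) * (\<i> * of_int k * g k \<xi>)))"
      by (rule linear_dist_cmult[OF that sg_k[OF g], symmetric])
    finally show ?thesis by simp
  qed
  have q: "sg (\<lambda>k \<xi>. - (of_int k ^ 2 + of_real \<xi> ^ 2) * h k \<xi>)" if "sg h" for h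
    by (rule sg_mult[OF om_minus[OF om_add[OF om_power[OF om_k] om_power[OF om_xi]]] that])
  have lap: "of_real c * Lap u (IF g) = u (IF (\<lambda>k \<xi>. - of_real c * (of_int k ^ 2 + of_real \<xi> ^ 2) * g k \<xi>))" if "linear_dist u" for u c
    unfolding IF_Lap[OF that g] linear_dist_cmult[OF that q[OF g], symmetric] by (simp only: mult.assoc mult_minus_left mult_minus_right)
  have zero: "u (IF (\<lambda>k \<xi>. 0 * g k \<xi>)) = 0" if "linear_dist u" for u
    using linear_dist_cmult[OF that g, of 0] by simp
  \<comment> \<open>The stream function is eliminated by testing -\<Delta>\<psi> = j with
    \<open>?h\<close>, whose symbol times k^2 + \<xi>^2 is -k \<xi> g. The factor k keeps this
    consistent at k = 0, where \<open>pk\<close> is 1, so the freedom in \<psi> has no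
    effect.\<close>
  have b: "2 * DX (b1 t) (IF g) = j t (IF (\<lambda>k \<xi>. - 2 * of_int k * of_real \<xi> * of_real (pk k \<xi> powr (-1)) * g k \<xi>))"
  proof -
    obtain \<psi> where \<psi>: "tempered \<psi>" "\<And>\<phi>. schwartz \<phi> \<Longrightarrow> - Lap \<psi> \<phi> = j t \<phi>" "\<And>\<phi>. schwartz \<phi> \<Longrightarrow> b1 t \<phi> = DY \<psi> \<phi>"
      using solution t unfolding bmhd_solution_def magnetic_field_def by blast
    have l\<psi>: "linear_dist \<psi>" using \<psi>(1) by (simp add: tempered_def)
    let ?h = "\<lambda>k \<xi>. - of_int k * of_real \<xi> * of_real (pk k \<xi> powr (-1)) * g k \<xi>"
    \<comment> \<open>The decay of \<open>?h\<close> is read off from the entry (2,2) of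
      \<open>Ad\<close>: half of that entry, after the viscous part is added back.\<close>
    have hs: "sg ?h"
    proof -
      have "sg (\<lambda>k \<xi>. (1 / 2) * ((- 2 * of_int k * of_real \<xi> * of_real (pk k \<xi> powr (-1)) - of_real \<nu> * (of_int k ^ 2 + of_real \<xi> ^ 2)) * g k \<xi>)
          + (1 / 2) * (of_real \<nu> * (of_int k ^ 2 + of_real \<xi> ^ 2) * g k \<xi>))"
      proof (rule sg_add[OF sg_cmult sg_cmult])
        show "sg (\<lambda>k \<xi>. (- 2 * of_int k * of_real \<xi> * of_real (pk k \<xi> powr (-1)) - of_real \<nu> * (of_int k ^ 2 + of_real \<xi> ^ 2)) * g k \<xi>)"
          using sg_Ad[OF g, of 2 2] unfolding Ad_def by (simp only: n if_False if_True simp_thms)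
        show "sg (\<lambda>k \<xi>. of_real \<nu> * (of_int k ^ 2 + of_real \<xi> ^ 2) * g k \<xi>)"
          by (rule sg_mult[OF om_cmult[OF om_add[OF om_power[OF om_k] om_power[OF om_xi]]] g])
      qed
      moreover have "(\<lambda>k \<xi>. (1 / 2) * ((- 2 * of_int k * of_real \<xi> * of_real (pk k \<xi> powr (-1)) - of_real \<nu> * (of_int k ^ 2 + of_real \<xi> ^ 2)) * g k \<xi>)
          + (1 / 2) * (of_real \<nu> * (of_int k ^ 2 + of_real \<xi> ^ 2) * g k \<xi>)) = ?h"
        by (intro ext) (simp add: algebra_simps)
      ultimately show ?thesis by simp
    qed
    have pk1: "(of_int k ^ 2 + of_real \<xi> ^ 2) * (of_int k * complex_of_real (pk k \<xi> powr (-1))) = of_int k" for k \<xi>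
    proof (cases "k = 0")
      case False
      have "pk k \<xi> * (pk k \<xi> powr (-1)) = 1" using pk_ge1[of k \<xi>]
        by (simp add: powr_minus_divide)
      then have "((real_of_int k)\<^sup>2 + \<xi>\<^sup>2) * (pk k \<xi> powr (-1)) = 1" using False by (simp only: pk_def if_False)
      from arg_cong[OF this, of complex_of_real]
      have e: "(of_int k ^ 2 + of_real \<xi> ^ 2) * complex_of_real (pk k \<xi> powr (-1)) = 1"
        by (simp only: of_real_mult of_real_add of_real_power of_real_of_int_eq of_real_1)
      show ?thesis by (simp only: mult.left_commute[of _ "complex_of_int k"] e mult_1_right)
    qed simp
    have "DX (b1 t) (IF g) = \<psi> (dY (dX (IF g)))"
      unfolding DX_def using \<psi>(3)[OF schwartz_dX[OF s]] by (simp add: DY_def)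
    also have "dY (dX (IF g)) = IF (\<lambda>k \<xi>. \<i> * of_real \<xi> * (\<i> * of_int k * g k \<xi>))"
      unfolding dX_IF[OF g] by (rule dY_IF[OF sg_k[OF g]])
    also have "(\<lambda>k \<xi>. \<i> * of_real \<xi> * (\<i> * of_int k * g k \<xi>)) = (\<lambda>k \<xi>. (-1) * (- (of_int k ^ 2 + of_real \<xi> ^ 2) * ?h k \<xi>))"
    proof (intro ext)
      fix k :: int and \<xi> :: real
      have "(-1) * (- (of_int k ^ 2 + of_real \<xi> ^ 2) * ?h k \<xi>)
          = - (((of_int k ^ 2 + of_real \<xi> ^ 2) * (of_int k * complex_of_real (pk k \<xi> powr (-1)))) * of_real \<xi> * g k \<xi>)"
        by (simp only: mult_minus_left mult_minus_right minus_minus mult_1_left mult_ac)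
      also have "\<dots> = \<i> * of_real \<xi> * (\<i> * of_int k * g k \<xi>)" unfolding pk1 by (simp add: algebra_simps)
      finally show "\<i> * of_real \<xi> * (\<i> * of_int k * g k \<xi>) = (-1) * (- (of_int k ^ 2 + of_real \<xi> ^ 2) * ?h k \<xi>)" by simp
    qed
    also have "\<psi> (IF (\<lambda>k \<xi>. (-1) * (- (of_int k ^ 2 + of_real \<xi> ^ 2) * ?h k \<xi>))) = - Lap \<psi> (IF ?h)"
      unfolding linear_dist_cmult[OF l\<psi> q[OF hs]] IF_Lap[OF l\<psi> hs] by simp
    also have "\<dots> = j t (IF ?h)" by (rule \<psi>(2)[OF schwartz_IF[OF hs]])
    finally have "2 * DX (b1 t) (IF g) = j t (IF (\<lambda>k \<xi>. 2 * ?h k \<xi>))" unfolding linear_dist_cmult[OF lin(2) hs] by simp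
    then show ?thesis by (simp add: mult.assoc)
  qed
  note A = sum_3 Ad_def us_def n if_False if_True simp_thms refl
  have j2: "j t (IF (\<lambda>k \<xi>. (- 2 * of_int k * of_real \<xi> * of_real (pk k \<xi> powr (-1)) - of_real \<nu> * (of_int k ^ 2 + of_real \<xi> ^ 2)) * g k \<xi>))
    = j t (IF (\<lambda>k \<xi>. - 2 * of_int k * of_real \<xi> * of_real (pk k \<xi> powr (-1)) * g k \<xi>)) + j t (IF (\<lambda>k \<xi>. - of_real \<nu> * (of_int k ^ 2 + of_real \<xi> ^ 2) * g k \<xi>))"
    (is "_ = j t (IF ?P) + j t (IF ?Q)")
  proof -
    have Q: "sg ?Q" using sg_Ad[OF g, of 1 1] unfolding Ad_def by (simp only: simp_thms if_True)
    have "sg (\<lambda>k \<xi>. (- 2 * of_int k * of_real \<xi> * of_real (pk k \<xi> powr (-1)) - of_real \<nu> * (of_int k ^ 2 + of_real \<xi> ^ 2)) * g k \<xi> + (-1) * ?Q k \<xi>)"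
      by (rule sg_add[OF _ sg_cmult[OF Q]], insert sg_Ad[OF g, of 2 2], unfold Ad_def, simp only: n if_False if_True simp_thms)
    moreover have "(\<lambda>k \<xi>. (- 2 * of_int k * of_real \<xi> * of_real (pk k \<xi> powr (-1)) - of_real \<nu> * (of_int k ^ 2 + of_real \<xi> ^ 2)) * g k \<xi> + (-1) * ?Q k \<xi>) = ?P"
      by (intro ext) (simp add: algebra_simps)
    ultimately have P: "sg ?P" by simp
    have "(\<lambda>k \<xi>. (- 2 * of_int k * of_real \<xi> * of_real (pk k \<xi> powr (-1)) - of_real \<nu> * (of_int k ^ 2 + of_real \<xi> ^ 2)) * g k \<xi>)
      = (\<lambda>k \<xi>. ?P k \<xi> + ?Q k \<xi>)" by (intro ext) (simp add: algebra_simps)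
    then show ?thesis using linear_dist_add[OF lin(2) P Q] by simp
  qed
  have alg2: "x + y - a - c - e = 0 \<Longrightarrow> x = - y + (a + (e + c) + 0)" for x y a c e :: complex
    by (simp add: algebra_simps)
  have alg3: "x + y - a = 0 \<Longrightarrow> x = - y + (0 + 0 + a)" for x y a :: complex
    by (simp add: algebra_simps)
  have n1: "DT w t (IF g) = - w t (IF (\<lambda>k \<xi>. of_int k * g' k \<xi>)) + (\<Sum>l\<in>UNIV. us l t (IF (\<lambda>k \<xi>. Ad k \<xi> 1 l * g k \<xi>)))"
    using eqs(1) unfolding A y[OF lin(1)] dx[OF lin(2)] dx[OF lin(3)] lap[OF lin(1)] by (simp add: algebra_simps)
  have n2: "DT j t (IF g) = - j t (IF (\<lambda>k \<xi>. of_int k * g' k \<xi>)) + (\<Sum>l\<in>UNIV. us l t (IF (\<lambda>k \<xi>. Ad k \<xi> 2 l * g k \<xi>)))"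
  proof -
    have "(\<Sum>l\<in>UNIV. us l t (IF (\<lambda>k \<xi>. Ad k \<xi> 2 l * g k \<xi>))) = w t (IF (\<lambda>k \<xi>. - \<i> * of_int k * g k \<xi>))
      + (j t (IF (\<lambda>k \<xi>. - 2 * of_int k * of_real \<xi> * of_real (pk k \<xi> powr (-1)) * g k \<xi>)) + j t (IF (\<lambda>k \<xi>. - of_real \<nu> * (of_int k ^ 2 + of_real \<xi> ^ 2) * g k \<xi>))) + 0"
      by (simp only: A j2 zero[OF lin(3)])
    then show ?thesis using alg2[OF eqs(2)[unfolded y[OF lin(2)] dx[OF lin(1)] lap[OF lin(2)] b]] by (simp only: add.assoc)
  qed
  have n3: "DT \<theta> t (IF g) = - \<theta> t (IF (\<lambda>k \<xi>. of_int k * g' k \<xi>)) + (\<Sum>l\<in>UNIV. us l t (IF (\<lambda>k \<xi>. Ad k \<xi> 3 l * g k \<xi>)))"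
  proof -
    have "(\<Sum>l\<in>UNIV. us l t (IF (\<lambda>k \<xi>. Ad k \<xi> 3 l * g k \<xi>))) = 0 + 0 + \<theta> t (IF (\<lambda>k \<xi>. - of_real \<eta> * (of_int k ^ 2 + of_real \<xi> ^ 2) * g k \<xi>))"
      by (simp only: A zero[OF lin(1)] zero[OF lin(2)])
    with alg3[OF eqs(3)[unfolded y[OF lin(3)] lap[OF lin(3)]]] show ?thesis by (rule eq_neg_add_subst)
  qed
  consider "i = 1" | "i = 2" | "i = 3" using exhaust_3[of i] by blast
  then show ?thesis
  proof cases
    case 1 then show ?thesis using n1 by (simp only: us_def if_True simp_thms)
  next
    case 2 then show ?thesis using n2 by (simp only: us_def if_True if_False n simp_thms)
  next
    case 3 then show ?thesis using n3 by (simp only: us_def if_True if_False n simp_thms)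
  qed
qed

text \<open>The evolved test function \<open>\<Phi>\<close> is a row of the propagator times the
  transported \<psi>. Its pairing is constant because \<partial>t \<open>\<Phi>\<close> equals k
  \<partial>\<xi> \<open>\<Phi>\<close> minus the transposed symbol applied to
  \<open>\<Phi>\<close>, the exact counterpart of \<open>pde\<close>.\<close>

lemma dual_identity:
  assumes T: "T \<ge> 0" and \<psi>: "sg \<psi>"
  shows "us i T (IF \<psi>) = (\<Sum>m\<in>UNIV. us m 0 (IF (\<lambda>k \<xi>. U T k \<xi> i m * \<psi> k (\<xi> - of_int k * T))))"
proof -
  obtain \<psi>' where \<psi>': "\<forall>k \<xi>. (\<psi> k has_vector_derivative \<psi>' k \<xi>) (at \<xi>)" "sg \<psi>'" using \<psi> by (rule sgE)
  define P where "P = (\<lambda>t k \<xi>. \<psi> k (\<xi> + of_int k * (t - T)))"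
  define P2 where "P2 = (\<lambda>t k \<xi>. \<psi>' k (\<xi> + of_int k * (t - T)))"
  have P: "sf T P" and P2: "sf T P2" unfolding P_def P2_def using T by (intro sf_shift \<psi> \<psi>'; simp)+
  have P_dt: "dt P (\<lambda>t k \<xi>. of_int k * P2 t k \<xi>)" unfolding dt_def
  proof (intro allI)
    fix t :: real and k :: int and \<xi> :: real
    have "((\<lambda>s. \<xi> + of_int k * (s - T)) has_vector_derivative of_int k) (at t)"
      unfolding has_real_derivative_iff_has_vector_derivative[symmetric] by (auto intro!: derivative_eq_intros)
    from vector_diff_chain_at[OF this \<psi>'(1)[rule_format, of k "\<xi> + of_int k * (t - T)"]]
    show "((\<lambda>s. P s k \<xi>) has_vector_derivative of_int k * P2 t k \<xi>) (at t)"
      unfolding P_def P2_def o_def by (simp add: scaleR_conv_of_real)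
  qed
  have P_dxi: "dxi P P2" unfolding dxi_def
  proof (intro allI)
    fix t :: real and k :: int and \<xi> :: real
    have "((\<lambda>s. s + of_int k * (t - T)) has_vector_derivative 1) (at \<xi>)"
      unfolding has_real_derivative_iff_has_vector_derivative[symmetric] by (auto intro!: derivative_eq_intros)
    from vector_diff_chain_at[OF this \<psi>'(1)[rule_format, of k "\<xi> + of_int k * (t - T)"]]
    show "(P t k has_vector_derivative P2 t k \<xi>) (at \<xi>)"
      unfolding P_def P2_def o_def by (simp add: scaleR_conv_of_real)
  qed
  define V where "V m = (\<lambda>t k \<xi>. U (T - t) k \<xi> i m)" for m
  have V: "om T (V m)" for m unfolding V_def by (rule om_U)
  have "\<exists>V1 V2. dt (V m) V1 \<and> dxi (V m) V2 \<and> om T V1 \<and> om T V2" for m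
    using V[of m] by (rule smthE) blast
  then obtain V1 V2 where V12: "\<And>m. dt (V m) (V1 m)" "\<And>m. dxi (V m) (V2 m)" "\<And>m. om T (V1 m)" "\<And>m. om T (V2 m)" by metis
  \<comment> \<open>For k \<noteq> 0 the products with \<open>Ad\<close> from the left cancel
    between the time derivative and k times the frequency derivative, as \<open>Bd\<close> is
    -\<open>Ad\<close>/k; multiplication from the right remains. For k = 0 all matrices are
    diagonal.\<close>
  have V_eq: "V1 m t k \<xi> = of_int k * V2 m t k \<xi> - (\<Sum>l\<in>UNIV. V l t k \<xi> * Ad k \<xi> l m)" for m t k \<xi>
  proof -
    have s: "((\<lambda>t. T - t) has_vector_derivative - 1) (at t)"
      unfolding has_real_derivative_iff_has_vector_derivative[symmetric] by (auto intro!: derivative_eq_intros)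
    have "((\<lambda>s. V m s k \<xi>) has_vector_derivative - (\<Sum>l\<in>UNIV. Ad k (\<xi> - of_int k * (T - t)) i l * U (T - t) k \<xi> l m)) (at t)"
      using vector_diff_chain_at[OF s U_time_deriv[of k \<xi> i m "T - t"]] unfolding V_def o_def by simp
    then have 1: "V1 m t k \<xi> = - (\<Sum>l\<in>UNIV. Ad k (\<xi> - of_int k * (T - t)) i l * U (T - t) k \<xi> l m)"
      using V12(1)[of m] vector_derivative_unique_at unfolding dt_def by blast
    show ?thesis
    proof (cases "k = 0")
      case True
      show ?thesis unfolding 1 unfolding True Ad_zero_sum unfolding V_def sum_3 Ad_zero
        unfolding U_def kron_def using exhaust_3[of i] exhaust_3[of m] by (elim disjE) simp_all
    next
      case False
      have "((\<lambda>\<xi>. V m t k \<xi>) has_vector_derivative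
         (\<Sum>l\<in>UNIV. Bd k (\<xi> - of_int k * (T - t)) i l * U (T - t) k \<xi> l m) - (\<Sum>l\<in>UNIV. U (T - t) k \<xi> i l * Bd k \<xi> l m)) (at \<xi>)"
        using U_freq_deriv[of "T - t" k i m \<xi>] False unfolding V_def by simp
      then have 2: "V2 m t k \<xi> = (\<Sum>l\<in>UNIV. Bd k (\<xi> - of_int k * (T - t)) i l * U (T - t) k \<xi> l m) - (\<Sum>l\<in>UNIV. U (T - t) k \<xi> i l * Bd k \<xi> l m)"
        using V12(2)[of m] vector_derivative_unique_at unfolding dxi_def by blast
      show ?thesis unfolding 1 2 V_def sum_3 Bd_def using False by (simp add: field_simps)
    qed
  qed
  define \<Phi> where "\<Phi> m = (\<lambda>t k \<xi>. V m t k \<xi> * P t k \<xi>)" for m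
  define X where "X m = (\<lambda>t k \<xi>. V m t k \<xi> * P2 t k \<xi> + V2 m t k \<xi> * P t k \<xi>)" for m
  define Y where "Y m = (\<lambda>t k \<xi>. V m t k \<xi> * (of_int k * P2 t k \<xi>) + V1 m t k \<xi> * P t k \<xi>)" for m
  have \<Phi>: "sf T (\<Phi> m)" for m unfolding \<Phi>_def by (rule sf_mult[OF V P])
  have X: "sf T (X m)" for m unfolding X_def by (rule sf_add[OF sf_mult[OF V P2] sf_mult[OF V12(4) P]])
  have Y: "sf T (Y m)" for m unfolding Y_def by (rule sf_add[OF sf_mult[OF V sf_mult[OF om_k P2]] sf_mult[OF V12(3) P]])
  have dX: "dxi (\<Phi> m) (X m)" for m unfolding \<Phi>_def X_def by (rule dxi_mult[OF V12(2) P_dxi])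
  have dY: "dt (\<Phi> m) (Y m)" for m unfolding \<Phi>_def Y_def by (rule dt_mult[OF V12(1) P_dt])
  have Y_eq: "Y m t = (\<lambda>k \<xi>. of_int k * X m t k \<xi> + (-1) * ((Ad k \<xi> 1 m * \<Phi> 1 t k \<xi> + Ad k \<xi> 2 m * \<Phi> 2 t k \<xi>) + Ad k \<xi> 3 m * \<Phi> 3 t k \<xi>))" for m t
    unfolding Y_def X_def \<Phi>_def V_eq sum_3 by (intro ext) (simp add: algebra_simps)
  define F where "F s = (\<Sum>m\<in>UNIV. us m s (IF (\<Phi> m s)))" for s
  have D: "(F has_vector_derivative 0) (at t)" if t: "0 < t" "t < T" for t
  proof -
    have tT: "t \<in> {0..T}" using t by simp
    have sl: "sg (\<Phi> m t)" "sg (X m t)" for m by (rule sf_slice[OF \<Phi> tT], rule sf_slice[OF X tT])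
    have dx: "\<forall>k \<xi>. (\<Phi> m t k has_vector_derivative X m t k \<xi>) (at \<xi>)" for m using dX[of m] unfolding dxi_def by blast
    define a where "a l m r = us l t (IF (\<lambda>k \<xi>. Ad k \<xi> m r * \<Phi> m t k \<xi>))" for l m r
    have 1: "DT (us m) t (IF (\<Phi> m t)) = - us m t (IF (\<lambda>k \<xi>. of_int k * X m t k \<xi>)) + (\<Sum>l\<in>UNIV. a l m l)" for m
      unfolding a_def by (rule pde[OF t(1) sl(1) dx sl(2)])
    have 2: "us m t (IF (Y m t)) = us m t (IF (\<lambda>k \<xi>. of_int k * X m t k \<xi>)) - (\<Sum>l\<in>UNIV. a m l m)" for m
    proof -
      have lin: "linear_dist (us m t)" using us_linear t by simp
      have k: "sg (\<lambda>k \<xi>. of_int k * X m t k \<xi>)" by (rule sg_mult[OF om_k sl(2)])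
      note S = sg_Ad[OF sl(1)]
      show ?thesis unfolding Y_eq a_def sum_3
        using linear_dist_add[OF lin k sg_cmult[OF sg_add[OF sg_add[OF S S] S], of "-1"]]
          linear_dist_cmult[OF lin sg_add[OF sg_add[OF S S] S], of "-1"]
          linear_dist_add[OF lin sg_add[OF S S] S] linear_dist_add[OF lin S S]
        by simp
    qed
    have "(F has_vector_derivative (\<Sum>m\<in>UNIV. DT (us m) t (IF (\<Phi> m t)) + us m t (IF (Y m t)))) (at t)"
      unfolding F_def by (intro has_vector_derivative_sum pairing_derivative[OF us_continuous us_differentiable \<Phi> dY Y t])
    moreover have "(\<Sum>m\<in>UNIV. DT (us m) t (IF (\<Phi> m t)) + us m t (IF (Y m t))) = 0"
      unfolding 1 2 sum_3 by simp
    ultimately show ?thesis by simp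
  qed
  have cF: "continuous_on {0..T} F" unfolding F_def
    by (intro continuous_on_sum pairing_continuous[OF us_continuous \<Phi>])
  \<comment> \<open>The equation is available only for t > 0, so the derivative vanishes in the open
    interval and continuity reaches both endpoints.\<close>
  have "F T = F 0"
  proof (rule has_derivative_zero_unique_strong_interval[where a = 0 and b = T and k = "{0, T}"])
    show "(F has_derivative (\<lambda>h. 0)) (at x within {0..T})" if "x \<in> {0..T} - {0, T}" for x
      using D[of x] that unfolding has_vector_derivative_def by (auto intro: has_derivative_at_withinI)
  qed (use T cF in auto)
  moreover have "F T = us i T (IF \<psi>)"
  proof -
    have "us m T (IF (\<Phi> m T)) = kron i m * us m T (IF \<psi>)" for m
      unfolding linear_dist_cmult[OF us_linear[OF T] \<psi>, symmetric] by (simp add: \<Phi>_def V_def P_def U_0)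
    then show ?thesis unfolding F_def by (simp only: sum_kron)
  qed
  moreover have "F 0 = (\<Sum>m\<in>UNIV. us m 0 (IF (\<lambda>k \<xi>. U T k \<xi> i m * \<psi> k (\<xi> - of_int k * T))))"
    by (simp add: F_def \<Phi>_def V_def P_def)
  ultimately show ?thesis by simp
qed

end

section \<open>Representation of solutions with finite norms\<close>

definition wb :: "real \<Rightarrow> int \<Rightarrow> real \<Rightarrow> real" where
  "wb b k \<xi> = (1 + (of_int k)\<^sup>2 + \<xi>\<^sup>2) powr (b/2)"

lemma om_wb:
  assumes x: "om T (\<lambda>t k \<xi>. of_real (x t k \<xi>))"
  shows "om T (\<lambda>t k \<xi>. complex_of_real (wb b k (x t k \<xi>)))"
  unfolding wb_def
proof (rule om_powr)
  have "om T (\<lambda>t k \<xi>. (1 + of_int k ^ 2) + of_real (x t k \<xi>) ^ 2)"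
    by (rule om_add[OF om_add[OF om_const om_power[OF om_k]] om_power[OF x]])
  then show "om T (\<lambda>t k \<xi>. complex_of_real (1 + (real_of_int k)\<^sup>2 + (x t k \<xi>)\<^sup>2))" by simp
qed simp

text \<open>Nonzero wave numbers have modulus at least 1 and \<open>0 powr s\<close> is 0, so
  negative powers are bounded multipliers; the exponent -1/3 will undo the weight of the temperature
  data.\<close>

lemma om_abs_powr:
  assumes s: "s \<le> 1" shows "om T (\<lambda>t k \<xi>. complex_of_real (\<bar>of_int k\<bar> powr s))"
proof (rule om_kfun[where B = 1 and n = 1])
  fix k :: int
  show "norm (complex_of_real (\<bar>of_int k\<bar> powr s)) \<le> 1 * (1 + \<bar>real_of_int k\<bar>) ^ 1"
  proof (cases "k = 0")
    case False
    then have k: "1 \<le> \<bar>real_of_int k\<bar>" by linarith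
    have "\<bar>real_of_int k\<bar> powr s \<le> \<bar>real_of_int k\<bar> powr 1" using k s by (intro powr_mono) auto
    then show ?thesis using k by simp
  qed simp
qed

lemma om_shift_t: "om T (\<lambda>t k \<xi>. of_real (\<xi> + t * of_int k))"
  using om_add[OF om_xi om_mult[OF om_t om_k]] by simp

lemma om_shift_c: "om T (\<lambda>t k \<xi>. of_real (\<xi> + c * of_int k))"
  using om_add[OF om_xi om_cmult[OF om_k], of T "of_real c"] by simp

text \<open>The symbol is even in (k, \<xi>), which absorbs the sign change from
  transposition.\<close>

lemma Lambda_eq:
  assumes \<phi>: "schwartz \<phi>"
  shows "Lambda t b u \<phi> = u (IF (\<lambda>k \<xi>. of_real (wb b k (\<xi> + t * of_int k)) * fourier \<phi> k \<xi>))"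
proof -
  have m: "(\<lambda>k \<xi>. (1 + (real_of_int (- k))\<^sup>2 + (- \<xi> + t * real_of_int (- k))\<^sup>2) powr (b / 2)) = (\<lambda>k \<xi>. wb b k (\<xi> + t * of_int k))"
  proof (intro ext)
    fix k :: int and \<xi> :: real
    have "(- \<xi> + t * real_of_int (- k))\<^sup>2 = (\<xi> + t * of_int k)\<^sup>2" by (simp add: power2_eq_square algebra_simps)
    then show "(1 + (real_of_int (- k))\<^sup>2 + (- \<xi> + t * real_of_int (- k))\<^sup>2) powr (b / 2) = wb b k (\<xi> + t * of_int k)"
      by (simp only: wb_def of_int_minus power2_minus)
  qed
  show ?thesis unfolding Lambda_def mult_def m
    by (rule arg_cong[of _ _ u], rule mult_fun_IF, rule sg_mult[OF om_wb[OF om_shift_c] sg_fourier[OF \<phi>]])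
qed

lemma absDx_eq:
  assumes \<phi>: "schwartz \<phi>" and s: "s \<le> 1"
  shows "absDx s u \<phi> = u (IF (\<lambda>k \<xi>. of_real (\<bar>of_int k\<bar> powr s) * fourier \<phi> k \<xi>))"
  unfolding absDx_def mult_def of_int_minus abs_minus_cancel
  by (rule arg_cong[of _ _ u], rule mult_fun_IF, rule sg_mult[OF om_abs_powr[OF s] sg_fourier[OF \<phi>]])

lemma sg_shift:
  assumes g: "sg g" and T: "T \<ge> 0" shows "sg (\<lambda>k \<xi>. g k (\<xi> - of_int k * T))"
  using sf_slice[OF sf_shift[OF g T order_refl], of 0] T by simp

lemma fourier_lincomb:
  assumes "schwartz \<phi>" "schwartz \<psi>"
  shows "fourier (\<lambda>p. a * \<phi> p + c * \<psi> p) = (\<lambda>k \<xi>. a * fourier \<phi> k \<xi> + c * fourier \<psi> k \<xi>)"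
proof (intro ext)
  fix k \<xi>
  have "(\<integral>p. (a * \<phi> p + c * \<psi> p) * ez (-k, -\<xi>) p \<partial>OmM)
    = (\<integral>p. a * (\<phi> p * ez (-k, -\<xi>) p) + c * (\<psi> p * ez (-k, -\<xi>) p) \<partial>OmM)"
    by (simp add: algebra_simps)
  also have "\<dots> = a * (\<integral>p. \<phi> p * ez (-k, -\<xi>) p \<partial>OmM) + c * (\<integral>p. \<psi> p * ez (-k, -\<xi>) p \<partial>OmM)"
    using assms[THEN schwartz_integrable_ez] by simp
  finally show "fourier (\<lambda>p. a * \<phi> p + c * \<psi> p) k \<xi> = a * fourier \<phi> k \<xi> + c * fourier \<psi> k \<xi>"
    unfolding fourier_ez .
qed

lemma nn_integral_FM_shift:
  assumes f: "f \<in> borel_measurable FM"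
  shows "(\<integral>\<^sup>+z. f (fst z, snd z - of_int (fst z) * T) \<partial>FM) = (\<integral>\<^sup>+z. f z \<partial>FM)"
proof -
  have fk: "(\<lambda>\<xi>. f (k, \<xi>)) \<in> borel_measurable borel" for k
  proof -
    have "(\<lambda>\<xi>. (k, \<xi>)) \<in> measurable borel FM" unfolding FM_def by (rule measurable_Pair) auto
    from measurable_compose[OF this f] show ?thesis .
  qed
  have "(\<lambda>z. f (fst z, snd z - of_int (fst z) * T)) \<in> borel_measurable FM"
  proof (rule measurable_FM)
    fix k
    have "(\<lambda>\<xi>::real. \<xi> - of_int k * T) \<in> borel_measurable borel" by measurable
    from measurable_compose[OF this fk[of k]]
    show "(\<lambda>\<xi>. f (fst (k, \<xi>), snd (k, \<xi>) - of_int (fst (k, \<xi>)) * T)) \<in> borel_measurable borel" by simp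
  qed
  from nn_integral_FM[OF this]
  have "(\<integral>\<^sup>+z. f (fst z, snd z - of_int (fst z) * T) \<partial>FM) = (\<integral>\<^sup>+k. \<integral>\<^sup>+\<xi>. f (k, \<xi> - of_int k * T) \<partial>lborel \<partial>count_space UNIV)" by simp
  also have "\<dots> = (\<integral>\<^sup>+k. \<integral>\<^sup>+\<xi>. f (k, \<xi>) \<partial>lborel \<partial>count_space UNIV)"
  proof (rule nn_integral_cong)
    fix k :: int
    show "(\<integral>\<^sup>+\<xi>. f (k, \<xi> - of_int k * T) \<partial>lborel) = (\<integral>\<^sup>+\<xi>. f (k, \<xi>) \<partial>lborel)"
      using nn_integral_real_affine[OF fk[of k], of 1 "- (of_int k * T)"] by simp
  qed
  also have "\<dots> = (\<integral>\<^sup>+z. f z \<partial>FM)" by (rule nn_integral_FM[OF f, symmetric])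
  finally show ?thesis .
qed

lemma fourier_shift_l2:
  assumes \<phi>: "schwartz \<phi>" and T: "T \<ge> 0"
  defines "g \<equiv> \<lambda>z. fourier \<phi> (fst z) (snd z - of_int (fst z) * T)"
  shows "l2 FM g" "nrm2 FM g \<le> 2 * pi * nrm2 OmM \<phi>"
proof -
  let ?f = "\<lambda>z. fourier \<phi> (fst z) (snd z)"
  show g: "l2 FM g" unfolding g_def by (rule l2_sg[OF sg_shift[OF sg_fourier[OF \<phi>] T]])
  have f: "l2 FM ?f" by (rule l2_sg[OF sg_fourier[OF \<phi>]])
  have m: "(\<lambda>z. ennreal ((norm (?f z))\<^sup>2)) \<in> borel_measurable FM"
    using l2_measurable[OF f] by measurable
  have "ennreal ((nrm2 FM g)\<^sup>2) = ennreal ((nrm2 FM ?f)\<^sup>2)"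
    unfolding l2_nn_integral[OF g, symmetric] l2_nn_integral[OF f, symmetric] unfolding g_def
    using nn_integral_FM_shift[OF m, of T] by simp
  then have "(nrm2 FM g)\<^sup>2 = (nrm2 FM ?f)\<^sup>2" by simp
  then have "nrm2 FM g = nrm2 FM ?f" by (simp only: power2_eq_iff_nonneg nrm2_nonneg)
  then show "nrm2 FM g \<le> 2 * pi * nrm2 OmM \<phi>" using bessel_fourier[OF \<phi>] by simp
qed

text \<open>Riesz representation on the frequency side, over symbols read as functions of the pair
  (k, \<xi>). It turns a norm bound for weighted initial data into a square-integrable density,
  although the data themselves are only distributions.\<close>

lemma riesz_FM:
  assumes u: "linear_dist u" and q: "om 0 (\<lambda>_. q)" and K: "K \<ge> 0"
    and bd: "\<And>g. sg g \<Longrightarrow> norm (u (IF (\<lambda>k \<xi>. q k \<xi> * g k \<xi>))) \<le> K * nrm2 FM (\<lambda>z. g (fst z) (snd z))"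
  shows "\<exists>d. l2 FM d \<and> nrm2 FM d \<le> K \<and>
    (\<forall>g. sg g \<longrightarrow> u (IF (\<lambda>k \<xi>. q k \<xi> * g k \<xi>)) = (\<integral>z. d z * g (fst z) (snd z) \<partial>FM))"
proof -
  define S where "S = {G. \<exists>g. sg g \<and> G = (\<lambda>z. g (fst z) (snd z :: real) :: complex)}"
  define l where "l G = u (IF (\<lambda>k \<xi>. q k \<xi> * G (k, \<xi>)))" for G
  have S: "(\<lambda>z. g (fst z) (snd z)) \<in> S" if "sg g" for g unfolding S_def using that by blast
  have Sx: "\<exists>g. sg g \<and> G = (\<lambda>z. g (fst z) (snd z))" if "G \<in> S" for G using that unfolding S_def by simp
  have "\<exists>f. l2 FM f \<and> nrm2 FM f \<le> K \<and> (\<forall>G\<in>S. l G = (\<integral>x. f x * G x \<partial>FM))"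
  proof (rule l2_riesz)
    show "S \<noteq> {}" using S[OF sg_zero] by blast
    show "(\<lambda>x. a * G x + c * H x) \<in> S" if GH: "G \<in> S" "H \<in> S" for G H a c
    proof -
      obtain g h where g: "sg g" "G = (\<lambda>z. g (fst z) (snd z))" and h: "sg h" "H = (\<lambda>z. h (fst z) (snd z))"
        using Sx[OF GH(1)] Sx[OF GH(2)] by metis
      show ?thesis unfolding g(2) h(2) using S[OF sg_add[OF sg_cmult[OF g(1)] sg_cmult[OF h(1)]]] by blast
    qed
    show "l2 FM G" if "G \<in> S" for G using Sx[OF that] l2_sg by auto
    show "l (\<lambda>x. a * G x + c * H x) = a * l G + c * l H" if GH: "G \<in> S" "H \<in> S" for G H a c
    proof -
      obtain g h where g: "sg g" "G = (\<lambda>z. g (fst z) (snd z))" and h: "sg h" "H = (\<lambda>z. h (fst z) (snd z))"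
        using Sx[OF GH(1)] Sx[OF GH(2)] by metis
      have "(\<lambda>k \<xi>. q k \<xi> * (a * g k \<xi> + c * h k \<xi>)) = (\<lambda>k \<xi>. a * (q k \<xi> * g k \<xi>) + c * (q k \<xi> * h k \<xi>))"
        by (intro ext) (simp add: algebra_simps)
      then show ?thesis unfolding l_def g(2) h(2) using linear_dist_lincomb[OF u sg_mult[OF q g(1)] sg_mult[OF q h(1)]] by simp
    qed
    show "norm (l G) \<le> K * nrm2 FM G" if G: "G \<in> S" for G
    proof -
      obtain g where g: "sg g" "G = (\<lambda>z. g (fst z) (snd z))" using Sx[OF G] by blast
      show ?thesis unfolding l_def g(2) using bd[OF g(1)] by simp
    qed
  qed (rule K)
  then obtain f where f: "l2 FM f" "nrm2 FM f \<le> K" "\<And>G. G \<in> S \<Longrightarrow> l G = (\<integral>x. f x * G x \<partial>FM)" by blast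
  have "u (IF (\<lambda>k \<xi>. q k \<xi> * g k \<xi>)) = (\<integral>z. f z * g (fst z) (snd z) \<partial>FM)" if "sg g" for g
    using f(3)[OF S[OF that]] unfolding l_def by simp
  with f show ?thesis by blast
qed

text \<open>Temperature data are measured only through |D_x|^(1/3); \<open>h1\<close> undoes this
  weight for k \<noteq> 0. At k = 0 both vanish for the temperature, since \<open>0 powr s\<close>
  is 0, so its zero mode is left undetermined.\<close>

definition h0 :: "3 \<Rightarrow> int \<Rightarrow> real" where "h0 i k = (if i = 3 then \<bar>of_int k\<bar> powr (1/3) else 1)"
definition h1 :: "3 \<Rightarrow> int \<Rightarrow> real" where "h1 i k = (if i = 3 then \<bar>of_int k\<bar> powr (-1/3) else 1)"

lemma om_h0: "om T (\<lambda>t k \<xi>. complex_of_real (h0 i k))"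
  unfolding h0_def by (cases "i = 3") (simp_all add: om_abs_powr om_const)
lemma om_h1: "om T (\<lambda>t k \<xi>. complex_of_real (h1 i k))"
  unfolding h1_def by (cases "i = 3") (simp_all add: om_abs_powr om_const)
lemma h0_mult_h1: "i \<noteq> 3 \<or> k \<noteq> 0 \<Longrightarrow> h0 i k * h1 i k = 1"
  unfolding h0_def h1_def by (auto simp: powr_add[symmetric])

context bmhd_sol begin

text \<open>Testing the weighted data with \<open>IF g\<close> exposes the weight by
  \<open>fourier_IF\<close>, and \<open>plancherel_IF\<close> converts the norm of the test function
  at the price 1/(2\<pi>).\<close>

lemma data_exists:
  assumes A: "\<And>i. A i \<ge> (0::real)" "H_norm b (w 0) \<le> ennreal (A 1)" "H_norm b (j 0) \<le> ennreal (A 2)"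
      "H_norm b (absDx (1/3) (\<theta> 0)) \<le> ennreal (A 3)"
  shows "\<exists>d. \<forall>i::3. l2 FM (d i) \<and> nrm2 FM (d i) \<le> A i / (2*pi) \<and>
    (\<forall>g. sg g \<longrightarrow> us i 0 (IF (\<lambda>k \<xi>. (of_real (wb b k \<xi>) * of_real (h0 i k)) * g k \<xi>)) = (\<integral>z. d i z * g (fst z) (snd z) \<partial>FM))"
proof (rule choice, rule allI, rule riesz_FM)
  fix i :: 3
  show "linear_dist (us i 0)" by (rule us_linear) simp
  show "om 0 (\<lambda>_ k \<xi>. of_real (wb b k \<xi>) * of_real (h0 i k))" by (rule om_mult[OF om_wb[OF om_xi] om_h0])
  show "A i / (2*pi) \<ge> 0" using A(1) by simp
  fix g assume g: "sg g"
  note s = schwartz_IF[OF g]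
  have L: "Lambda 0 b u (IF g) = u (IF (\<lambda>k \<xi>. of_real (wb b k \<xi>) * g k \<xi>))" for u
    using Lambda_eq[OF s, of 0 b u] unfolding fourier_IF[OF g] by simp
  have wg: "sg (\<lambda>k \<xi>. of_real (wb b k \<xi>) * g k \<xi>)" by (rule sg_mult[OF om_wb[OF om_xi] g])
  have L3: "Lambda 0 b (absDx (1/3) u) (IF g) = u (IF (\<lambda>k \<xi>. (of_real (wb b k \<xi>) * of_real (\<bar>of_int k\<bar> powr (1/3))) * g k \<xi>))" for u
    unfolding L using absDx_eq[OF schwartz_IF[OF wg], of "1/3" u] unfolding fourier_IF[OF wg] by (simp add: ac_simps)
  have bd: "norm (F (IF g)) \<le> A i / (2*pi) * nrm2 FM (\<lambda>z. g (fst z) (snd z))" if "L2_norm F \<le> ennreal (A i)" for F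
    using L2_norm_bound[OF s that A(1)] unfolding plancherel_IF[OF g] by simp
  have n: "(2::3) \<noteq> 1" "(3::3) \<noteq> 1" "(3::3) \<noteq> 2" "(1::3) \<noteq> 3" "(2::3) \<noteq> 3" by simp_all
  consider "i = 1" | "i = 2" | "i = 3" using exhaust_3[of i] by blast
  then show "norm (us i 0 (IF (\<lambda>k \<xi>. of_real (wb b k \<xi>) * of_real (h0 i k) * g k \<xi>))) \<le> A i / (2*pi) * nrm2 FM (\<lambda>z. g (fst z) (snd z))"
  proof cases
    case 1
    show ?thesis using bd[of "Lambda 0 b (w 0)"] A(2) unfolding H_norm_def L 1
      by (simp only: us_def h0_def n if_True if_False simp_thms of_real_1 mult_1_right)
  next
    case 2
    show ?thesis using bd[of "Lambda 0 b (j 0)"] A(3) unfolding H_norm_def L 2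
      by (simp only: us_def h0_def n if_True if_False simp_thms of_real_1 mult_1_right)
  next
    case 3
    show ?thesis using bd[of "Lambda 0 b (absDx (1/3) (\<theta> 0))"] A(4) unfolding H_norm_def L3 3
      by (simp only: us_def h0_def n if_True if_False simp_thms)
  qed
qed

end

locale bmhd_data = bmhd_sol +
  fixes b :: real and d :: "3 \<Rightarrow> int \<times> real \<Rightarrow> complex"
  assumes d_l2: "l2 FM (d i)"
    and d_rep: "sg g \<Longrightarrow> us i 0 (IF (\<lambda>k \<xi>. (of_real (wb b k \<xi>) * of_real (h0 i k)) * g k \<xi>)) = (\<integral>z. d i z * g (fst z) (snd z) \<partial>FM)"
begin

text \<open>Data for the ODE: the temperature weight is taken off again, whereas the weight of order
  b stays inside, since a scalar depending on the frequency label passes through the linear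
  propagator.\<close>

definition dd :: "int \<times> real \<Rightarrow> 3 \<Rightarrow> complex" where "dd z i = of_real (h1 i (fst z)) * d i z"

abbreviation "so z t i \<equiv> sol (dd z) (fst z) (snd z) t i"

text \<open>Wave numbers are countable, so joint measurability reduces to joint continuity in time
  and \<zeta> at each fixed k.\<close>

lemma U_measurable: "(\<lambda>v. U (fst v) (fst (snd v)) (snd (snd v)) i m) \<in> borel_measurable (borel \<Otimes>\<^sub>M FM)"
proof (rule measurable_compose_countable[where g = "\<lambda>v. fst (snd v)" and f = "\<lambda>k v. U (fst v) k (snd (snd v)) i m"])
  show "(\<lambda>v. fst (snd v)) \<in> measurable (borel \<Otimes>\<^sub>M FM) (count_space UNIV)" unfolding FM_def by measurable
  fix k
  have 1: "(\<lambda>v. U (fst v) k (snd v) i m) \<in> borel_measurable borel"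
    by (rule borel_measurable_continuous_onI[OF U_joint_continuous])
  have 2: "(\<lambda>v. (fst v, snd (snd v))) \<in> measurable (borel \<Otimes>\<^sub>M FM) (borel :: (real \<times> real) measure)"
    unfolding FM_def borel_prod[symmetric] by measurable
  from measurable_compose[OF 2 1] show "(\<lambda>v. U (fst v) k (snd (snd v)) i m) \<in> borel_measurable (borel \<Otimes>\<^sub>M FM)" by simp
qed

lemma dd_measurable: "(\<lambda>z. dd z i) \<in> borel_measurable FM"
proof -
  have "(\<lambda>z. complex_of_real (h1 i (fst z))) \<in> borel_measurable FM" unfolding FM_def by measurable
  then show ?thesis unfolding dd_def using l2_measurable[OF d_l2] by measurable
qed

lemma so_measurable: "(\<lambda>v. so (snd v) (fst v) i) \<in> borel_measurable (borel \<Otimes>\<^sub>M FM)"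
proof -
  have "(\<lambda>v. dd (snd v) m) \<in> borel_measurable (borel \<Otimes>\<^sub>M FM)" for m
    by (rule measurable_compose[OF measurable_snd dd_measurable])
  then show ?thesis unfolding sol_def by (intro borel_measurable_sum borel_measurable_times U_measurable)
qed

lemma so_measurable_slice: "(\<lambda>z. so z t i) \<in> borel_measurable FM"
  using measurable_compose[OF measurable_Pair1' so_measurable, of t] by simp

text \<open>\<open>dual_identity\<close> for a weighted test function: the shift by k T turns
  \<open>wb\<close> at \<xi> + T k into \<open>wb\<close> at the label, the weight that
  \<open>d_rep\<close> expects. The condition on \<open>m\<close> at k = 0 excludes the temperature
  mode on which the data give no information.\<close>

lemma us_rep:
  assumes T: "T \<ge> 0" and m: "om 0 (\<lambda>_. m)" and m3: "\<And>\<xi>. i = 3 \<Longrightarrow> m 0 \<xi> = 0" and g: "sg g"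
  shows "us i T (IF (\<lambda>k \<xi>. of_real (wb b k (\<xi> + T * of_int k)) * (m k \<xi> * g k \<xi>)))
    = (\<integral>z. (m (fst z) (snd z - of_int (fst z) * T) * so z T i) * g (fst z) (snd z - of_int (fst z) * T) \<partial>FM)"
proof -
  let ?\<psi> = "\<lambda>k \<xi>. of_real (wb b k (\<xi> + T * of_int k)) * (m k \<xi> * g k \<xi>)"
  define G where "G k \<xi> = m k (\<xi> - of_int k * T) * g k (\<xi> - of_int k * T)" for k \<xi>
  have G: "sg G" unfolding G_def by (rule sg_shift[OF sg_mult[OF m g] T])
  have \<psi>: "sg ?\<psi>" by (rule sg_mult[OF om_wb[OF om_shift_c] sg_mult[OF m g]])
  have oU: "om 0 (\<lambda>_ k \<xi>. U T k \<xi> i l)" for l using om_slice[OF om_U[of T i l], of 0] T by simp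
  have gl: "sg (\<lambda>k \<xi>. of_real (h1 l k) * (U T k \<xi> i l * G k \<xi>))" for l
    by (rule sg_mult[OF om_h1 sg_mult[OF oU G]])
  have e: "U T k \<xi> i l * ?\<psi> k (\<xi> - of_int k * T)
      = (of_real (wb b k \<xi>) * of_real (h0 l k)) * (of_real (h1 l k) * (U T k \<xi> i l * G k \<xi>))" for l k \<xi>
  proof (cases "l \<noteq> 3 \<or> k \<noteq> 0")
    case True
    have "complex_of_real (h0 l k) * of_real (h1 l k) = 1" using arg_cong[OF h0_mult_h1[OF True], of complex_of_real] by simp
    then have "(of_real (wb b k \<xi>) * of_real (h0 l k)) * (of_real (h1 l k) * (U T k \<xi> i l * G k \<xi>))
      = of_real (wb b k \<xi>) * (U T k \<xi> i l * G k \<xi>)" by (metis mult.assoc mult_1_left)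
    then show ?thesis unfolding G_def by (simp add: mult.commute mult.left_commute)
  next
    case False
    \<comment> \<open>The undetermined mode: for i \<noteq> 3 the temperature does not act at k = 0,
      \<open>U\<close> being diagonal there, and for i = 3 the multiplier vanishes.\<close>
    have "U T 0 \<xi> i 3 * m 0 \<xi> = 0" using m3 by (cases "i = 3") (simp_all add: U_def kron_def)
    then show ?thesis using False unfolding G_def by (auto simp: h0_def)
  qed
  have int: "integrable FM (\<lambda>z. d l z * (of_real (h1 l (fst z)) * (U T (fst z) (snd z) i l * G (fst z) (snd z))))" for l
    by (rule l2_mult_integrable[OF d_l2 l2_sg[OF gl]])
  have "us i T (IF ?\<psi>) = (\<Sum>l\<in>UNIV. us l 0 (IF (\<lambda>k \<xi>. (of_real (wb b k \<xi>) * of_real (h0 l k)) * (of_real (h1 l k) * (U T k \<xi> i l * G k \<xi>)))))"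
    unfolding dual_identity[OF T \<psi>] e ..
  also have "\<dots> = (\<Sum>l\<in>UNIV. \<integral>z. d l z * (of_real (h1 l (fst z)) * (U T (fst z) (snd z) i l * G (fst z) (snd z))) \<partial>FM)"
    unfolding d_rep[OF gl] ..
  also have "\<dots> = (\<integral>z. (\<Sum>l\<in>UNIV. d l z * (of_real (h1 l (fst z)) * (U T (fst z) (snd z) i l * G (fst z) (snd z)))) \<partial>FM)"
    by (rule Bochner_Integration.integral_sum[OF int, symmetric])
  also have "(\<lambda>z. \<Sum>l\<in>UNIV. d l z * (of_real (h1 l (fst z)) * (U T (fst z) (snd z) i l * G (fst z) (snd z))))
      = (\<lambda>z. (m (fst z) (snd z - of_int (fst z) * T) * so z T i) * g (fst z) (snd z - of_int (fst z) * T))"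
    unfolding sol_def dd_def G_def sum_3 by (intro ext) (simp add: algebra_simps)
  finally show ?thesis .
qed

text \<open>The pairing has density \<open>G\<close> against the shifted transform of the test
  function, and Bessel's inequality costs 2\<pi>, hence 4 \<pi>^2. An infinite right-hand side is
  split off because \<open>l2\<close> presupposes finiteness.\<close>

lemma L2_norm_sq_le:
  assumes T: "T \<ge> 0" and m: "om 0 (\<lambda>_. m)" and m3: "\<And>\<xi>. i = 3 \<Longrightarrow> m 0 \<xi> = 0"
    and F: "\<And>\<phi>. schwartz \<phi> \<Longrightarrow> F \<phi> = us i T (IF (\<lambda>k \<xi>. of_real (wb b k (\<xi> + T * of_int k)) * (m k \<xi> * fourier \<phi> k \<xi>)))"
  shows "(L2_norm F)\<^sup>2 \<le> ennreal (4 * pi\<^sup>2) * (\<integral>\<^sup>+z. ennreal ((norm (m (fst z) (snd z - of_int (fst z) * T)))\<^sup>2 * (norm (so z T i))\<^sup>2) \<partial>FM)"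
    (is "_ \<le> _ * ?I")
proof (cases "?I < top")
  case False
  then have "?I = top" unfolding less_top[symmetric] by blast
  then show ?thesis by (simp add: ennreal_mult_top)
next
  case True
  define G where "G z = m (fst z) (snd z - of_int (fst z) * T) * so z T i" for z
  have mc: "continuous_on UNIV (m k)" for k
  proof -
    obtain m1 m2 where "dxi (\<lambda>_::real. m) m2" using m by (rule smthE)
    then have "\<And>\<xi>. (m k has_vector_derivative m2 0 k \<xi>) (at \<xi>)" unfolding dxi_def by blast
    then show ?thesis by (rule continuous_on_if_has_vector_derivative)
  qed
  have "(\<lambda>z. m (fst z) (snd z - of_int (fst z) * T)) \<in> borel_measurable FM"
  proof (rule measurable_FM)
    fix k
    have "continuous_on UNIV (\<lambda>\<xi>. m k (\<xi> - of_int k * T))"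
      by (rule continuous_on_compose2[OF mc]) (auto intro!: continuous_intros)
    then show "(\<lambda>\<xi>. m (fst (k, \<xi>)) (snd (k, \<xi>) - of_int (fst (k, \<xi>)) * T)) \<in> borel_measurable borel"
      by (simp add: borel_measurable_continuous_onI)
  qed
  then have Gm: "G \<in> borel_measurable FM" unfolding G_def by (rule borel_measurable_times[OF _ so_measurable_slice])
  have I: "?I = (\<integral>\<^sup>+z. ennreal ((norm (G z))\<^sup>2) \<partial>FM)" unfolding G_def norm_mult power_mult_distrib ..
  have G: "l2 FM G" unfolding l2_iff_nn_integral using Gm True unfolding I by blast
  have rep: "F \<phi> = (\<integral>z. G z * fourier \<phi> (fst z) (snd z - of_int (fst z) * T) \<partial>FM)" if "schwartz \<phi>" for \<phi>
    unfolding F[OF that] G_def by (rule us_rep[OF T m m3 sg_fourier[OF that]])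
  have "L2_norm F \<le> ennreal (nrm2 FM G * (2*pi))"
  proof (rule L2_norm_le)
    show "linear_dist F" unfolding linear_dist_def
    proof (intro allI impI)
      fix \<phi> \<psi> a c assume s: "schwartz \<phi>" "schwartz \<psi>"
      note i = l2_mult_integrable[OF G fourier_shift_l2(1)[OF s(1) T]] l2_mult_integrable[OF G fourier_shift_l2(1)[OF s(2) T]]
      show "F (\<lambda>p. a * \<phi> p + c * \<psi> p) = a * F \<phi> + c * F \<psi>"
        unfolding rep[OF schwartz_lincomb[OF s]] rep[OF s(1)] rep[OF s(2)] fourier_lincomb[OF s]
        using i by (simp add: distrib_left mult.left_commute)
    qed
    show "norm (F \<phi>) \<le> nrm2 FM G * (2*pi) * nrm2 OmM \<phi>" if s: "schwartz \<phi>" for \<phi>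
    proof -
      have "norm (F \<phi>) \<le> nrm2 FM G * nrm2 FM (\<lambda>z. fourier \<phi> (fst z) (snd z - of_int (fst z) * T))"
        unfolding rep[OF s] by (rule l2_cauchy_schwarz[OF G fourier_shift_l2(1)[OF s T]])
      also have "\<dots> \<le> nrm2 FM G * (2*pi * nrm2 OmM \<phi>)"
        by (rule mult_left_mono[OF fourier_shift_l2(2)[OF s T] nrm2_nonneg])
      finally show ?thesis by (simp only: mult.assoc)
    qed
  qed simp
  then have "(L2_norm F)\<^sup>2 \<le> (ennreal (nrm2 FM G * (2*pi)))\<^sup>2" by (rule power_mono) simp
  also have "\<dots> = ennreal (4 * pi\<^sup>2) * ennreal ((nrm2 FM G)\<^sup>2)"
    by (simp add: ennreal_power ennreal_mult'[symmetric] power_mult_distrib mult.commute)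
  also have "\<dots> = ennreal (4 * pi\<^sup>2) * ?I" unfolding I l2_nn_integral[OF G] ..
  finally show ?thesis .
qed

end

section \<open>Norm estimates\<close>

lemma esqrt_sq: "(esqrt a)\<^sup>2 = a"
  by (cases a) (simp_all add: esqrt_def ennreal_power)

lemma pair_norm_sq: "(pair_norm x y)\<^sup>2 = x\<^sup>2 + y\<^sup>2"
  unfolding pair_norm_def by (rule esqrt_sq)

lemma scaled_le_of_sq:
  fixes x :: ennreal
  assumes "ennreal (s\<^sup>2) * x\<^sup>2 \<le> ennreal (K\<^sup>2)" "s > 0" "K \<ge> 0"
  shows "ennreal s * x \<le> ennreal K"
proof (cases x)
  case (real r)
  then have "ennreal ((s * r)\<^sup>2) \<le> ennreal (K\<^sup>2)"
    using assms by (simp add: ennreal_power ennreal_mult'[symmetric] power_mult_distrib)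
  then have "(s * r)\<^sup>2 \<le> K\<^sup>2" by (simp add: ennreal_le_iff)
  then have "s * r \<le> K" using assms(3) by (rule power2_le_imp_le)
  then show ?thesis using real assms by (simp add: ennreal_mult'[symmetric] ennreal_leI)
next
  case top
  then show ?thesis using assms by (simp add: ennreal_mult_top ennreal_top_mult top_unique power2_eq_square)
qed

text \<open>The factor 2, in place of the square root of 2, keeps the constants integral.\<close>

lemma scaled_pair_norm_le:
  assumes "ennreal s * x \<le> ennreal K" "ennreal s * y \<le> ennreal K" "s > 0" "K \<ge> 0"
  shows "ennreal s * pair_norm x y \<le> ennreal (2 * K)"
proof (rule scaled_le_of_sq)
  have "ennreal (s\<^sup>2) * (pair_norm x y)\<^sup>2 = (ennreal s * x)\<^sup>2 + (ennreal s * y)\<^sup>2"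
    using assms(3) by (simp add: pair_norm_sq power_mult_distrib distrib_left ennreal_power)
  also have "\<dots> \<le> (ennreal K)\<^sup>2 + (ennreal K)\<^sup>2" using assms by (intro add_mono power_mono) auto
  also have "\<dots> = ennreal (2 * K\<^sup>2)" using assms(4) by (simp add: ennreal_power flip: ennreal_plus)
  also have "\<dots> \<le> ennreal ((2 * K)\<^sup>2)" by (intro ennreal_leI) (simp add: power_mult_distrib)
  finally show "ennreal (s\<^sup>2) * (pair_norm x y)\<^sup>2 \<le> ennreal ((2 * K)\<^sup>2)" .
qed (use assms in auto)

lemma Linf_t_le:
  assumes "f \<in> borel_measurable (restrict_space lborel {0<..})" "\<And>t. t > 0 \<Longrightarrow> f t \<le> B"
  shows "Linf_t f \<le> B"
  unfolding Linf_t_def by (rule esssup_I[OF assms(1)]) (auto intro!: AE_I2 assms(2) simp: space_restrict_space)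

text \<open>Tonelli exchanges time and frequency, so that time bounds at single frequencies can be
  inserted under the frequency integral.\<close>

lemma L2_t_sq_le:
  assumes h: "(\<lambda>v. h (fst v) (snd v)) \<in> borel_measurable (borel \<Otimes>\<^sub>M FM)"
    and N: "\<And>t. t > 0 \<Longrightarrow> (N t)\<^sup>2 \<le> c * (\<integral>\<^sup>+z. h t z \<partial>FM)"
    and H: "\<And>z. (\<integral>\<^sup>+t\<in>{0<..}. h t z \<partial>lborel) \<le> H z"
  shows "(L2_t N)\<^sup>2 \<le> c * (\<integral>\<^sup>+z. H z \<partial>FM)"
proof -
  interpret TF: pair_sigma_finite "lborel :: real measure" FM
    unfolding pair_sigma_finite_def using OF.M2.sigma_finite_measure_axioms lborel.sigma_finite_measure_axioms by blast
  have h': "(\<lambda>v. h (fst v) (snd v) * indicator {0<..} (fst v)) \<in> borel_measurable (lborel \<Otimes>\<^sub>M FM)"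
  proof -
    have "sets (lborel \<Otimes>\<^sub>M FM) = sets (borel \<Otimes>\<^sub>M FM)" by (intro sets_pair_measure_cong) auto
    then have "borel_measurable (lborel \<Otimes>\<^sub>M FM) = (borel_measurable (borel \<Otimes>\<^sub>M FM) :: (real \<times> int \<times> real \<Rightarrow> ennreal) set)"
      by (rule measurable_cong_sets) simp
    then show ?thesis using h by simp
  qed
  have hz: "(\<lambda>z. h t z) \<in> borel_measurable FM" for t
    using measurable_compose[OF measurable_Pair1' h, of t] by simp
  have "(L2_t N)\<^sup>2 = (\<integral>\<^sup>+t\<in>{0<..}. (N t)\<^sup>2 \<partial>lborel)" unfolding L2_t_def by (rule esqrt_sq)
  also have "\<dots> \<le> (\<integral>\<^sup>+t. c * (\<integral>\<^sup>+z. h t z * indicator {0<..} t \<partial>FM) \<partial>lborel)"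
  proof (rule nn_integral_mono)
    fix t :: real
    show "(N t)\<^sup>2 * indicator {0<..} t \<le> c * (\<integral>\<^sup>+z. h t z * indicator {0<..} t \<partial>FM)"
      using N[of t] by (cases "t > 0") auto
  qed
  also have "\<dots> = c * (\<integral>\<^sup>+t. (\<integral>\<^sup>+z. h t z * indicator {0<..} t \<partial>FM) \<partial>lborel)"
    by (rule nn_integral_cmult) (use OF.M2.borel_measurable_nn_integral_fst[OF h'] in simp)
  also have "(\<integral>\<^sup>+t. (\<integral>\<^sup>+z. h t z * indicator {0<..} t \<partial>FM) \<partial>lborel) = (\<integral>\<^sup>+z. (\<integral>\<^sup>+t. h t z * indicator {0<..} t \<partial>lborel) \<partial>FM)"
    using TF.Fubini'[of "\<lambda>t z. h t z * indicator {0<..} t"] h' by (simp add: case_prod_beta')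
  also have "\<dots> \<le> (\<integral>\<^sup>+z. H z \<partial>FM)" by (intro nn_integral_mono H)
  finally show ?thesis by (simp add: mult_left_mono)
qed

lemma nn_integral_scaled_le:
  fixes f g :: "real \<Rightarrow> real"
  assumes I: "(\<integral>\<^sup>+t\<in>{0<..}. ennreal (f t) \<partial>lborel) \<le> ennreal B" and f: "continuous_on UNIV f" and c: "c \<ge> 0"
    and g: "\<And>t. t > 0 \<Longrightarrow> g t \<le> c * f t"
  shows "(\<integral>\<^sup>+t\<in>{0<..}. ennreal (g t) \<partial>lborel) \<le> ennreal (c * B)"
proof -
  have fm: "f \<in> borel_measurable borel" using f by (rule borel_measurable_continuous_onI)
  have "(\<integral>\<^sup>+t\<in>{0<..}. ennreal (g t) \<partial>lborel) \<le> (\<integral>\<^sup>+t. ennreal c * (ennreal (f t) * indicator {0<..} t) \<partial>lborel)"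
  proof (rule nn_integral_mono)
    fix t :: real
    show "ennreal (g t) * indicator {0<..} t \<le> ennreal c * (ennreal (f t) * indicator {0<..} t)"
      using g[of t] c by (cases "t > 0") (auto simp: ennreal_mult'[symmetric] intro: ennreal_leI)
  qed
  also have "\<dots> = ennreal c * (\<integral>\<^sup>+t\<in>{0<..}. ennreal (f t) \<partial>lborel)"
    by (rule nn_integral_cmult) (use fm in measurable)
  also have "\<dots> \<le> ennreal c * ennreal B" by (rule mult_left_mono[OF I]) simp
  finally show ?thesis using c by (simp add: ennreal_mult'[symmetric])
qed

context bmhd_data begin

abbreviation "dn i z \<equiv> (norm (d i z))\<^sup>2"

text \<open>The squared right-hand side of the theorem at one frequency: the coefficients \<nu>^-4
  and \<nu>^-8 (\<nu> \<eta>)^(-1/3) are the squares of the two prefactors of the data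
  norms.\<close>

definition Q :: "int \<times> real \<Rightarrow> real" where
  "Q z = \<nu> powr (-4) * (dn 1 z + dn 2 z) + \<nu> powr (-8) * (\<nu> * \<eta>) powr (-1/3) * dn 3 z"

lemma \<nu>_powr: "s \<le> s' \<Longrightarrow> \<nu> powr s' \<le> \<nu> powr s"
  by (rule powr_mono') (use \<nu> in auto)

lemma Q_nonneg: "Q z \<ge> 0" by (simp add: Q_def)

lemma dn_le_Q: "dn 1 z \<le> Q z" "dn 2 z \<le> Q z"
proof -
  have c: "1 \<le> \<nu> powr (-4)" using \<nu>_powr[of "-4" 0] \<nu> by simp
  have "1 * (dn 1 z + dn 2 z) \<le> \<nu> powr (-4) * (dn 1 z + dn 2 z)" by (rule mult_right_mono[OF c]) simp
  moreover have "0 \<le> \<nu> powr (-8) * (\<nu> * \<eta>) powr (-1/3) * dn 3 z" by simp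
  moreover have "0 \<le> dn 1 z" "0 \<le> dn 2 z" by simp_all
  moreover have "x \<le> Q' \<and> y \<le> Q'" if "1 * (x + y) \<le> u" "0 \<le> v" "0 \<le> x" "0 \<le> y" "Q' = u + v" for x y u v Q' :: real
    using that by simp
  ultimately have "dn 1 z \<le> Q z \<and> dn 2 z \<le> Q z" using Q_def by blast
  then show "dn 1 z \<le> Q z" "dn 2 z \<le> Q z" by blast+
qed

lemma dd_simps: "norm (dd z 1) = norm (d 1 z)" "norm (dd z 2) = norm (d 2 z)"
proof -
  have n: "(1::3) \<noteq> 3" "(2::3) \<noteq> 3" by simp_all
  show "norm (dd z 1) = norm (d 1 z)" "norm (dd z 2) = norm (d 2 z)" unfolding dd_def h1_def by (simp_all only: n if_False of_real_1 mult_1_left)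
qed

lemma k_abs: "k \<noteq> 0 \<Longrightarrow> 1 \<le> \<bar>real_of_int k\<bar>" by linarith

lemma weighted_dd3: "fst z \<noteq> 0 \<Longrightarrow> (\<bar>of_int (fst z)\<bar> powr (1/3))\<^sup>2 * (norm (dd z 3))\<^sup>2 = dn 3 z"
proof -
  assume k: "fst z \<noteq> 0"
  have "\<bar>real_of_int (fst z)\<bar> powr (1/3) * \<bar>of_int (fst z)\<bar> powr (-1/3) = 1"
    using k by (simp add: powr_add[symmetric])
  then show ?thesis unfolding dd_def h1_def norm_mult power_mult_distrib mult.assoc[symmetric]
    by (simp flip: power_mult_distrib)
qed

lemma dd3_le: "fst z \<noteq> 0 \<Longrightarrow> (norm (dd z 3))\<^sup>2 \<le> dn 3 z"
proof -
  assume k: "fst z \<noteq> 0"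
  have "1 \<le> \<bar>real_of_int (fst z)\<bar> powr (1/3)" using k_abs[OF k] by (intro ge_one_powr_ge_zero) auto
  then have "1 \<le> (\<bar>real_of_int (fst z)\<bar> powr (1/3))\<^sup>2" by (rule one_le_power)
  from mult_right_mono[OF this, of "(norm (dd z 3))\<^sup>2"] show ?thesis unfolding weighted_dd3[OF k] by simp
qed

text \<open>Bookkeeping of losses. The energy carries the temperature with a factor at most 20
  \<nu>^-1 \<eta>^(-1/3), because |k| \<ge> 1; for s \<ge> -4 the exponent s - 1 still exceeds -8 -
  1/3, so one budget s covers all three components.\<close>

lemma data_energy_le:
  assumes k: "fst z \<noteq> 0" and s: "-4 \<le> s"
  shows "\<nu> powr s * data_energy (dd z) (fst z) \<le> 20 * Q z"
proof -
  have r: "0 < \<eta> powr (1/3)" "\<eta> powr (1/3) \<le> rk (fst z)" using \<eta> rk_ge[OF k] by auto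
  have "20 / (\<nu> * rk (fst z)) \<le> 20 / (\<nu> * \<eta> powr (1/3))"
    using r \<nu> by (intro divide_left_mono mult_left_mono mult_pos_pos) auto
  also have "\<dots> = 20 * (\<nu> powr (-1) * \<eta> powr (-1/3))" using \<nu> \<eta> by (simp add: powr_minus_divide)
  finally have "20 / (\<nu> * rk (fst z)) * (norm (dd z 3))\<^sup>2 \<le> 20 * (\<nu> powr (-1) * \<eta> powr (-1/3)) * dn 3 z"
    using dd3_le[OF k] by (intro mult_mono) auto
  then have "data_energy (dd z) (fst z) \<le> 2 * (dn 1 z + dn 2 z) + 20 * (\<nu> powr (-1) * \<eta> powr (-1/3)) * dn 3 z"
    unfolding dd_simps by (rule add_left_mono)
  from mult_left_mono[OF this powr_ge_zero[of \<nu> s]]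
  have "\<nu> powr s * data_energy (dd z) (fst z) \<le> 2 * (\<nu> powr s * (dn 1 z + dn 2 z)) + 20 * (\<nu> powr s * \<nu> powr (-1) * \<eta> powr (-1/3) * dn 3 z)"
    by (simp add: algebra_simps)
  also have "\<dots> \<le> 20 * (\<nu> powr (-4) * (dn 1 z + dn 2 z)) + 20 * (\<nu> powr (-8) * (\<nu> * \<eta>) powr (-1/3) * dn 3 z)"
  proof (rule add_mono)
    have "\<nu> powr s * (dn 1 z + dn 2 z) \<le> \<nu> powr (-4) * (dn 1 z + dn 2 z)" by (rule mult_right_mono[OF \<nu>_powr[OF s]]) simp
    moreover have "0 \<le> \<nu> powr (-4) * (dn 1 z + dn 2 z)" by simp
    ultimately show "2 * (\<nu> powr s * (dn 1 z + dn 2 z)) \<le> 20 * (\<nu> powr (-4) * (dn 1 z + dn 2 z))" by linarith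
    have "\<nu> powr s * \<nu> powr (-1) \<le> \<nu> powr (-8) * \<nu> powr (-1/3)"
      unfolding powr_add[symmetric] by (rule \<nu>_powr) (use s in simp)
    then have "\<nu> powr s * \<nu> powr (-1) * \<eta> powr (-1/3) \<le> \<nu> powr (-8) * (\<nu> * \<eta>) powr (-1/3)"
      using mult_right_mono[of _ _ "\<eta> powr (-1/3)"] powr_mult[of \<nu> \<eta> "-1/3"] \<nu> \<eta>
      by (simp only: mult.assoc[symmetric] powr_ge_zero)
    from mult_right_mono[OF this, of "dn 3 z"]
    show "20 * (\<nu> powr s * \<nu> powr (-1) * \<eta> powr (-1/3) * dn 3 z) \<le> 20 * (\<nu> powr (-8) * (\<nu> * \<eta>) powr (-1/3) * dn 3 z)" by simp
  qed
  finally show ?thesis by (simp add: Q_def algebra_simps)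
qed

section \<open>Time bounds at a fixed frequency\<close>

lemma so_continuous: "continuous_on UNIV (\<lambda>t. so z t i)"
  by (rule continuous_on_if_has_vector_derivative[OF sol_deriv])

abbreviation "pz z t \<equiv> pt (fst z) (snd z) t"
abbreviation "son z t i \<equiv> (norm (so z t i))\<^sup>2"

lemma pz_ge: "(of_int (fst z))\<^sup>2 \<le> pz z t" by simp

lemma son_le_WJ: "i \<noteq> 3 \<Longrightarrow> son z t i \<le> WJ (dd z) (fst z) (snd z) t"
  using exhaust_3[of i] by (auto simp del: One_nat_def)

lemma diff_coeff_12: "i \<noteq> 3 \<Longrightarrow> diff_coeff i = \<nu>" by (simp add: diff_coeff_def)

lemma dd_le_Q: "i \<noteq> 3 \<Longrightarrow> (norm (dd z i))\<^sup>2 \<le> Q z"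
  using exhaust_3[of i] dn_le_Q[of z] by (auto simp: dd_simps)

text \<open>320 is 16 from \<open>energy\<close> times 20 from \<open>data_energy_le\<close>; the
  loss is \<nu>^-2 out of the available \<nu>^-4.\<close>

lemma freq_sup:
  assumes i: "i \<noteq> 3" and t: "t \<ge> 0" shows "son z t i \<le> 320 * Q z"
proof (cases "fst z = 0")
  case True
  have "son z t i \<le> (norm (dd z i))\<^sup>2" using sol_bounds_zero(1)[OF t, of "dd z" "snd z" i] True by simp
  then show ?thesis using dd_le_Q[OF i, of z] Q_nonneg[of z] by linarith
next
  case False
  have "son z t i \<le> 16 / \<nu>\<^sup>2 * data_energy (dd z) (fst z)"
    using son_le_WJ[OF i, of z t] sol_bounds(1)[OF False t, of "dd z" "snd z"] by linarith
  also have "\<dots> = 16 * (\<nu> powr (-2) * data_energy (dd z) (fst z))" using \<nu> by (simp add: powr_minus_divide powr_numeral)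
  also have "\<dots> \<le> 16 * (20 * Q z)" using data_energy_le[OF False, of "-2"] by simp
  finally show ?thesis by simp
qed

text \<open>At k = 0 coupling, growth and forcing vanish and the heat equation suffices. Otherwise
  \<nu> times \<nu>^-3 leaves \<nu>^-2, and 640 is 32 times 20.\<close>

lemma freq_grad:
  assumes i: "i \<noteq> 3" shows "(\<integral>\<^sup>+t\<in>{0<..}. ennreal (\<nu> * (pz z t * son z t i)) \<partial>lborel) \<le> ennreal (640 * Q z)"
proof (cases "fst z = 0")
  case True
  have "(\<integral>\<^sup>+t\<in>{0<..}. ennreal (\<nu> * (pz z t * son z t i)) \<partial>lborel) \<le> ennreal ((norm (dd z i))\<^sup>2)"
    using sol_bounds_zero(2)[of i "snd z" "dd z"] unfolding True diff_coeff_12[OF i] mult.assoc .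
  also have "\<dots> \<le> ennreal (640 * Q z)" using dd_le_Q[OF i, of z] Q_nonneg[of z] by (intro ennreal_leI) linarith
  finally show ?thesis .
next
  case False
  have "(\<integral>\<^sup>+t\<in>{0<..}. ennreal (\<nu> * (pz z t * son z t i)) \<partial>lborel) \<le> ennreal (\<nu> * (32 / \<nu>^3 * data_energy (dd z) (fst z)))"
  proof (rule nn_integral_scaled_le[OF sol_bounds(2)[OF False, of "snd z" "dd z"]])
    show "continuous_on UNIV (\<lambda>t. pz z t * WJ (dd z) (fst z) (snd z) t)" by (intro continuous_intros so_continuous)
    show "\<nu> * (pz z t * son z t i) \<le> \<nu> * (pz z t * WJ (dd z) (fst z) (snd z) t)" for t
      using son_le_WJ[OF i] \<nu> by (intro mult_left_mono) auto
  qed (use \<nu> in simp)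
  also have "\<nu> * (32 / \<nu>^3 * data_energy (dd z) (fst z)) = 32 * (\<nu> powr (-2) * data_energy (dd z) (fst z))"
    using \<nu> by (simp add: powr_minus_divide powr_numeral power3_eq_cube power2_eq_square)
  also have "ennreal \<dots> \<le> ennreal (640 * Q z)" using data_energy_le[OF False, of "-2"] by (intro ennreal_leI) simp
  finally show ?thesis .
qed

lemma abs_powr_sq_le: "s \<le> 1 \<Longrightarrow> k \<noteq> 0 \<Longrightarrow> (\<bar>real_of_int k\<bar> powr s)\<^sup>2 \<le> (of_int k)\<^sup>2"
proof -
  assume s: "s \<le> 1" and k: "k \<noteq> 0"
  have "\<bar>real_of_int k\<bar> powr s \<le> \<bar>real_of_int k\<bar> powr 1" using k_abs[OF k] s by (intro powr_mono) auto
  then have "(\<bar>real_of_int k\<bar> powr s)\<^sup>2 \<le> \<bar>real_of_int k\<bar>\<^sup>2" by (intro power_mono) auto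
  then show ?thesis by simp
qed

text \<open>For k \<noteq> 0 one has |k|^(2/3) \<le> k^2 \<le> p, so the viscous bound already
  contains this term. The price \<nu>^(1/3 - 3) = \<nu>^(-8/3) lies within the budget \<nu>^-4; at k
  = 0 the weight is zero.\<close>

lemma freq_enhanced:
  assumes i: "i \<noteq> 3"
  shows "(\<integral>\<^sup>+t\<in>{0<..}. ennreal (\<nu> powr (1/3) * ((\<bar>of_int (fst z)\<bar> powr (1/3))\<^sup>2 * son z t i)) \<partial>lborel) \<le> ennreal (640 * Q z)"
proof (cases "fst z = 0")
  case True
  then show ?thesis by simp
next
  case False
  have "(\<integral>\<^sup>+t\<in>{0<..}. ennreal (\<nu> powr (1/3) * ((\<bar>of_int (fst z)\<bar> powr (1/3))\<^sup>2 * son z t i)) \<partial>lborel)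
      \<le> ennreal (\<nu> powr (1/3) * (32 / \<nu>^3 * data_energy (dd z) (fst z)))"
  proof (rule nn_integral_scaled_le[OF sol_bounds(2)[OF False, of "snd z" "dd z"]])
    show "continuous_on UNIV (\<lambda>t. pz z t * WJ (dd z) (fst z) (snd z) t)" by (intro continuous_intros so_continuous)
    show "\<nu> powr (1/3) * ((\<bar>of_int (fst z)\<bar> powr (1/3))\<^sup>2 * son z t i) \<le> \<nu> powr (1/3) * (pz z t * WJ (dd z) (fst z) (snd z) t)" for t
      using son_le_WJ[OF i] order_trans[OF abs_powr_sq_le[of "1/3", OF _ False] pz_ge]
      by (intro mult_left_mono mult_mono) auto
  qed simp
  also have "\<nu> powr (1/3) * (32 / \<nu>^3 * data_energy (dd z) (fst z)) = 32 * (\<nu> powr (1/3) * \<nu> powr (-3) * data_energy (dd z) (fst z))"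
    using \<nu> by (simp add: powr_minus_divide powr_numeral)
  also have "\<nu> powr (1/3) * \<nu> powr (-3) = \<nu> powr (-8/3)" unfolding powr_add[symmetric] by simp
  also have "ennreal (32 * (\<nu> powr (-8/3) * data_energy (dd z) (fst z))) \<le> ennreal (640 * Q z)"
    using data_energy_le[OF False, of "-8/3"] by (intro ennreal_leI) simp
  finally show ?thesis .
qed

lemma heat_sup:
  assumes t: "t \<ge> 0" shows "(\<bar>of_int (fst z)\<bar> powr (1/3))\<^sup>2 * son z t 3 \<le> dn 3 z"
proof (cases "fst z = 0")
  case True then show ?thesis by simp
next
  case False
  have "(\<bar>of_int (fst z)\<bar> powr (1/3))\<^sup>2 * son z t 3 \<le> (\<bar>of_int (fst z)\<bar> powr (1/3))\<^sup>2 * (norm (dd z 3))\<^sup>2"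
    by (rule mult_left_mono[OF sol_bounds(3)[OF False t]]) simp
  then show ?thesis unfolding weighted_dd3[OF False] .
qed

lemma heat_grad:
  "(\<integral>\<^sup>+t\<in>{0<..}. ennreal (\<eta> * ((\<bar>of_int (fst z)\<bar> powr (1/3))\<^sup>2 * (pz z t * son z t 3))) \<partial>lborel) \<le> ennreal (dn 3 z)"
proof (cases "fst z = 0")
  case True then show ?thesis by simp
next
  case False
  have "(\<integral>\<^sup>+t\<in>{0<..}. ennreal (\<eta> * ((\<bar>of_int (fst z)\<bar> powr (1/3))\<^sup>2 * (pz z t * son z t 3))) \<partial>lborel)
    \<le> ennreal ((\<bar>of_int (fst z)\<bar> powr (1/3))\<^sup>2 * (norm (dd z 3))\<^sup>2)"
  proof (rule nn_integral_scaled_le[OF sol_bounds(4)[OF False, of "snd z" "dd z"]])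
    show "continuous_on UNIV (\<lambda>t. \<eta> * pz z t * son z t 3)" by (intro continuous_intros so_continuous)
    show "\<eta> * ((\<bar>of_int (fst z)\<bar> powr (1/3))\<^sup>2 * (pz z t * son z t 3)) \<le> (\<bar>of_int (fst z)\<bar> powr (1/3))\<^sup>2 * (\<eta> * pz z t * son z t 3)" for t
      by (simp only: mult.left_commute mult.assoc order_refl)
  qed simp
  then show ?thesis unfolding weighted_dd3[OF False] .
qed

text \<open>|k|^(4/3) is split evenly: one factor |k|^(2/3) forms the rate \<open>rk\<close>
  together with \<eta>^(1/3), the other restores the weight of the data by
  \<open>weighted_dd3\<close>.\<close>

lemma heat_enhanced:
  "(\<integral>\<^sup>+t\<in>{0<..}. ennreal (\<eta> powr (1/3) * ((\<bar>of_int (fst z)\<bar> powr (2/3))\<^sup>2 * son z t 3)) \<partial>lborel) \<le> ennreal (5 * dn 3 z)"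
proof (cases "fst z = 0")
  case True then show ?thesis by simp
next
  case False
  let ?k = "\<bar>real_of_int (fst z)\<bar>"
  have a: "(?k powr (2/3))\<^sup>2 = ?k powr (2/3) * (?k powr (1/3))\<^sup>2"
    unfolding power2_eq_square powr_add[symmetric] by simp
  have b: "\<eta> powr (1/3) * ?k powr (2/3) = rk (fst z)"
  proof -
    have "(real_of_int (fst z))\<^sup>2 = ?k powr 2" using False by (simp add: powr_numeral)
    then have "((real_of_int (fst z))\<^sup>2) powr (1/3) = ?k powr (2/3)" by (simp only: powr_powr) simp
    then show ?thesis using powr_mult[of \<eta> "(real_of_int (fst z))\<^sup>2" "1/3"] \<eta> by (simp only: zero_le_power2)
  qed
  have e: "\<eta> powr (1/3) * ((?k powr (2/3))\<^sup>2 * x) = (?k powr (1/3))\<^sup>2 * (rk (fst z) * x)" for x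
    unfolding a b[symmetric] by (simp only: mult_ac)
  have "(\<integral>\<^sup>+t\<in>{0<..}. ennreal (\<eta> powr (1/3) * ((?k powr (2/3))\<^sup>2 * son z t 3)) \<partial>lborel)
    \<le> ennreal ((?k powr (1/3))\<^sup>2 * (5 * (norm (dd z 3))\<^sup>2))"
  proof (rule nn_integral_scaled_le[OF sol_bounds(5)[OF False, of "dd z" "snd z"]])
    show "continuous_on UNIV (\<lambda>t. rk (fst z) * son z t 3)" by (intro continuous_intros so_continuous)
    show "\<eta> powr (1/3) * ((?k powr (2/3))\<^sup>2 * son z t 3) \<le> (?k powr (1/3))\<^sup>2 * (rk (fst z) * son z t 3)" for t
      unfolding e by (rule order_refl)
  qed simp
  then show ?thesis using weighted_dd3[OF False] by (simp add: mult.left_commute)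
qed

definition form :: "(real \<Rightarrow> dist) \<Rightarrow> 3 \<Rightarrow> (int \<Rightarrow> real) \<Rightarrow> bool" where
  "form F i \<kappa> \<longleftrightarrow> (i = 3 \<longrightarrow> \<kappa> 0 = 0) \<and> (\<forall>T. om T (\<lambda>_ k \<xi>. complex_of_real (\<kappa> k))) \<and>
    (\<forall>t\<ge>0. \<forall>\<phi>. schwartz \<phi> \<longrightarrow>
      F t \<phi> = us i t (IF (\<lambda>k \<xi>. of_real (wb b k (\<xi> + t * of_int k)) * (of_real (\<kappa> k) * fourier \<phi> k \<xi>))))"

lemma form_Lambda: "i \<noteq> 3 \<Longrightarrow> form (\<lambda>t. Lambda t b (us i t)) i (\<lambda>_. 1)"
  unfolding form_def by (auto simp: Lambda_eq intro: om_const)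

lemma form_absDx: "s \<le> 1 \<Longrightarrow> form (\<lambda>t. absDx s (Lambda t b (us i t))) i (\<lambda>k. \<bar>of_int k\<bar> powr s)"
proof -
  assume s: "s \<le> 1"
  have "absDx s (Lambda t b u) \<phi> = u (IF (\<lambda>k \<xi>. of_real (wb b k (\<xi> + t * of_int k)) * (of_real (\<bar>of_int k\<bar> powr s) * fourier \<phi> k \<xi>)))"
    if \<phi>: "schwartz \<phi>" for \<phi> u t
  proof -
    have g: "sg (\<lambda>k \<xi>. of_real (\<bar>of_int k\<bar> powr s) * fourier \<phi> k \<xi>)"
      by (rule sg_mult[OF om_abs_powr[OF s] sg_fourier[OF \<phi>]])
    show ?thesis unfolding absDx_eq[OF \<phi> s] Lambda_eq[OF schwartz_IF[OF g]] fourier_IF[OF g] ..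
  qed
  then show ?thesis unfolding form_def using om_abs_powr[OF s] by simp
qed

lemma formD:
  assumes "form F i \<kappa>"
  shows "i = 3 \<Longrightarrow> \<kappa> 0 = 0" "om T (\<lambda>_ k \<xi>. complex_of_real (\<kappa> k))"
    "t \<ge> 0 \<Longrightarrow> schwartz \<phi> \<Longrightarrow> F t \<phi> = us i t (IF (\<lambda>k \<xi>. of_real (wb b k (\<xi> + t * of_int k)) * (of_real (\<kappa> k) * fourier \<phi> k \<xi>)))"
  using assms unfolding form_def by blast+

lemma form_sg:
  assumes "form F i \<kappa>" "schwartz \<phi>"
  shows "sg (\<lambda>k \<xi>. of_real (wb b k (\<xi> + t * of_int k)) * (of_real (\<kappa> k) * fourier \<phi> k \<xi>))"
  by (rule sg_mult[OF om_wb[OF om_shift_c] sg_mult[OF formD(2)[OF assms(1)] sg_fourier[OF assms(2)]]])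

lemma form_linear:
  assumes F: "form F i \<kappa>" and t: "t \<ge> 0" shows "linear_dist (F t)"
  unfolding linear_dist_def
proof (intro allI impI)
  fix \<phi> \<psi> a c assume s: "schwartz \<phi>" "schwartz \<psi>"
  have e: "(\<lambda>k \<xi>. of_real (wb b k (\<xi> + t * of_int k)) * (of_real (\<kappa> k) * (a * fourier \<phi> k \<xi> + c * fourier \<psi> k \<xi>)))
    = (\<lambda>k \<xi>. a * (of_real (wb b k (\<xi> + t * of_int k)) * (of_real (\<kappa> k) * fourier \<phi> k \<xi>))
      + c * (of_real (wb b k (\<xi> + t * of_int k)) * (of_real (\<kappa> k) * fourier \<psi> k \<xi>)))"
    by (intro ext) (simp add: algebra_simps)
  show "F t (\<lambda>p. a * \<phi> p + c * \<psi> p) = a * F t \<phi> + c * F t \<psi>"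
    unfolding formD(3)[OF F t schwartz_lincomb[OF s]] formD(3)[OF F t s(1)] formD(3)[OF F t s(2)] fourier_lincomb[OF s] e
    by (rule linear_dist_lincomb[OF us_linear[OF t] form_sg[OF F s(1)] form_sg[OF F s(2)]])
qed

text \<open>By duality \<open>L2_norm (F t) \<le> a\<close> is a family of closed conditions on t,
  one for each Schwartz function, as pairings are continuous in t. On each [0, n] the sublevel set
  is thus closed, although the family of conditions is uncountable.\<close>

lemma form_measurable:
  assumes F: "form F i \<kappa>"
  shows "(\<lambda>t. L2_norm (F t)) \<in> borel_measurable (restrict_space lborel {0<..})"
proof (rule borel_measurableI_le)
  fix y :: ennreal
  have sp: "space (restrict_space lborel {0<..}) = ({0<..} :: real set)" by (simp add: space_restrict_space)
  show "{t \<in> space (restrict_space lborel {0<..}). L2_norm (F t) \<le> y} \<in> sets (restrict_space lborel {0<..})"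
  proof (cases y)
    case top
    have "{t \<in> space (restrict_space lborel {0<..}). L2_norm (F t) \<le> y} = space (restrict_space lborel {0<..})"
      using top by auto
    then show ?thesis using sets.top by metis
  next
    case (real a)
    define C where "C n = {0..real n} \<inter> (\<Inter>\<phi>\<in>Collect schwartz. {t \<in> {0..real n}. norm (F t \<phi>) \<le> a * nrm2 OmM \<phi>})" for n
    have "closed (C n)" for n unfolding C_def
    proof (intro closed_Int closed_INT ballI)
      fix \<phi> assume "\<phi> \<in> Collect schwartz"
      then have \<phi>: "schwartz \<phi>" by simp
      have "sf (real n) (\<lambda>t k \<xi>. of_real (wb b k (\<xi> + t * of_int k)) * (of_real (\<kappa> k) * fourier \<phi> k \<xi>))"
        by (rule sf_mult[OF om_wb[OF om_shift_t] sf_mult[OF formD(2)[OF F] sf_static[OF sg_fourier[OF \<phi>]]]])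
      from pairing_continuous[OF us_continuous[of i] this]
      have "continuous_on {0..real n} (\<lambda>t. F t \<phi>)"
        by (rule continuous_on_eq) (simp add: formD(3)[OF F _ \<phi>])
      then show "closed {t \<in> {0..real n}. norm (F t \<phi>) \<le> a * nrm2 OmM \<phi>}"
        by (intro continuous_on_closed_Collect_le continuous_on_norm continuous_on_const) auto
    qed simp
    then have "{0<..} \<inter> (\<Union>n. C n) \<in> sets (borel :: real measure)" by (intro sets.Int sets.countable_UN) auto
    moreover have "{t \<in> {0<..}. L2_norm (F t) \<le> y} = {0<..} \<inter> (\<Union>n. C n)"
    proof (intro set_eqI iffI)
      fix t assume "t \<in> {t \<in> {0<..}. L2_norm (F t) \<le> y}"
      then have t: "t > 0" and L: "L2_norm (F t) \<le> ennreal a" using real by auto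
      obtain n where n: "t \<le> real n" using real_arch_simple by blast
      have "t \<in> C n" unfolding C_def using L2_norm_bound[OF _ L real(1)] t n by auto
      then show "t \<in> {0<..} \<inter> (\<Union>n. C n)" using t by auto
    next
      fix t assume "t \<in> {0<..} \<inter> (\<Union>n. C n)"
      then obtain n where t: "t > 0" "t \<in> C n" by auto
      have "L2_norm (F t) \<le> ennreal a"
        by (rule L2_norm_le[OF form_linear[OF F] real(1)]) (use t in \<open>auto simp: C_def\<close>)
      then show "t \<in> {t \<in> {0<..}. L2_norm (F t) \<le> y}" using t real by simp
    qed
    ultimately show ?thesis unfolding sp by (subst sets_restrict_space_iff) auto
  qed
qed

lemma form_sq_le:
  assumes F: "form F i \<kappa>" and t: "t \<ge> 0"
  shows "(L2_norm (F t))\<^sup>2 \<le> ennreal (4 * pi\<^sup>2) * (\<integral>\<^sup>+z. ennreal ((\<kappa> (fst z))\<^sup>2 * son z t i) \<partial>FM)"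
  using L2_norm_sq_le[OF t formD(2)[OF F] _ formD(3)[OF F t]] formD(1)[OF F] by simp

lemma son_measurable: "(\<lambda>v. son (snd v) (fst v) i) \<in> borel_measurable (borel \<Otimes>\<^sub>M FM)"
  using so_measurable[of i] by measurable

lemma k_measurable: "(\<lambda>v. h (fst (snd v)) :: real) \<in> borel_measurable (borel \<Otimes>\<^sub>M FM)"
  and xi_measurable: "(\<lambda>v. snd (snd v)) \<in> borel_measurable (borel \<Otimes>\<^sub>M FM)"
  unfolding FM_def by measurable

lemma t_slice_measurable:
  "(\<lambda>v. h (fst v) (snd v)) \<in> borel_measurable (borel \<Otimes>\<^sub>M FM) \<Longrightarrow> (\<lambda>z. h (t::real) z :: real) \<in> borel_measurable FM"
proof -
  assume h: "(\<lambda>v. h (fst v) (snd v)) \<in> borel_measurable (borel \<Otimes>\<^sub>M FM)"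
  have "t \<in> space borel" by simp
  from measurable_compose[OF measurable_Pair1'[OF this] h] show ?thesis by simp
qed

text \<open>Up to factors of modulus 1 the multipliers of \<partial>x and \<partial>y at the running
  frequency are k and \<zeta> - k t, whose squares add up to \<open>pz\<close>.\<close>

lemma form_grad_sq_le:
  assumes F: "form F i \<kappa>" and t: "t \<ge> 0"
  shows "(L2_norm_grad (F t))\<^sup>2 \<le> ennreal (4 * pi\<^sup>2) * (\<integral>\<^sup>+z. ennreal ((\<kappa> (fst z))\<^sup>2 * (pz z t * son z t i)) \<partial>FM)"
proof -
  let ?I = "\<lambda>m::int \<Rightarrow> real \<Rightarrow> complex. \<integral>\<^sup>+z. ennreal ((norm (m (fst z) (snd z - of_int (fst z) * t)))\<^sup>2 * son z t i) \<partial>FM"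
  have neg: "- us i t (IF f) = us i t (IF (\<lambda>k \<xi>. - f k \<xi>))" if "sg f" for f
    using linear_dist_cmult[OF us_linear[OF t] that, where a = "-1"] by simp
  have X: "(L2_norm (DX (F t)))\<^sup>2 \<le> ennreal (4 * pi\<^sup>2) * ?I (\<lambda>k \<xi>. - \<i> * of_int k * of_real (\<kappa> k))"
  proof (rule L2_norm_sq_le[OF t])
    show "om 0 (\<lambda>_ k \<xi>. - \<i> * of_int k * of_real (\<kappa> k))" by (rule om_mult[OF om_cmult[OF om_k] formD(2)[OF F]])
    fix \<phi> assume \<phi>: "schwartz \<phi>"
    show "DX (F t) \<phi> = us i t (IF (\<lambda>k \<xi>. of_real (wb b k (\<xi> + t * of_int k)) * (- \<i> * of_int k * of_real (\<kappa> k) * fourier \<phi> k \<xi>)))"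
      unfolding DX_def formD(3)[OF F t schwartz_dX[OF \<phi>]] neg[OF form_sg[OF F schwartz_dX[OF \<phi>], of t]]
      unfolding fourier_dX[OF \<phi>]
      by (rule arg_cong[where f = "\<lambda>f. us i t (IF f)"]) (intro ext, simp)
  qed simp
  have Y: "(L2_norm (DY (F t)))\<^sup>2 \<le> ennreal (4 * pi\<^sup>2) * ?I (\<lambda>k \<xi>. - \<i> * of_real \<xi> * of_real (\<kappa> k))"
  proof (rule L2_norm_sq_le[OF t])
    show "om 0 (\<lambda>_ k \<xi>. - \<i> * of_real \<xi> * of_real (\<kappa> k))" by (rule om_mult[OF om_cmult[OF om_xi] formD(2)[OF F]])
    show "- \<i> * complex_of_real \<xi> * complex_of_real (\<kappa> 0) = 0" if "i = 3" for \<xi> using formD(1)[OF F that] by simp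
    fix \<phi> assume \<phi>: "schwartz \<phi>"
    show "DY (F t) \<phi> = us i t (IF (\<lambda>k \<xi>. of_real (wb b k (\<xi> + t * of_int k)) * (- \<i> * of_real \<xi> * of_real (\<kappa> k) * fourier \<phi> k \<xi>)))"
      unfolding DY_def formD(3)[OF F t schwartz_dY[OF \<phi>]] neg[OF form_sg[OF F schwartz_dY[OF \<phi>], of t]]
      unfolding fourier_dY[OF \<phi>]
      by (rule arg_cong[where f = "\<lambda>f. us i t (IF f)"]) (intro ext, simp)
  qed
  have sm: "(\<lambda>z. son z t i) \<in> borel_measurable FM"
    by (rule t_slice_measurable[of "\<lambda>t z. son z t i"]) (rule son_measurable)
  have km: "(\<lambda>z. h (fst z) :: real) \<in> borel_measurable FM" "(\<lambda>z. snd z) \<in> borel_measurable FM" for h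
    unfolding FM_def by measurable
  have "(L2_norm_grad (F t))\<^sup>2 = (L2_norm (DX (F t)))\<^sup>2 + (L2_norm (DY (F t)))\<^sup>2"
    unfolding L2_norm_grad_def by (rule pair_norm_sq)
  also have "\<dots> \<le> ennreal (4 * pi\<^sup>2) * (?I (\<lambda>k \<xi>. - \<i> * of_int k * of_real (\<kappa> k)) + ?I (\<lambda>k \<xi>. - \<i> * of_real \<xi> * of_real (\<kappa> k)))"
    unfolding distrib_left by (rule add_mono[OF X Y])
  also have "?I (\<lambda>k \<xi>. - \<i> * of_int k * of_real (\<kappa> k)) + ?I (\<lambda>k \<xi>. - \<i> * of_real \<xi> * of_real (\<kappa> k))
    = (\<integral>\<^sup>+z. ennreal ((\<kappa> (fst z))\<^sup>2 * (of_int (fst z))\<^sup>2 * son z t i) \<partial>FM)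
      + (\<integral>\<^sup>+z. ennreal ((\<kappa> (fst z))\<^sup>2 * (snd z - of_int (fst z) * t)\<^sup>2 * son z t i) \<partial>FM)"
    by (simp add: norm_mult power_mult_distrib mult.commute flip: of_real_diff of_real_mult)
  also have "\<dots> = (\<integral>\<^sup>+z. ennreal ((\<kappa> (fst z))\<^sup>2 * (of_int (fst z))\<^sup>2 * son z t i) + ennreal ((\<kappa> (fst z))\<^sup>2 * (snd z - of_int (fst z) * t)\<^sup>2 * son z t i) \<partial>FM)"
    by (rule nn_integral_add[symmetric])
      (intro measurable_compose[OF _ measurable_ennreal] borel_measurable_times borel_measurable_power borel_measurable_diff sm km borel_measurable_const)+
  also have "\<dots> = (\<integral>\<^sup>+z. ennreal ((\<kappa> (fst z))\<^sup>2 * (pz z t * son z t i)) \<partial>FM)"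
    by (intro nn_integral_cong) (simp add: algebra_simps flip: ennreal_plus)
  finally show ?thesis .
qed

lemma form_Linf:
  assumes F: "form F i \<kappa>" and H: "\<And>t z. t \<ge> 0 \<Longrightarrow> (\<kappa> (fst z))\<^sup>2 * son z t i \<le> H z"
    and K: "ennreal (4 * pi\<^sup>2) * (\<integral>\<^sup>+z. ennreal (H z) \<partial>FM) \<le> ennreal (K\<^sup>2)" "K \<ge> 0"
  shows "Linf_t (\<lambda>t. L2_norm (F t)) \<le> ennreal K"
proof (rule Linf_t_le[OF form_measurable[OF F]])
  fix t :: real assume t: "t > 0"
  have "(L2_norm (F t))\<^sup>2 \<le> ennreal (4 * pi\<^sup>2) * (\<integral>\<^sup>+z. ennreal ((\<kappa> (fst z))\<^sup>2 * son z t i) \<partial>FM)"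
    using form_sq_le[OF F] t by simp
  also have "\<dots> \<le> ennreal (4 * pi\<^sup>2) * (\<integral>\<^sup>+z. ennreal (H z) \<partial>FM)"
    by (intro mult_left_mono nn_integral_mono ennreal_leI H) (use t in auto)
  also have "\<dots> \<le> ennreal (K\<^sup>2)" by (rule K(1))
  finally show "L2_norm (F t) \<le> ennreal K" using scaled_le_of_sq[of 1 "L2_norm (F t)" K] K(2) by simp
qed

text \<open>The prefactor s is moved inside the time integral, where the single-frequency bounds
  already include the power of \<nu> or \<eta>, and is divided out in front.\<close>

lemma weighted_L2_t:
  assumes g: "(\<lambda>v. g (fst v) (snd v)) \<in> borel_measurable (borel \<Otimes>\<^sub>M FM)" "\<And>t z. g t z \<ge> 0"
    and N: "\<And>t. t > 0 \<Longrightarrow> (N t)\<^sup>2 \<le> ennreal (4 * pi\<^sup>2) * (\<integral>\<^sup>+z. ennreal (g t z) \<partial>FM)"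
    and H: "\<And>z. (\<integral>\<^sup>+t\<in>{0<..}. ennreal (s\<^sup>2 * g t z) \<partial>lborel) \<le> ennreal (H z)"
    and K: "ennreal (4 * pi\<^sup>2) * (\<integral>\<^sup>+z. ennreal (H z) \<partial>FM) \<le> ennreal (K\<^sup>2)" "K \<ge> 0" and s: "s > 0"
  shows "ennreal s * L2_t N \<le> ennreal K"
proof (rule scaled_le_of_sq[OF _ s K(2)])
  have "(L2_t N)\<^sup>2 \<le> ennreal (4 * pi\<^sup>2 / s\<^sup>2) * (\<integral>\<^sup>+z. ennreal (H z) \<partial>FM)"
  proof (rule L2_t_sq_le[where h = "\<lambda>t z. ennreal (s\<^sup>2 * g t z)"])
    show "(\<lambda>v. ennreal (s\<^sup>2 * g (fst v) (snd v))) \<in> borel_measurable (borel \<Otimes>\<^sub>M FM)"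
      using g(1) by measurable
    fix t :: real assume t: "t > 0"
    have gm: "(\<lambda>z. ennreal (g t z)) \<in> borel_measurable FM"
      by (rule measurable_compose[OF t_slice_measurable[OF g(1)] measurable_ennreal])
    have "ennreal (4 * pi\<^sup>2) * (\<integral>\<^sup>+z. ennreal (g t z) \<partial>FM) = ennreal (4 * pi\<^sup>2 / s\<^sup>2) * (ennreal (s\<^sup>2) * (\<integral>\<^sup>+z. ennreal (g t z) \<partial>FM))"
      using s by (simp add: mult.assoc[symmetric] ennreal_mult'[symmetric])
    also have "ennreal (s\<^sup>2) * (\<integral>\<^sup>+z. ennreal (g t z) \<partial>FM) = (\<integral>\<^sup>+z. ennreal (s\<^sup>2 * g t z) \<partial>FM)"
      by (simp add: nn_integral_cmult[OF gm, symmetric] ennreal_mult')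
    finally show "(N t)\<^sup>2 \<le> ennreal (4 * pi\<^sup>2 / s\<^sup>2) * (\<integral>\<^sup>+z. ennreal (s\<^sup>2 * g t z) \<partial>FM)" using N[OF t] by simp
  qed (rule H)
  then have "ennreal (s\<^sup>2) * (L2_t N)\<^sup>2 \<le> ennreal (s\<^sup>2) * (ennreal (4 * pi\<^sup>2 / s\<^sup>2) * (\<integral>\<^sup>+z. ennreal (H z) \<partial>FM))"
    by (rule mult_left_mono) simp
  also have "\<dots> = ennreal (4 * pi\<^sup>2) * (\<integral>\<^sup>+z. ennreal (H z) \<partial>FM)"
    using s by (simp add: mult.assoc[symmetric] ennreal_mult'[symmetric])
  also have "\<dots> \<le> ennreal (K\<^sup>2)" by (rule K(1))
  finally show "ennreal (s\<^sup>2) * (L2_t N)\<^sup>2 \<le> ennreal (K\<^sup>2)" .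
qed

lemma form_L2:
  assumes F: "form F i \<kappa>" and H: "\<And>z. (\<integral>\<^sup>+t\<in>{0<..}. ennreal (s\<^sup>2 * ((\<kappa> (fst z))\<^sup>2 * son z t i)) \<partial>lborel) \<le> ennreal (H z)"
    and K: "ennreal (4 * pi\<^sup>2) * (\<integral>\<^sup>+z. ennreal (H z) \<partial>FM) \<le> ennreal (K\<^sup>2)" "K \<ge> 0" and s: "s > 0"
  shows "ennreal s * L2_t (\<lambda>t. L2_norm (F t)) \<le> ennreal K"
proof (rule weighted_L2_t[OF _ _ form_sq_le[OF F] H K s])
  show "(\<lambda>v. (\<kappa> (fst (snd v)))\<^sup>2 * son (snd v) (fst v) i) \<in> borel_measurable (borel \<Otimes>\<^sub>M FM)"
    by (intro borel_measurable_times borel_measurable_power[OF k_measurable] son_measurable)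
qed auto

lemma form_L2_grad:
  assumes F: "form F i \<kappa>" and H: "\<And>z. (\<integral>\<^sup>+t\<in>{0<..}. ennreal (s\<^sup>2 * ((\<kappa> (fst z))\<^sup>2 * (pz z t * son z t i))) \<partial>lborel) \<le> ennreal (H z)"
    and K: "ennreal (4 * pi\<^sup>2) * (\<integral>\<^sup>+z. ennreal (H z) \<partial>FM) \<le> ennreal (K\<^sup>2)" "K \<ge> 0" and s: "s > 0"
  shows "ennreal s * L2_t (\<lambda>t. L2_norm_grad (F t)) \<le> ennreal K"
proof (rule weighted_L2_t[OF _ _ form_grad_sq_le[OF F] H K s])
  show "(\<lambda>v. (\<kappa> (fst (snd v)))\<^sup>2 * (pz (snd v) (fst v) * son (snd v) (fst v) i)) \<in> borel_measurable (borel \<Otimes>\<^sub>M FM)"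
    by (intro borel_measurable_times borel_measurable_add borel_measurable_power borel_measurable_diff k_measurable xi_measurable son_measurable)
      measurable
qed auto

text \<open>The constants 18, 26 and 3 round up the square roots of 320, 640 and 5. Combining
  \<open>w\<close> with \<open>j\<close> doubles the first two, and the three temperature terms
  contribute 1 + 1 + 3, so the total is 36 + 52 + 52 + 5 = 145.\<close>

lemma estimate:
  assumes A0: "\<And>i. A i \<ge> 0" and dA: "\<And>i. nrm2 FM (d i) \<le> A i / (2*pi)"
  defines "M \<equiv> \<nu> powr (-2) * sqrt ((A 1)\<^sup>2 + (A 2)\<^sup>2) + \<nu> powr (-4) * (\<nu> * \<eta>) powr (-1/6) * A 3"
  shows "pair_norm (Linf_t (\<lambda>t. L2_norm (Lambda t b (w t)))) (Linf_t (\<lambda>t. L2_norm (Lambda t b (j t))))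
        + ennreal (\<nu> powr (1/2)) *
            pair_norm (L2_t (\<lambda>t. L2_norm_grad (Lambda t b (w t)))) (L2_t (\<lambda>t. L2_norm_grad (Lambda t b (j t))))
        + ennreal (\<nu> powr (1/6)) *
            pair_norm (L2_t (\<lambda>t. L2_norm (absDx (1/3) (Lambda t b (w t))))) (L2_t (\<lambda>t. L2_norm (absDx (1/3) (Lambda t b (j t)))))
        + ennreal (\<nu> powr (-4) * (\<nu> * \<eta>) powr (-1/6)) *
            (Linf_t (\<lambda>t. L2_norm (absDx (1/3) (Lambda t b (\<theta> t))))
             + ennreal (\<eta> powr (1/2)) * L2_t (\<lambda>t. L2_norm_grad (absDx (1/3) (Lambda t b (\<theta> t))))
             + ennreal (\<eta> powr (1/6)) * L2_t (\<lambda>t. L2_norm (absDx (2/3) (Lambda t b (\<theta> t)))))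
        \<le> ennreal (145 * M)"
proof -
  let ?c = "\<nu> powr (-4) * (\<nu> * \<eta>) powr (-1/6)"
  have M0: "M \<ge> 0" unfolding M_def using A0 by (intro add_nonneg_nonneg mult_nonneg_nonneg) auto
  have c0: "?c \<ge> 0" by simp
  have int: "integrable FM (\<lambda>z. dn i z)" for i using d_l2[of i] by (simp add: l2_def)
  \<comment> \<open>The factor 2\<pi> lost in Bessel's inequality is regained from 1/(2\<pi>) in the
    data bound, so no power of \<pi> reaches the final constant.\<close>
  have n4: "4 * pi\<^sup>2 * (nrm2 FM (d i))\<^sup>2 \<le> (A i)\<^sup>2" for i
  proof -
    have "2 * pi * nrm2 FM (d i) \<le> A i" using dA[of i] by (simp add: field_simps)
    then have "(2 * pi * nrm2 FM (d i))\<^sup>2 \<le> (A i)\<^sup>2" by (rule power_mono) simp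
    then show ?thesis by (simp add: power_mult_distrib)
  qed
  have dnK: "ennreal (4 * pi\<^sup>2) * (\<integral>\<^sup>+z. ennreal (e * dn 3 z) \<partial>FM) \<le> ennreal ((\<kappa> * A 3)\<^sup>2)" if "0 \<le> e" "e \<le> \<kappa>\<^sup>2" for e \<kappa>
  proof -
    have "(\<integral>\<^sup>+z. ennreal (e * dn 3 z) \<partial>FM) = ennreal (\<integral>z. e * dn 3 z \<partial>FM)"
      by (rule nn_integral_eq_integral) (use int[of 3] that in auto)
    also have "(\<integral>z. e * dn 3 z \<partial>FM) = e * (nrm2 FM (d 3))\<^sup>2" by (simp add: nrm2_sq)
    finally have "ennreal (4 * pi\<^sup>2) * (\<integral>\<^sup>+z. ennreal (e * dn 3 z) \<partial>FM) = ennreal (e * (4 * pi\<^sup>2 * (nrm2 FM (d 3))\<^sup>2))"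
      using that by (simp add: ennreal_mult'[symmetric] mult.left_commute)
    also have "\<dots> \<le> ennreal (\<kappa>\<^sup>2 * (A 3)\<^sup>2)" using that n4[of 3] by (intro ennreal_leI mult_mono) auto
    finally show ?thesis by (simp add: power_mult_distrib)
  qed
  have QK: "ennreal (4 * pi\<^sup>2) * (\<integral>\<^sup>+z. ennreal (e * Q z) \<partial>FM) \<le> ennreal ((\<kappa> * M)\<^sup>2)" if e: "0 \<le> e" "e \<le> \<kappa>\<^sup>2" for e \<kappa>
  proof -
    let ?c1 = "\<nu> powr (-4)" and ?c3 = "\<nu> powr (-8) * (\<nu> * \<eta>) powr (-1/3)"
    let ?R = "?c1 * ((nrm2 FM (d 1))\<^sup>2 + (nrm2 FM (d 2))\<^sup>2) + ?c3 * (nrm2 FM (d 3))\<^sup>2"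
    have iQ: "integrable FM Q" unfolding Q_def[abs_def] using int by (intro Bochner_Integration.integrable_add integrable_mult_right) auto
    have "(\<integral>z. Q z \<partial>FM) = ?R" unfolding Q_def nrm2_sq using int by simp
    then have I: "(\<integral>z. e * Q z \<partial>FM) = e * ?R" by simp
    have R: "4 * pi\<^sup>2 * ?R \<le> M\<^sup>2"
    proof -
      define x where "x = \<nu> powr (-2) * sqrt ((A 1)\<^sup>2 + (A 2)\<^sup>2)"
      define y where "y = ?c * A 3"
      have xy: "x \<ge> 0" "y \<ge> 0" unfolding x_def y_def using A0 by auto
      have c1: "?c1 = (\<nu> powr (-2))\<^sup>2" unfolding power2_eq_square powr_add[symmetric] by simp
      have "(\<nu> powr (-4))\<^sup>2 = \<nu> powr (-8)" "((\<nu> * \<eta>) powr (-1/6))\<^sup>2 = (\<nu> * \<eta>) powr (-1/3)"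
        unfolding power2_eq_square powr_add[symmetric] by simp_all
      then have c3: "?c3 = ?c\<^sup>2" by (simp only: power_mult_distrib)
      have "4 * pi\<^sup>2 * ?R = ?c1 * (4 * pi\<^sup>2 * (nrm2 FM (d 1))\<^sup>2 + 4 * pi\<^sup>2 * (nrm2 FM (d 2))\<^sup>2) + ?c3 * (4 * pi\<^sup>2 * (nrm2 FM (d 3))\<^sup>2)"
        by (simp add: algebra_simps)
      also have "\<dots> \<le> ?c1 * ((A 1)\<^sup>2 + (A 2)\<^sup>2) + ?c3 * (A 3)\<^sup>2"
        by (intro add_mono mult_left_mono n4) auto
      also have "\<dots> = x\<^sup>2 + y\<^sup>2" unfolding c1 c3 x_def y_def by (simp add: power_mult_distrib)
      also have "\<dots> \<le> (x + y)\<^sup>2" using xy by (simp add: power2_sum)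
      finally show ?thesis unfolding M_def x_def y_def .
    qed
    have "(\<integral>\<^sup>+z. ennreal (e * Q z) \<partial>FM) = ennreal (e * ?R)"
      unfolding I[symmetric] by (rule nn_integral_eq_integral) (use iQ e Q_nonneg in auto)
    moreover have assoc: "ennreal (4 * pi\<^sup>2) * ennreal (e * x) = ennreal (e * (4 * pi\<^sup>2 * x))" for x
      by (simp add: ennreal_mult'[symmetric] mult.left_commute)
    ultimately have "ennreal (4 * pi\<^sup>2) * (\<integral>\<^sup>+z. ennreal (e * Q z) \<partial>FM) = ennreal (e * (4 * pi\<^sup>2 * ?R))"
      by (simp only:)
    also have "\<dots> \<le> ennreal (\<kappa>\<^sup>2 * M\<^sup>2)" using e R by (intro ennreal_leI mult_mono) auto
    finally show ?thesis by (simp add: power_mult_distrib)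
  qed
  have half: "(x powr (1/2))\<^sup>2 = x" "(x powr (1/6))\<^sup>2 = x powr (1/3)" if "x > 0" for x :: real
    using that unfolding power2_eq_square powr_add[symmetric] by simp_all
  have n: "(1::3) \<noteq> 3" "(2::3) \<noteq> 3" "(2::3) \<noteq> 1" "(3::3) \<noteq> 1" "(3::3) \<noteq> 2" by simp_all
  have us: "us 1 = w" "us 2 = j" "us 3 = \<theta>" unfolding us_def by (simp_all only: n if_True if_False simp_thms)
  have p: "\<nu> powr (1/2) > 0" "\<nu> powr (1/6) > 0" "\<eta> powr (1/2) > 0" "\<eta> powr (1/6) > 0" using \<nu> \<eta> by auto
  have m: "0 \<le> k * M" if "0 \<le> k" for k using that M0 by simp
  have T1: "Linf_t (\<lambda>t. L2_norm (Lambda t b (us i t))) \<le> ennreal (18 * M)" if i: "i \<noteq> 3" for i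
    by (rule form_Linf[OF form_Lambda[OF i] _ QK[of 320]]) (use freq_sup[OF i] m in auto)
  have T2: "ennreal (\<nu> powr (1/2)) * L2_t (\<lambda>t. L2_norm_grad (Lambda t b (us i t))) \<le> ennreal (26 * M)" if i: "i \<noteq> 3" for i
    by (rule form_L2_grad[OF form_Lambda[OF i] _ QK[of 640] _ p(1)]) (use freq_grad[OF i] m half(1)[OF \<nu>(1)] in auto)
  have T3: "ennreal (\<nu> powr (1/6)) * L2_t (\<lambda>t. L2_norm (absDx (1/3) (Lambda t b (us i t)))) \<le> ennreal (26 * M)" if i: "i \<noteq> 3" for i
    by (rule form_L2[OF form_absDx _ QK[of 640] _ p(2)]) (use freq_enhanced[OF i] m half(2)[OF \<nu>(1)] in auto)
  have S1: "Linf_t (\<lambda>t. L2_norm (absDx (1/3) (Lambda t b (us 3 t)))) \<le> ennreal (1 * A 3)"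
    by (rule form_Linf[OF form_absDx _ dnK[of 1]]) (use heat_sup A0 in auto)
  have S2: "ennreal (\<eta> powr (1/2)) * L2_t (\<lambda>t. L2_norm_grad (absDx (1/3) (Lambda t b (us 3 t)))) \<le> ennreal (1 * A 3)"
    by (rule form_L2_grad[OF form_absDx _ dnK[of 1] _ p(3)]) (use heat_grad A0 half(1)[OF \<eta>(1)] in auto)
  have S3: "ennreal (\<eta> powr (1/6)) * L2_t (\<lambda>t. L2_norm (absDx (2/3) (Lambda t b (us 3 t)))) \<le> ennreal (3 * A 3)"
    by (rule form_L2[OF form_absDx _ dnK[of 5] _ p(4)]) (use heat_enhanced A0 half(2)[OF \<eta>(1)] in auto)
  have U1: "pair_norm (Linf_t (\<lambda>t. L2_norm (Lambda t b (w t)))) (Linf_t (\<lambda>t. L2_norm (Lambda t b (j t)))) \<le> ennreal (36 * M)"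
    using scaled_pair_norm_le[of 1 _ "18 * M"] T1[OF n(1)] T1[OF n(2)] M0 unfolding us by simp
  have U2: "ennreal (\<nu> powr (1/2)) * pair_norm (L2_t (\<lambda>t. L2_norm_grad (Lambda t b (w t)))) (L2_t (\<lambda>t. L2_norm_grad (Lambda t b (j t)))) \<le> ennreal (52 * M)"
    using scaled_pair_norm_le[OF T2[OF n(1)] T2[OF n(2)] p(1)] M0 unfolding us by simp
  have U3: "ennreal (\<nu> powr (1/6)) * pair_norm (L2_t (\<lambda>t. L2_norm (absDx (1/3) (Lambda t b (w t))))) (L2_t (\<lambda>t. L2_norm (absDx (1/3) (Lambda t b (j t))))) \<le> ennreal (52 * M)"
    using scaled_pair_norm_le[OF T3[OF n(1)] T3[OF n(2)] p(2)] M0 unfolding us by simp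
  have "ennreal ?c * (Linf_t (\<lambda>t. L2_norm (absDx (1/3) (Lambda t b (\<theta> t))))
             + ennreal (\<eta> powr (1/2)) * L2_t (\<lambda>t. L2_norm_grad (absDx (1/3) (Lambda t b (\<theta> t))))
             + ennreal (\<eta> powr (1/6)) * L2_t (\<lambda>t. L2_norm (absDx (2/3) (Lambda t b (\<theta> t)))))
    \<le> ennreal ?c * (ennreal (1 * A 3) + ennreal (1 * A 3) + ennreal (3 * A 3))"
    by (intro mult_left_mono add_mono S1[unfolded us] S2[unfolded us] S3[unfolded us]) simp
  also have "\<dots> = ennreal (?c * (1 * A 3 + 1 * A 3 + 3 * A 3))"
    using A0[of 3] by (simp only: ennreal_mult'[OF c0] ennreal_plus mult_nonneg_nonneg add_nonneg_nonneg zero_le_one zero_le_numeral)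
  also have "\<dots> \<le> ennreal (5 * M)"
  proof (rule ennreal_leI)
    have "?c * A 3 \<le> M" unfolding M_def using A0 by simp
    then show "?c * (1 * A 3 + 1 * A 3 + 3 * A 3) \<le> 5 * M" by (simp add: algebra_simps)
  qed
  finally have U4: "ennreal ?c * (Linf_t (\<lambda>t. L2_norm (absDx (1/3) (Lambda t b (\<theta> t))))
             + ennreal (\<eta> powr (1/2)) * L2_t (\<lambda>t. L2_norm_grad (absDx (1/3) (Lambda t b (\<theta> t))))
             + ennreal (\<eta> powr (1/6)) * L2_t (\<lambda>t. L2_norm (absDx (2/3) (Lambda t b (\<theta> t))))) \<le> ennreal (5 * M)" .
  have "ennreal (36 * M) + ennreal (52 * M) + ennreal (52 * M) + ennreal (5 * M) = ennreal (145 * M)"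
    using M0 by (simp flip: ennreal_plus)
  then show ?thesis using add_mono[OF add_mono[OF add_mono[OF U1 U2] U3] U4] by simp
qed

end

section \<open>Data of infinite norm and conclusion\<close>

lemma pair_norm_ennreal: "x \<ge> 0 \<Longrightarrow> y \<ge> 0 \<Longrightarrow> pair_norm (ennreal x) (ennreal y) = ennreal (sqrt (x\<^sup>2 + y\<^sup>2))"
  unfolding pair_norm_def esqrt_def by (simp add: ennreal_power flip: ennreal_plus)

lemma pair_norm_top: "pair_norm top y = top" "pair_norm x top = top"
  unfolding pair_norm_def esqrt_def by (simp_all add: power2_eq_square ennreal_top_mult)

lemma ennreal_sum_top: "0 < x \<Longrightarrow> 0 < y \<Longrightarrow> P = top \<or> H = top \<Longrightarrow> ennreal x * P + ennreal y * H = top"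
  by (auto simp: ennreal_mult_top)

theorem theorem1p2:
  shows "\<exists>C::real. C > 0 \<and>
    (\<forall>(b::real) (\<nu>::real) (\<mu>::real) (\<eta>::real) w j \<theta> b1 b2.
      0 < \<nu> \<longrightarrow> \<nu> = \<mu> \<longrightarrow> \<mu> \<le> \<eta> \<longrightarrow> \<eta> \<le> 1 \<longrightarrow> bmhd_solution \<nu> \<mu> \<eta> w j \<theta> b1 b2 \<longrightarrow>
        pair_norm (Linf_t (\<lambda>t. L2_norm (Lambda t b (w t))))
                  (Linf_t (\<lambda>t. L2_norm (Lambda t b (j t))))
        + ennreal (\<nu> powr (1/2)) *
            pair_norm (L2_t (\<lambda>t. L2_norm_grad (Lambda t b (w t))))
                      (L2_t (\<lambda>t. L2_norm_grad (Lambda t b (j t))))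
        + ennreal (\<nu> powr (1/6)) *
            pair_norm (L2_t (\<lambda>t. L2_norm (absDx (1/3) (Lambda t b (w t)))))
                      (L2_t (\<lambda>t. L2_norm (absDx (1/3) (Lambda t b (j t)))))
        + ennreal (\<nu> powr (-4) * (\<nu> * \<eta>) powr (-1/6)) *
            (Linf_t (\<lambda>t. L2_norm (absDx (1/3) (Lambda t b (\<theta> t))))
             + ennreal (\<eta> powr (1/2)) *
                 L2_t (\<lambda>t. L2_norm_grad (absDx (1/3) (Lambda t b (\<theta> t))))
             + ennreal (\<eta> powr (1/6)) *
                 L2_t (\<lambda>t. L2_norm (absDx (2/3) (Lambda t b (\<theta> t)))))
        \<le> ennreal C *
           (ennreal (\<nu> powr (-2)) * pair_norm (H_norm b (w 0)) (H_norm b (j 0))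
            + ennreal (\<nu> powr (-4) * (\<nu> * \<eta>) powr (-1/6)) *
                H_norm b (absDx (1/3) (\<theta> 0))))"
proof (intro exI[of _ "145::real"] conjI allI impI)
  fix b \<nu> \<mu> \<eta> :: real and w j \<theta> b1 b2
  assume *: "0 < \<nu>" "\<nu> = \<mu>" "\<mu> \<le> \<eta>" "\<eta> \<le> 1" "bmhd_solution \<nu> \<mu> \<eta> w j \<theta> b1 b2"
  let ?c = "\<nu> powr (-4) * (\<nu> * \<eta>) powr (-1/6)"
  let ?R = "ennreal (\<nu> powr (-2)) * pair_norm (H_norm b (w 0)) (H_norm b (j 0)) + ennreal ?c * H_norm b (absDx (1/3) (\<theta> 0))"
  have \<eta>0: "\<eta> > 0" and \<nu>1: "\<nu> \<le> 1" using * by auto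
  have pos: "\<nu> powr (-2) > 0" "?c > 0" using *(1) \<eta>0 by auto
  have sol: "bmhd_sol \<nu> \<eta> w j \<theta> b1 b2" using * \<eta>0 \<nu>1 by unfold_locales auto
  show "pair_norm (Linf_t (\<lambda>t. L2_norm (Lambda t b (w t))))
                  (Linf_t (\<lambda>t. L2_norm (Lambda t b (j t))))
        + ennreal (\<nu> powr (1/2)) *
            pair_norm (L2_t (\<lambda>t. L2_norm_grad (Lambda t b (w t))))
                      (L2_t (\<lambda>t. L2_norm_grad (Lambda t b (j t))))
        + ennreal (\<nu> powr (1/6)) *
            pair_norm (L2_t (\<lambda>t. L2_norm (absDx (1/3) (Lambda t b (w t)))))
                      (L2_t (\<lambda>t. L2_norm (absDx (1/3) (Lambda t b (j t)))))
        + ennreal ?c *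
            (Linf_t (\<lambda>t. L2_norm (absDx (1/3) (Lambda t b (\<theta> t))))
             + ennreal (\<eta> powr (1/2)) *
                 L2_t (\<lambda>t. L2_norm_grad (absDx (1/3) (Lambda t b (\<theta> t))))
             + ennreal (\<eta> powr (1/6)) *
                 L2_t (\<lambda>t. L2_norm (absDx (2/3) (Lambda t b (\<theta> t)))))
        \<le> ennreal 145 * ?R" (is "?L \<le> _")
  \<comment> \<open>An infinite data norm makes the right-hand side \<open>top\<close>, as both
    prefactors are positive. Otherwise the three norms are real numbers and
    \<open>data_exists\<close> supplies the densities.\<close>
  proof (cases "H_norm b (w 0) = top \<or> H_norm b (j 0) = top \<or> H_norm b (absDx (1/3) (\<theta> 0)) = top")
    case True
    then have "pair_norm (H_norm b (w 0)) (H_norm b (j 0)) = top \<or> H_norm b (absDx (1/3) (\<theta> 0)) = top"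
      by (auto simp: pair_norm_top)
    from ennreal_sum_top[OF pos this] have "?R = top" .
    moreover have "ennreal 145 * x = top" if "x = top" for x using that by (simp add: ennreal_mult_top)
    ultimately have "ennreal 145 * ?R = top" by blast
    then show ?thesis by (simp only: top_greatest)
  next
    case False
    then obtain A1 A2 A3 where A: "H_norm b (w 0) = ennreal A1" "A1 \<ge> 0" "H_norm b (j 0) = ennreal A2" "A2 \<ge> 0"
      "H_norm b (absDx (1/3) (\<theta> 0)) = ennreal A3" "A3 \<ge> 0"
      by (metis ennreal_cases)
    define A :: "3 \<Rightarrow> real" where "A i = (if i = 1 then A1 else if i = 2 then A2 else A3)" for i
    have n: "(2::3) \<noteq> 1" "(3::3) \<noteq> 1" "(3::3) \<noteq> 2" by simp_all
    have A_simps: "A 1 = A1" "A 2 = A2" "A 3 = A3" unfolding A_def by (simp_all only: n if_True if_False simp_thms)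
    have A0: "A i \<ge> 0" for i using A by (simp add: A_def)
    have "\<exists>d. \<forall>i::3. l2 FM (d i) \<and> nrm2 FM (d i) \<le> A i / (2*pi) \<and>
      (\<forall>g. sg g \<longrightarrow> bmhd_sol.us w j \<theta> i 0 (IF (\<lambda>k \<xi>. (of_real (wb b k \<xi>) * of_real (h0 i k)) * g k \<xi>)) = (\<integral>z. d i z * g (fst z) (snd z) \<partial>FM))"
      by (rule bmhd_sol.data_exists[OF sol A0]) (simp_all only: A A_simps order_refl)
    then obtain d where d: "\<And>i::3. l2 FM (d i)" "\<And>i. nrm2 FM (d i) \<le> A i / (2*pi)"
      "\<And>i g. sg g \<Longrightarrow> bmhd_sol.us w j \<theta> i 0 (IF (\<lambda>k \<xi>. (of_real (wb b k \<xi>) * of_real (h0 i k)) * g k \<xi>)) = (\<integral>z. d i z * g (fst z) (snd z) \<partial>FM)"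
      by blast
    have "bmhd_data \<nu> \<eta> w j \<theta> b1 b2 b d"
      by (intro bmhd_data.intro sol bmhd_data_axioms.intro d)
    from bmhd_data.estimate[OF this, of A, OF A0 d(2)]
    have "?L \<le> ennreal (145 * (\<nu> powr (-2) * sqrt (A1\<^sup>2 + A2\<^sup>2) + ?c * A3))" unfolding A_simps .
    also have "\<dots> = ennreal 145 * ?R"
      unfolding A(1,3,5) pair_norm_ennreal[OF A(2,4)]
      using pos A(2,4,6) by (simp add: ennreal_mult' ennreal_plus)
    finally show ?thesis .
  qed
qed simp

end
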